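(* Let $G$ be a finite group. In $\mathbb{A}_G$ we have the equation \[ \sum_{n\geq 1}(-1)^n\,\mathrm{ch}_{G\wr S_n}\bigl(\widetilde{H}_{n-2}(\overline{R_n(G)};\mathbb{Q})\bigr)=1-\mathrm{Exp}_G\circ L. \]
   Context: Posets. Write $[n]=\{1,\dots,n\}$. $G$ acts on $G\times[n]$ by left multiplication on the first factor, and $G\wr S_n$ denotes the group of permutations of $G\times[n]$ commuting with this action. The Dowling lattice $Q_n(G)$ ($n\ge1$) is the poset of pairs $(J,\pi)$ where $J$ is a $G$-stable subset of $G\times[n]$ and $\pi$ is a set partition of $(G\times[n])\setminus J$ (into nonempty parts; the empty set has one partition, the empty one) whose parts are permuted freely by $G$ (for all $1\neq g\in G$, $K\in\pi$: $K\neq g.K\in\pi$). The order is: $(J,\pi)\le(J',\pi')$ iff $J\subseteq J'$ and every $K\in\pi$ satisfies either $K\subseteq J'$ or $K$ is contained in a single part of $\pi'$. Its minimum $\hat0$ has $J=\emptyset$ and all parts singletons; its maximum is $\hat1=(G\times[n],\emptyset)$. The group $G\wr S_n$ acts on it. $R_n(G)$ is the $(G\wr S_n)$-stable sub-poset of pairs $(J,\pi)$ with $J=\emptyset$ or $J=G\times[n]$; it contains $\hat0,\hat1$, and is pure and Cohen-Macaulay of length $n$. Homology. For a bounded poset $P$, $\overline P=P\setminus\{\hat0,\hat1\}$, and $\widetilde H_i(\overline P;\mathbb{Q})$ is the reduced homology of its order complex, with the induced group action as a representation over $\mathbb{Q}$; $\widetilde H_{-1}(\emptyset;\mathbb{Q})$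 is the one-dimensional trivial representation. Characters. Let $G_*$ be the set of conjugacy classes of $G$. $\Lambda_G=\mathbb{Q}[p_i(c)\mid i\ge1,c\in G_*]$, graded by $\deg p_i(c)=i$, and $\mathbb{A}_G=\mathbb{Q}[\![p_i(c)]\!]$ is its completion with respect to the grading; $\mathbb{A}_{G,+}$ is the ideal of elements with zero degree-$0$ term. For $G=\{1\}$ write $p_i=p_i(\{1\})$. For a representation $M$ of $G\wr S_n$ over $\mathbb{Q}$, \[ \mathrm{ch}_{G\wr S_n}(M)=\frac{1}{|G|^nn!}\sum_{x\in G\wr S_n}\mathrm{tr}(x,M)\,\Psi(x),\qquad \Psi(x)=\prod_{i,c}p_i(c)^{a_i(c)}, \] where $a_i(c)$ is the number of cycles of length $i$ and type $c$ of $x$: a cycle of the permutation of $[n]$ induced by $x$, of length $i$ and containing $m$, has type the conjugacy class of the $h\in G$ with $x^i.(1,m)=(h,m)$. Plethysm. The right plethystic action $\circ:\mathbb{A}_G\times\mathbb{A}_{\{1\},+}\to\mathbb{A}_G$ is determined by: $f\mapsto f\circ g$ is a continuous $\mathbb{Q}$-algebra homomorphism for each $g$; $g\mapsto p_i(c)\circ g$ extends to a continuous $\mathbb{Q}$-algebra homomorphism $\mathbb{A}_{\{1\}}\to\mathbb{A}_G$; and $p_i(c)\circ p_j=p_{ij}(c^j)$, where $c^j$ is the class of $j$th powers of elements of $c$. Series. $\mathrm{Exp}_G=\sum_{n\ge0}\mathrm{ch}_{G\wr S_n}(\mathbf 1)=\exp\bigl(\sum_{i\ge1,c\in G_*}\frac{|c|\,p_i(c)}{|G|\,i}\bigr)$,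 with $\mathbf 1$ the trivial representation; and $L=\sum_{e\ge1}\frac{\mu(e)}{e}\log(1+p_e)\in\mathbb{A}_{\{1\},+}$, with $\mu$ the number-theoretic Möbius function. *)

theory Defs
  imports
    "HOL-Algebra.Elementary_Groups"
    "HOL-Combinatorics.Orbits"
    "HOL-Computational_Algebra.Computational_Algebra"
    "HOL-Library.Disjoint_Sets"
    "HOL-Library.Poly_Mapping"
begin

unbundle fps_syntax

section \<open>Dowling lattices\<close>

definition points :: "('a, 'b) monoid_scheme \<Rightarrow> nat \<Rightarrow> ('a \<times> nat) set" where
  "points G n = carrier G \<times> {1..n}"

definition lmult :: "('a, 'b) monoid_scheme \<Rightarrow> 'a \<Rightarrow> 'a \<times> nat \<Rightarrow> 'a \<times> nat" where
  "lmult G g z = (g \<otimes>\<^bsub>G\<^esub> fst z, snd z)"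

text \<open>Elements of the wreath product are the identity outside of \<^term>\<open>points G n\<close>.\<close>

definition wreath :: "('a, 'b) monoid_scheme \<Rightarrow> nat \<Rightarrow> ('a \<times> nat \<Rightarrow> 'a \<times> nat) set" where
  "wreath G n = {x. x permutes points G n \<and>
     (\<forall>g\<in>carrier G. \<forall>z\<in>points G n. x (lmult G g z) = lmult G g (x z))}"

type_synonym 'a dowling_elt = "('a \<times> nat) set \<times> ('a \<times> nat) set set"

definition dowling :: "('a, 'b) monoid_scheme \<Rightarrow> nat \<Rightarrow> 'a dowling_elt set" where
  "dowling G n = {(J, \<pi>). J \<subseteq> points G n \<and> (\<forall>g\<in>carrier G. lmult G g ` J = J) \<and>
     partition_on (points G n - J) \<pi> \<and>
     (\<forall>g\<in>carrier G - {\<one>\<^bsub>G\<^esub>}. \<forall>K\<in>\<pi>. lmult G g ` K \<noteq> K \<and> lmult G g ` K \<in> \<pi>)}"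

definition dowling_le :: "'a dowling_elt \<Rightarrow> 'a dowling_elt \<Rightarrow> bool" where
  "dowling_le a b \<longleftrightarrow> fst a \<subseteq> fst b \<and> (\<forall>K\<in>snd a. K \<subseteq> fst b \<or> (\<exists>K'\<in>snd b. K \<subseteq> K'))"

definition dowling_bot :: "('a, 'b) monoid_scheme \<Rightarrow> nat \<Rightarrow> 'a dowling_elt" where
  "dowling_bot G n = ({}, (\<lambda>z. {z}) ` points G n)"

definition dowling_top :: "('a, 'b) monoid_scheme \<Rightarrow> nat \<Rightarrow> 'a dowling_elt" where
  "dowling_top G n = (points G n, {})"

definition dowling_act :: "('a \<times> nat \<Rightarrow> 'a \<times> nat) \<Rightarrow> 'a dowling_elt \<Rightarrow> 'a dowling_elt" where
  "dowling_act x a = (x ` fst a, (\<lambda>K. x ` K) ` snd a)"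

definition R_poset :: "('a, 'b) monoid_scheme \<Rightarrow> nat \<Rightarrow> 'a dowling_elt set" where
  "R_poset G n = {a \<in> dowling G n. fst a = {} \<or> fst a = points G n}"

definition R_proper :: "('a, 'b) monoid_scheme \<Rightarrow> nat \<Rightarrow> 'a dowling_elt set" where
  "R_proper G n = R_poset G n - {dowling_bot G n, dowling_top G n}"


section \<open>Rational vector spaces with a basis, and traces on subquotients\<close>

text \<open>The free rational vector space on \<^typ>\<open>'k\<close> is \<^typ>\<open>'k \<Rightarrow>\<^sub>0 rat\<close>.\<close>

definition qscale :: "rat \<Rightarrow> ('k \<Rightarrow>\<^sub>0 rat) \<Rightarrow> ('k \<Rightarrow>\<^sub>0 rat)" where
  "qscale r v = Poly_Mapping.map ((*) r) v"

lemma lookup_qscale [simp]: "Poly_Mapping.lookup (qscale r v) k = r * Poly_Mapping.lookup v k"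
  unfolding qscale_def by transfer (simp add: when_def)

interpretation qv: vector_space qscale
  by unfold_locales (auto intro!: poly_mapping_eqI simp: lookup_add algebra_simps)

definition lin_ext :: "('k \<Rightarrow> ('l \<Rightarrow>\<^sub>0 rat)) \<Rightarrow> ('k \<Rightarrow>\<^sub>0 rat) \<Rightarrow> ('l \<Rightarrow>\<^sub>0 rat)" where
  "lin_ext f v = (\<Sum>k\<in>Poly_Mapping.keys v. qscale (Poly_Mapping.lookup v k) (f k))"

text \<open>A representation on a subquotient \<open>V / W\<close> of a free rational vector space; a basis of
  the quotient is given by representatives in \<open>V\<close>.\<close>

record ('x, 'k) qrep =
  rep_V :: "('k \<Rightarrow>\<^sub>0 rat) set"
  rep_W :: "('k \<Rightarrow>\<^sub>0 rat) set"
  rep_act :: "'x \<Rightarrow> ('k \<Rightarrow>\<^sub>0 rat) \<Rightarrow> ('k \<Rightarrow>\<^sub>0 rat)"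

definition quot_basis ::
  "('k \<Rightarrow>\<^sub>0 rat) set \<Rightarrow> ('k \<Rightarrow>\<^sub>0 rat) set \<Rightarrow> ('k \<Rightarrow>\<^sub>0 rat) set \<Rightarrow> bool" where
  "quot_basis V W B \<longleftrightarrow> finite B \<and> B \<subseteq> V \<and>
     (\<forall>v\<in>V. \<exists>a. v - (\<Sum>b\<in>B. qscale (a b) b) \<in> W) \<and>
     (\<forall>a. (\<Sum>b\<in>B. qscale (a b) b) \<in> W \<longrightarrow> (\<forall>b\<in>B. a b = 0))"

definition quot_matrix :: "('k \<Rightarrow>\<^sub>0 rat) set \<Rightarrow> ('k \<Rightarrow>\<^sub>0 rat) set \<Rightarrow>
    (('k \<Rightarrow>\<^sub>0 rat) \<Rightarrow> ('k \<Rightarrow>\<^sub>0 rat)) \<Rightarrow> (('k \<Rightarrow>\<^sub>0 rat) \<Rightarrow> ('k \<Rightarrow>\<^sub>0 rat) \<Rightarrow> rat) \<Rightarrow> bool" where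
  "quot_matrix W B T M \<longleftrightarrow> (\<forall>b\<in>B. T b - (\<Sum>c\<in>B. qscale (M c b) c) \<in> W)"

definition quot_trace ::
  "('k \<Rightarrow>\<^sub>0 rat) set \<Rightarrow> ('k \<Rightarrow>\<^sub>0 rat) set \<Rightarrow> (('k \<Rightarrow>\<^sub>0 rat) \<Rightarrow> ('k \<Rightarrow>\<^sub>0 rat)) \<Rightarrow> rat" where
  "quot_trace V W T =
     (THE t. \<exists>B M. quot_basis V W B \<and> quot_matrix W B T M \<and> t = (\<Sum>b\<in>B. M b b))"

definition rep_trace :: "('x, 'k) qrep \<Rightarrow> 'x \<Rightarrow> rat" where
  "rep_trace M x = quot_trace (rep_V M) (rep_W M) (rep_act M x)"

definition trivial_rep :: "('x, unit) qrep" where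
  "trivial_rep = \<lparr>rep_V = UNIV, rep_W = {0}, rep_act = (\<lambda>x v. v)\<rparr>"

text \<open>The trace does not depend on the chosen basis of the quotient.\<close>

lemma quot_trace_unique:
  assumes W: "qv.subspace W"
    and T: "\<And>u v. T (u + v) = T u + T v" "\<And>r v. T (qscale r v) = qscale r (T v)"
    and TW: "\<And>v. v \<in> W \<Longrightarrow> T v \<in> W"
    and B: "quot_basis V W B" "quot_matrix W B T M"
  shows "quot_trace V W T = (\<Sum>b\<in>B. M b b)"
proof -
  define eqv where "eqv u v \<longleftrightarrow> u - v \<in> W" for u v
  have refl: "eqv u u" for u
    using qv.subspace_0[OF W] by (simp add: eqv_def)
  have sym: "eqv u v \<Longrightarrow> eqv v u" for u v
    using qv.subspace_neg[OF W] unfolding eqv_def by (metis minus_diff_eq)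
  have trans: "eqv u w" if "eqv u v" "eqv v w" for u v w
    using qv.subspace_add[OF W that[unfolded eqv_def]] by (simp add: eqv_def)
  have eqv_sc: "eqv (qscale r u) (qscale r v)" if "eqv u v" for r u v
    using qv.subspace_scale[OF W that[unfolded eqv_def], of r]
    by (simp add: eqv_def qv.scale_right_diff_distrib)
  have eqv_sum: "eqv (\<Sum>i\<in>I. f i) (\<Sum>i\<in>I. g i)" if "\<And>i. i \<in> I \<Longrightarrow> eqv (f i) (g i)"
    for I :: "('a \<Rightarrow>\<^sub>0 rat) set" and f g
    using qv.subspace_sum[OF W, of I "\<lambda>i. f i - g i"] that
    by (auto simp: eqv_def sum_subtractf)
  have T0: "T 0 = 0" using T(2)[of 0 0] by simp
  have T_sum: "T (\<Sum>i\<in>I. f i) = (\<Sum>i\<in>I. T (f i))" if "finite I"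
    for I :: "('a \<Rightarrow>\<^sub>0 rat) set" and f
    using that by induction (auto simp: T T0)
  have T_minus: "T (- v) = - T v" for v
    using T(2)[of "-1" v] by simp
  have T_eqv: "eqv (T u) (T v)" if "eqv u v" for u v
    using TW[OF that[unfolded eqv_def]] T(1)[of u "- v"] by (simp add: eqv_def T_minus)
  have uniq: "a c = a' c"
    if "quot_basis V W B'" "eqv (\<Sum>b\<in>B'. qscale (a b) b) (\<Sum>b\<in>B'. qscale (a' b) b)" "c \<in> B'"
    for B' a a' c
  proof -
    have "(\<Sum>b\<in>B'. qscale (a b - a' b) b) \<in> W"
      using that(2) by (simp add: eqv_def qv.scale_left_diff_distrib sum_subtractf)
    moreover have "\<forall>d. (\<Sum>b\<in>B'. qscale (d b) b) \<in> W \<longrightarrow> (\<forall>b\<in>B'. d b = 0)"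
      using that(1) by (auto simp: quot_basis_def)
    note spec[OF this, of "\<lambda>b. a b - a' b"]
    ultimately have "a c - a' c = 0"
      using that(3) by blast
    then show ?thesis by simp
  qed
  have main: "(\<Sum>b\<in>B'. M' b b) = (\<Sum>b\<in>B. M b b)"
    if B': "quot_basis V W B'" "quot_matrix W B' T M'" for B' M'
  proof -
    have fin: "finite B" "finite B'" using B B' by (auto simp: quot_basis_def)
    have "\<forall>b\<in>B. \<exists>a. eqv b (\<Sum>c\<in>B'. qscale (a c) c)"
      using B(1) B'(1) unfolding quot_basis_def eqv_def by blast
    then obtain Q where Q: "\<And>b. b \<in> B \<Longrightarrow> eqv b (\<Sum>c\<in>B'. qscale (Q b c) c)"
      by metis
    have "\<forall>b\<in>B'. \<exists>a. eqv b (\<Sum>c\<in>B. qscale (a c) c)"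
      using B(1) B'(1) unfolding quot_basis_def eqv_def by blast
    then obtain P where P: "\<And>b. b \<in> B' \<Longrightarrow> eqv b (\<Sum>c\<in>B. qscale (P b c) c)"
      by metis
    have M: "eqv (T b) (\<Sum>c\<in>B. qscale (M c b) c)" if "b \<in> B" for b
      using B(2) that by (auto simp: quot_matrix_def eqv_def)
    have M': "eqv (T b) (\<Sum>c\<in>B'. qscale (M' c b) c)" if "b \<in> B'" for b
      using B'(2) that by (auto simp: quot_matrix_def eqv_def)
    have QP: "(\<Sum>b'\<in>B'. Q c b' * P b' b) = (if b = c then 1 else 0)"
      if bc: "b \<in> B" "c \<in> B" for b c
    proof (rule uniq[OF B(1) _ bc(1), of "\<lambda>b. \<Sum>b'\<in>B'. Q c b' * P b' b" "\<lambda>b. if b = c then 1 else 0"])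
      have "(\<Sum>b\<in>B. qscale (\<Sum>b'\<in>B'. Q c b' * P b' b) b)
          = (\<Sum>b'\<in>B'. qscale (Q c b') (\<Sum>b\<in>B. qscale (P b' b) b))"
        by (simp add: qv.scale_sum_left qv.scale_sum_right sum.swap[of _ B B'])
      moreover have "eqv (\<Sum>b'\<in>B'. qscale (Q c b') (\<Sum>b\<in>B. qscale (P b' b) b))
          (\<Sum>b'\<in>B'. qscale (Q c b') b')"
        by (intro eqv_sum eqv_sc sym[OF P])
      moreover have "eqv (\<Sum>b'\<in>B'. qscale (Q c b') b') c"
        by (intro sym[OF Q] bc)
      moreover have "(\<Sum>b\<in>B. qscale (if b = c then 1 else 0) b) = c"
      proof -
        have "(\<Sum>b\<in>B. qscale (if b = c then 1 else 0) b) = (\<Sum>b\<in>B. if b = c then b else 0)"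
          by (intro sum.cong) auto
        then show ?thesis using fin bc by simp
      qed
      ultimately show "eqv (\<Sum>b\<in>B. qscale (\<Sum>b'\<in>B'. Q c b' * P b' b) b)
          (\<Sum>b\<in>B. qscale (if b = c then 1 else 0) b)"
        by (auto intro: trans)
    qed
    have M'_eq: "M' c' b' = (\<Sum>b\<in>B. \<Sum>c\<in>B. P b' b * M c b * Q c c')"
      if bc: "b' \<in> B'" "c' \<in> B'" for b' c'
    proof (rule uniq[OF B'(1) _ bc(2), of "\<lambda>c'. M' c' b'"
          "\<lambda>c'. \<Sum>b\<in>B. \<Sum>c\<in>B. P b' b * M c b * Q c c'"])
      have "eqv (\<Sum>c'\<in>B'. qscale (M' c' b') c') (T b')"
        by (intro sym[OF M'] bc)
      moreover have "eqv (T b') (T (\<Sum>b\<in>B. qscale (P b' b) b))"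
        by (intro T_eqv P bc)
      moreover have "T (\<Sum>b\<in>B. qscale (P b' b) b) = (\<Sum>b\<in>B. qscale (P b' b) (T b))"
        using fin by (simp add: T_sum T)
      moreover have "eqv (\<Sum>b\<in>B. qscale (P b' b) (T b))
          (\<Sum>b\<in>B. qscale (P b' b) (\<Sum>c\<in>B. qscale (M c b) c))"
        by (intro eqv_sum eqv_sc M)
      moreover have "eqv (\<Sum>b\<in>B. qscale (P b' b) (\<Sum>c\<in>B. qscale (M c b) c))
          (\<Sum>b\<in>B. qscale (P b' b) (\<Sum>c\<in>B. qscale (M c b) (\<Sum>c'\<in>B'. qscale (Q c c') c')))"
        by (intro eqv_sum eqv_sc Q)
      moreover have "(\<Sum>b\<in>B. qscale (P b' b) (\<Sum>c\<in>B. qscale (M c b) (\<Sum>c'\<in>B'. qscale (Q c c') c')))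
          = (\<Sum>c'\<in>B'. qscale (\<Sum>b\<in>B. \<Sum>c\<in>B. P b' b * M c b * Q c c') c')"
      proof -
        have "(\<Sum>b\<in>B. qscale (P b' b) (\<Sum>c\<in>B. qscale (M c b) (\<Sum>c'\<in>B'. qscale (Q c c') c')))
          = (\<Sum>b\<in>B. \<Sum>c\<in>B. \<Sum>c'\<in>B'. qscale (P b' b * M c b * Q c c') c')"
          by (simp add: qv.scale_sum_right mult.assoc)
        also have "\<dots> = (\<Sum>b\<in>B. \<Sum>c'\<in>B'. \<Sum>c\<in>B. qscale (P b' b * M c b * Q c c') c')"
          by (intro sum.cong refl sum.swap) simp
        also have "\<dots> = (\<Sum>c'\<in>B'. \<Sum>b\<in>B. \<Sum>c\<in>B. qscale (P b' b * M c b * Q c c') c')"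
          by (rule sum.swap)
        finally show ?thesis by (simp add: qv.scale_sum_left)
      qed
      ultimately show "eqv (\<Sum>c'\<in>B'. qscale (M' c' b') c')
          (\<Sum>c'\<in>B'. qscale (\<Sum>b\<in>B. \<Sum>c\<in>B. P b' b * M c b * Q c c') c')"
        by (auto intro: trans)
    qed
    have "(\<Sum>b'\<in>B'. M' b' b') = (\<Sum>b'\<in>B'. \<Sum>b\<in>B. \<Sum>c\<in>B. P b' b * M c b * Q c b')"
      by (intro sum.cong M'_eq) auto
    also have "\<dots> = (\<Sum>b\<in>B. \<Sum>b'\<in>B'. \<Sum>c\<in>B. P b' b * M c b * Q c b')"
      by (rule sum.swap)
    also have "\<dots> = (\<Sum>b\<in>B. \<Sum>c\<in>B. \<Sum>b'\<in>B'. P b' b * M c b * Q c b')"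
      by (rule sum.cong[OF HOL.refl], rule sum.swap)
    also have "\<dots> = (\<Sum>b\<in>B. \<Sum>c\<in>B. M c b * (\<Sum>b'\<in>B'. Q c b' * P b' b))"
      by (simp add: sum_distrib_left mult_ac)
    also have "\<dots> = (\<Sum>b\<in>B. \<Sum>c\<in>B. if b = c then M c b else 0)"
      by (intro sum.cong HOL.refl) (simp add: QP)
    also have "\<dots> = (\<Sum>b\<in>B. M b b)"
      using fin by simp
    finally show ?thesis .
  qed
  show ?thesis
    unfolding quot_trace_def
  proof (rule the_equality)
    show "\<exists>B' M'. quot_basis V W B' \<and> quot_matrix W B' T M' \<and> (\<Sum>b\<in>B. M b b) = (\<Sum>b\<in>B'. M' b b)"
      using B by blast
  qed (use main in blast)
qed

lemma rep_trace_trivial [simp]: "rep_trace trivial_rep x = 1"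
proof -
  let ?e = "Poly_Mapping.single () (1::rat)"
  have *: "v = qscale (Poly_Mapping.lookup v ()) ?e" for v
    by (rule poly_mapping_eqI) (simp add: lookup_single)
  have ne: "?e \<noteq> 0" by (simp add: poly_mapping_eq_iff fun_eq_iff lookup_single)
  have "quot_basis UNIV {0} {?e}"
  proof -
    have "\<exists>a. v = qscale (a ?e) ?e" for v
      using * by (intro exI[of _ "\<lambda>_. Poly_Mapping.lookup v ()"])
    with ne show ?thesis
      by (auto simp: quot_basis_def)
  qed
  moreover have "quot_matrix {0} {?e} (\<lambda>v. v) (\<lambda>_ _. 1)"
    by (simp add: quot_matrix_def)
  ultimately have "quot_trace (UNIV :: (unit \<Rightarrow>\<^sub>0 rat) set) {0} (\<lambda>v. v) = (\<Sum>b\<in>{?e}. 1)"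
    using quot_trace_unique[of "{0}" "\<lambda>v. v" UNIV "{?e}" "\<lambda>_ _. 1"]
    by (simp add: qv.subspace_single_0)
  then show ?thesis
    by (simp add: rep_trace_def trivial_rep_def)
qed


section \<open>Reduced homology of order complexes\<close>

text \<open>Simplices of dimension \<open>i \<ge> -1\<close> are chains with \<open>i + 1\<close> elements, the empty chain
  included; each is oriented by listing its vertices in increasing order. An order automorphism
  therefore permutes the oriented simplices without signs.\<close>

definition simplices :: "'p set \<Rightarrow> ('p \<Rightarrow> 'p \<Rightarrow> bool) \<Rightarrow> int \<Rightarrow> 'p set set" where
  "simplices P leq i = {C. C \<subseteq> P \<and> finite C \<and> int (card C) = i + 1 \<and>
     (\<forall>a\<in>C. \<forall>b\<in>C. leq a b \<or> leq b a)}"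

definition chain_space :: "'p set \<Rightarrow> ('p \<Rightarrow> 'p \<Rightarrow> bool) \<Rightarrow> int \<Rightarrow> ('p set \<Rightarrow>\<^sub>0 rat) set" where
  "chain_space P leq i = {v. Poly_Mapping.keys v \<subseteq> simplices P leq i}"

definition boundary :: "('p \<Rightarrow> 'p \<Rightarrow> bool) \<Rightarrow> ('p set \<Rightarrow>\<^sub>0 rat) \<Rightarrow> ('p set \<Rightarrow>\<^sub>0 rat)" where
  "boundary leq = lin_ext (\<lambda>C. \<Sum>a\<in>C.
     Poly_Mapping.single (C - {a}) ((-1) ^ card {b\<in>C. leq b a \<and> b \<noteq> a}))"

definition reduced_homology ::
  "'p set \<Rightarrow> ('p \<Rightarrow> 'p \<Rightarrow> bool) \<Rightarrow> ('x \<Rightarrow> 'p \<Rightarrow> 'p) \<Rightarrow> int \<Rightarrow> ('x, 'p set) qrep" where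
  "reduced_homology P leq act i =
     \<lparr>rep_V = {v \<in> chain_space P leq i. boundary leq v = 0},
      rep_W = boundary leq ` chain_space P leq (i + 1),
      rep_act = (\<lambda>x. lin_ext (\<lambda>C. Poly_Mapping.single (act x ` C) 1))\<rparr>"

definition R_homology ::
  "('a, 'b) monoid_scheme \<Rightarrow> nat \<Rightarrow> ('a \<times> nat \<Rightarrow> 'a \<times> nat, 'a dowling_elt set) qrep" where
  "R_homology G n = reduced_homology (R_proper G n) dowling_le dowling_act (int n - 2)"


section \<open>The completed ring of power sums\<close>

definition conj_class :: "('a, 'b) monoid_scheme \<Rightarrow> 'a \<Rightarrow> 'a set" where
  "conj_class G h = (\<lambda>g. g \<otimes>\<^bsub>G\<^esub> h \<otimes>\<^bsub>G\<^esub> inv\<^bsub>G\<^esub> g) ` carrier G"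

definition conj_classes :: "('a, 'b) monoid_scheme \<Rightarrow> 'a set set" where
  "conj_classes G = conj_class G ` carrier G"

definition class_pow :: "('a, 'b) monoid_scheme \<Rightarrow> 'a set \<Rightarrow> nat \<Rightarrow> 'a set" where
  "class_pow G c j = (\<lambda>h. h [^]\<^bsub>G\<^esub> j) ` c"

text \<open>The variable \<open>p\<^sub>i(c)\<close> is encoded as \<open>(i, c)\<close>, monomials and polynomials as finitely
  supported functions. The completion of \<open>\<Lambda>\<^sub>G\<close> is the product of its graded pieces; it is
  realised inside the ring of power series over the polynomial ring, as the set of series whose
  \<open>n\<close>-th coefficient is homogeneous of degree \<open>n\<close>. Thus \<^const>\<open>fps_X\<close> only records the degree, and
  the topology of the completion is the one of \<^typ>\<open>'r fps\<close>.\<close>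

type_synonym 'a pvar = "nat \<times> 'a set"
type_synonym 'a ppoly = "('a pvar \<Rightarrow>\<^sub>0 nat) \<Rightarrow>\<^sub>0 rat"
type_synonym 'a pseries = "'a ppoly fps"

definition weight :: "('a pvar \<Rightarrow>\<^sub>0 nat) \<Rightarrow> nat" where
  "weight m = (\<Sum>v\<in>Poly_Mapping.keys m. fst v * Poly_Mapping.lookup m v)"

definition homog :: "('a, 'b) monoid_scheme \<Rightarrow> nat \<Rightarrow> 'a ppoly set" where
  "homog G n = {P. \<forall>m\<in>Poly_Mapping.keys P. Poly_Mapping.keys m \<subseteq> {1..} \<times> conj_classes G \<and> weight m = n}"

definition A_ring :: "('a, 'b) monoid_scheme \<Rightarrow> 'a pseries set" where
  "A_ring G = {F. \<forall>n. F $ n \<in> homog G n}"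

definition A_plus :: "('a, 'b) monoid_scheme \<Rightarrow> 'a pseries set" where
  "A_plus G = {F \<in> A_ring G. F $ 0 = 0}"

definition qconst :: "rat \<Rightarrow> 'a pseries" where
  "qconst r = fps_const (Poly_Mapping.single 0 r)"

definition psum :: "nat \<Rightarrow> 'a set \<Rightarrow> 'a pseries" where
  "psum i c = fps_const (Poly_Mapping.single (Poly_Mapping.single (i, c) 1) 1) * fps_X ^ i"


section \<open>Characteristics\<close>

definition base_perm :: "('a, 'b) monoid_scheme \<Rightarrow> ('a \<times> nat \<Rightarrow> 'a \<times> nat) \<Rightarrow> nat \<Rightarrow> nat" where
  "base_perm G x m = snd (x (\<one>\<^bsub>G\<^esub>, m))"

definition cycle_count ::
  "('a, 'b) monoid_scheme \<Rightarrow> nat \<Rightarrow> ('a \<times> nat \<Rightarrow> 'a \<times> nat) \<Rightarrow> nat \<Rightarrow> 'a set \<Rightarrow> nat" where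
  "cycle_count G n x i c = card {Z \<in> orbit (base_perm G x) ` {1..n}.
     card Z = i \<and> (\<exists>m\<in>Z. \<exists>h\<in>c. (x ^^ i) (\<one>\<^bsub>G\<^esub>, m) = (h, m))}"

text \<open>All cycles of an element of \<^term>\<open>wreath G n\<close> have length at most \<open>n\<close>.\<close>

definition cycle_indicator ::
  "('a, 'b) monoid_scheme \<Rightarrow> nat \<Rightarrow> ('a \<times> nat \<Rightarrow> 'a \<times> nat) \<Rightarrow> 'a pseries" where
  "cycle_indicator G n x = (\<Prod>i\<in>{1..n}. \<Prod>c\<in>conj_classes G. psum i c ^ cycle_count G n x i c)"

definition ch ::
  "('a, 'b) monoid_scheme \<Rightarrow> nat \<Rightarrow> ('a \<times> nat \<Rightarrow> 'a \<times> nat, 'k) qrep \<Rightarrow> 'a pseries" where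
  "ch G n M = qconst (1 / (of_nat (card (carrier G)) ^ n * fact n)) *
     (\<Sum>x\<in>wreath G n. qconst (rep_trace M x) * cycle_indicator G n x)"

definition Exp_series :: "('a, 'b) monoid_scheme \<Rightarrow> 'a pseries" where
  "Exp_series G = suminf (\<lambda>n. ch G n trivial_rep)"


section \<open>Plethysm\<close>

text \<open>\<open>psubst \<phi> F\<close> substitutes \<open>\<phi> v\<close> for every variable \<open>v\<close> in \<open>F\<close>.\<close>

definition eval_monom :: "('v \<Rightarrow> 'a pseries) \<Rightarrow> ('v \<Rightarrow>\<^sub>0 nat) \<Rightarrow> 'a pseries" where
  "eval_monom \<phi> m = (\<Prod>v\<in>Poly_Mapping.keys m. \<phi> v ^ Poly_Mapping.lookup m v)"

definition eval_poly :: "('v \<Rightarrow> 'a pseries) \<Rightarrow> (('v \<Rightarrow>\<^sub>0 nat) \<Rightarrow>\<^sub>0 rat) \<Rightarrow> 'a pseries" where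
  "eval_poly \<phi> P = (\<Sum>m\<in>Poly_Mapping.keys P. qconst (Poly_Mapping.lookup P m) * eval_monom \<phi> m)"

definition psubst :: "('c pvar \<Rightarrow> 'a pseries) \<Rightarrow> 'c pseries \<Rightarrow> 'a pseries" where
  "psubst \<phi> F = suminf (\<lambda>n. eval_poly \<phi> (F $ n))"

text \<open>The ring for the trivial group has variables \<open>(j, {()})\<close>.\<close>

abbreviation triv :: "unit monoid" where
  "triv \<equiv> singleton_group ()"

definition plethysm ::
  "('a, 'b) monoid_scheme \<Rightarrow> 'a pseries \<Rightarrow> unit pseries \<Rightarrow> 'a pseries" where
  "plethysm G f g =
     psubst (\<lambda>(i, c). psubst (\<lambda>(j, _). psum (i * j) (class_pow G c j)) g) f"

text \<open>Plethysm is characterised below, in \<open>plethysm_right_plethysm\<close> and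
  \<open>right_plethysm_unique\<close>, by the following axioms.\<close>

definition cont_alg_hom :: "('c, 'd) monoid_scheme \<Rightarrow> ('a, 'b) monoid_scheme \<Rightarrow>
    ('c pseries \<Rightarrow> 'a pseries) \<Rightarrow> bool" where
  "cont_alg_hom H G \<phi> \<longleftrightarrow>
     (\<forall>F\<in>A_ring H. \<phi> F \<in> A_ring G) \<and>
     (\<forall>r. \<phi> (qconst r) = qconst r) \<and>
     (\<forall>F\<in>A_ring H. \<forall>F'\<in>A_ring H. \<phi> (F + F') = \<phi> F + \<phi> F' \<and> \<phi> (F * F') = \<phi> F * \<phi> F') \<and>
     continuous_on (A_ring H) \<phi>"

definition right_plethysm ::
  "('a, 'b) monoid_scheme \<Rightarrow> ('a pseries \<Rightarrow> unit pseries \<Rightarrow> 'a pseries) \<Rightarrow> bool" where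
  "right_plethysm G pl \<longleftrightarrow>
     (\<forall>g\<in>A_plus triv. cont_alg_hom G G (\<lambda>f. pl f g)) \<and>
     (\<forall>i\<ge>1. \<forall>c\<in>conj_classes G. \<exists>\<phi>. cont_alg_hom triv G \<phi> \<and>
        (\<forall>g\<in>A_plus triv. pl (psum i c) g = \<phi> g)) \<and>
     (\<forall>i\<ge>1. \<forall>c\<in>conj_classes G. \<forall>j\<ge>1.
        pl (psum i c) (psum j {()}) = psum (i * j) (class_pow G c j))"

lemma qconst_simps [simp]:
  "qconst 0 = 0" "qconst 1 = 1" "qconst (r + s) = qconst r + qconst s"
  "qconst (r * s) = qconst r * qconst s"
  by (simp_all add: qconst_def single_add mult_single mult.commute)

lemma eval_monom_superset:
  assumes "finite S" "Poly_Mapping.keys m \<subseteq> S"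
  shows "eval_monom \<phi> m = (\<Prod>v\<in>S. \<phi> v ^ Poly_Mapping.lookup m v)"
  unfolding eval_monom_def
  by (rule prod.mono_neutral_left) (use assms in \<open>auto simp: in_keys_iff\<close>)

lemma eval_monom_add: "eval_monom \<phi> (m + m') = eval_monom \<phi> m * eval_monom \<phi> m'"
proof -
  let ?S = "Poly_Mapping.keys m \<union> Poly_Mapping.keys m'"
  have "eval_monom \<phi> (m + m') = (\<Prod>v\<in>?S. \<phi> v ^ Poly_Mapping.lookup (m + m') v)"
    by (rule eval_monom_superset) (use keys_add[of m m'] in auto)
  then show ?thesis
    by (simp add: eval_monom_superset[of ?S] lookup_add power_add prod.distrib)
qed

lemma eval_monom_0 [simp]: "eval_monom \<phi> 0 = 1"
  by (simp add: eval_monom_def)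

lemma eval_monom_single [simp]: "eval_monom \<phi> (Poly_Mapping.single v k) = \<phi> v ^ k"
  by (simp add: eval_monom_def)

lemma weight_superset:
  assumes "finite S" "Poly_Mapping.keys m \<subseteq> S"
  shows "weight m = (\<Sum>v\<in>S. fst v * Poly_Mapping.lookup m v)"
  unfolding weight_def
  by (rule sum.mono_neutral_left) (use assms in \<open>auto simp: in_keys_iff\<close>)

lemma weight_add: "weight (m + m') = weight m + weight m'"
proof -
  let ?S = "Poly_Mapping.keys m \<union> Poly_Mapping.keys m'"
  have "weight (m + m') = (\<Sum>v\<in>?S. fst v * Poly_Mapping.lookup (m + m') v)"
    by (rule weight_superset) (use keys_add[of m m'] in auto)
  then show ?thesis
    by (simp add: weight_superset[of ?S] lookup_add distrib_left sum.distrib)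
qed

lemma eval_poly_superset:
  assumes "finite S" "Poly_Mapping.keys P \<subseteq> S"
  shows "eval_poly \<phi> P = (\<Sum>m\<in>S. qconst (Poly_Mapping.lookup P m) * eval_monom \<phi> m)"
  unfolding eval_poly_def
  by (rule sum.mono_neutral_left) (use assms in \<open>auto simp: in_keys_iff\<close>)

lemma eval_poly_0 [simp]: "eval_poly \<phi> 0 = 0"
  by (simp add: eval_poly_def)

lemma eval_poly_single [simp]:
  "eval_poly \<phi> (Poly_Mapping.single m r) = qconst r * eval_monom \<phi> m"
  by (simp add: eval_poly_def)

lemma eval_poly_add: "eval_poly \<phi> (P + Q) = eval_poly \<phi> P + eval_poly \<phi> Q"
proof -
  let ?S = "Poly_Mapping.keys P \<union> Poly_Mapping.keys Q"
  have "eval_poly \<phi> (P + Q) =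
      (\<Sum>m\<in>?S. qconst (Poly_Mapping.lookup (P + Q) m) * eval_monom \<phi> m)"
    by (rule eval_poly_superset) (use keys_add[of P Q] in auto)
  then show ?thesis
    by (simp add: eval_poly_superset[of ?S] lookup_add distrib_right sum.distrib)
qed

lemma eval_poly_sum: "eval_poly \<phi> (\<Sum>i\<in>I. f i) = (\<Sum>i\<in>I. eval_poly \<phi> (f i))"
  by (induction I rule: infinite_finite_induct) (simp_all add: eval_poly_add)

lemma poly_expand:
  "P = (\<Sum>m\<in>Poly_Mapping.keys P. Poly_Mapping.single m (Poly_Mapping.lookup P m))"
  by (rule poly_mapping_eqI)
     (simp add: lookup_sum lookup_single when_def in_keys_iff)

lemma eval_poly_mult: "eval_poly \<phi> (P * Q) = eval_poly \<phi> P * eval_poly \<phi> Q"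
proof -
  have "eval_poly \<phi> (P * Q) = eval_poly \<phi>
      ((\<Sum>m\<in>Poly_Mapping.keys P. Poly_Mapping.single m (Poly_Mapping.lookup P m)) *
       (\<Sum>m\<in>Poly_Mapping.keys Q. Poly_Mapping.single m (Poly_Mapping.lookup Q m)))"
    by (simp only: poly_expand[symmetric])
  also have "\<dots> = eval_poly \<phi> P * eval_poly \<phi> Q"
    by (simp add: sum_product eval_poly_sum mult_single eval_poly_def[of _ P] eval_poly_def[of _ Q]
        eval_monom_add mult_ac)
  finally show ?thesis .
qed


lemma homog_0 [simp]: "0 \<in> homog G n"
  by (simp add: homog_def)

lemma homog_single_0 [simp]: "Poly_Mapping.single 0 r \<in> homog G 0"
  by (auto simp: homog_def weight_def)

lemma homog_add: "P \<in> homog G n \<Longrightarrow> Q \<in> homog G n \<Longrightarrow> P + Q \<in> homog G n"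
  unfolding homog_def using keys_add[of P Q] by blast

lemma homog_sum: "(\<And>i. i \<in> I \<Longrightarrow> f i \<in> homog G n) \<Longrightarrow> (\<Sum>i\<in>I. f i) \<in> homog G n"
  by (induction I rule: infinite_finite_induct) (simp_all add: homog_add)

lemma homog_mult:
  assumes "P \<in> homog G n" "Q \<in> homog G k"
  shows "P * Q \<in> homog G (n + k)"
  unfolding homog_def
proof (intro CollectI ballI)
  fix m assume "m \<in> Poly_Mapping.keys (P * Q)"
  then obtain a b where "m = a + b" "a \<in> Poly_Mapping.keys P" "b \<in> Poly_Mapping.keys Q"
    using keys_mult[of P Q] by blast
  moreover from this assms have "Poly_Mapping.keys a \<subseteq> {1..} \<times> conj_classes G" "weight a = n"
    "Poly_Mapping.keys b \<subseteq> {1..} \<times> conj_classes G" "weight b = k"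
    unfolding homog_def by blast+
  ultimately show "Poly_Mapping.keys m \<subseteq> {1..} \<times> conj_classes G \<and> weight m = n + k"
    using keys_add[of a b] by (simp add: weight_add) blast
qed

lemma A_ring_nth: "F \<in> A_ring G \<Longrightarrow> F $ n \<in> homog G n"
  by (simp add: A_ring_def)

lemma A_ring_add: "F \<in> A_ring G \<Longrightarrow> F' \<in> A_ring G \<Longrightarrow> F + F' \<in> A_ring G"
  by (simp add: A_ring_def homog_add)

lemma A_ring_mult:
  assumes "F \<in> A_ring G" "F' \<in> A_ring G"
  shows "F * F' \<in> A_ring G"
proof -
  have "F $ i * F' $ (n - i) \<in> homog G n" if "i \<in> {0..n}" for n i
    using homog_mult[of "F $ i" G i "F' $ (n - i)" "n - i"] assms that by (simp add: A_ring_def)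
  then show ?thesis
    by (auto simp: A_ring_def fps_mult_nth intro!: homog_sum)
qed

lemma A_ring_qconst [simp]: "qconst r \<in> A_ring G"
  by (auto simp: A_ring_def qconst_def)

lemma A_ring_0 [simp]: "0 \<in> A_ring G" and A_ring_1 [simp]: "1 \<in> A_ring G"
  using A_ring_qconst[of 0 G] A_ring_qconst[of 1 G] by simp_all

lemma A_ring_power: "F \<in> A_ring G \<Longrightarrow> F ^ n \<in> A_ring G"
  by (induction n) (simp_all add: A_ring_mult)

lemma A_ring_prod: "(\<And>i. i \<in> I \<Longrightarrow> f i \<in> A_ring G) \<Longrightarrow> (\<Prod>i\<in>I. f i) \<in> A_ring G"
  by (induction I rule: infinite_finite_induct) (simp_all add: A_ring_mult)

lemma A_ring_sum: "(\<And>i. i \<in> I \<Longrightarrow> f i \<in> A_ring G) \<Longrightarrow> (\<Sum>i\<in>I. f i) \<in> A_ring G"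
  by (induction I rule: infinite_finite_induct) (simp_all add: A_ring_add)

lemma psum_nth: "psum i c $ n =
    (if n = i then Poly_Mapping.single (Poly_Mapping.single (i, c) 1) 1 else 0)"
  by (auto simp: psum_def)

lemma A_ring_psum: "i \<ge> 1 \<Longrightarrow> c \<in> conj_classes G \<Longrightarrow> psum i c \<in> A_ring G"
  by (auto simp: A_ring_def psum_nth homog_def weight_def)

definition vanish :: "nat \<Rightarrow> 'r::zero fps \<Rightarrow> bool" where
  "vanish n F \<longleftrightarrow> (\<forall>k<n. F $ k = 0)"

lemma vanish_mult:
  assumes "vanish a F" "vanish b F'"
  shows "vanish (a + b) (F * (F' :: 'r::comm_ring_1 fps))"
  unfolding vanish_def fps_mult_nth
proof (intro allI impI sum.neutral ballI)
  fix k i assume "k < a + b" "i \<in> {0..k}"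
  then have "i < a \<or> k - i < b" by auto
  with assms show "F $ i * F' $ (k - i) = 0" by (auto simp: vanish_def)
qed

lemma vanish_power: "vanish a F \<Longrightarrow> vanish (a * n) (F ^ n :: 'r::comm_ring_1 fps)"
  by (induction n) (auto simp: vanish_mult vanish_def[of 0])

lemma vanish_prod:
  "(\<And>i. i \<in> I \<Longrightarrow> vanish (a i) (f i)) \<Longrightarrow> vanish (\<Sum>i\<in>I. a i) (\<Prod>i\<in>I. f i :: 'r::comm_ring_1 fps)"
  by (induction I rule: infinite_finite_induct) (auto simp: vanish_mult vanish_def[of 0])

lemma vanish_sum:
  "(\<And>i. i \<in> I \<Longrightarrow> vanish n (f i)) \<Longrightarrow> vanish n (\<Sum>i\<in>I. f i :: 'r::comm_ring_1 fps)"
  by (simp add: vanish_def fps_sum_nth)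

lemma eval_monom_vanish:
  assumes "\<And>v. v \<in> Poly_Mapping.keys m \<Longrightarrow> vanish (fst v) (\<phi> v)"
  shows "vanish (weight m) (eval_monom \<phi> m)"
  unfolding weight_def eval_monom_def
  by (intro vanish_prod vanish_power assms)

definition graded_subst ::
  "('c, 'd) monoid_scheme \<Rightarrow> ('a, 'b) monoid_scheme \<Rightarrow> ('c pvar \<Rightarrow> 'a pseries) \<Rightarrow> bool" where
  "graded_subst H G \<phi> \<longleftrightarrow>
     (\<forall>v\<in>{1..} \<times> conj_classes H. \<phi> v \<in> A_ring G \<and> vanish (fst v) (\<phi> v))"

lemma eval_poly_vanish:
  assumes "graded_subst H G \<phi>" "P \<in> homog H n"
  shows "vanish n (eval_poly \<phi> P)"
  unfolding eval_poly_def
proof (rule vanish_sum)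
  fix m assume m: "m \<in> Poly_Mapping.keys P"
  then have "vanish (fst v) (\<phi> v)" if "v \<in> Poly_Mapping.keys m" for v
    using assms that unfolding graded_subst_def homog_def by blast
  then have "vanish (weight m) (eval_monom \<phi> m)"
    by (rule eval_monom_vanish)
  moreover have "weight m = n" using assms m by (auto simp: homog_def)
  ultimately show "vanish n (qconst (Poly_Mapping.lookup P m) * eval_monom \<phi> m)"
    using vanish_mult[of 0 "qconst (Poly_Mapping.lookup P m)" n "eval_monom \<phi> m"]
    by (simp add: vanish_def)
qed

lemma eval_poly_A_ring:
  assumes "graded_subst H G \<phi>" "P \<in> homog H n"
  shows "eval_poly \<phi> P \<in> A_ring G"
  unfolding eval_poly_def eval_monom_def
  by (intro A_ring_sum A_ring_mult A_ring_qconst A_ring_prod A_ring_power)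
     (use assms in \<open>auto simp: graded_subst_def homog_def\<close>)

lemma fps_tendsto_iff:
  "(f \<longlonglongrightarrow> (l :: 'r::comm_ring_1 fps)) \<longleftrightarrow> (\<forall>k. \<forall>\<^sub>F n in sequentially. \<forall>j\<le>k. f n $ j = l $ j)"
proof
  assume *: "f \<longlonglongrightarrow> l"
  show "\<forall>k. \<forall>\<^sub>F n in sequentially. \<forall>j\<le>k. f n $ j = l $ j"
  proof
    fix k
    have "\<forall>\<^sub>F n in sequentially. dist (f n) l < inverse (2 ^ k)"
      using * by (rule tendstoD) simp
    then show "\<forall>\<^sub>F n in sequentially. \<forall>j\<le>k. f n $ j = l $ j"
      by (simp add: dist_less_eq_nth_equal)
  qed
next
  assume *: "\<forall>k. \<forall>\<^sub>F n in sequentially. \<forall>j\<le>k. f n $ j = l $ j"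
  show "f \<longlonglongrightarrow> l"
  proof (rule tendstoI)
    fix e :: real assume "e > 0"
    then obtain k where k: "inverse (2 ^ k) < e"
      using real_arch_pow_inv[of e "1/2"] by (auto simp: field_simps)
    have "\<forall>\<^sub>F n in sequentially. dist (f n) l < inverse (2 ^ k)"
      using * by (simp add: dist_less_eq_nth_equal)
    then show "\<forall>\<^sub>F n in sequentially. dist (f n) l < e"
      by eventually_elim (use k in simp)
  qed
qed

lemma vanish_sums:
  fixes f :: "nat \<Rightarrow> 'r::comm_ring_1 fps"
  assumes "\<And>n. vanish n (f n)"
  shows "f sums Abs_fps (\<lambda>k. \<Sum>n\<le>k. f n $ k)"
  unfolding sums_def_le fps_tendsto_iff
proof
  fix k
  have "f i $ j = 0" if "j < i" for i j
    using assms that by (simp add: vanish_def)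
  then have "\<forall>n\<ge>k. \<forall>j\<le>k. (\<Sum>i\<le>n. f i) $ j = Abs_fps (\<lambda>k. \<Sum>n\<le>k. f n $ k) $ j"
    by (auto simp: fps_sum_nth intro!: sum.mono_neutral_right) (meson linorder_not_less)
  then show "\<forall>\<^sub>F n in sequentially. \<forall>j\<le>k. (\<Sum>i\<le>n. f i) $ j = Abs_fps (\<lambda>k. \<Sum>n\<le>k. f n $ k) $ j"
    by (auto simp: eventually_sequentially)
qed

lemma psubst_nth:
  assumes "graded_subst H G \<phi>" "F \<in> A_ring H"
  shows "psubst \<phi> F $ k = (\<Sum>n\<le>k. eval_poly \<phi> (F $ n) $ k)"
proof -
  have "psubst \<phi> F = Abs_fps (\<lambda>k. \<Sum>n\<le>k. eval_poly \<phi> (F $ n) $ k)"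
    unfolding psubst_def
    by (intro sums_unique[symmetric] vanish_sums eval_poly_vanish[OF assms(1)] A_ring_nth assms)
  then show ?thesis by simp
qed

lemma psubst_nth':
  assumes "graded_subst H G \<phi>" "F \<in> A_ring H" "k \<le> N"
  shows "psubst \<phi> F $ k = eval_poly \<phi> (\<Sum>n\<le>N. F $ n) $ k"
  unfolding psubst_nth[OF assms(1,2)] eval_poly_sum fps_sum_nth
  by (rule sum.mono_neutral_left)
     (use assms eval_poly_vanish[OF assms(1) A_ring_nth[OF assms(2)]] in \<open>auto simp: vanish_def\<close>)

lemma psubst_mult:
  assumes "graded_subst H G \<phi>" "F \<in> A_ring H" "F' \<in> A_ring H"
  shows "psubst \<phi> (F * F') = psubst \<phi> F * psubst \<phi> F'"
proof (rule fps_ext)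
  fix k :: nat
  let ?I = "{..k} \<times> {..k}"
  let ?t = "\<lambda>(a, b). eval_poly \<phi> (F $ a * F' $ b) $ k"
  have vanish: "vanish (a + b) (eval_poly \<phi> (F $ a * F' $ b))" for a b
    by (intro eval_poly_vanish[OF assms(1)] homog_mult A_ring_nth assms)
  have "(psubst \<phi> F * psubst \<phi> F') $ k =
      (eval_poly \<phi> (\<Sum>n\<le>k. F $ n) * eval_poly \<phi> (\<Sum>n\<le>k. F' $ n)) $ k"
    by (simp add: fps_mult_nth psubst_nth'[OF assms(1,2), of _ k] psubst_nth'[OF assms(1,3), of _ k])
  also have "\<dots> = (\<Sum>p\<in>?I. ?t p)"
    by (simp add: eval_poly_mult[symmetric] sum_product eval_poly_sum fps_sum_nth sum.cartesian_product
        case_prod_unfold)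
  also have "\<dots> = (\<Sum>p | p \<in> ?I \<and> fst p + snd p \<le> k. ?t p)"
    by (rule sum.mono_neutral_right)
       (use vanish in \<open>auto simp: vanish_def not_le[symmetric]\<close>, metis not_le)
  also have "\<dots> = (\<Sum>(n, a)\<in>Sigma {..k} (\<lambda>n. {0..n}). ?t (a, n - a))"
    by (rule sum.reindex_bij_witness[of _ "\<lambda>(n, a). (a, n - a)" "\<lambda>(a, b). (a + b, a)"]) auto
  also have "\<dots> = psubst \<phi> (F * F') $ k"
    by (simp add: psubst_nth[OF assms(1) A_ring_mult[OF assms(2,3)]] fps_mult_nth eval_poly_sum
        fps_sum_nth sum.Sigma)
  finally show "psubst \<phi> (F * F') $ k = (psubst \<phi> F * psubst \<phi> F') $ k" ..
qed

lemma continuous_on_fpsI: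
  fixes \<phi> :: "'r::comm_ring_1 fps \<Rightarrow> 's::comm_ring_1 fps"
  assumes "\<And>F F' k. F \<in> S \<Longrightarrow> F' \<in> S \<Longrightarrow> (\<And>j. j \<le> k \<Longrightarrow> F $ j = F' $ j) \<Longrightarrow> \<phi> F $ k = \<phi> F' $ k"
  shows "continuous_on S \<phi>"
  unfolding continuous_on_def
proof (intro ballI tendstoI)
  fix F and e :: real assume F: "F \<in> S" "e > 0"
  obtain k where k: "inverse (2 ^ k) < e"
    using real_arch_pow_inv[of e "1/2"] F by (auto simp: field_simps)
  have "dist (\<phi> F') (\<phi> F) < e" if "F' \<in> S" "dist F' F < inverse (2 ^ k)" for F'
  proof -
    have "dist (\<phi> F') (\<phi> F) < inverse (2 ^ k)"
      using that F assms[of F' F] by (auto simp: dist_less_eq_nth_equal)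
    with k show ?thesis by simp
  qed
  then show "\<forall>\<^sub>F F' in at F within S. dist (\<phi> F') (\<phi> F) < e"
    unfolding eventually_at by (intro exI[of _ "inverse (2 ^ k)"]) auto
qed

lemma psubst_cont_alg_hom:
  assumes "graded_subst H G \<phi>"
  shows "cont_alg_hom H G (psubst \<phi>)"
  unfolding cont_alg_hom_def
proof (intro conjI ballI allI)
  fix F assume F: "F \<in> A_ring H"
  have "psubst \<phi> F $ n \<in> homog G n" for n
    unfolding psubst_nth[OF assms F]
    by (intro homog_sum A_ring_nth eval_poly_A_ring[OF assms A_ring_nth[OF F]])
  then show "psubst \<phi> F \<in> A_ring G"
    by (simp add: A_ring_def)
  fix F' assume F': "F' \<in> A_ring H"
  show "psubst \<phi> (F * F') = psubst \<phi> F * psubst \<phi> F'"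
    using psubst_mult[OF assms F F'] .
  show "psubst \<phi> (F + F') = psubst \<phi> F + psubst \<phi> F'"
    by (rule fps_ext)
       (simp add: psubst_nth[OF assms] A_ring_add F F' eval_poly_add sum.distrib)
next
  fix r
  have "eval_poly \<phi> (qconst r $ n) = (if n = 0 then qconst r else 0)" for n
    by (simp add: qconst_def)
  then show "psubst \<phi> (qconst r) = qconst r"
    by (intro fps_ext) (simp add: psubst_nth[OF assms] if_distrib[of "\<lambda>x. x $ _"] cong: if_cong)
next
  show "continuous_on (A_ring H) (psubst \<phi>)"
    by (rule continuous_on_fpsI) (simp add: psubst_nth[OF assms])
qed

lemma psubst_psum:
  assumes "graded_subst H G \<phi>" "i \<ge> 1" "c \<in> conj_classes H"
  shows "psubst \<phi> (psum i c) = \<phi> (i, c)"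
proof (rule fps_ext)
  fix k
  have "psubst \<phi> (psum i c) $ k = (\<Sum>n\<le>k. if n = i then \<phi> (i, c) $ k else 0)"
    unfolding psubst_nth[OF assms(1) A_ring_psum[OF assms(2,3)]]
    by (intro sum.cong refl) (auto simp: psum_nth)
  also have "\<dots> = \<phi> (i, c) $ k"
    using assms by (auto simp: graded_subst_def vanish_def)
  finally show "psubst \<phi> (psum i c) $ k = \<phi> (i, c) $ k" .
qed

lemma psubst_cong:
  assumes "F \<in> A_ring H" "\<And>i c. i \<ge> 1 \<Longrightarrow> c \<in> conj_classes H \<Longrightarrow> \<phi> (i, c) = \<psi> (i, c)"
  shows "psubst \<phi> F = psubst \<psi> F"
proof -
  have "eval_poly \<phi> (F $ n) = eval_poly \<psi> (F $ n)" for n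
    unfolding eval_poly_def eval_monom_def
    using A_ring_nth[OF assms(1), of n] assms(2)
    by (intro sum.cong prod.cong refl arg_cong2[of _ _ _ _ "(*)"])
       (fastforce simp: homog_def)
  then show ?thesis by (simp add: psubst_def)
qed

lemma eval_poly_psum:
  assumes "P \<in> homog H n"
  shows "eval_poly (\<lambda>(i, c). psum i c) P = fps_const P * fps_X ^ n"
proof -
  have mon: "eval_monom (\<lambda>(i, c). psum i c) m =
      fps_const (Poly_Mapping.single m 1) * fps_X ^ weight m" for m :: "'a pvar \<Rightarrow>\<^sub>0 nat"
  proof -
    have pw: "Poly_Mapping.single (Poly_Mapping.single v 1) (1::rat) ^ k =
        Poly_Mapping.single (Poly_Mapping.single v k) 1" for v :: "'a pvar" and k :: nat
      by (induction k) (auto simp: mult_single single_add[symmetric])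
    have ps: "(case v of (i, c) \<Rightarrow> psum i c) ^ k = fps_const
        (Poly_Mapping.single (Poly_Mapping.single v k) 1) * fps_X ^ (fst v * k)" for v :: "'a pvar" and k
      by (cases v) (simp add: psum_def power_mult_distrib fps_const_power pw[simplified] power_mult)
    have pr: "(\<Prod>v\<in>S. Poly_Mapping.single (f v) (1::rat)) = Poly_Mapping.single (\<Sum>v\<in>S. f v) 1"
      for S :: "'a pvar set" and f :: "'a pvar \<Rightarrow> 'a pvar \<Rightarrow>\<^sub>0 nat"
      by (induction S rule: infinite_finite_induct)
         (auto simp: mult_single single_one[symmetric] simp del: single_one)
    have fprod: "(\<Prod>i\<in>S. fps_const (f i)) = fps_const (\<Prod>i\<in>S. f i)"
      for S :: "'a pvar set" and f :: "'a pvar \<Rightarrow> 'a ppoly"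
      by (induction S rule: infinite_finite_induct) auto
    have "eval_monom (\<lambda>(i, c). psum i c) m = (\<Prod>v\<in>Poly_Mapping.keys m.
        fps_const (Poly_Mapping.single (Poly_Mapping.single v (Poly_Mapping.lookup m v)) 1) *
        fps_X ^ (fst v * Poly_Mapping.lookup m v))"
      unfolding eval_monom_def ps ..
    also have "\<dots> = fps_const (\<Prod>v\<in>Poly_Mapping.keys m.
        Poly_Mapping.single (Poly_Mapping.single v (Poly_Mapping.lookup m v)) 1) * fps_X ^ weight m"
      by (simp add: prod.distrib weight_def power_sum fprod)
    also have "\<dots> = fps_const (Poly_Mapping.single m 1) * fps_X ^ weight m"
      unfolding pr by (subst poly_expand[of m, symmetric]) simp
    finally show ?thesis .
  qed
  have fsum: "(\<Sum>i\<in>S. fps_const (f i)) = fps_const (\<Sum>i\<in>S. f i)"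
    for S :: "('a pvar \<Rightarrow>\<^sub>0 nat) set" and f :: "('a pvar \<Rightarrow>\<^sub>0 nat) \<Rightarrow> 'a ppoly"
    by (induction S rule: infinite_finite_induct) auto
  have "eval_poly (\<lambda>(i, c). psum i c) P = (\<Sum>m\<in>Poly_Mapping.keys P.
      fps_const (Poly_Mapping.single m (Poly_Mapping.lookup P m)) * fps_X ^ n)"
    unfolding eval_poly_def mon
    using assms by (intro sum.cong refl) (auto simp: homog_def qconst_def mult_single
        mult.assoc[symmetric])
  also have "\<dots> = fps_const (\<Sum>m\<in>Poly_Mapping.keys P.
      Poly_Mapping.single m (Poly_Mapping.lookup P m)) * fps_X ^ n"
    by (simp add: sum_distrib_right[symmetric] fsum)
  finally show ?thesis by (simp only: poly_expand[symmetric])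
qed

lemma cont_alg_hom_eval:
  assumes "cont_alg_hom H G \<phi>" "P \<in> homog H n"
  shows "\<phi> (eval_poly (\<lambda>(i, c). psum i c) P) = eval_poly (\<lambda>(i, c). \<phi> (psum i c)) P"
proof -
  have mult: "\<phi> (F * F') = \<phi> F * \<phi> F'" and add: "\<phi> (F + F') = \<phi> F + \<phi> F'"
    if "F \<in> A_ring H" "F' \<in> A_ring H" for F F'
    using assms that by (auto simp: cont_alg_hom_def)
  have const: "\<phi> (qconst r) = qconst r" for r
    using assms by (auto simp: cont_alg_hom_def)
  have one: "\<phi> 1 = 1" and zero: "\<phi> 0 = 0" using const[of 1] const[of 0] by simp_all
  have power: "\<phi> (F ^ k) = \<phi> F ^ k" if "F \<in> A_ring H" for F k
    by (induction k) (auto simp: one mult A_ring_power that)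
  have prod: "\<phi> (\<Prod>i\<in>I. f i) = (\<Prod>i\<in>I. \<phi> (f i))" if "\<And>i. i \<in> I \<Longrightarrow> f i \<in> A_ring H"
    for I :: "'a pvar set" and f
    using that by (induction I rule: infinite_finite_induct) (auto simp: one mult A_ring_prod)
  have sum: "\<phi> (\<Sum>i\<in>I. f i) = (\<Sum>i\<in>I. \<phi> (f i))" if "\<And>i. i \<in> I \<Longrightarrow> f i \<in> A_ring H"
    for I :: "('a pvar \<Rightarrow>\<^sub>0 nat) set" and f
    using that by (induction I rule: infinite_finite_induct) (auto simp: zero add A_ring_sum)
  have vars: "(\<lambda>(i, c). psum i c) v \<in> A_ring H"
    if "m \<in> Poly_Mapping.keys P" "v \<in> Poly_Mapping.keys m" for m v
  proof -
    have "v \<in> {1..} \<times> conj_classes H"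
      using assms(2) that unfolding homog_def by blast
    then show ?thesis by (auto intro!: A_ring_psum)
  qed
  have "\<phi> (eval_poly (\<lambda>(i, c). psum i c) P) = (\<Sum>m\<in>Poly_Mapping.keys P.
      \<phi> (qconst (Poly_Mapping.lookup P m) * eval_monom (\<lambda>(i, c). psum i c) m))"
    unfolding eval_poly_def eval_monom_def
    by (intro sum A_ring_mult A_ring_qconst A_ring_prod A_ring_power vars)
  also have "\<dots> = eval_poly (\<lambda>(i, c). \<phi> (psum i c)) P"
    unfolding eval_poly_def
  proof (intro sum.cong refl)
    fix m assume m: "m \<in> Poly_Mapping.keys P"
    have va: "psum a b \<in> A_ring H" if "(a, b) \<in> Poly_Mapping.keys m" for a b
      using vars[OF m that] by simp
    have "\<phi> (eval_monom (\<lambda>(i, c). psum i c) m) = (\<Prod>v\<in>Poly_Mapping.keys m.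
        \<phi> ((\<lambda>(i, c). psum i c) v ^ Poly_Mapping.lookup m v))"
      unfolding eval_monom_def by (intro prod A_ring_power vars[OF m])
    also have "\<dots> = eval_monom (\<lambda>(i, c). \<phi> (psum i c)) m"
      unfolding eval_monom_def
      by (intro prod.cong refl, subst power) (auto simp: va)
    finally have ev: "\<phi> (eval_monom (\<lambda>(i, c). psum i c) m) = eval_monom (\<lambda>(i, c). \<phi> (psum i c)) m" .
    show "\<phi> (qconst (Poly_Mapping.lookup P m) * eval_monom (\<lambda>(i, c). psum i c) m) =
        qconst (Poly_Mapping.lookup P m) * eval_monom (\<lambda>(i, c). \<phi> (psum i c)) m"
      by (subst mult) (auto simp: const ev, auto simp: eval_monom_def va intro!: A_ring_prod A_ring_power)
  qed
  finally show ?thesis .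
qed

text \<open>A continuous homomorphism is determined by its values on the power sums.\<close>

lemma cont_alg_hom_eq_psubst:
  assumes \<phi>: "cont_alg_hom H G \<phi>" and F: "F \<in> A_ring H"
  shows "\<phi> F = psubst (\<lambda>(i, c). \<phi> (psum i c)) F"
proof -
  let ?p = "\<lambda>n. eval_poly (\<lambda>(i, c). psum i c) (F $ n)"
  have p: "?p n = fps_const (F $ n) * fps_X ^ n" for n
    by (rule eval_poly_psum[OF A_ring_nth[OF F]])
  have pA: "?p n \<in> A_ring H" for n
    using A_ring_nth[OF F] by (auto simp: p A_ring_def)
  have "?p sums Abs_fps (\<lambda>k. \<Sum>n\<le>k. ?p n $ k)"
    by (rule vanish_sums) (simp add: p vanish_def)
  also have "Abs_fps (\<lambda>k. \<Sum>n\<le>k. ?p n $ k) = F"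
    by (rule fps_ext) (simp add: p mult_delta_right)
  finally have "(\<lambda>N. \<Sum>n<N. ?p n) \<longlonglongrightarrow> F" by (simp add: sums_def)
  moreover have "continuous_on (A_ring H) \<phi>" using \<phi> by (simp add: cont_alg_hom_def)
  ultimately have "(\<lambda>N. \<phi> (\<Sum>n<N. ?p n)) \<longlonglongrightarrow> \<phi> F"
    using F by (elim continuous_on_tendsto_compose) (auto intro!: always_eventually A_ring_sum pA)
  moreover have "\<phi> (\<Sum>n<N. ?p n) = (\<Sum>n<N. eval_poly (\<lambda>(i, c). \<phi> (psum i c)) (F $ n))" for N
  proof (induction N)
    case 0
    have "\<phi> (qconst 0) = qconst 0" using \<phi> unfolding cont_alg_hom_def by blast
    then show ?case by simp
  next
    case (Suc N)
    have "\<phi> ((\<Sum>n<N. ?p n) + ?p N) = \<phi> (\<Sum>n<N. ?p n) + \<phi> (?p N)"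
      using \<phi> A_ring_sum[of "{..<N}" ?p H] pA unfolding cont_alg_hom_def by blast
    with Suc cont_alg_hom_eval[OF \<phi> A_ring_nth[OF F]] show ?case by simp
  qed
  ultimately have "(\<lambda>n. eval_poly (\<lambda>(i, c). \<phi> (psum i c)) (F $ n)) sums \<phi> F"
    by (simp add: sums_def)
  then show ?thesis unfolding psubst_def by (rule sums_unique)
qed

lemma conj_classes_triv [simp]: "conj_classes triv = {{()}}"
  by (auto simp: conj_classes_def conj_class_def singleton_group_def)

lemma class_pow_conj_classes:
  assumes "group G" "c \<in> conj_classes G"
  shows "class_pow G c j \<in> conj_classes G"
proof -
  interpret group G by fact
  obtain h where h: "h \<in> carrier G" "c = conj_class G h"
    using assms by (auto simp: conj_classes_def)
  have canc: "inv\<^bsub>G\<^esub> g \<otimes>\<^bsub>G\<^esub> (g \<otimes>\<^bsub>G\<^esub> x) = x"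
    if "g \<in> carrier G" "x \<in> carrier G" for g x
    using that by (simp add: m_assoc[symmetric])
  have "(g \<otimes>\<^bsub>G\<^esub> h \<otimes>\<^bsub>G\<^esub> inv\<^bsub>G\<^esub> g) [^]\<^bsub>G\<^esub> j = g \<otimes>\<^bsub>G\<^esub> (h [^]\<^bsub>G\<^esub> j) \<otimes>\<^bsub>G\<^esub> inv\<^bsub>G\<^esub> g"
    if g: "g \<in> carrier G" for g
  proof (induction j)
    case (Suc j)
    with g h show ?case by (simp add: m_assoc canc)
  qed (use g in simp)
  then have "class_pow G c j = conj_class G (h [^]\<^bsub>G\<^esub> j)"
    by (auto simp: h class_pow_def conj_class_def image_image)
  then show ?thesis using h by (auto simp: conj_classes_def)
qed

lemma graded_subst_inner:
  assumes "group G" "i \<ge> 1" "c \<in> conj_classes G"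
  shows "graded_subst triv G (\<lambda>(j, _). psum (i * j) (class_pow G c j))"
proof -
  have "j \<le> i * j" for j using assms(2) by simp
  then show ?thesis
    using assms(2)
    by (auto simp: graded_subst_def vanish_def psum_nth intro!: A_ring_psum
        class_pow_conj_classes[OF assms(1,3)])
qed

lemma psubst_inner_vanish:
  assumes "group G" "i \<ge> 1" "c \<in> conj_classes G" "g \<in> A_plus triv"
  shows "vanish i (psubst (\<lambda>(j, _). psum (i * j) (class_pow G c j)) g)"
proof -
  let ?\<phi> = "\<lambda>(j, _ :: unit set). psum (i * j) (class_pow G c j)"
  have g: "g \<in> A_ring triv" "g $ 0 = 0" using assms(4) by (auto simp: A_plus_def)
  have "eval_poly ?\<phi> (g $ n) $ k = 0" if "k < i" for n k
  proof (cases "n = 0")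
    case False
    have "vanish i (eval_monom ?\<phi> m)" if m: "m \<in> Poly_Mapping.keys (g $ n)" for m
    proof -
      have wt: "weight m = n" and m': "Poly_Mapping.keys m \<subseteq> {1..} \<times> {{()}}"
        using A_ring_nth[OF g(1), of n] m by (auto simp: homog_def)
      have "vanish (\<Sum>v\<in>Poly_Mapping.keys m. (i * fst v) * Poly_Mapping.lookup m v) (eval_monom ?\<phi> m)"
        unfolding eval_monom_def
        by (intro vanish_prod vanish_power) (auto simp: vanish_def psum_nth)
      also have "(\<Sum>v\<in>Poly_Mapping.keys m. (i * fst v) * Poly_Mapping.lookup m v) = i * n"
        unfolding wt[symmetric] weight_def by (simp add: sum_distrib_left mult.assoc)
      finally have "vanish (i * n) (eval_monom ?\<phi> m)" .
      moreover have "i \<le> i * n" using False by simp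
      ultimately show ?thesis unfolding vanish_def by (meson less_le_trans)
    qed
    with \<open>k < i\<close> show ?thesis
      unfolding eval_poly_def by (simp add: fps_sum_nth qconst_def vanish_def)
  qed (simp add: g)
  then show ?thesis
    unfolding vanish_def psubst_nth[OF graded_subst_inner[OF assms(1-3)] g(1)] by simp
qed

lemma graded_subst_outer:
  assumes "group G" "g \<in> A_plus triv"
  shows "graded_subst G G (\<lambda>(i, c). psubst (\<lambda>(j, _). psum (i * j) (class_pow G c j)) g)"
proof -
  have "psubst (\<lambda>(j, _). psum (i * j) (class_pow G c j)) g \<in> A_ring G"
    if "i \<ge> 1" "c \<in> conj_classes G" for i c
    using psubst_cont_alg_hom[OF graded_subst_inner[OF assms(1) that]] assms(2)
    by (auto simp: cont_alg_hom_def A_plus_def)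
  with psubst_inner_vanish[OF assms(1) _ _ assms(2)] show ?thesis
    by (auto simp: graded_subst_def)
qed

theorem plethysm_right_plethysm:
  assumes "group G"
  shows "right_plethysm G (plethysm G)"
  unfolding right_plethysm_def
proof (intro conjI ballI allI impI)
  fix g assume "g \<in> A_plus triv"
  then show "cont_alg_hom G G (\<lambda>f. plethysm G f g)"
    unfolding plethysm_def by (intro psubst_cont_alg_hom graded_subst_outer assms)
next
  fix i c assume ic: "i \<ge> (1::nat)" "c \<in> conj_classes G"
  have eq: "plethysm G (psum i c) g = psubst (\<lambda>(j, _). psum (i * j) (class_pow G c j)) g"
    if "g \<in> A_plus triv" for g
    unfolding plethysm_def using psubst_psum[OF graded_subst_outer[OF assms that] ic] by simp
  show "\<exists>\<phi>. cont_alg_hom triv G \<phi> \<and> (\<forall>g\<in>A_plus triv. plethysm G (psum i c) g = \<phi> g)"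
    using eq psubst_cont_alg_hom[OF graded_subst_inner[OF assms ic]] by blast
  fix j assume j: "j \<ge> (1::nat)"
  then have "psum j {()} \<in> A_plus triv"
    by (auto simp: A_plus_def psum_nth intro!: A_ring_psum)
  then show "plethysm G (psum i c) (psum j {()}) = psum (i * j) (class_pow G c j)"
    using psubst_psum[OF graded_subst_inner[OF assms ic] j, of "{()}"] by (simp add: eq)
qed

theorem right_plethysm_unique:
  assumes "right_plethysm G pl" "f \<in> A_ring G" "g \<in> A_plus triv"
  shows "pl f g = plethysm G f g"
proof -
  have g: "g \<in> A_ring triv" using assms by (simp add: A_plus_def)
  have "pl f g = psubst (\<lambda>(i, c). pl (psum i c) g) f"
    using assms cont_alg_hom_eq_psubst[of G G "\<lambda>f. pl f g" f] by (simp add: right_plethysm_def)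
  also have "\<dots> = plethysm G f g"
    unfolding plethysm_def
  proof (rule psubst_cong[OF assms(2)])
    fix i c assume ic: "i \<ge> (1::nat)" "c \<in> conj_classes G"
    then obtain \<phi> where \<phi>: "cont_alg_hom triv G \<phi>" "\<And>g. g \<in> A_plus triv \<Longrightarrow> pl (psum i c) g = \<phi> g"
      using assms(1) unfolding right_plethysm_def by blast
    have "\<phi> g = psubst (\<lambda>(j, d). \<phi> (psum j d)) g"
      by (rule cont_alg_hom_eq_psubst[OF \<phi>(1) g])
    also have "\<dots> = psubst (\<lambda>(j, _). psum (i * j) (class_pow G c j)) g"
    proof (rule psubst_cong[OF g])
      fix j d assume j: "j \<ge> (1::nat)" "d \<in> conj_classes triv"
      then have "psum j {()} \<in> A_plus triv"
        by (auto simp: A_plus_def psum_nth intro!: A_ring_psum)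
      then have "\<phi> (psum j {()}) = pl (psum i c) (psum j {()})"
        by (simp add: \<phi>(2))
      also have "\<dots> = psum (i * j) (class_pow G c j)"
        using assms(1) ic j(1) unfolding right_plethysm_def by blast
      finally show "(case (j, d) of (j, d) \<Rightarrow> \<phi> (psum j d)) =
          (case (j, d) of (j, _) \<Rightarrow> psum (i * j) (class_pow G c j))"
        using j(2) by simp
    qed
    finally show "(case (i, c) of (i, c) \<Rightarrow> pl (psum i c) g) =
        (case (i, c) of (i, c) \<Rightarrow> psubst (\<lambda>(j, _). psum (i * j) (class_pow G c j)) g)"
      using \<phi>(2)[OF assms(3)] by simp
  qed
  finally show ?thesis .
qed


section \<open>The plethystic logarithm\<close>

definition moebius :: "nat \<Rightarrow> int" where
  "moebius e = (if squarefree e then (-1) ^ card (prime_factors e) else 0)"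

definition log1p :: "'a pseries \<Rightarrow> 'a pseries" where
  "log1p F = suminf (\<lambda>k. qconst ((-1) ^ k / of_nat (Suc k)) * F ^ Suc k)"

definition L_series :: "unit pseries" where
  "L_series = suminf (\<lambda>k. qconst (of_int (moebius (Suc k)) / of_nat (Suc k)) * log1p (psum (Suc k) {()}))"

end

theory Submission
  imports Defs
begin

text \<open>
  The poset \<open>R\<^sub>n(G)\<close> without its top is the poset of \<open>G\<close>-invariant equivalence relations on
  \<open>G \<times> [n]\<close> whose classes are permuted freely, and its reduced homology vanishes below the top
  degree. By the Hopf trace formula the trace of \<open>x\<close> on \<open>(-1)\<^sup>n H\<^sub>n\<^sub>-\<^sub>2\<close> is therefore
  the Moebius number \<open>\<mu>\<^sub>x(0, 1)\<close> of the subposet fixed by \<open>x\<close>. The part of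
  the poset above a relation \<open>r\<close> is again of this form, for the quotient of \<open>G \<times> [n]\<close> by \<open>r\<close>, so
  \<open>\<Sum>\<^sub>r \<mu>\<^sub>x(r, 1) = -1\<close> becomes a sum over pairs \<open>(x, y)\<close> of group elements weighted by the number of
  equivariant surjections \<open>G \<times> [n] \<rightarrow> G \<times> [k]\<close> intertwining \<open>x\<close> and \<open>y\<close>. Counting all intertwining maps cycle by
  cycle, the generating function of those surjections is the product over the cycles of \<open>y\<close> of
  \<open>p\<^sub>i(c) \<circ> (Exp - 1)\<close>, with \<open>Exp\<close> the series of the trivial group.
  Hence the homology series \<open>F\<close>, including a constant term \<open>-1\<close>, satisfies \<open>F \<circ> (Exp - 1) = - Exp\<^sub>G\<close>. Moebius inversion
  shows that \<open>L\<close> is a plethystic inverse of \<open>Exp - 1\<close>, so \<open>F = - Exp\<^sub>G \<circ> L\<close>.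
\<close>

section \<open>Linear extensions\<close>

text \<open>The vanishing of homology is shown by building the poset one relation at a time, each
  new relation having a link that is a cone or, for certain atoms, an upper interval handled by
  induction on the number of indices. Arbitrary finite index sets occur because merging two fibres
  deletes an index. The obstacle in passing to generating functions is that the quotient by a
  relation is isomorphic to G x [k] only after a choice, and \<open>x\<close> becomes an element
  \<open>y\<close> of the smaller wreath product only through that choice. Averaging over all |G|^k
  k! choices removes it, and this factor is the normalisation of the characteristic. The image of an
  intertwining map consists of the fibres over a set of cycles of \<open>y\<close>. Sorting maps by
  this set is an inclusion-exclusion that replaces each factor Exp by Exp - 1. For fixed
  \<open>y\<close> the number of all maps is multiplicative over the cycles of \<open>x\<close>, so
  the sum over \<open>x\<close> is an exponential, found from a recursion on the cycle through one
  chosen index. The inversion rests on the one-sided identity (F o (Exp - 1)) o L = F.\<close>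

lemma qscale_single [simp]: "qscale r (Poly_Mapping.single k s) = Poly_Mapping.single k (r * s)"
  by (rule poly_mapping_eqI) (simp add: lookup_single when_def)

lemma lin_ext_superset:
  assumes "finite S" "Poly_Mapping.keys v \<subseteq> S"
  shows "lin_ext f v = (\<Sum>k\<in>S. qscale (Poly_Mapping.lookup v k) (f k))"
  unfolding lin_ext_def
  by (rule sum.mono_neutral_left) (use assms in \<open>auto simp: in_keys_iff\<close>)

lemma lin_ext_add: "lin_ext f (u + v) = lin_ext f u + lin_ext f v"
proof -
  let ?S = "Poly_Mapping.keys u \<union> Poly_Mapping.keys v"
  have "lin_ext f (u + v) = (\<Sum>k\<in>?S. qscale (Poly_Mapping.lookup (u + v) k) (f k))"
    by (rule lin_ext_superset) (use keys_add[of u v] in auto)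
  then show ?thesis
    by (simp add: lin_ext_superset[of ?S] lookup_add qv.scale_left_distrib sum.distrib)
qed

lemma lin_ext_scale: "lin_ext f (qscale r v) = qscale r (lin_ext f v)"
proof -
  have "lin_ext f (qscale r v) = (\<Sum>k\<in>Poly_Mapping.keys v. qscale (Poly_Mapping.lookup (qscale r v) k) (f k))"
    by (rule lin_ext_superset) (auto simp: in_keys_iff)
  then show ?thesis
    by (simp add: lin_ext_def qv.scale_sum_right)
qed

lemma lin_ext_0 [simp]: "lin_ext f 0 = 0"
  by (simp add: lin_ext_def)

lemma lin_ext_minus: "lin_ext f (- v) = - lin_ext f v"
  using lin_ext_scale[of f "-1" v] by simp

lemma lin_ext_diff: "lin_ext f (u - v) = lin_ext f u - lin_ext f v"
  using lin_ext_add[of f u "-v"] by (simp add: lin_ext_minus)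

lemma lin_ext_sum: "lin_ext f (\<Sum>i\<in>I. g i) = (\<Sum>i\<in>I. lin_ext f (g i))"
  by (induction I rule: infinite_finite_induct) (simp_all add: lin_ext_add)

lemma lin_ext_single [simp]: "lin_ext f (Poly_Mapping.single k r) = qscale r (f k)"
  by (cases "r = 0") (simp_all add: lin_ext_def)

text \<open>Additivity together with \<open>P (single k r)\<close> proves \<open>P\<close> on a whole coordinate subspace.\<close>

lemma keys_induct [consumes 1, case_names zero add]:
  fixes v :: "'k \<Rightarrow>\<^sub>0 rat"
  assumes "Poly_Mapping.keys v \<subseteq> K"
    and "P 0"
    and "\<And>k r v. k \<in> K \<Longrightarrow> Poly_Mapping.keys v \<subseteq> K \<Longrightarrow> P v \<Longrightarrow> P (Poly_Mapping.single k r + v)"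
  shows "P v"
proof -
  have "P (\<Sum>k\<in>S. Poly_Mapping.single k (Poly_Mapping.lookup v k))" if "finite S" "S \<subseteq> K" for S
    using that
  proof (induction S)
    case (insert x S)
    have "Poly_Mapping.keys (\<Sum>k\<in>S. Poly_Mapping.single k (Poly_Mapping.lookup v k)) \<subseteq> S"
      using insert(1) by (auto simp: in_keys_iff lookup_sum lookup_single when_def split: if_splits)
    with insert show ?case
      by (subst sum.insert) (auto intro!: assms(3))
  qed (simp add: assms)
  from this[of "Poly_Mapping.keys v"] show ?thesis
    using assms(1) poly_expand[of v, symmetric] by simp
qed

lemma keys_lin_ext:
  assumes "\<And>k. k \<in> Poly_Mapping.keys v \<Longrightarrow> Poly_Mapping.keys (f k) \<subseteq> L"
  shows "Poly_Mapping.keys (lin_ext f v) \<subseteq> L"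
proof
  fix l assume "l \<in> Poly_Mapping.keys (lin_ext f v)"
  then have "(\<Sum>k\<in>Poly_Mapping.keys v. Poly_Mapping.lookup v k * Poly_Mapping.lookup (f k) l) \<noteq> 0"
    by (simp add: lin_ext_def in_keys_iff lookup_sum)
  then obtain k where "k \<in> Poly_Mapping.keys v" "Poly_Mapping.lookup (f k) l \<noteq> 0"
    by (metis (mono_tags, lifting) mult_zero_right sum.neutral)
  with assms[of k] show "l \<in> L" by (auto simp flip: lookup_not_eq_zero_eq_in_keys)
qed

section \<open>Acyclicity of order complexes\<close>

text \<open>Vanishing of the reduced homology of the order complex of \<open>X\<close> in degree
  \<open>i\<close>.\<close>

definition acyc :: "('p \<Rightarrow> 'p \<Rightarrow> bool) \<Rightarrow> 'p set \<Rightarrow> int \<Rightarrow> bool" where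
  "acyc leq X i \<longleftrightarrow> (\<forall>z\<in>chain_space X leq i. boundary leq z = 0 \<longrightarrow>
     (\<exists>u\<in>chain_space X leq (i + 1). boundary leq u = z))"

text \<open>Removing \<open>q\<close> from the chains through \<open>q\<close> leaves exactly the
  chains of this set, so its order complex is the link of the vertex \<open>q\<close>.\<close>

definition link :: "('p \<Rightarrow> 'p \<Rightarrow> bool) \<Rightarrow> 'p set \<Rightarrow> 'p \<Rightarrow> 'p set" where
  "link leq X q = {p \<in> X. p \<noteq> q \<and> (leq p q \<or> leq q p)}"

text \<open>Up to the sign of the shuffle, \<open>coneop leq q\<close> is the join with the vertex \<open>q\<close>.\<close>

definition coneop :: "('p \<Rightarrow> 'p \<Rightarrow> bool) \<Rightarrow> 'p \<Rightarrow> ('p set \<Rightarrow>\<^sub>0 rat) \<Rightarrow> ('p set \<Rightarrow>\<^sub>0 rat)" where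
  "coneop leq q = lin_ext (\<lambda>C. Poly_Mapping.single (insert q C) ((-1) ^ card {b\<in>C. leq b q \<and> b \<noteq> q}))"

text \<open>The axioms are relative to \<open>P\<close> because \<open>dowling_le\<close> is
  antisymmetric on elements of the lattice but not on arbitrary pairs of sets.\<close>

locale poset_on =
  fixes P :: "'p set" and leq :: "'p \<Rightarrow> 'p \<Rightarrow> bool"
  assumes refl: "a \<in> P \<Longrightarrow> leq a a"
    and antisym: "a \<in> P \<Longrightarrow> b \<in> P \<Longrightarrow> leq a b \<Longrightarrow> leq b a \<Longrightarrow> a = b"
    and trans: "a \<in> P \<Longrightarrow> b \<in> P \<Longrightarrow> c \<in> P \<Longrightarrow> leq a b \<Longrightarrow> leq b c \<Longrightarrow> leq a c"
begin

definition chains :: "'p set set" where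
  "chains = {C. C \<subseteq> P \<and> finite C \<and> (\<forall>a\<in>C. \<forall>b\<in>C. leq a b \<or> leq b a)}"

lemma chainsD: "C \<in> chains \<Longrightarrow> finite C" "C \<in> chains \<Longrightarrow> C \<subseteq> P"
  "C \<in> chains \<Longrightarrow> a \<in> C \<Longrightarrow> b \<in> C \<Longrightarrow> leq a b \<or> leq b a"
  by (auto simp: chains_def)

text \<open>The homotopy formula d(q C) = C - q dC of a cone. The sign in \<open>coneop\<close> is
  the one that moves \<open>q\<close> to the front of the chain.\<close>

lemma boundary_coneop_single:
  assumes "insert q C \<in> chains" "q \<notin> C"
  shows "boundary leq (coneop leq q (Poly_Mapping.single C 1)) =
    Poly_Mapping.single C 1 - coneop leq q (boundary leq (Poly_Mapping.single C 1))"
proof -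
  let ?s = "card {b\<in>C. leq b q \<and> b \<noteq> q}"
  let ?pos = "\<lambda>C a. card {b\<in>C. leq b a \<and> b \<noteq> a}"
  have fin: "finite C" and CP: "C \<subseteq> P" and qP: "q \<in> P"
    using chainsD[OF assms(1)] by auto
  have q: "?pos (insert q C) q = ?s"
    by (rule arg_cong[where f = card]) auto
  \<comment> \<open>If \<open>a\<close> lies below \<open>q\<close>, its removal lowers the number
    of vertices before \<open>q\<close>; otherwise inserting \<open>q\<close> raises the position of
    \<open>a\<close>. Exactly one of the exponents changes, and by one.\<close>
  have sgn_a: "(- 1 :: rat) ^ ?s * (-1) ^ ?pos (insert q C) a =
      - ((-1) ^ ?pos C a * (-1) ^ card {b\<in>C - {a}. leq b q \<and> b \<noteq> q})" if a: "a \<in> C" for a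
  proof -
    have aq: "a \<noteq> q" "a \<in> P" using a assms CP by auto
    consider "leq a q" "\<not> leq q a" | "leq q a" "\<not> leq a q"
      using chainsD(3)[OF assms(1), of a q] a aq antisym[of a q] qP by blast
    then show ?thesis
    proof cases
      case 1
      have "{b\<in>insert q C. leq b a \<and> b \<noteq> a} = {b\<in>C. leq b a \<and> b \<noteq> a}" using 1 by auto
      moreover have "{b\<in>C. leq b q \<and> b \<noteq> q} = insert a {b\<in>C - {a}. leq b q \<and> b \<noteq> q}"
        using 1 a aq by auto
      then have "?s = Suc (card {b\<in>C - {a}. leq b q \<and> b \<noteq> q})"
        using fin by simp
      ultimately show ?thesis by simp
    next
      case 2
      have "{b\<in>insert q C. leq b a \<and> b \<noteq> a} = insert q {b\<in>C. leq b a \<and> b \<noteq> a}" using 2 aq by auto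
      then have "?pos (insert q C) a = Suc (?pos C a)"
        using fin assms(2) by simp
      moreover have "{b\<in>C. leq b q \<and> b \<noteq> q} = {b\<in>C - {a}. leq b q \<and> b \<noteq> q}"
        using 2 by auto
      ultimately show ?thesis by simp
    qed
  qed
  have "boundary leq (coneop leq q (Poly_Mapping.single C 1)) =
      qscale ((-1) ^ ?s) (\<Sum>a\<in>insert q C. Poly_Mapping.single (insert q C - {a}) ((-1) ^ ?pos (insert q C) a))"
    by (simp add: boundary_def coneop_def)
  also have "\<dots> = Poly_Mapping.single C 1 +
      (\<Sum>a\<in>C. Poly_Mapping.single (insert q C - {a}) ((-1) ^ ?s * (-1) ^ ?pos (insert q C) a))"
    unfolding sum.insert[OF fin assms(2)] q using assms(2)
    by (simp add: qv.scale_right_distrib qv.scale_sum_right)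
  also have "(\<Sum>a\<in>C. Poly_Mapping.single (insert q C - {a}) ((-1) ^ ?s * (-1) ^ ?pos (insert q C) a)) =
      (\<Sum>a\<in>C. - Poly_Mapping.single (insert q (C - {a}))
        ((-1) ^ ?pos C a * (-1) ^ card {b\<in>C - {a}. leq b q \<and> b \<noteq> q} :: rat))"
  proof (intro sum.cong HOL.refl)
    fix a assume a: "a \<in> C"
    then have "insert q C - {a} = insert q (C - {a})" using assms(2) by auto
    then show "Poly_Mapping.single (insert q C - {a}) ((-1) ^ ?s * (-1) ^ ?pos (insert q C) a) =
      - Poly_Mapping.single (insert q (C - {a}))
        ((-1) ^ ?pos C a * (-1) ^ card {b\<in>C - {a}. leq b q \<and> b \<noteq> q} :: rat)"
      by (simp only: sgn_a[OF a] single_uminus)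
  qed
  also have "\<dots> = - coneop leq q (boundary leq (Poly_Mapping.single C 1))"
    by (simp add: boundary_def coneop_def lin_ext_sum sum_negf)
  finally show ?thesis by simp
qed

lemma boundary_coneop:
  assumes "Poly_Mapping.keys w \<subseteq> {C. insert q C \<in> chains \<and> q \<notin> C}"
  shows "boundary leq (coneop leq q w) = w - coneop leq q (boundary leq w)"
  using assms
proof (induction w rule: keys_induct)
  case (add k r v)
  have "boundary leq (coneop leq q (qscale r (Poly_Mapping.single k 1))) =
      qscale r (Poly_Mapping.single k 1) - coneop leq q (boundary leq (qscale r (Poly_Mapping.single k 1)))"
    using boundary_coneop_single[of q k] add(1)
    unfolding boundary_def coneop_def lin_ext_scale by (simp add: qv.scale_right_diff_distrib)
  with add show ?case
    by (simp add: boundary_def coneop_def lin_ext_add)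
qed (simp_all add: boundary_def coneop_def)

lemma keys_boundary_single:
  "Poly_Mapping.keys (boundary leq (Poly_Mapping.single C 1)) \<subseteq> (\<lambda>a. C - {a}) ` C"
proof
  fix D assume "D \<in> Poly_Mapping.keys (boundary leq (Poly_Mapping.single C 1))"
  then have "(\<Sum>a\<in>C. Poly_Mapping.lookup (Poly_Mapping.single (C - {a})
      ((-1) ^ card {b\<in>C. leq b a \<and> b \<noteq> a}) :: 'p set \<Rightarrow>\<^sub>0 rat) D) \<noteq> 0"
    by (simp add: boundary_def in_keys_iff lookup_sum)
  then obtain a where "a \<in> C" "Poly_Mapping.lookup (Poly_Mapping.single (C - {a})
      ((-1) ^ card {b\<in>C. leq b a \<and> b \<noteq> a}) :: 'p set \<Rightarrow>\<^sub>0 rat) D \<noteq> 0"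
    by (metis (mono_tags, lifting) sum.neutral)
  then show "D \<in> (\<lambda>a. C - {a}) ` C"
    by (auto simp: lookup_single when_def split: if_splits)
qed

lemma keys_boundary:
  assumes "\<And>C a. C \<in> Poly_Mapping.keys v \<Longrightarrow> a \<in> C \<Longrightarrow> C - {a} \<in> L"
  shows "Poly_Mapping.keys (boundary leq v) \<subseteq> L"
  unfolding boundary_def
proof (rule keys_lin_ext)
  fix C assume "C \<in> Poly_Mapping.keys v"
  with keys_boundary_single[of C] assms
  show "Poly_Mapping.keys (\<Sum>a\<in>C. Poly_Mapping.single (C - {a}) ((-1) ^ card {b\<in>C. leq b a \<and> b \<noteq> a})
      :: 'p set \<Rightarrow>\<^sub>0 rat) \<subseteq> L"
    by (auto simp: boundary_def)
qed

lemma boundary_chain_space: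
  assumes "v \<in> chain_space X leq i"
  shows "boundary leq v \<in> chain_space X leq (i - 1)"
proof -
  have "C - {a} \<in> simplices X leq (i - 1)" if "C \<in> Poly_Mapping.keys v" "a \<in> C" for C a
  proof -
    have "C \<in> simplices X leq i" using assms that by (auto simp: chain_space_def)
    moreover from this have "card C > 0" using that by (auto simp: simplices_def card_gt_0_iff)
    ultimately show ?thesis using that by (auto simp: simplices_def)
  qed
  then show ?thesis by (simp add: chain_space_def keys_boundary)
qed

text \<open>With C = q D the homotopy formula gives dd(q D) = d(D - q dD) = q ddD, so induction on
  the number of vertices takes the place of pairing off faces.\<close>

lemma boundary_boundary_single: "C \<in> chains \<Longrightarrow> boundary leq (boundary leq (Poly_Mapping.single C 1)) = 0"
proof (induction "card C" arbitrary: C)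
  case 0
  then have "C = {}" using chainsD by auto
  then show ?case by (simp add: boundary_def)
next
  case (Suc n)
  then have "C \<noteq> {}" by auto
  then obtain q where q: "q \<in> C" by auto
  define D where "D = C - {q}"
  have C: "C = insert q D" "q \<notin> D" using q by (auto simp: D_def)
  have D: "D \<in> chains" "card D = n"
    using Suc C chainsD(1)[OF Suc.prems] by (auto simp: chains_def)
  define s :: rat where "s = (-1) ^ card {b\<in>D. leq b q \<and> b \<noteq> q}"
  have s: "s * s = 1" by (simp add: s_def)
  have e: "Poly_Mapping.single C 1 = qscale s (coneop leq q (Poly_Mapping.single D 1))"
    by (simp add: C coneop_def s flip: s_def)
  let ?b = "boundary leq"
  have sub: "Poly_Mapping.keys (?b (Poly_Mapping.single D 1)) \<subseteq> {C. insert q C \<in> chains \<and> q \<notin> C}"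
    using keys_boundary_single[of D] C Suc.prems by (fastforce simp: chains_def)
  have "?b (?b (coneop leq q (Poly_Mapping.single D 1))) =
      ?b (Poly_Mapping.single D 1 - coneop leq q (?b (Poly_Mapping.single D 1)))"
    using boundary_coneop_single[of q D] C Suc.prems by simp
  also have "\<dots> = ?b (Poly_Mapping.single D 1) - ?b (coneop leq q (?b (Poly_Mapping.single D 1)))"
    by (simp add: boundary_def lin_ext_diff)
  also have "\<dots> = 0"
    using boundary_coneop[OF sub] Suc(1)[of D] D by (simp add: coneop_def)
  finally have "?b (?b (coneop leq q (Poly_Mapping.single D 1))) = 0" .
  then show ?case
    unfolding e by (simp add: boundary_def lin_ext_scale)
qed

lemma boundary_boundary:
  assumes "Poly_Mapping.keys v \<subseteq> chains"
  shows "boundary leq (boundary leq v) = 0"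
  using assms
proof (induction v rule: keys_induct)
  case (add k r v)
  have "boundary leq (boundary leq (qscale r (Poly_Mapping.single k 1))) = 0"
    using boundary_boundary_single[OF add(1)]
    unfolding boundary_def lin_ext_scale by simp
  with add show ?case
    by (simp add: boundary_def lin_ext_add)
qed (simp_all add: boundary_def)

text \<open>All simplices in the support of \<open>coneop leq q w\<close> contain \<open>q\<close>,
  those of \<open>v\<close> do not, and removing \<open>q\<close> recovers \<open>w\<close> up to
  signs.\<close>

lemma coneop_eq_0:
  assumes "coneop leq q w + v = 0"
    and "Poly_Mapping.keys w \<subseteq> {C. q \<notin> C}" "Poly_Mapping.keys v \<subseteq> {C. q \<notin> C}"
  shows "w = 0" "v = 0"
proof -
  have l: "Poly_Mapping.lookup (coneop leq q w) D =
      (if q \<in> D then (-1) ^ card {b\<in>D - {q}. leq b q \<and> b \<noteq> q} * Poly_Mapping.lookup w (D - {q}) else 0)"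
    for D using assms(2)
  proof (induction w rule: keys_induct)
    case (add k r v)
    have "q \<in> D \<Longrightarrow> D - {q} = k \<longleftrightarrow> insert q k = D" using add(1) by auto
    with add show ?case
      by (auto simp: coneop_def lin_ext_add lookup_add lookup_single when_def algebra_simps)
  qed (simp add: coneop_def)
  have v: "Poly_Mapping.lookup v D = 0" if "q \<in> D" for D
    using assms(3) that by (auto simp: in_keys_iff)
  have s: "Poly_Mapping.lookup (coneop leq q w) D + Poly_Mapping.lookup v D = 0" for D
    using assms(1) by (metis lookup_add lookup_zero)
  show "w = 0"
  proof (rule poly_mapping_eqI)
    fix D
    show "Poly_Mapping.lookup w D = Poly_Mapping.lookup 0 D"
    proof (cases "q \<in> D")
      case True
      then show ?thesis using assms(2) by (auto simp: in_keys_iff)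
    next
      case False
      then show ?thesis using s[of "insert q D"] v[of "insert q D"] by (simp add: l)
    qed
  qed
  then show "v = 0" using assms(1) by (simp add: coneop_def)
qed

text \<open>A simplex of \<open>insert q X\<close> either avoids \<open>q\<close> or is the join of
  \<open>q\<close> with a simplex of the link.\<close>

lemma chain_space_insert:
  assumes "z \<in> chain_space (insert q X) leq i" "q \<notin> X" 
  obtains v w where "v \<in> chain_space X leq i" "w \<in> chain_space (link leq X q) leq (i - 1)"
    "z = v + coneop leq q w"
proof -
  have "\<exists>v w. v \<in> chain_space X leq i \<and> w \<in> chain_space (link leq X q) leq (i - 1) \<and>
    z = v + coneop leq q w"
    using assms(1) unfolding chain_space_def mem_Collect_eq
  proof (induction z rule: keys_induct)
    case zero
    show ?case by (intro exI[of _ 0]) (simp add: coneop_def)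
  next
    case (add k r z)
    then obtain v w where vw: "Poly_Mapping.keys v \<subseteq> simplices X leq i"
      "Poly_Mapping.keys w \<subseteq> simplices (link leq X q) leq (i - 1)" "z = v + coneop leq q w"
      by blast
    show ?case
    proof (cases "q \<in> k")
      case False
      then have "k \<in> simplices X leq i" using add(1) by (auto simp: simplices_def)
      then have "Poly_Mapping.keys (Poly_Mapping.single k r + v) \<subseteq> simplices X leq i"
        using vw keys_add[of "Poly_Mapping.single k r" v] by (auto split: if_splits)
      then show ?thesis using vw by (intro exI[of _ "Poly_Mapping.single k r + v"] exI[of _ w]) (simp add: add.assoc)
    next
      case True
      \<comment> \<open>The factor \<open>s\<close> cancels the sign built into
        \<open>coneop\<close>.\<close>
      define s :: rat where "s = (-1) ^ card {b\<in>k - {q}. leq b q \<and> b \<noteq> q}"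
      have s: "s * s = 1" by (simp add: s_def)
      have "coneop leq q (Poly_Mapping.single (k - {q}) (s * r)) = Poly_Mapping.single k r"
        using True s unfolding coneop_def lin_ext_single s_def[symmetric] qscale_single
        by (simp add: insert_absorb mult.commute[of "s * r"] flip: mult.assoc)
      moreover have "k - {q} \<in> simplices (link leq X q) leq (i - 1)"
      proof -
        have "card k > 0" using add(1) True by (auto simp: simplices_def card_gt_0_iff)
        then show ?thesis using add(1) True by (auto simp: simplices_def link_def)
      qed
      then have "Poly_Mapping.keys (Poly_Mapping.single (k - {q}) (s * r) + w)
          \<subseteq> simplices (link leq X q) leq (i - 1)"
        using vw keys_add[of "Poly_Mapping.single (k - {q}) (s * r)" w] by (auto split: if_splits)
      ultimately show ?thesis using vw
        by (intro exI[of _ v] exI[of _ "Poly_Mapping.single (k - {q}) (s * r) + w"])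
          (simp add: coneop_def lin_ext_add algebra_simps)
    qed
  qed
  then show thesis using that by blast
qed

lemma coneop_chain_space:
  assumes "w \<in> chain_space (link leq X q) leq (i - 1)" "q \<in> P"
  shows "coneop leq q w \<in> chain_space (insert q X) leq i"
  unfolding chain_space_def coneop_def mem_Collect_eq
proof (rule keys_lin_ext)
  fix C assume "C \<in> Poly_Mapping.keys w"
  then have C: "C \<in> simplices (link leq X q) leq (i - 1)"
    using assms by (auto simp: chain_space_def)
  then have "q \<notin> C" by (auto simp: simplices_def link_def)
  with C have "insert q C \<in> simplices (insert q X) leq i"
    using assms(2) refl by (auto simp: simplices_def link_def)
  then show "Poly_Mapping.keys (Poly_Mapping.single (insert q C)
      ((-1) ^ card {b\<in>C. leq b q \<and> b \<noteq> q}) :: 'p set \<Rightarrow>\<^sub>0 rat) \<subseteq> simplices (insert q X) leq i"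
    by simp
qed

lemma link_keys:
  assumes "w \<in> chain_space (link leq X q) leq i" "insert q X \<subseteq> P"
  shows "Poly_Mapping.keys w \<subseteq> {C. insert q C \<in> chains \<and> q \<notin> C}"
proof
  fix C assume "C \<in> Poly_Mapping.keys w"
  then have C: "C \<in> simplices (link leq X q) leq i"
    using assms by (auto simp: chain_space_def)
  then show "C \<in> {C. insert q C \<in> chains \<and> q \<notin> C}"
    using assms(2) refl by (auto simp: simplices_def link_def chains_def)
qed

lemma chain_space_mono: "v \<in> chain_space X leq i \<Longrightarrow> X \<subseteq> Y \<Longrightarrow> v \<in> chain_space Y leq i"
  unfolding chain_space_def simplices_def by blast

lemma chain_space_add: "v \<in> chain_space X leq i \<Longrightarrow> w \<in> chain_space X leq i \<Longrightarrow> v + w \<in> chain_space X leq i"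
  unfolding chain_space_def using keys_add[of v w] by auto

lemma chain_space_minus: "v \<in> chain_space X leq i \<Longrightarrow> - v \<in> chain_space X leq i"
  unfolding chain_space_def by (simp add: keys_def)

lemma chain_space_diff: "v \<in> chain_space X leq i \<Longrightarrow> w \<in> chain_space X leq i \<Longrightarrow> v - w \<in> chain_space X leq i"
  using chain_space_add[of v X i "- w"] chain_space_minus[of w] by simp

text \<open>With z = v + q w the equation dz = 0 reads (dv + w) - q dw = 0, and the two parts have
  disjoint supports.\<close>

lemma cycle_insert:
  assumes "insert q X \<subseteq> P" "q \<notin> X" "z \<in> chain_space (insert q X) leq i" "boundary leq z = 0"
  obtains v w where "v \<in> chain_space X leq i" "w \<in> chain_space (link leq X q) leq (i - 1)"
    "z = v + coneop leq q w" "boundary leq w = 0" "boundary leq v = - w"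
proof -
  obtain v w where vw: "v \<in> chain_space X leq i" "w \<in> chain_space (link leq X q) leq (i - 1)"
    "z = v + coneop leq q w"
    using chain_space_insert[OF assms(3,2)] .
  have "boundary leq z = boundary leq v + w - coneop leq q (boundary leq w)"
    using boundary_coneop[OF link_keys[OF vw(2) assms(1)]] by (simp add: vw boundary_def lin_ext_add)
  then have 0: "coneop leq q (boundary leq w) + (- (boundary leq v + w)) = 0"
    using assms(4) by simp
  have a: "Poly_Mapping.keys (boundary leq w) \<subseteq> {C. q \<notin> C}"
    using link_keys[OF vw(2) assms(1)] by (intro keys_boundary) auto
  have "boundary leq v \<in> chain_space X leq (i - 1)" "w \<in> chain_space X leq (i - 1)"
    using boundary_chain_space[OF vw(1)] chain_space_mono[OF vw(2), of X] by (auto simp: link_def)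
  then have "- (boundary leq v + w) \<in> chain_space X leq (i - 1)"
    by (intro chain_space_minus chain_space_add)
  then have b: "Poly_Mapping.keys (- (boundary leq v + w)) \<subseteq> {C. q \<notin> C}"
    using assms(2) unfolding chain_space_def simplices_def by auto
  from coneop_eq_0[OF 0 a b] vw show thesis
    by (intro that[of v w]) (auto simp: eq_neg_iff_add_eq_0)
qed

text \<open>One step of the Mayer-Vietoris sequence: the complex of \<open>insert q X\<close> is
  that of \<open>X\<close> with a cone over the link of \<open>q\<close> glued on.\<close>

lemma acyc_insert:
  assumes X: "insert q X \<subseteq> P" "q \<notin> X" and ac: "acyc leq X i" "acyc leq (link leq X q) (i - 1)"
  shows "acyc leq (insert q X) i"
  unfolding acyc_def
proof (intro ballI impI)
  fix z assume z: "z \<in> chain_space (insert q X) leq i" "boundary leq z = 0"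
  from cycle_insert[OF X z] obtain v w where vw:
    "v \<in> chain_space X leq i" "w \<in> chain_space (link leq X q) leq (i - 1)"
    "z = v + coneop leq q w" "boundary leq w = 0" "boundary leq v = - w" .
  \<comment> \<open>\<open>u\<close> fills \<open>w\<close> in the link and \<open>t\<close> below
    fills the cycle v + u in \<open>X\<close>; then d(t - q u) = v + u - (u - q w) = z.\<close>
  obtain u where u: "u \<in> chain_space (link leq X q) leq i" "boundary leq u = w"
    using ac(2) vw by (auto simp: acyc_def)
  have uX: "u \<in> chain_space X leq i" using chain_space_mono[OF u(1), of X] by (auto simp: link_def)
  have "v + u \<in> chain_space X leq i" using vw uX by (intro chain_space_add)
  moreover have "boundary leq (v + u) = 0"
    using vw u by (simp add: boundary_def lin_ext_add)
  ultimately obtain t where t: "t \<in> chain_space X leq (i + 1)" "boundary leq t = v + u"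
    using ac(1) by (auto simp: acyc_def)
  have Ju: "coneop leq q u \<in> chain_space (insert q X) leq (i + 1)"
    using coneop_chain_space[of u X q "i + 1"] u X by simp
  have "boundary leq (coneop leq q u) = u - coneop leq q w"
    using boundary_coneop[OF link_keys[OF u(1) X(1)]] u by simp
  then have "boundary leq (t - coneop leq q u) = z"
    using t vw by (simp add: boundary_def lin_ext_diff)
  moreover have "t - coneop leq q u \<in> chain_space (insert q X) leq (i + 1)"
    using Ju chain_space_mono[OF t(1), of "insert q X"] by (intro chain_space_diff) auto
  ultimately show "\<exists>u\<in>chain_space (insert q X) leq (i + 1). boundary leq u = z" by blast
qed

text \<open>The order complex is a cone with apex \<open>q\<close>: the part of a cycle away from
  \<open>q\<close> lies in the link, and joining it with \<open>q\<close> gives a preimage of the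
  cycle.\<close>

lemma acyc_apex:
  assumes X: "X \<subseteq> P" "q \<in> X" and q: "\<And>p. p \<in> X \<Longrightarrow> leq p q \<or> leq q p"
  shows "acyc leq X i"
  unfolding acyc_def
proof (intro ballI impI)
  fix z assume z: "z \<in> chain_space X leq i" "boundary leq z = 0"
  let ?X = "X - {q}"
  have iX: "insert q ?X = X" using X by auto
  have lX: "link leq ?X q = ?X" using q by (auto simp: link_def)
  from cycle_insert[of q ?X z i] obtain v w where vw:
    "v \<in> chain_space ?X leq i" "w \<in> chain_space (link leq ?X q) leq (i - 1)"
    "z = v + coneop leq q w" "boundary leq w = 0" "boundary leq v = - w"
    using X z unfolding iX by auto
  have v: "v \<in> chain_space (link leq ?X q) leq i" using vw lX by simp
  have "boundary leq (coneop leq q v) = v - coneop leq q (- w)"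
    using boundary_coneop[OF link_keys[OF v]] X vw by auto
  then have "boundary leq (coneop leq q v) = z"
    using vw by (simp add: coneop_def lin_ext_minus)
  moreover have "coneop leq q v \<in> chain_space X leq (i + 1)"
    using coneop_chain_space[of v ?X q "i + 1"] v X iX by auto
  ultimately show "\<exists>u\<in>chain_space X leq (i + 1). boundary leq u = z" by blast
qed

end

section \<open>Certificates for the vanishing of homology\<close>

lemma acyc_low: "i < -1 \<Longrightarrow> acyc leq X i"
proof -
  assume "i < -1"
  then have "simplices X leq i = {}" unfolding simplices_def by auto
  then have "z = 0" if "z \<in> chain_space X leq i" for z
    using that by (simp add: chain_space_def)
  then show ?thesis
    unfolding acyc_def by (intro ballI impI bexI[of _ 0]) (auto simp: boundary_def chain_space_def)
qed

text \<open>A certificate for the vanishing of the reduced homology below degree \<open>d - 1\<close>.\<close>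

inductive cc :: "('p \<Rightarrow> 'p \<Rightarrow> bool) \<Rightarrow> 'p set \<Rightarrow> nat \<Rightarrow> bool" for leq where
  cc_0: "cc leq X 0"
| cc_apex: "q \<in> X \<Longrightarrow> (\<And>p. p \<in> X \<Longrightarrow> leq p q \<or> leq q p) \<Longrightarrow> cc leq X d"
| cc_insert: "q \<notin> X \<Longrightarrow> cc leq X (Suc d) \<Longrightarrow> cc leq (link leq X q) d \<Longrightarrow> cc leq (insert q X) (Suc d)"

text \<open>Degree bookkeeping: \<open>cc_0\<close> covers only degrees below -1, where there are no
  simplices, and \<open>cc_insert\<close> lowers the bound by one on passing to the link, as in
  \<open>acyc_insert\<close>.\<close>

lemma (in poset_on) cc_acyc:
  "cc leq X d \<Longrightarrow> X \<subseteq> P \<Longrightarrow> i < int d - 1 \<Longrightarrow> acyc leq X i"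
proof (induction arbitrary: i rule: cc.induct)
  case (cc_insert q X d)
  have "link leq X q \<subseteq> P" using cc_insert.prems by (auto simp: link_def)
  with cc_insert show ?case
    by (intro acyc_insert) auto
qed (auto intro: acyc_low acyc_apex)

text \<open>Transports certificates along order isomorphisms: from a quotient to an upper interval,
  and from relations to elements of the Dowling poset.\<close>

lemma cc_image:
  assumes "cc leq X d" "inj_on h X"
    and "\<And>a b. a \<in> X \<Longrightarrow> b \<in> X \<Longrightarrow> leq' (h a) (h b) \<longleftrightarrow> leq a b"
  shows "cc leq' (h ` X) d"
  using assms
proof (induction rule: cc.induct)
  case (cc_0 X)
  show ?case by (rule cc.cc_0)
next
  case (cc_apex q X d)
  then show ?case by (intro cc.cc_apex[of "h q"]) auto
next
  case (cc_insert q X d)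
  have leq: "leq' (h a) (h b) \<longleftrightarrow> leq a b" if "a \<in> insert q X" "b \<in> insert q X" for a b
    using cc_insert.prems(2) that by blast
  have "h p \<noteq> h q" if "p \<in> X" for p
    using cc_insert.prems(1) cc_insert.hyps(1) that by (auto simp: inj_on_def)
  then have "link leq' (h ` X) (h q) = h ` link leq X q"
    using cc_insert.hyps(1) by (auto simp: link_def leq)
  moreover have sub: "link leq X q \<subseteq> insert q X" "X \<subseteq> insert q X" by (auto simp: link_def)
  moreover have "cc leq' (h ` link leq X q) d"
    by (intro cc_insert.IH leq inj_on_subset[OF cc_insert.prems(1)] sub) (use sub in auto)
  moreover have "cc leq' (h ` X) (Suc d)"
    by (intro cc_insert.IH leq inj_on_subset[OF cc_insert.prems(1)] sub) auto
  moreover have "h q \<notin> h ` X"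
    using cc_insert.prems(1) cc_insert.hyps(1) by (auto simp: inj_on_def)
  ultimately show ?case unfolding image_insert by (intro cc.cc_insert) simp_all
qed

text \<open>Elements may be added in any order compatible with \<open>R\<close>.\<close>

lemma cc_union:
  assumes "finite Y" "acyclic R" "cc leq X (Suc d)" "X \<inter> Y = {}"
    and "\<And>y Y'. y \<in> Y \<Longrightarrow> Y' \<subseteq> Y - {y} \<Longrightarrow> (\<And>y'. y' \<in> Y' \<Longrightarrow> (y, y') \<notin> R) \<Longrightarrow>
      cc leq (link leq (X \<union> Y') y) d"
  shows "cc leq (X \<union> Y) (Suc d)"
  using assms(1,4,5)
proof (induction "card Y" arbitrary: Y)
  case 0
  then show ?case using assms(3) by simp
next
  case (Suc n)
  then have "Y \<noteq> {}" by auto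
  \<comment> \<open>The element \<open>y\<close> chosen below has no successor under
    \<open>R\<close> inside \<open>Y\<close>, so it may be added after all the others.\<close>
  have "wf ((R \<inter> Y \<times> Y)\<inverse>)"
    using Suc.prems(1) assms(2)
    by (intro finite_acyclic_wf_converse[OF _ acyclic_subset[OF assms(2)]]) auto
  moreover obtain y0 where "y0 \<in> Y" using \<open>Y \<noteq> {}\<close> by auto
  ultimately obtain y where y: "y \<in> Y" "\<And>y'. (y', y) \<in> (R \<inter> Y \<times> Y)\<inverse> \<Longrightarrow> y' \<notin> Y"
    by (rule wfE_min) blast
  have yR: "(y, y') \<notin> R" if "y' \<in> Y" for y'
    using y(2)[of y'] y(1) that by auto
  have "cc leq (X \<union> (Y - {y})) (Suc d)"
  proof (rule Suc.hyps(1))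
    show "n = card (Y - {y})" using Suc.hyps(2) y(1) by simp
    fix z Y' assume "z \<in> Y - {y}" "Y' \<subseteq> Y - {y} - {z}" "\<And>y'. y' \<in> Y' \<Longrightarrow> (z, y') \<notin> R"
    then show "cc leq (link leq (X \<union> Y') z) d"
      by (intro Suc.prems(3)) blast+
  next
    show "finite (Y - {y})" "X \<inter> (Y - {y}) = {}" using Suc.prems(1,2) by auto
  qed
  moreover have "cc leq (link leq (X \<union> (Y - {y})) y) d"
    by (intro Suc.prems(3) y(1) order.refl yR) auto
  moreover have "insert y (X \<union> (Y - {y})) = X \<union> Y" "y \<notin> X \<union> (Y - {y})"
    using y(1) Suc.prems(2) by auto
  ultimately show ?case using cc_insert[of y "X \<union> (Y - {y})" leq d] by simp
qed

section \<open>Traces and the Hopf trace formula\<close>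

text \<open>The body of the definite description in \<open>quot_trace\<close>; as a relation it can
  be computed with before uniqueness is invoked.\<close>

definition has_trace where
  "has_trace V W T t \<longleftrightarrow> (\<exists>B M. quot_basis V W B \<and> quot_matrix W B T M \<and> t = (\<Sum>b\<in>B. M b b))"

lemma has_trace_eq:
  assumes "qv.subspace W"
    and "\<And>u v. T (u + v) = T u + T v" "\<And>r v. T (qscale r v) = qscale r (T v)"
    and "\<And>v. v \<in> W \<Longrightarrow> T v \<in> W" "has_trace V W T t"
  shows "quot_trace V W T = t"
proof -
  obtain B M where B: "quot_basis V W B" "quot_matrix W B T M" and t: "t = (\<Sum>b\<in>B. M b b)"
    using assms(5) unfolding has_trace_def by blast
  show ?thesis unfolding t by (rule quot_trace_unique[OF assms(1-4) B])
qed

lemma quot_basis_combine: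
  assumes "quot_basis V W B" "v \<in> V"
  obtains a where "v - (\<Sum>b\<in>B. qscale (a b) b) \<in> W"
  using assms by (auto simp: quot_basis_def)

lemma quot_basis_indep:
  assumes "quot_basis V W B" "(\<Sum>b\<in>B. qscale (a b) b) \<in> W" "b \<in> B"
  shows "a b = 0"
  using assms unfolding quot_basis_def by blast

lemma sum_delta_scale:
  "finite B \<Longrightarrow> c \<in> B \<Longrightarrow> (\<Sum>b\<in>B. qscale (if b = c then r else 0) b) = qscale r c"
proof -
  assume *: "finite B" "c \<in> B"
  have "(\<Sum>b\<in>B. qscale (if b = c then r else 0) b) = (\<Sum>b\<in>B. if b = c then qscale r b else 0)"
    by (intro sum.cong) auto
  then show ?thesis using * by simp
qed

text \<open>A basis \<open>A\<close> of \<open>W\<close> is extended to a basis \<open>B\<close> of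
  \<open>V\<close>; the vectors of \<open>B - A\<close> represent a basis of the quotient.\<close>

lemma has_trace_exists:
  assumes V: "qv.subspace V" "V \<subseteq> qv.span F" "finite F" and W: "qv.subspace W" "W \<subseteq> V"
    and T: "\<And>v. v \<in> V \<Longrightarrow> T v \<in> V"
  shows "\<exists>t. has_trace V W T t"
proof -
  obtain A where A: "A \<subseteq> W" "qv.independent A" "W \<subseteq> qv.span A"
    using qv.maximal_independent_subset[of W] by auto
  have "A \<subseteq> V" using A W by auto
  then obtain B where B: "A \<subseteq> B" "B \<subseteq> V" "qv.independent B" "V \<subseteq> qv.span B"
    using qv.maximal_independent_subset_extend[of A V] A(2) by auto
  have fin: "finite B"
    using qv.independent_span_bound[OF V(3) B(3) order.trans[OF B(2) V(2)]] by (rule conjunct1)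
  then have finA: "finite A" using B(1) finite_subset by auto
  have spA: "qv.span A = W"
    using qv.span_minimal[OF A(1) W(1)] A(3) by blast
  have split: "(\<Sum>b\<in>B. qscale (a b) b) = (\<Sum>b\<in>B - A. qscale (a b) b) + (\<Sum>b\<in>A. qscale (a b) b)" for a
    using sum.subset_diff[OF B(1) fin] .
  have inA: "(\<Sum>b\<in>A. qscale (a b) b) \<in> W" for a
    unfolding spA[symmetric] by (intro qv.span_sum qv.span_scale qv.span_base)
  have qb: "quot_basis V W (B - A)"
    unfolding quot_basis_def
  proof (intro conjI ballI allI impI)
    fix v assume "v \<in> V"
    then have "v \<in> qv.span B" using B by auto
    then obtain a where a: "v = (\<Sum>b\<in>B. qscale (a b) b)"
      using qv.span_finite[OF fin] by auto
    have "v - (\<Sum>b\<in>B - A. qscale (a b) b) \<in> W"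
      unfolding a split using inA by simp
    then show "\<exists>a. v - (\<Sum>b\<in>B - A. qscale (a b) b) \<in> W" by blast
  next
    fix a b assume a: "(\<Sum>b\<in>B - A. qscale (a b) b) \<in> W" and b: "b \<in> B - A"
    from a have "(\<Sum>b\<in>B - A. qscale (a b) b) \<in> qv.span A" by (simp add: spA)
    then obtain c where c: "(\<Sum>b\<in>B - A. qscale (a b) b) = (\<Sum>b\<in>A. qscale (c b) b)"
      using qv.span_finite[OF finA] by auto
    \<comment> \<open>A combination of \<open>B - A\<close> lying in \<open>W\<close> is also a
      combination of \<open>A\<close>; their difference, with coefficients \<open>d\<close>, is a
      vanishing combination of the basis \<open>B\<close>.\<close>
    define d where "d b = (if b \<in> A then - c b else a b)" for b
    have "(\<Sum>b\<in>B. qscale (d b) b) = (\<Sum>b\<in>B - A. qscale (a b) b) + (\<Sum>b\<in>A. qscale (- c b) b)"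
      unfolding split by (intro arg_cong2[of _ _ _ _ "(+)"] sum.cong) (auto simp: d_def)
    then have "(\<Sum>b\<in>B. qscale (d b) b) = 0"
      using c by (simp add: sum_negf)
    then have "d b = 0"
      using qv.independentD[OF B(3) fin order.refl, of d b] b by blast
    then show "a b = 0" using b by (simp add: d_def)
  qed (use fin B in auto)
  have "\<forall>b\<in>B - A. \<exists>a. T b - (\<Sum>c\<in>B - A. qscale (a c) c) \<in> W"
  proof
    fix b assume "b \<in> B - A"
    then have "T b \<in> V" using B T by auto
    from quot_basis_combine[OF qb this] show "\<exists>a. T b - (\<Sum>c\<in>B - A. qscale (a c) c) \<in> W"
      by blast
  qed
  then obtain m where "\<And>b. b \<in> B - A \<Longrightarrow> T b - (\<Sum>c\<in>B - A. qscale (m b c) c) \<in> W"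
    by metis
  then have "quot_matrix W (B - A) T (\<lambda>c b. m b c)"
    by (simp add: quot_matrix_def)
  with qb show ?thesis unfolding has_trace_def by blast
qed

text \<open>A basis of \<open>Z\<close> and representatives of a basis of V / Z together make the
  matrix of \<open>T\<close> block triangular.\<close>

lemma has_trace_add:
  assumes Z: "qv.subspace Z" "Z \<subseteq> V"
    and t: "has_trace Z {0} T s" "has_trace V Z T t"
  shows "has_trace V {0} T (s + t)"
proof -
  obtain A M where A: "quot_basis Z {0} A" "quot_matrix {0} A T M" and s: "s = (\<Sum>b\<in>A. M b b)"
    using t by (auto simp: has_trace_def)
  obtain D N where D: "quot_basis V Z D" "quot_matrix Z D T N" and t: "t = (\<Sum>b\<in>D. N b b)"
    using t by (auto simp: has_trace_def)
  have fin: "finite A" "finite D" and AZ: "A \<subseteq> Z" and DV: "D \<subseteq> V"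
    using A D by (auto simp: quot_basis_def)
  have disj: "A \<inter> D = {}"
  proof (rule ccontr)
    assume "A \<inter> D \<noteq> {}"
    then obtain d where d: "d \<in> D" "d \<in> Z" using AZ by auto
    then have "(\<Sum>b\<in>D. qscale (if b = d then 1 else 0) b) \<in> Z"
      using fin by (simp add: sum_delta_scale)
    from quot_basis_indep[OF D(1) this d(1)] show False by simp
  qed
  have sumZ: "(\<Sum>b\<in>A. qscale (a b) b) \<in> Z" for a
    using AZ by (intro qv.subspace_sum[OF Z(1)] qv.subspace_scale[OF Z(1)]) auto
  have un: "(\<Sum>b\<in>A \<union> D. qscale (a b) b) = (\<Sum>b\<in>A. qscale (a b) b) + (\<Sum>b\<in>D. qscale (a b) b)" for a
    using fin disj by (simp add: sum.union_disjoint)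
  have ex: "\<exists>e. v = (\<Sum>b\<in>A. qscale (e b) b)" if "v \<in> Z" for v
    using quot_basis_combine[OF A(1) that] by (metis eq_iff_diff_eq_0 singletonD)
  have qb: "quot_basis V {0} (A \<union> D)"
    unfolding quot_basis_def
  proof (intro conjI ballI allI impI)
    fix v assume "v \<in> V"
    from quot_basis_combine[OF D(1) this] obtain a where "v - (\<Sum>b\<in>D. qscale (a b) b) \<in> Z" .
    from ex[OF this] obtain e where e: "v - (\<Sum>b\<in>D. qscale (a b) b) = (\<Sum>b\<in>A. qscale (e b) b)" ..
    have "(\<Sum>b\<in>A \<union> D. qscale (if b \<in> A then e b else a b) b) =
        (\<Sum>b\<in>A. qscale (e b) b) + (\<Sum>b\<in>D. qscale (a b) b)"
      unfolding un using disj by (intro arg_cong2[of _ _ _ _ "(+)"] sum.cong) auto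
    then show "\<exists>a. v - (\<Sum>b\<in>A \<union> D. qscale (a b) b) \<in> {0}"
      unfolding e[symmetric]
      by (intro exI[of _ "\<lambda>b. if b \<in> A then e b else a b"]) simp
  next
    fix a b assume a: "(\<Sum>b\<in>A \<union> D. qscale (a b) b) \<in> {0}" and b: "b \<in> A \<union> D"
    then have "(\<Sum>b\<in>D. qscale (a b) b) = - (\<Sum>b\<in>A. qscale (a b) b)"
      unfolding un by (simp add: eq_neg_iff_add_eq_0 add.commute)
    then have "(\<Sum>b\<in>D. qscale (a b) b) \<in> Z"
      using qv.subspace_neg[OF Z(1) sumZ] by simp
    then have D0: "a b = 0" if "b \<in> D" for b using quot_basis_indep[OF D(1)] that by blast
    then have "(\<Sum>b\<in>A. qscale (a b) b) \<in> {0}"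
      using a unfolding un by simp
    then have "a b = 0" if "b \<in> A" for b using quot_basis_indep[OF A(1)] that by blast
    with D0 b show "a b = 0" by auto
  qed (use fin AZ DV Z in auto)
  have "\<forall>b\<in>D. \<exists>e. T b - (\<Sum>c\<in>D. qscale (N c b) c) = (\<Sum>c\<in>A. qscale (e c) c)"
    using D(2) ex unfolding quot_matrix_def by blast
  from bchoice[OF this] obtain E where
    E: "\<And>b. b \<in> D \<Longrightarrow> T b - (\<Sum>c\<in>D. qscale (N c b) c) = (\<Sum>c\<in>A. qscale (E b c) c)"
    by auto
  \<comment> \<open>\<open>E\<close> is the off-diagonal block and does not enter the trace.\<close>
  define K where "K c b = (if b \<in> A then if c \<in> A then M c b else 0 else if c \<in> D then N c b else E b c)" for c b
  have "quot_matrix {0} (A \<union> D) T K"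
    unfolding quot_matrix_def
  proof
    fix b assume b: "b \<in> A \<union> D"
    show "T b - (\<Sum>c\<in>A \<union> D. qscale (K c b) c) \<in> {0}"
    proof (cases "b \<in> A")
      case True
      have "(\<Sum>c\<in>A \<union> D. qscale (K c b) c) = (\<Sum>c\<in>A. qscale (M c b) c) + (\<Sum>c\<in>D. 0)"
        unfolding un using disj True by (intro arg_cong2[of _ _ _ _ "(+)"] sum.cong) (auto simp: K_def)
      then show ?thesis using A(2) True by (simp add: quot_matrix_def)
    next
      case False
      then have "b \<in> D" using b by auto
      have "(\<Sum>c\<in>A \<union> D. qscale (K c b) c) = (\<Sum>c\<in>A. qscale (E b c) c) + (\<Sum>c\<in>D. qscale (N c b) c)"
        unfolding un using disj False by (intro arg_cong2[of _ _ _ _ "(+)"] sum.cong) (auto simp: K_def)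
      then show ?thesis using E[OF \<open>b \<in> D\<close>] by (simp add: algebra_simps)
    qed
  qed
  moreover have "s + t = (\<Sum>b\<in>A \<union> D. K b b)"
    unfolding s t using fin disj
    by (subst sum.union_disjoint) (auto simp: K_def intro!: arg_cong2[of _ _ _ _ "(+)"] sum.cong)
  ultimately show ?thesis using qb unfolding has_trace_def by blast
qed

text \<open>\<open>f\<close> induces an isomorphism from \<open>V\<close> modulo its kernel onto its
  image and commutes with \<open>T\<close>, so it carries basis and matrix along.\<close>

lemma has_trace_image:
  assumes f: "\<And>u v. f (u + v) = f u + f v" "\<And>r v. f (qscale r v) = qscale r (f v)"
    and V: "qv.subspace V" and T: "\<And>v. v \<in> V \<Longrightarrow> T v \<in> V" "\<And>v. v \<in> V \<Longrightarrow> f (T v) = T (f v)"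
    and t: "has_trace V {v \<in> V. f v = 0} T t"
  shows "has_trace (f ` V) {0} T t"
proof -
  let ?Z = "{v \<in> V. f v = 0}"
  obtain D N where D: "quot_basis V ?Z D" "quot_matrix ?Z D T N" and t: "t = (\<Sum>b\<in>D. N b b)"
    using t by (auto simp: has_trace_def)
  have fin: "finite D" and DV: "D \<subseteq> V" using D by (auto simp: quot_basis_def)
  have f0: "f 0 = 0" using f(2)[of 0 0] by simp
  have fneg: "f (- v) = - f v" for v using f(2)[of "-1" v] by simp
  have fdiff: "f (u - v) = f u - f v" for u v using f(1)[of u "- v"] by (simp add: fneg)
  have fsum: "f (\<Sum>b\<in>D. qscale (a b) b) = (\<Sum>b\<in>D. qscale (a b) (f b))" for a
  proof -
    have "f (\<Sum>b\<in>S. qscale (a b) b) = (\<Sum>b\<in>S. qscale (a b) (f b))" if "finite S" for S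
      using that by induction (simp_all add: f f0)
    then show ?thesis using fin by blast
  qed
  have sumV: "(\<Sum>b\<in>D. qscale (a b) b) \<in> V" for a
    using DV by (intro qv.subspace_sum[OF V] qv.subspace_scale[OF V]) auto
  have inj: "inj_on f D"
  proof (rule inj_onI, rule ccontr)
    fix b c assume bc: "b \<in> D" "c \<in> D" "f b = f c" "b \<noteq> c"
    let ?a = "\<lambda>x. (if x = b then 1 else 0) - (if x = c then 1 else 0) :: rat"
    have "(\<Sum>x\<in>D. qscale (?a x) x) = b - c"
      using bc fin by (simp add: qv.scale_left_diff_distrib sum_subtractf sum_delta_scale)
    then have "f (\<Sum>x\<in>D. qscale (?a x) x) = 0"
      using bc by (simp add: fdiff)
    then have "(\<Sum>x\<in>D. qscale (?a x) x) \<in> ?Z" using sumV[of ?a] by blast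
    from quot_basis_indep[OF D(1) this bc(1)] bc show False by simp
  qed
  define g where "g = inv_into D f"
  have g: "g (f b) = b" if "b \<in> D" for b using inj that by (simp add: g_def)
  have reind: "(\<Sum>x\<in>f ` D. qscale (a x) x) = f (\<Sum>b\<in>D. qscale (a (f b)) b)" for a
    unfolding fsum by (simp add: sum.reindex[OF inj])
  have "quot_basis (f ` V) {0} (f ` D)"
    unfolding quot_basis_def
  proof (intro conjI ballI allI impI)
    fix w assume "w \<in> f ` V"
    then obtain v where v: "v \<in> V" "w = f v" by auto
    from quot_basis_combine[OF D(1) v(1)] obtain a where "v - (\<Sum>b\<in>D. qscale (a b) b) \<in> ?Z" .
    then have "w = f (\<Sum>b\<in>D. qscale (a b) b)" by (simp add: v fdiff)
    also have "(\<Sum>b\<in>D. qscale (a b) b) = (\<Sum>b\<in>D. qscale (a (g (f b))) b)"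
      by (intro sum.cong) (auto simp: g)
    finally show "\<exists>a. w - (\<Sum>b\<in>f ` D. qscale (a b) b) \<in> {0}"
      by (intro exI[of _ "\<lambda>x. a (g x)"]) (simp add: reind)
  next
    fix a x assume a: "(\<Sum>b\<in>f ` D. qscale (a b) b) \<in> {0}" and x: "x \<in> f ` D"
    then have "(\<Sum>b\<in>D. qscale (a (f b)) b) \<in> ?Z" using sumV by (simp add: reind)
    with quot_basis_indep[OF D(1) this] x show "a x = 0" by auto
  qed (use fin DV in auto)
  moreover have "quot_matrix {0} (f ` D) T (\<lambda>x y. N (g x) (g y))"
    unfolding quot_matrix_def
  proof
    fix x assume "x \<in> f ` D"
    then obtain b where b: "b \<in> D" "x = f b" by auto
    have "T b - (\<Sum>c\<in>D. qscale (N c b) c) \<in> ?Z" using D(2) b by (simp add: quot_matrix_def)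
    then have "f (T b) = f (\<Sum>c\<in>D. qscale (N c b) c)" by (simp add: fdiff)
    moreover have "(\<Sum>c\<in>D. qscale (N c b) c) = (\<Sum>c\<in>D. qscale (N (g (f c)) (g (f b))) c)"
      using b by (intro sum.cong) (auto simp: g)
    ultimately show "T x - (\<Sum>c\<in>f ` D. qscale (N (g c) (g x)) c) \<in> {0}"
      using b DV T(2)[of b] by (auto simp: reind)
  qed
  moreover have "t = (\<Sum>x\<in>f ` D. N (g x) (g x))"
    unfolding t by (simp add: sum.reindex[OF inj] g)
  ultimately show ?thesis unfolding has_trace_def by blast
qed

section \<open>Traces on chain spaces and cycle spaces\<close>

lemma chain_space_sum_singles:
  assumes "v \<in> chain_space X leq i" "finite (simplices X leq i)"
  shows "v = (\<Sum>C\<in>simplices X leq i. qscale (Poly_Mapping.lookup v C) (Poly_Mapping.single C 1))"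
proof (rule poly_mapping_eqI)
  fix D
  have "(\<Sum>C\<in>simplices X leq i. if C = D then Poly_Mapping.lookup v C else 0) = Poly_Mapping.lookup v D"
    using assms by (auto simp: chain_space_def in_keys_iff)
  then show "Poly_Mapping.lookup v D = Poly_Mapping.lookup
      (\<Sum>C\<in>simplices X leq i. qscale (Poly_Mapping.lookup v C) (Poly_Mapping.single C 1)) D"
    by (simp add: lookup_sum lookup_single when_def)
qed

lemma subspace_chain_space: "qv.subspace (chain_space X leq i)"
  unfolding qv.subspace_def chain_space_def
proof (intro conjI ballI allI)
  fix u v :: "'a set \<Rightarrow>\<^sub>0 rat"
  assume "u \<in> {v. Poly_Mapping.keys v \<subseteq> simplices X leq i}"
    "v \<in> {v. Poly_Mapping.keys v \<subseteq> simplices X leq i}"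
  then show "u + v \<in> {v. Poly_Mapping.keys v \<subseteq> simplices X leq i}"
    using keys_add[of u v] by auto
qed (auto simp: in_keys_iff)

text \<open>In the basis of oriented simplices every column of the matrix has a single entry 1, and
  it lies on the diagonal exactly for the fixed simplices.\<close>

lemma has_trace_chain_space:
  assumes fin: "finite (simplices X leq i)"
    and h: "\<And>C. C \<in> simplices X leq i \<Longrightarrow> h ` C \<in> simplices X leq i"
  shows "has_trace (chain_space X leq i) {0} (lin_ext (\<lambda>C. Poly_Mapping.single (h ` C) 1))
    (of_nat (card {C \<in> simplices X leq i. h ` C = C}))"
proof -
  let ?S = "simplices X leq i" and ?T = "lin_ext (\<lambda>C. Poly_Mapping.single (h ` C) (1 :: rat))"
  define e where "e C = Poly_Mapping.single C (1::rat)" for C :: "'a set"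
  have inj: "inj_on e ?S" by (auto simp: inj_on_def e_def poly_mapping_eq_iff fun_eq_iff lookup_single when_def split: if_splits)
  have Te: "?T (e C) = e (h ` C)" for C by (simp add: e_def)
  have "quot_basis (chain_space X leq i) {0} (e ` ?S)"
    unfolding quot_basis_def
  proof (intro conjI ballI allI impI)
    fix v assume v: "v \<in> chain_space X leq i"
    have "(\<Sum>b\<in>e ` ?S. qscale (Poly_Mapping.lookup v (inv_into ?S e b)) b) =
        (\<Sum>C\<in>?S. qscale (Poly_Mapping.lookup v C) (e C))"
      by (simp add: sum.reindex[OF inj] inj)
    also have "\<dots> = v" unfolding e_def by (rule chain_space_sum_singles[OF v fin, symmetric])
    finally show "\<exists>a. v - (\<Sum>b\<in>e ` ?S. qscale (a b) b) \<in> {0}"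
      by (intro exI[of _ "\<lambda>b. Poly_Mapping.lookup v (inv_into ?S e b)"]) simp
  next
    fix a b assume a: "(\<Sum>b\<in>e ` ?S. qscale (a b) b) \<in> {0}" and b: "b \<in> e ` ?S"
    then obtain D where D: "D \<in> ?S" "b = e D" by auto
    have "0 = Poly_Mapping.lookup (\<Sum>C\<in>?S. qscale (a (e C)) (e C)) D"
      using a by (simp add: sum.reindex[OF inj])
    also have "\<dots> = (\<Sum>C\<in>?S. if C = D then a (e C) else 0)"
      by (auto simp: lookup_sum e_def lookup_single when_def intro!: sum.cong)
    finally show "a b = 0" using D fin by simp
  qed (use fin in \<open>auto simp: e_def chain_space_def\<close>)
  moreover have "quot_matrix {0} (e ` ?S) ?T (\<lambda>c b. if c = ?T b then 1 else 0)"
    unfolding quot_matrix_def using fin h by (auto simp: sum_delta_scale Te)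
  moreover have "of_nat (card {C \<in> ?S. h ` C = C}) = (\<Sum>b\<in>e ` ?S. if b = ?T b then 1 else (0 :: rat))"
  proof -
    have "(\<Sum>b\<in>e ` ?S. if b = ?T b then 1 else 0) = (\<Sum>C\<in>?S. if h ` C = C then 1 else (0 :: rat))"
      unfolding sum.reindex[OF inj] comp_def Te
      by (intro sum.cong refl) (use inj h in \<open>auto simp: inj_on_def\<close>)
    then show ?thesis using fin by (simp add: sum.If_cases Int_def)
  qed
  ultimately show ?thesis unfolding has_trace_def by blast
qed

text \<open>For an order automorphism \<open>h\<close> this is minus the reduced Lefschetz number: a
  chain of k elements is a simplex of dimension k - 1 but is counted with the sign (-1)^k.\<close>

definition euler :: "'p set \<Rightarrow> ('p \<Rightarrow> 'p \<Rightarrow> bool) \<Rightarrow> ('p \<Rightarrow> 'p) \<Rightarrow> rat" where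
  "euler X leq h = (\<Sum>C | C \<subseteq> X \<and> finite C \<and> (\<forall>a\<in>C. \<forall>b\<in>C. leq a b \<or> leq b a) \<and> h ` C = C. (-1) ^ card C)"

context poset_on
begin

text \<open>The assumptions say that all simplices have dimension at most n - 2 and that reduced
  homology vanishes below that degree.\<close>

context
  fixes h n
  assumes fin: "finite P" and bij: "bij_betw h P P"
    and h: "\<And>a b. a \<in> P \<Longrightarrow> b \<in> P \<Longrightarrow> leq (h a) (h b) \<longleftrightarrow> leq a b"
    and ac: "\<And>i. i < int n - 2 \<Longrightarrow> acyc leq P i"
    and dim: "\<And>C. C \<in> chains \<Longrightarrow> card C < n" and n: "n \<ge> 1"
begin

abbreviation hmap where "hmap \<equiv> lin_ext (\<lambda>C. Poly_Mapping.single (h ` C) (1::rat))"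

lemma inj_h: "inj_on h P" and h_P: "a \<in> P \<Longrightarrow> h a \<in> P"
  using bij by (auto simp: bij_betw_def)

lemma h_simplices:
  assumes "C \<in> simplices P leq i" shows "h ` C \<in> simplices P leq i"
proof -
  have C: "C \<subseteq> P" "finite C" "int (card C) = i + 1" "\<And>a b. a \<in> C \<Longrightarrow> b \<in> C \<Longrightarrow> leq a b \<or> leq b a"
    using assms by (auto simp: simplices_def)
  have "card (h ` C) = card C" using inj_on_subset[OF inj_h C(1)] by (rule card_image)
  moreover have "leq (h a) (h b) \<or> leq (h b) (h a)" if "a \<in> C" "b \<in> C" for a b
    using C that h[of a b] h[of b a] by blast
  ultimately show ?thesis using C h_P by (auto simp: simplices_def)
qed

lemma hmap_chain_space: "v \<in> chain_space P leq i \<Longrightarrow> hmap v \<in> chain_space P leq i"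
  unfolding chain_space_def mem_Collect_eq
  by (intro keys_lin_ext) (use h_simplices in \<open>auto split: if_splits\<close>)

lemma boundary_hmap_single:
  assumes "C \<subseteq> P" "finite C"
  shows "boundary leq (hmap (Poly_Mapping.single C 1)) = hmap (boundary leq (Poly_Mapping.single C 1))"
proof -
  have inj: "inj_on h C" using inj_on_subset[OF inj_h assms(1)] .
  have "(\<Sum>a\<in>C. Poly_Mapping.single (h ` C - {h a}) ((-1) ^ card {b\<in>h ` C. leq b (h a) \<and> b \<noteq> h a})) =
     (\<Sum>a\<in>C. Poly_Mapping.single (h ` (C - {a})) ((-1) ^ card {b\<in>C. leq b a \<and> b \<noteq> a}) :: _ \<Rightarrow>\<^sub>0 rat)"
  proof (intro sum.cong HOL.refl)
    fix a assume a: "a \<in> C"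
    have "h ` C - {h a} = h ` (C - {a})" using inj a by (auto simp: inj_on_def)
    moreover have "{b\<in>h ` C. leq b (h a) \<and> b \<noteq> h a} = h ` {b\<in>C. leq b a \<and> b \<noteq> a}"
      using a assms h inj by (auto simp: inj_on_def subset_iff) 
    then have "card {b\<in>h ` C. leq b (h a) \<and> b \<noteq> h a} = card {b\<in>C. leq b a \<and> b \<noteq> a}"
      by (simp add: card_image inj_on_subset[OF inj])
    ultimately show "Poly_Mapping.single (h ` C - {h a}) ((-1) ^ card {b\<in>h ` C. leq b (h a) \<and> b \<noteq> h a}) =
      (Poly_Mapping.single (h ` (C - {a})) ((-1) ^ card {b\<in>C. leq b a \<and> b \<noteq> a}) :: _ \<Rightarrow>\<^sub>0 rat)" by simp
  qed
  then show ?thesis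
    by (simp add: boundary_def lin_ext_sum sum.reindex[OF inj])
qed

lemma boundary_hmap:
  assumes "v \<in> chain_space P leq i"
  shows "boundary leq (hmap v) = hmap (boundary leq v)"
  using assms unfolding chain_space_def mem_Collect_eq
proof (induction v rule: keys_induct)
  case (add k r v)
  have "boundary leq (hmap (qscale r (Poly_Mapping.single k 1))) =
      hmap (boundary leq (qscale r (Poly_Mapping.single k 1)))"
    using boundary_hmap_single[of k] add(1)
    unfolding boundary_def lin_ext_scale by (simp add: simplices_def)
  with add show ?case
    by (simp add: boundary_def lin_ext_add)
qed (simp_all add: boundary_def)

definition cycles where "cycles i = {v \<in> chain_space P leq i. boundary leq v = 0}"

lemma boundary_add: "boundary leq (u + v) = boundary leq u + boundary leq v"
  and boundary_scale: "boundary leq (qscale r v) = qscale r (boundary leq v)"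
  by (simp_all add: boundary_def lin_ext_add lin_ext_scale)

lemma subspace_cycles: "qv.subspace (cycles i)"
  using subspace_chain_space[of P leq i]
  by (simp add: qv.subspace_def cycles_def boundary_add boundary_scale) (simp add: boundary_def)

lemma simplices_chains: "simplices P leq i = {C \<in> chains. int (card C) = i + 1}"
  by (auto simp: simplices_def chains_def)

lemma finite_chains: "finite chains"
  by (rule finite_subset[of _ "Pow P"]) (use fin in \<open>auto simp: chains_def\<close>)

lemma finite_simplices: "finite (simplices P leq i)"
  unfolding simplices_chains using finite_chains by simp

lemma hmap_cycles: "v \<in> cycles i \<Longrightarrow> hmap v \<in> cycles i"
  by (auto simp: cycles_def hmap_chain_space boundary_hmap)

lemma image_boundary:
  assumes "i < int n - 2"
  shows "boundary leq ` chain_space P leq (i + 1) = cycles i"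
proof
  have "boundary leq (boundary leq v) = 0" if "v \<in> chain_space P leq (i + 1)" for v
    using that by (intro boundary_boundary) (auto simp: chain_space_def simplices_chains)
  then show "boundary leq ` chain_space P leq (i + 1) \<subseteq> cycles i"
    using boundary_chain_space[of _ P "i + 1"] by (auto simp: cycles_def)
  show "cycles i \<subseteq> boundary leq ` chain_space P leq (i + 1)"
    using ac[OF assms] unfolding acyc_def cycles_def by blast
qed

lemma has_trace_unique0:
  "has_trace V {0} hmap s \<Longrightarrow> has_trace V {0} hmap t \<Longrightarrow> s = t"
  using has_trace_eq[of "{0}" hmap V s] has_trace_eq[of "{0}" hmap V t]
  by (simp add: lin_ext_add lin_ext_scale qv.subspace_single_0)

text \<open>Homology vanishes in degree i - 1, so 0 -> Z_i -> C_i -> Z_(i-1) -> 0 is exact for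
  chains C and cycles Z, and traces are additive.\<close>

lemma trace_cycles_step:
  assumes "i \<le> int n - 2" "has_trace (cycles (i - 1)) {0} hmap s"
  shows "has_trace (cycles i) {0} hmap (of_nat (card {C \<in> simplices P leq i. h ` C = C}) - s)"
proof -
  let ?V = "chain_space P leq i"
  have sp: "?V \<subseteq> qv.span ((\<lambda>C. Poly_Mapping.single C 1) ` simplices P leq i)"
  proof
    fix v assume v: "v \<in> ?V"
    show "v \<in> qv.span ((\<lambda>C. Poly_Mapping.single C 1) ` simplices P leq i)"
      by (subst chain_space_sum_singles[OF v finite_simplices])
        (intro qv.span_sum qv.span_scale qv.span_base imageI)
  qed
  have finF: "finite ((\<lambda>C. Poly_Mapping.single C (1 :: rat)) ` simplices P leq i)"
    using finite_simplices by simp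
  have sub: "cycles i \<subseteq> ?V" by (auto simp: cycles_def)
  obtain t where t: "has_trace ?V (cycles i) hmap t"
    using has_trace_exists[OF subspace_chain_space sp finF subspace_cycles sub] hmap_chain_space
    by blast
  obtain t' where t': "has_trace (cycles i) {0} hmap t'"
    using has_trace_exists[OF subspace_cycles order.trans[OF sub sp] finF, of "{0}" hmap] hmap_cycles
      subspace_cycles[of i] by (auto simp: qv.subspace_single_0 qv.subspace_0)
  have "has_trace (boundary leq ` ?V) {0} hmap t"
    by (rule has_trace_image)
      (use t subspace_chain_space hmap_chain_space boundary_hmap in \<open>auto simp: boundary_add boundary_scale cycles_def\<close>)
  also have "boundary leq ` ?V = cycles (i - 1)"
    using image_boundary[of "i - 1"] assms(1) by simp
  finally have "t = s" using assms(2) has_trace_unique0 by blast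
  moreover have "has_trace ?V {0} hmap (t' + t)"
    by (rule has_trace_add[OF subspace_cycles sub t' t])
  then have "t' + t = of_nat (card {C \<in> simplices P leq i. h ` C = C})"
    using has_trace_unique0 has_trace_chain_space[OF finite_simplices h_simplices] by blast
  ultimately show ?thesis using t' by (simp add: eq_diff_eq flip: eq_diff_eq)
qed

text \<open>Unrolls the exact sequences, starting from the zero space in degree -2. The cycles of
  degree k - 2 involve the chains with at most k - 1 elements, as the empty chain has degree
  -1.\<close>

lemma trace_cycles:
  "int k \<le> int n \<Longrightarrow> has_trace (cycles (int k - 2)) {0} hmap
     (\<Sum>j<k. (-1) ^ (k - 1 - j) * of_nat (card {C \<in> chains. card C = j \<and> h ` C = C}))"
proof (induction k)
  case 0
  have "simplices P leq (- 2) = {}" by (auto simp: simplices_def)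
  then have "cycles (-2) = {0}"
    by (auto simp: cycles_def chain_space_def boundary_def)
  moreover have "has_trace {0} {0} hmap (0 :: rat)"
    unfolding has_trace_def
    by (intro exI[of _ "{}"] exI[of _ "\<lambda>_ _. 0"]) (simp add: quot_basis_def quot_matrix_def)
  ultimately show ?case by simp
next
  case (Suc k)
  have "{C \<in> simplices P leq (int (Suc k) - 2). h ` C = C} = {C \<in> chains. card C = k \<and> h ` C = C}"
    by (auto simp: simplices_chains)
  moreover have "(\<Sum>j<k. (-1) ^ (k - j) * of_nat (card {C \<in> chains. card C = j \<and> h ` C = C})) =
      - (\<Sum>j<k. (-1) ^ (k - 1 - j) * of_nat (card {C \<in> chains. card C = j \<and> h ` C = C}) :: rat)"
    unfolding sum_negf[symmetric]
  proof (intro sum.cong HOL.refl)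
    fix j assume "j \<in> {..<k}"
    then have "k - j = Suc (k - 1 - j)" by auto
    then show "(-1) ^ (k - j) * of_nat (card {C \<in> chains. card C = j \<and> h ` C = C}) =
      - ((-1) ^ (k - 1 - j) * of_nat (card {C \<in> chains. card C = j \<and> h ` C = C}) :: rat)" by simp
  qed
  ultimately show ?case
    using trace_cycles_step[of "int (Suc k) - 2"] Suc by (simp add: lessThan_Suc)
qed

text \<open>There are no simplices of degree n - 1, so the top homology is the space of cycles
  itself; multiplication by (-1)^n turns the alternating signs into those of \<open>euler\<close>,
  up to an overall minus.\<close>

lemma hopf_trace:
  assumes "act x = h"
  shows "(-1) ^ n * rep_trace (reduced_homology P leq act (int n - 2)) x = - euler P leq h"
proof -
  have "simplices P leq (int n - 1) = {}"
    using dim by (force simp: simplices_chains)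
  then have "boundary leq ` chain_space P leq (int n - 2 + 1) = {0}"
    by (auto simp: chain_space_def boundary_def)
  then have "rep_trace (reduced_homology P leq act (int n - 2)) x =
      quot_trace (cycles (int n - 2)) {0} hmap"
    by (simp add: rep_trace_def reduced_homology_def cycles_def assms)
  also have "\<dots> = (\<Sum>j<n. (-1) ^ (n - 1 - j) * of_nat (card {C \<in> chains. card C = j \<and> h ` C = C}))"
    by (intro has_trace_eq trace_cycles) (auto simp: lin_ext_add lin_ext_scale qv.subspace_single_0)
  finally have "(-1) ^ n * rep_trace (reduced_homology P leq act (int n - 2)) x =
      (\<Sum>j<n. (-1) ^ n * (-1) ^ (n - 1 - j) * of_nat (card {C \<in> chains. card C = j \<and> h ` C = C}))"
    by (simp add: sum_distrib_left mult.assoc)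
  also have "\<dots> = (\<Sum>j<n. - (\<Sum>C\<in>{C \<in> {C \<in> chains. h ` C = C}. card C = j}. (-1) ^ card C))"
  proof (intro sum.cong HOL.refl)
    fix j assume "j \<in> {..<n}"
    then obtain m where m: "n = Suc (j + m)" using less_imp_Suc_add[of j n] by auto
    have "n - 1 - j = m" by (simp add: m)
    then have "(-1 :: rat) ^ n * (-1) ^ (n - 1 - j) = - ((-1) ^ j * ((-1) ^ m * (-1) ^ m))"
      unfolding m power_Suc power_add by (simp only: mult.assoc mult_minus_left mult_1)
    then have e: "(-1 :: rat) ^ n * (-1) ^ (n - 1 - j) = - ((-1) ^ j)" by simp
    have "{C \<in> {C \<in> chains. h ` C = C}. card C = j} = {C \<in> chains. card C = j \<and> h ` C = C}" by auto
    then show "(-1) ^ n * (-1) ^ (n - 1 - j) * of_nat (card {C \<in> chains. card C = j \<and> h ` C = C}) =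
      - (\<Sum>C\<in>{C \<in> {C \<in> chains. h ` C = C}. card C = j}. (-1) ^ card C :: rat)"
      unfolding e by simp
  qed
  also have "\<dots> = - (\<Sum>C | C \<in> chains \<and> h ` C = C. (-1) ^ card C)"
    unfolding sum_negf using dim finite_chains by (subst sum.group) auto
  also have "{C. C \<in> chains \<and> h ` C = C} =
      {C. C \<subseteq> P \<and> finite C \<and> (\<forall>a\<in>C. \<forall>b\<in>C. leq a b \<or> leq b a) \<and> h ` C = C}"
    by (auto simp: chains_def)
  finally show ?thesis by (simp add: euler_def)
qed

end

end

section \<open>Equivariant maps and free invariant equivalence relations\<close>

text \<open>The index set is arbitrary because indices are deleted when fibres merge and are split
  up into cycles.\<close>

definition pts :: "('a, 'b) monoid_scheme \<Rightarrow> nat set \<Rightarrow> ('a \<times> nat) set" where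
  "pts G A = carrier G \<times> A"

definition equivar :: "('a, 'b) monoid_scheme \<Rightarrow> nat set \<Rightarrow> ('a \<times> nat \<Rightarrow> 'a \<times> nat) \<Rightarrow> bool" where
  "equivar G A f \<longleftrightarrow> (\<forall>g\<in>carrier G. \<forall>z\<in>pts G A. f (lmult G g z) = lmult G g (f z))"

definition wr :: "('a, 'b) monoid_scheme \<Rightarrow> nat set \<Rightarrow> ('a \<times> nat \<Rightarrow> 'a \<times> nat) set" where
  "wr G A = {x. x permutes pts G A \<and> equivar G A x}"

text \<open>The extensional function space makes maps equal as soon as they agree on
  \<open>pts G A\<close>, on which the later counting of maps relies.\<close>

definition eqv :: "('a, 'b) monoid_scheme \<Rightarrow> nat set \<Rightarrow> nat set \<Rightarrow> ('a \<times> nat \<Rightarrow> 'a \<times> nat) set" where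
  "eqv G A B = {f \<in> pts G A \<rightarrow>\<^sub>E pts G B. equivar G A f}"

definition esurj :: "('a, 'b) monoid_scheme \<Rightarrow> nat set \<Rightarrow> nat set \<Rightarrow> ('a \<times> nat \<Rightarrow> 'a \<times> nat) set" where
  "esurj G A B = {f \<in> eqv G A B. f ` pts G A = pts G B}"

text \<open>The pair \<open>({}, \<pi>)\<close> of the Dowling lattice is encoded by the equivalence relation with classes \<open>\<pi>\<close>.
  A nontrivial \<open>g\<close> fixes a class iff it relates a point to its translate.\<close>

definition frel :: "('a, 'b) monoid_scheme \<Rightarrow> nat set \<Rightarrow> ('a \<times> nat) rel set" where
  "frel G A = {r. equiv (pts G A) r \<and>
     (\<forall>g\<in>carrier G. \<forall>(u, v)\<in>r. (lmult G g u, lmult G g v) \<in> r) \<and>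
     (\<forall>g\<in>carrier G. \<forall>z\<in>pts G A. (z, lmult G g z) \<in> r \<longrightarrow> g = \<one>\<^bsub>G\<^esub>)}"

definition pull :: "('a, 'b) monoid_scheme \<Rightarrow> nat set \<Rightarrow> ('a \<times> nat \<Rightarrow> 'a \<times> nat) \<Rightarrow> ('a \<times> nat) rel \<Rightarrow> ('a \<times> nat) rel" where
  "pull G A f r = {(u, v) \<in> pts G A \<times> pts G A. (f u, f v) \<in> r}"

abbreviation idrel :: "('a, 'b) monoid_scheme \<Rightarrow> nat set \<Rightarrow> ('a \<times> nat) rel" where
  "idrel G A \<equiv> Id_on (pts G A)"

text \<open>The largest relation below \<open>q\<close> all of whose classes over the index
  \<open>a\<close> are singletons.\<close>

definition isolate :: "('a, 'b) monoid_scheme \<Rightarrow> nat set \<Rightarrow> nat \<Rightarrow> ('a \<times> nat) rel \<Rightarrow> ('a \<times> nat) rel" where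
  "isolate G A a q = (q \<inter> pts G (A - {a}) \<times> pts G (A - {a})) \<union> idrel G A"

text \<open>Glues the fibre over \<open>a\<close> to the fibre over \<open>m\<close> so that (1, a)
  goes to (g, m); the kernels of these maps are the atoms of the poset.\<close>

definition merge :: "('a, 'b) monoid_scheme \<Rightarrow> nat set \<Rightarrow> nat \<Rightarrow> nat \<Rightarrow> 'a \<Rightarrow> 'a \<times> nat \<Rightarrow> 'a \<times> nat" where
  "merge G A a m g = (\<lambda>z\<in>pts G A. if snd z = a then (fst z \<otimes>\<^bsub>G\<^esub> g, m) else z)"

lemma wreath_eq: "wreath G n = wr G {1..n}"
  by (simp add: wreath_def wr_def equivar_def points_def pts_def)

locale fgroup = group G for G (structure) +
  assumes fin_G: "finite (carrier G)"
begin

lemma finite_pts: "finite A \<Longrightarrow> finite (pts G A)"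
  using fin_G by (simp add: pts_def)

lemma card_G_pos: "card (carrier G) > 0"
  using fin_G one_closed by (auto simp: card_gt_0_iff)

lemma lmult_pts [simp]: "g \<in> carrier G \<Longrightarrow> z \<in> pts G A \<Longrightarrow> lmult G g z \<in> pts G A"
  by (auto simp: lmult_def pts_def)

lemma lmult_lmult: "g \<in> carrier G \<Longrightarrow> h \<in> carrier G \<Longrightarrow> z \<in> pts G A \<Longrightarrow>
  lmult G g (lmult G h z) = lmult G (g \<otimes> h) z"
  by (auto simp: lmult_def pts_def m_assoc)

lemma lmult_one [simp]: "z \<in> pts G A \<Longrightarrow> lmult G \<one> z = z"
  by (auto simp: lmult_def pts_def)

lemma pts_mono: "A \<subseteq> B \<Longrightarrow> pts G A \<subseteq> pts G B"
  by (auto simp: pts_def)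

lemma equivarD: "equivar G A f \<Longrightarrow> g \<in> carrier G \<Longrightarrow> z \<in> pts G A \<Longrightarrow> f (lmult G g z) = lmult G g (f z)"
  by (simp add: equivar_def)

lemma frelD:
  assumes "r \<in> frel G A"
  shows "r \<subseteq> pts G A \<times> pts G A" "z \<in> pts G A \<Longrightarrow> (z, z) \<in> r" "(u, v) \<in> r \<Longrightarrow> (v, u) \<in> r"
    "(u, v) \<in> r \<Longrightarrow> (v, w) \<in> r \<Longrightarrow> (u, w) \<in> r"
    "g \<in> carrier G \<Longrightarrow> (u, v) \<in> r \<Longrightarrow> (lmult G g u, lmult G g v) \<in> r"
    "g \<in> carrier G \<Longrightarrow> z \<in> pts G A \<Longrightarrow> (z, lmult G g z) \<in> r \<Longrightarrow> g = \<one>"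
proof -
  have e: "equiv (pts G A) r" using assms by (simp add: frel_def)
  show "r \<subseteq> pts G A \<times> pts G A" "z \<in> pts G A \<Longrightarrow> (z, z) \<in> r"
    using equiv_type[OF e] e by (auto simp: equiv_def refl_on_def)
  show "(u, v) \<in> r \<Longrightarrow> (v, u) \<in> r" "(u, v) \<in> r \<Longrightarrow> (v, w) \<in> r \<Longrightarrow> (u, w) \<in> r"
    using e unfolding equiv_def by (blast dest: symD transD)+
  show "g \<in> carrier G \<Longrightarrow> (u, v) \<in> r \<Longrightarrow> (lmult G g u, lmult G g v) \<in> r"
    "g \<in> carrier G \<Longrightarrow> z \<in> pts G A \<Longrightarrow> (z, lmult G g z) \<in> r \<Longrightarrow> g = \<one>"
    using assms unfolding frel_def by blast+
qed

lemma frelI [case_names sub refl sym trans lmult free]: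
  assumes "r \<subseteq> pts G A \<times> pts G A" "\<And>z. z \<in> pts G A \<Longrightarrow> (z, z) \<in> r" "\<And>u v. (u, v) \<in> r \<Longrightarrow> (v, u) \<in> r"
    "\<And>u v w. (u, v) \<in> r \<Longrightarrow> (v, w) \<in> r \<Longrightarrow> (u, w) \<in> r"
    "\<And>g u v. g \<in> carrier G \<Longrightarrow> (u, v) \<in> r \<Longrightarrow> (lmult G g u, lmult G g v) \<in> r"
    "\<And>g z. g \<in> carrier G \<Longrightarrow> z \<in> pts G A \<Longrightarrow> (z, lmult G g z) \<in> r \<Longrightarrow> g = \<one>"
  shows "r \<in> frel G A"
proof -
  have "equiv (pts G A) r"
    by (rule equivI[OF assms(1) refl_onI[OF assms(2)] symI[OF assms(3)] transI[OF assms(4)]])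
  then show ?thesis using assms(5,6) unfolding frel_def by blast
qed

lemma finite_frel: "finite A \<Longrightarrow> finite (frel G A)"
  by (rule finite_subset[of _ "Pow (pts G A \<times> pts G A)"]) (use frelD(1) finite_pts in auto)

lemma finite_frel_elem: "finite A \<Longrightarrow> r \<in> frel G A \<Longrightarrow> finite r"
  using finite_subset[OF frelD(1)] finite_pts by auto

lemma lmult_eq_iff: "g \<in> carrier G \<Longrightarrow> z \<in> pts G A \<Longrightarrow> z = lmult G g z \<Longrightarrow> g = \<one>"
  by (auto simp: lmult_def pts_def)

lemma idrel_frel: "idrel G A \<in> frel G A"
  by (rule frelI) (auto simp: lmult_eq_iff)

lemma idrel_sub: "r \<in> frel G A \<Longrightarrow> idrel G A \<subseteq> r"
  using frelD(2) by auto

lemma eqvD: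
  assumes "f \<in> eqv G A B"
  shows "z \<in> pts G A \<Longrightarrow> f z \<in> pts G B"
    "g \<in> carrier G \<Longrightarrow> z \<in> pts G A \<Longrightarrow> f (lmult G g z) = lmult G g (f z)"
  using assms by (auto simp: eqv_def equivar_def)

lemma pull_frel:
  assumes f: "f \<in> eqv G A B" and r: "r \<in> frel G B"
  shows "pull G A f r \<in> frel G A"
proof (rule frelI)
  fix u v w assume "(u, v) \<in> pull G A f r" "(v, w) \<in> pull G A f r"
  then show "(u, w) \<in> pull G A f r" using frelD(4)[OF r] unfolding pull_def by blast
next
  fix g u v assume g: "g \<in> carrier G" and uv: "(u, v) \<in> pull G A f r"
  then have "(lmult G g (f u), lmult G g (f v)) \<in> r" "u \<in> pts G A" "v \<in> pts G A"
    using frelD(5)[OF r g] unfolding pull_def by blast+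
  then show "(lmult G g u, lmult G g v) \<in> pull G A f r"
    using g eqvD(2)[OF f g, of u] eqvD(2)[OF f g, of v] lmult_pts[of g u] lmult_pts[of g v]
    by (simp add: pull_def)
next
  fix g z assume g: "g \<in> carrier G" and z: "z \<in> pts G A" "(z, lmult G g z) \<in> pull G A f r"
  then have "(f z, lmult G g (f z)) \<in> r" using eqvD(2)[OF f g z(1)] by (simp add: pull_def)
  then show "g = \<one>" using frelD(6)[OF r g eqvD(1)[OF f z(1)]] by simp
next
  fix u v assume "(u, v) \<in> pull G A f r"
  then show "(v, u) \<in> pull G A f r" using frelD(3)[OF r] unfolding pull_def by blast
next
  fix z assume "z \<in> pts G A"
  then show "(z, z) \<in> pull G A f r" using frelD(2)[OF r] eqvD(1)[OF f] unfolding pull_def by blast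
qed (auto simp: pull_def)

lemma esurjD: "f \<in> esurj G A B \<Longrightarrow> f \<in> eqv G A B" "f \<in> esurj G A B \<Longrightarrow> f ` pts G A = pts G B"
  by (auto simp: esurj_def)

lemma pull_mono_iff:
  assumes f: "f \<in> esurj G A B" and r: "r \<in> frel G B"
  shows "pull G A f r \<subseteq> pull G A f s \<longleftrightarrow> r \<subseteq> s"
proof
  assume *: "pull G A f r \<subseteq> pull G A f s"
  show "r \<subseteq> s"
  proof clarify
    fix a m b n assume uv: "((a, m), (b, n)) \<in> r"
    then have "(a, m) \<in> f ` pts G A" "(b, n) \<in> f ` pts G A"
      using frelD(1)[OF r] esurjD(2)[OF f] by auto
    then obtain u v where "u \<in> pts G A" "v \<in> pts G A" "(a, m) = f u" "(b, n) = f v" by blast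
    with * uv show "((a, m), (b, n)) \<in> s" by (auto simp: pull_def)
  qed
qed (auto simp: pull_def)

text \<open>A relation containing the kernel of \<open>f\<close> is saturated with respect to the
  fibres of \<open>f\<close>, so it can be recovered from its image under
  \<open>map_prod f f\<close>.\<close>

lemma pull_surj:
  assumes f: "f \<in> esurj G A B" and r: "r \<in> frel G A" and ker: "pull G A f (idrel G B) \<subseteq> r"
  obtains s where "s \<in> frel G B" "r = pull G A f s"
proof
  note fe = eqvD[OF esurjD(1)[OF f]]
  have k: "(u, v) \<in> r" if "u \<in> pts G A" "v \<in> pts G A" "f u = f v" for u v
  proof -
    have "(f u, f v) \<in> idrel G B" using that fe(1)[of u] by (simp add: Id_onI)
    then have "(u, v) \<in> pull G A f (idrel G B)" using that(1,2) by (simp add: pull_def)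
    then show ?thesis using ker by (rule subsetD[rotated])
  qed
  let ?s = "map_prod f f ` r"
  have s: "(f u, f v) \<in> ?s \<longleftrightarrow> (u, v) \<in> r" if uv: "u \<in> pts G A" "v \<in> pts G A" for u v
  proof
    assume "(f u, f v) \<in> ?s"
    then obtain u' v' where uv': "(u', v') \<in> r" "f u = f u'" "f v = f v'" by auto
    then have "u' \<in> pts G A" "v' \<in> pts G A" using frelD(1)[OF r] by auto
    with uv' uv have "(u, u') \<in> r" "(v', v) \<in> r" using k by auto
    with uv'(1) show "(u, v) \<in> r" using frelD(4)[OF r] by blast
  qed auto
  have lift: "\<exists>u v. u \<in> pts G A \<and> v \<in> pts G A \<and> x = f u \<and> y = f v \<and> (u, v) \<in> r" if "(x, y) \<in> ?s" for x y
  proof -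
    obtain u v where "(u, v) \<in> r" "x = f u" "y = f v" using \<open>(x, y) \<in> ?s\<close> by auto
    then show ?thesis using frelD(1)[OF r] by blast
  qed
  have liftp: "\<exists>u \<in> pts G A. x = f u" if "x \<in> pts G B" for x
    using that esurjD(2)[OF f] by blast
  show "?s \<in> frel G B"
  proof (rule frelI)
    show "?s \<subseteq> pts G B \<times> pts G B" using frelD(1)[OF r] fe(1) by auto
    fix z assume "z \<in> pts G B"
    then show "(z, z) \<in> ?s" using liftp[of z] s frelD(2)[OF r] by auto
  next
    fix x y assume "(x, y) \<in> ?s"
    then show "(y, x) \<in> ?s" using lift[of x y] s frelD(3)[OF r] by auto
  next
    fix x y z assume xy: "(x, y) \<in> ?s" and yz: "(y, z) \<in> ?s"
    obtain u v where u: "u \<in> pts G A" "v \<in> pts G A" "x = f u" "y = f v" "(u, v) \<in> r"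
      using lift[OF xy] by blast
    obtain w where w: "w \<in> pts G A" "z = f w" using lift[OF yz] by blast
    have "(v, w) \<in> r" using yz s u w by auto
    then show "(x, z) \<in> ?s" using s u w frelD(4)[OF r] by auto
  next
    fix g x y assume g: "g \<in> carrier G" and xy: "(x, y) \<in> ?s"
    obtain u v where u: "u \<in> pts G A" "v \<in> pts G A" "x = f u" "y = f v" "(u, v) \<in> r"
      using lift[OF xy] by blast
    have "(f (lmult G g u), f (lmult G g v)) \<in> ?s"
      using frelD(5)[OF r g u(5)] by auto
    then show "(lmult G g x, lmult G g y) \<in> ?s" using u g fe(2) by simp
  next
    fix g z assume g: "g \<in> carrier G" and z: "z \<in> pts G B" "(z, lmult G g z) \<in> ?s"
    obtain u where u: "u \<in> pts G A" "z = f u" using liftp[OF z(1)] by blast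
    then have "(f u, f (lmult G g u)) \<in> ?s" using z(2) fe(2)[OF g u(1)] by simp
    then have "(u, lmult G g u) \<in> r" by (rule iffD1[OF s[OF u(1) lmult_pts[OF g u(1)]]])
    then show "g = \<one>" using frelD(6)[OF r g u(1)] by simp
  qed
  show "r = pull G A f ?s"
  proof (rule Set.set_eqI)
    fix w :: "('a \<times> nat) \<times> ('a \<times> nat)" obtain u v where w: "w = (u, v)" by (cases w)
    show "w \<in> r \<longleftrightarrow> w \<in> pull G A f ?s"
    proof (cases "u \<in> pts G A \<and> v \<in> pts G A")
      case True
      then show ?thesis unfolding w pull_def mem_Collect_eq case_prod_conv mem_Sigma_iff
        using s[of u v] by (simp only: simp_thms)
    next
      case False
      then show ?thesis using frelD(1)[OF r] unfolding w pull_def by blast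
    qed
  qed
qed

abbreviation ker where "ker A B f \<equiv> pull G A f (idrel G B)"

lemma ker_iff: "f \<in> eqv G A B \<Longrightarrow> (u, v) \<in> ker A B f \<longleftrightarrow> u \<in> pts G A \<and> v \<in> pts G A \<and> f u = f v"
  using eqvD(1)[of f A B v] by (auto simp: pull_def Id_on_iff simp del: split_paired_All)

text \<open>The bottom \<open>idrel G B\<close> corresponds to the kernel of \<open>f\<close>. Links
  of atoms, lengths of chains and upper Moebius numbers are all reduced to smaller index sets in
  this way.\<close>

lemma pull_above:
  assumes f: "f \<in> esurj G A B"
  shows "(pull G A f) ` (frel G B - {idrel G B}) = {r \<in> frel G A. ker A B f \<subset> r}"
    and "inj_on (pull G A f) (frel G B)"
proof -
  show "inj_on (pull G A f) (frel G B)"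
    by (intro inj_onI) (metis f pull_mono_iff subset_antisym subset_refl)
  show "(pull G A f) ` (frel G B - {idrel G B}) = {r \<in> frel G A. ker A B f \<subset> r}" (is "?L = ?R")
  proof
    show "?L \<subseteq> ?R"
    proof clarify
      fix s assume s: "s \<in> frel G B" "s \<noteq> idrel G B"
      then have "idrel G B \<subset> s" using idrel_sub by blast
      then show "pull G A f s \<in> frel G A \<and> ker A B f \<subset> pull G A f s"
        using pull_frel[OF esurjD(1)[OF f] s(1)] pull_mono_iff[OF f s(1), of "idrel G B"]
          pull_mono_iff[OF f idrel_frel, of s] by auto
    qed
    show "?R \<subseteq> ?L"
    proof
      fix r assume r: "r \<in> ?R"
      then obtain s where "s \<in> frel G B" "r = pull G A f s"
        using pull_surj[OF f, of r] by blast
      then show "r \<in> ?L" using r by auto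
    qed
  qed
qed

section \<open>Merging two fibres and isolating one\<close>

lemma merge_simps:
  assumes "a \<in> A" "m \<in> A - {a}" "g \<in> carrier G"
  shows "z \<in> pts G (A - {a}) \<Longrightarrow> merge G A a m g z = z"
    "h \<in> carrier G \<Longrightarrow> merge G A a m g (h, a) = (h \<otimes> g, m)"
  using assms by (auto simp: merge_def pts_def)

lemma merge_esurj:
  assumes "a \<in> A" "m \<in> A - {a}" "g \<in> carrier G"
  shows "merge G A a m g \<in> esurj G A (A - {a})"
proof -
  have "merge G A a m g \<in> pts G A \<rightarrow>\<^sub>E pts G (A - {a})"
    using assms by (auto simp: merge_def pts_def)
  moreover have "equivar G A (merge G A a m g)"
    using assms by (auto simp: equivar_def merge_def pts_def lmult_def m_assoc)
  moreover have "z \<in> merge G A a m g ` pts G A" if "z \<in> pts G (A - {a})" for z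
    using merge_simps(1)[OF assms that] that pts_mono[of "A - {a}" A] by (metis Diff_subset image_eqI subsetD)
  ultimately show ?thesis unfolding esurj_def eqv_def by blast
qed

lemma restrict_frel:
  assumes "q \<in> frel G A" "B \<subseteq> A"
  shows "q \<inter> pts G B \<times> pts G B \<in> frel G B"
proof (rule frelI)
  fix u v w assume "(u, v) \<in> q \<inter> pts G B \<times> pts G B" "(v, w) \<in> q \<inter> pts G B \<times> pts G B"
  then show "(u, w) \<in> q \<inter> pts G B \<times> pts G B" using frelD(4)[OF assms(1)] by blast
next
  fix u v assume "(u, v) \<in> q \<inter> pts G B \<times> pts G B"
  then show "(v, u) \<in> q \<inter> pts G B \<times> pts G B" using frelD(3)[OF assms(1)] by blast
next
  fix g u v assume "g \<in> carrier G" "(u, v) \<in> q \<inter> pts G B \<times> pts G B"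
  then show "(lmult G g u, lmult G g v) \<in> q \<inter> pts G B \<times> pts G B"
    using frelD(5)[OF assms(1)] lmult_pts by blast
next
  fix z assume "z \<in> pts G B"
  then show "(z, z) \<in> q \<inter> pts G B \<times> pts G B"
    using frelD(2)[OF assms(1)] pts_mono[OF assms(2)] by blast
next
  fix g z assume "g \<in> carrier G" "z \<in> pts G B" "(z, lmult G g z) \<in> q \<inter> pts G B \<times> pts G B"
  then show "g = \<one>" using frelD(6)[OF assms(1)] pts_mono[OF assms(2)] by blast
qed auto

lemma isolate_frel:
  assumes "q \<in> frel G A"
  shows "isolate G A a q \<in> frel G A"
proof -
  let ?B = "pts G (A - {a})"
  have BA: "?B \<subseteq> pts G A" by (rule pts_mono) auto
  have mem: "(u, v) \<in> isolate G A a q \<longleftrightarrow> (u, v) \<in> q \<and> (u \<in> ?B \<and> v \<in> ?B \<or> u = v)" for u v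
    using frelD(1)[OF assms] frelD(2)[OF assms, of v] unfolding isolate_def by (auto simp: Id_on_iff)
  show ?thesis
  proof (rule frelI)
    fix u v w assume "(u, v) \<in> isolate G A a q" "(v, w) \<in> isolate G A a q"
    then show "(u, w) \<in> isolate G A a q" using frelD(4)[OF assms] unfolding mem by blast
  next
    fix u v assume "(u, v) \<in> isolate G A a q"
    then show "(v, u) \<in> isolate G A a q" using frelD(3)[OF assms] unfolding mem by blast
  next
    fix g u v assume "g \<in> carrier G" "(u, v) \<in> isolate G A a q"
    then show "(lmult G g u, lmult G g v) \<in> isolate G A a q"
      using frelD(5)[OF assms] lmult_pts unfolding mem by blast
  next
    fix g z assume "g \<in> carrier G" "z \<in> pts G A" "(z, lmult G g z) \<in> isolate G A a q"
    then show "g = \<one>" using frelD(6)[OF assms] unfolding mem by blast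
  next
    show "isolate G A a q \<subseteq> pts G A \<times> pts G A"
      using frelD(1)[OF assms] BA by (auto simp: isolate_def)
  qed (auto simp: isolate_def)
qed

lemma isolate_sub: "q \<in> frel G A \<Longrightarrow> isolate G A a q \<subseteq> q"
  using frelD(2) by (auto simp: isolate_def)

lemma isolate_isolate: "isolate G A a (isolate G A a q) = isolate G A a q"
  by (auto simp: isolate_def)

lemma isolate_mono: "p \<subseteq> q \<Longrightarrow> isolate G A a p \<subseteq> isolate G A a q"
  by (auto simp: isolate_def)

lemma merge_rel:
  assumes "a \<in> A" "m \<in> A - {a}" "g \<in> carrier G" "q \<in> frel G A" "((\<one>, a), (g, m)) \<in> q" "z \<in> pts G A"
  shows "(z, merge G A a m g z) \<in> q"
proof (cases "snd z = a")
  case True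
  then obtain h where h: "z = (h, a)" "h \<in> carrier G" using assms(6) by (auto simp: pts_def)
  have "(lmult G h (\<one>, a), lmult G h (g, m)) \<in> q"
    by (rule frelD(5)[OF assms(4) h(2) assms(5)])
  then show ?thesis using h merge_simps(2)[OF assms(1-3)] by (simp add: lmult_def)
next
  case False
  then have "z \<in> pts G (A - {a})" using assms(6) by (auto simp: pts_def)
  then show ?thesis using merge_simps(1)[OF assms(1-3)] frelD(2)[OF assms(4,6)] by simp
qed

text \<open>Together with \<open>atom_in_ker\<close> this makes the kernel of a merge map the least
  relation that relates (1, a) to (g, m).\<close>

lemma ker_merge_sub:
  assumes "a \<in> A" "m \<in> A - {a}" "g \<in> carrier G" "q \<in> frel G A" "((\<one>, a), (g, m)) \<in> q"
  shows "ker A (A - {a}) (merge G A a m g) \<subseteq> q"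
proof clarify
  fix h k i j assume uv: "((h, i), (k, j)) \<in> ker A (A - {a}) (merge G A a m g)"
  let ?f = "merge G A a m g"
  have "(h, i) \<in> pts G A" "(k, j) \<in> pts G A" "?f (h, i) = ?f (k, j)"
    using uv by (auto simp: ker_iff[OF esurjD(1)[OF merge_esurj[OF assms(1-3)]]])
  with merge_rel[OF assms] show "((h, i), (k, j)) \<in> q"
    using frelD(3,4)[OF assms(4)] by metis
qed

lemma atom_in_ker:
  assumes "a \<in> A" "m \<in> A - {a}" "g \<in> carrier G"
  shows "((\<one>, a), (g, m)) \<in> ker A (A - {a}) (merge G A a m g)"
  using assms merge_simps[OF assms]
  by (subst ker_iff[OF esurjD(1)[OF merge_esurj[OF assms]]]) (auto simp: pts_def)

text \<open>Translation moves the first point of a related pair to the unit element, and freeness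
  forbids two distinct related points in one fibre, so that \<open>m\<close> differs from
  \<open>a\<close>.\<close>

lemma nontrivial_rel:
  assumes q: "q \<in> frel G A" "q \<noteq> idrel G A"
  obtains a m g where "a \<in> A" "m \<in> A - {a}" "g \<in> carrier G" "((\<one>, a), (g, m)) \<in> q"
proof -
  obtain h a k m where uv: "((h, a), (k, m)) \<in> q" "(h, a) \<noteq> (k, m)"
  proof -
    obtain u v where "(u, v) \<in> q" "(u, v) \<notin> idrel G A"
      using idrel_sub[OF q(1)] q(2) by auto
    moreover from this have "u \<in> pts G A" using frelD(1)[OF q(1)] by auto
    ultimately have "u \<noteq> v" by auto
    with \<open>(u, v) \<in> q\<close> that[of "fst u" "snd u" "fst v" "snd v"] show thesis by simp
  qed
  then have p: "h \<in> carrier G" "a \<in> A" "k \<in> carrier G" "m \<in> A"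
    using frelD(1)[OF q(1)] by (auto simp: pts_def)
  have e: "((\<one>, a), (inv h \<otimes> k, m)) \<in> q"
    using frelD(5)[OF q(1) inv_closed[OF p(1)] uv(1)] p by (simp add: lmult_def)
  have "m \<noteq> a"
  proof
    assume "m = a"
    then have "((\<one>, a), lmult G (inv h \<otimes> k) (\<one>, a)) \<in> q" using e p by (simp add: lmult_def)
    then have "inv h \<otimes> k = \<one>"
      using frelD(6)[OF q(1), of "inv h \<otimes> k" "(\<one>, a)"] p by (auto simp: pts_def)
    then have "h = k" using p by (metis inv_closed inv_equality inv_inv)
    with uv \<open>m = a\<close> show False by simp
  qed
  with e p show thesis by (intro that[of a m "inv h \<otimes> k"]) auto
qed

text \<open>The merge map moves both ends of a related pair off the fibre over \<open>a\<close>
  within their class, and away from that fibre \<open>q\<close> is trivial by assumption.\<close>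

lemma atom_eq_ker:
  assumes "a \<in> A" "m \<in> A - {a}" "g \<in> carrier G" "q \<in> frel G A" "((\<one>, a), (g, m)) \<in> q"
    and "isolate G A a q = idrel G A"
  shows "q = ker A (A - {a}) (merge G A a m g)"
proof
  let ?f = "merge G A a m g"
  have e: "?f \<in> eqv G A (A - {a})" using esurjD(1)[OF merge_esurj[OF assms(1-3)]] .
  show "q \<subseteq> ker A (A - {a}) ?f"
  proof clarify
    fix h i k j assume uv: "((h, i), (k, j)) \<in> q"
    then have p: "(h, i) \<in> pts G A" "(k, j) \<in> pts G A" using frelD(1)[OF assms(4)] by auto
    have "(?f (h, i), ?f (k, j)) \<in> q"
      using merge_rel[OF assms(1-5) p(1)] merge_rel[OF assms(1-5) p(2)] uv frelD(3,4)[OF assms(4)] by blast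
    moreover have "?f (h, i) \<in> pts G (A - {a})" "?f (k, j) \<in> pts G (A - {a})"
      using eqvD(1)[OF e] p by auto
    ultimately have "(?f (h, i), ?f (k, j)) \<in> isolate G A a q" by (auto simp: isolate_def)
    then show "((h, i), (k, j)) \<in> ker A (A - {a}) ?f"
      using p by (auto simp: assms(6) ker_iff[OF e])
  qed
qed (rule ker_merge_sub[OF assms(1-5)])

text \<open>A nontrivial pair avoiding \<open>a\<close> would survive isolation; a pair that ends in
  the fibre over \<open>a\<close> is reversed and translated back.\<close>

lemma isolate_atom:
  assumes q: "q \<in> frel G A" "q \<noteq> idrel G A" "isolate G A a q = idrel G A" and "a \<in> A"
  obtains m g where "m \<in> A - {a}" "g \<in> carrier G" "((\<one>, a), (g, m)) \<in> q"
proof -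
  obtain b m g where b: "b \<in> A" "m \<in> A - {b}" "g \<in> carrier G" "((\<one>, b), (g, m)) \<in> q"
    using nontrivial_rel[OF q(1,2)] .
  consider "b = a" | "b \<noteq> a" "m = a" | "b \<noteq> a" "m \<noteq> a" by blast
  then show thesis
  proof cases
    case 1
    with b show thesis by (intro that[of m g]) auto
  next
    case 2
    have "((g, m), (\<one>, b)) \<in> q" using frelD(3)[OF q(1) b(4)] .
    then have "(lmult G (inv g) (g, m), lmult G (inv g) (\<one>, b)) \<in> q"
      using frelD(5)[OF q(1)] b by auto
    with 2 b show thesis by (intro that[of b "inv g"]) (auto simp: lmult_def)
  next
    case 3
    with b have "((\<one>, b), (g, m)) \<in> isolate G A a q" by (auto simp: isolate_def pts_def)
    then show thesis using b(2) by (auto simp: q(3))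
  qed
qed

end

section \<open>Vanishing of the homology below the top degree\<close>

lemma finite_proper_acyclic: "acyclic finite_psubset" "acyclic (finite_psubset\<inverse>)"
  using wf_acyclic[OF wf_finite_psubset] by (simp_all add: acyclic_converse)

lemma finite_chain_min:
  "finite C \<Longrightarrow> C \<noteq> {} \<Longrightarrow> (\<And>a b. a \<in> C \<Longrightarrow> b \<in> C \<Longrightarrow> a \<subseteq> b \<or> b \<subseteq> a) \<Longrightarrow> \<exists>m\<in>C. \<forall>b\<in>C. m \<subseteq> b"
proof (induction C rule: finite_ne_induct)
  case (insert x F)
  then obtain m where m: "m \<in> F" "\<forall>b\<in>F. m \<subseteq> b" by blast
  show ?case
  proof (cases "x \<subseteq> m")
    case True
    then show ?thesis using m by (intro bexI[of _ x]) auto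
  next
    case False
    then have "m \<subseteq> x" using insert.prems[of x m] m(1) by blast
    then show ?thesis using m by (intro bexI[of _ m]) auto
  qed
qed auto

context fgroup
begin

lemma pts_empty [simp]: "pts G {} = {}"
  by (simp add: pts_def)

text \<open>The relations above a fixed atom \<alpha> form a cone. The others are added in three
  batches: \<open>X1\<close>, where \<open>a\<close> is isolated, from small to large;
  \<open>X2\<close>, where isolating \<open>a\<close> changes the relation but leaves something
  nontrivial, from large to small; and \<open>X3\<close>, the atoms involving \<open>a\<close> other
  than \<alpha>. All links are cones, except in \<open>X3\<close>, where the link is an upper
  interval to which \<open>IH\<close> applies.\<close>

lemma frel_insert_cc:
  assumes fin: "finite A" and a: "a \<in> A" and b: "b \<in> A - {a}"
    and IH: "cc (\<subseteq>) (frel G (A - {a}) - {idrel G (A - {a})}) d"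
  shows "cc (\<subseteq>) (frel G A - {idrel G A}) (Suc d)"
proof -
  let ?B = "A - {a}"
  define f where "f = merge G A a b \<one>"
  define \<alpha> where "\<alpha> = ker A ?B f"
  have bb: "a \<in> A" "b \<in> ?B" "\<one> \<in> carrier G" using a b by auto
  note fs = merge_esurj[OF bb, folded f_def]
  note fe = esurjD(1)[OF fs]
  have at: "((\<one>, a), (\<one>, b)) \<in> \<alpha>" using atom_in_ker[OF bb] by (simp add: \<alpha>_def f_def)
  \<comment> \<open>\<alpha> relates a point over \<open>a\<close> to a point over \<open>b\<close>,
    which no isolated relation does.\<close>
  have not_iso: "\<not> \<alpha> \<subseteq> isolate G A a q" for q
  proof
    assume "\<alpha> \<subseteq> isolate G A a q"
    then have "((\<one>, a), (\<one>, b)) \<in> isolate G A a q" using at by blast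
    then show False using b by (auto simp: isolate_def pts_def)
  qed
  have \<alpha>: "\<alpha> \<in> frel G A" unfolding \<alpha>_def by (rule pull_frel[OF fe idrel_frel])
  define X0 where "X0 = {q \<in> frel G A. \<alpha> \<subseteq> q}"
  define X1 where "X1 = {q \<in> frel G A. q = isolate G A a q \<and> q \<noteq> idrel G A}"
  define X2 where "X2 = {q \<in> frel G A. \<not> \<alpha> \<subseteq> q \<and> q \<noteq> isolate G A a q \<and> isolate G A a q \<noteq> idrel G A}"
  define X3 where "X3 = {q \<in> frel G A. \<not> \<alpha> \<subseteq> q \<and> q \<noteq> idrel G A \<and> isolate G A a q = idrel G A}"
  have finX: "finite X1" "finite X2" "finite X3"
    using finite_frel[OF fin] by (auto simp: X1_def X2_def X3_def)
  have subs: "X0 \<subseteq> frel G A" "X1 \<subseteq> frel G A" "X2 \<subseteq> frel G A" "X3 \<subseteq> frel G A"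
    by (auto simp: X0_def X1_def X2_def X3_def)
  have psub: "(p, q) \<in> finite_psubset \<longleftrightarrow> p \<subset> q" if "q \<in> frel G A" for p q
    using finite_frel_elem[OF fin that] by (simp add: finite_psubset_def)
  have c0: "cc (\<subseteq>) X0 (Suc d)"
    by (rule cc_apex[of \<alpha>]) (auto simp: X0_def \<alpha>)
  \<comment> \<open>The order is increasing, so the elements of the link above \<open>p\<close> lie
    in \<open>X0\<close> and hence above the join of \<open>p\<close> and \<alpha>, which serves as
    apex.\<close>
  have c1: "cc (\<subseteq>) (X0 \<union> X1) (Suc d)"
  proof (rule cc_union[OF finX(1) finite_proper_acyclic(1) c0])
    show "X0 \<inter> X1 = {}" using not_iso by (auto simp: X0_def X1_def)
    fix p Y assume p: "p \<in> X1" and Y: "Y \<subseteq> X1 - {p}" and "\<And>y'. y' \<in> Y \<Longrightarrow> (p, y') \<notin> finite_psubset"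
    then have Ymin: "\<not> p \<subset> y" if "y \<in> Y" for y using psub subs that by blast
    have pf: "p \<in> frel G A" "p = isolate G A a p" using p by (auto simp: X1_def)
    \<comment> \<open>\<open>s\<close> is this join: restrict \<open>p\<close> to the indices other
      than \<open>a\<close>, then pull back along the merge map, which puts (1, a) into the class of
      (1, b).\<close>
    define s where "s = pull G A f (p \<inter> pts G ?B \<times> pts G ?B)"
    have r: "p \<inter> pts G ?B \<times> pts G ?B \<in> frel G ?B" by (rule restrict_frel[OF pf(1)]) auto
    have s: "s \<in> frel G A" unfolding s_def by (rule pull_frel[OF fe r])
    have \<alpha>s: "\<alpha> \<subseteq> s" unfolding s_def \<alpha>_def by (subst pull_mono_iff[OF fs idrel_frel]) (rule idrel_sub[OF r])
    have fid: "f z = z" if "z \<in> pts G ?B" for z using merge_simps(1)[OF bb that] by (simp add: f_def)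
    have ps: "p \<subset> s"
    proof
      show "p \<subseteq> s"
      proof
        fix w assume w: "w \<in> p"
        then have "w \<in> isolate G A a p" using pf(2) by simp
        then consider "w \<in> pts G ?B \<times> pts G ?B" | "w \<in> idrel G A" unfolding isolate_def by blast
        then show "w \<in> s"
        proof cases
          case 1
          then obtain u v where "w = (u, v)" "u \<in> pts G ?B" "v \<in> pts G ?B" by blast
          then show ?thesis using w fid pts_mono[of ?B A] unfolding s_def pull_def by auto
        next
          case 2
          then show ?thesis using idrel_sub[OF s] by blast
        qed
      qed
      show "p \<noteq> s" using \<alpha>s not_iso[of p] pf(2) by metis
    qed
    show "cc (\<subseteq>) (link (\<subseteq>) (X0 \<union> Y) p) d"
    proof (rule cc_apex[of s])
      show "s \<in> link (\<subseteq>) (X0 \<union> Y) p" using s \<alpha>s ps by (auto simp: link_def X0_def)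
      fix c assume "c \<in> link (\<subseteq>) (X0 \<union> Y) p"
      then have c: "c \<in> X0 \<union> Y" "c \<noteq> p" "c \<subseteq> p \<or> p \<subseteq> c" by (auto simp: link_def)
      show "c \<subseteq> s \<or> s \<subseteq> c"
      proof (cases "c \<subseteq> p")
        case True
        then show ?thesis using ps by blast
      next
        case False
        then have pc: "p \<subset> c" using c by blast
        then have cX: "c \<in> frel G A" "\<alpha> \<subseteq> c" using c Ymin by (auto simp: X0_def)
        have ff: "(z, f z) \<in> c" if "z \<in> pts G A" for z
          using merge_rel[OF bb cX(1) _ that] at cX(2) by (auto simp: f_def)
        have "s \<subseteq> c"
        proof
          fix w assume "w \<in> s"
          then obtain u v where w: "w = (u, v)" "u \<in> pts G A" "v \<in> pts G A" "(f u, f v) \<in> p"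
            unfolding s_def pull_def by blast
          then have "(f u, f v) \<in> c" using pc by blast
          then have "(u, f v) \<in> c" using frelD(4)[OF cX(1) ff[OF w(2)]] by blast
          moreover have "(f v, v) \<in> c" using frelD(3)[OF cX(1) ff[OF w(3)]] .
          ultimately show "w \<in> c" using frelD(4)[OF cX(1)] w(1) by blast
        qed
        then show ?thesis ..
      qed
    qed
  qed
  \<comment> \<open>The order is decreasing, so the elements of the link below \<open>q\<close> lie
    in \<open>X1\<close> and hence below the isolation of \<open>q\<close>, which serves as
    apex.\<close>
  have c2: "cc (\<subseteq>) (X0 \<union> X1 \<union> X2) (Suc d)"
  proof (rule cc_union[OF finX(2) finite_proper_acyclic(2) c1])
    show "(X0 \<union> X1) \<inter> X2 = {}" by (auto simp: X0_def X1_def X2_def)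
    fix q Y assume q: "q \<in> X2" and Y: "Y \<subseteq> X2 - {q}" and "\<And>y'. y' \<in> Y \<Longrightarrow> (q, y') \<notin> finite_psubset\<inverse>"
    then have Ymax: "\<not> y \<subset> q" if "y \<in> Y" for y using psub subs that by blast
    have qf: "q \<in> frel G A" "\<not> \<alpha> \<subseteq> q" "q \<noteq> isolate G A a q" "isolate G A a q \<noteq> idrel G A"
      using q by (auto simp: X2_def)
    let ?i = "isolate G A a q"
    show "cc (\<subseteq>) (link (\<subseteq>) (X0 \<union> X1 \<union> Y) q) d"
    proof (rule cc_apex[of ?i])
      show "?i \<in> link (\<subseteq>) (X0 \<union> X1 \<union> Y) q"
        using qf isolate_frel[OF qf(1)] isolate_sub[OF qf(1)] isolate_isolate[of A a q]
        by (auto simp: link_def X1_def)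
      fix c assume "c \<in> link (\<subseteq>) (X0 \<union> X1 \<union> Y) q"
      then have c: "c \<in> X0 \<union> X1 \<union> Y" "c \<noteq> q" "c \<subseteq> q \<or> q \<subseteq> c" by (auto simp: link_def)
      show "c \<subseteq> ?i \<or> ?i \<subseteq> c"
      proof (cases "c \<subseteq> q")
        case True
        then have "c \<in> X1" using c Ymax qf(2) by (auto simp: X0_def)
        then have "c = isolate G A a c" by (simp add: X1_def)
        then have "c \<subseteq> ?i" using isolate_mono[OF True, of A a] by simp
        then show ?thesis ..
      next
        case False
        then have "q \<subseteq> c" using c(3) by blast
        then show ?thesis using isolate_sub[OF qf(1), of a] by blast
      qed
    qed
  qed
  \<comment> \<open>By \<open>atom_eq_ker\<close> the members of \<open>X3\<close> are kernels of
    merge maps, so they form an antichain.\<close>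
  have uniq: "c = q" if c: "c \<in> X3" and q: "q \<in> X3" and sub: "c \<subseteq> q" for c q
  proof -
    have cf: "c \<in> frel G A" "c \<noteq> idrel G A" "isolate G A a c = idrel G A"
      and qf: "q \<in> frel G A" "isolate G A a q = idrel G A" using c q by (auto simp: X3_def)
    obtain m g where mg: "m \<in> A - {a}" "g \<in> carrier G" "((\<one>, a), (g, m)) \<in> c"
      using isolate_atom[OF cf a] .
    have "((\<one>, a), (g, m)) \<in> q" using mg(3) sub by blast
    from atom_eq_ker[OF a mg(1,2) cf(1) mg(3) cf(3)] atom_eq_ker[OF a mg(1,2) qf(1) this qf(2)]
    show ?thesis by simp
  qed
  have all: "X0 \<union> X1 \<union> X2 \<union> X3 = frel G A - {idrel G A}"
  proof -
    have "idrel G A \<notin> X0" using not_iso[of "{}"] by (auto simp: X0_def isolate_def)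
    moreover have "isolate G A a (idrel G A) = idrel G A"
      using isolate_sub[OF idrel_frel] idrel_sub[OF isolate_frel[OF idrel_frel]] by blast
    ultimately have mem: "q \<in> X0 \<union> X1 \<union> X2 \<union> X3 \<longleftrightarrow> q \<in> frel G A - {idrel G A}" for q
      unfolding X0_def X1_def X2_def X3_def by (cases "q = idrel G A") auto
    show ?thesis by (rule Set.set_eqI) (rule mem)
  qed
  have "cc (\<subseteq>) (X0 \<union> X1 \<union> X2 \<union> X3) (Suc d)"
  proof (rule cc_union[OF finX(3) finite_proper_acyclic(2) c2])
    show "(X0 \<union> X1 \<union> X2) \<inter> X3 = {}" by (auto simp: X0_def X1_def X2_def X3_def)
    fix q Y assume q: "q \<in> X3" and Y: "Y \<subseteq> X3 - {q}"
    have qf: "q \<in> frel G A" "\<not> \<alpha> \<subseteq> q" "q \<noteq> idrel G A" "isolate G A a q = idrel G A"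
      using q by (auto simp: X3_def)
    obtain m g where mg: "m \<in> A - {a}" "g \<in> carrier G" "((\<one>, a), (g, m)) \<in> q"
      using isolate_atom[OF qf(1,3,4) a] .
    define h where "h = merge G A a m g"
    have qh: "q = ker A ?B h" unfolding h_def by (rule atom_eq_ker[OF a mg(1,2) qf(1) mg(3) qf(4)])
    have hs: "h \<in> esurj G A ?B" unfolding h_def by (rule merge_esurj[OF a mg(1,2)])
    \<comment> \<open>Nothing nontrivial lies strictly below the atom \<open>q\<close>, and every
      relation strictly above it is already present.\<close>
    have "link (\<subseteq>) (X0 \<union> X1 \<union> X2 \<union> Y) q = {c \<in> frel G A. q \<subset> c}"
    proof (intro subset_antisym subsetI)
      fix c assume "c \<in> link (\<subseteq>) (X0 \<union> X1 \<union> X2 \<union> Y) q"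
      then have c: "c \<in> X0 \<union> X1 \<union> X2 \<union> Y" "c \<noteq> q" "c \<subseteq> q \<or> q \<subseteq> c" by (auto simp: link_def)
      have cf: "c \<in> frel G A" "c \<noteq> idrel G A" using c(1) Y subs all by auto
      have "\<not> c \<subseteq> q"
      proof
        assume cq: "c \<subseteq> q"
        have "isolate G A a c \<subseteq> idrel G A" using isolate_mono[OF cq, of A a] qf(4) by simp
        then have i: "isolate G A a c = idrel G A" using idrel_sub[OF isolate_frel[OF cf(1)]] by blast
        have "\<not> \<alpha> \<subseteq> c" using cq qf(2) by blast
        then have "c \<in> X3" using i cf by (simp add: X3_def)
        then show False using uniq[OF _ q cq] c(2) by blast
      qed
      then show "c \<in> {c \<in> frel G A. q \<subset> c}" using c cf by auto
    next
      fix c assume "c \<in> {c \<in> frel G A. q \<subset> c}"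
      then have c: "c \<in> frel G A" "q \<subset> c" by auto
      then have "c \<noteq> idrel G A" using idrel_sub[OF qf(1)] by blast
      then have "c \<in> X0 \<union> X1 \<union> X2 \<union> X3" using c all by auto
      moreover have "c \<notin> X3" using uniq[OF q, of c] c(2) by blast
      ultimately show "c \<in> link (\<subseteq>) (X0 \<union> X1 \<union> X2 \<union> Y) q" using c by (auto simp: link_def)
    qed
    also have "\<dots> = pull G A h ` (frel G ?B - {idrel G ?B})"
      unfolding qh by (rule pull_above(1)[OF hs, symmetric])
    finally have l: "link (\<subseteq>) (X0 \<union> X1 \<union> X2 \<union> Y) q = pull G A h ` (frel G ?B - {idrel G ?B})" .
    show "cc (\<subseteq>) (link (\<subseteq>) (X0 \<union> X1 \<union> X2 \<union> Y) q) d"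
      unfolding l
    proof (rule cc_image[OF IH])
      show "inj_on (pull G A h) (frel G ?B - {idrel G ?B})"
        using inj_on_subset[OF pull_above(2)[OF hs]] by blast
      show "pull G A h s \<subseteq> pull G A h t \<longleftrightarrow> s \<subseteq> t" if "s \<in> frel G ?B - {idrel G ?B}" for s t
        using pull_mono_iff[OF hs] that by blast
    qed
  qed
  then show ?thesis unfolding all .
qed

lemma frel_cc: "finite A \<Longrightarrow> cc (\<subseteq>) (frel G A - {idrel G A}) (card A - 1)"
proof (induction "card A" arbitrary: A)
  case 0
  then show ?case by (simp add: cc_0)
next
  case (Suc n)
  show ?case
  proof (cases n)
    case 0
    then show ?thesis using Suc.hyps(2) by (simp add: cc_0 flip: Suc.hyps(2))
  next
    case (Suc m)
    then have "card A = Suc (Suc m)" using Suc.hyps(2) by simp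
    then obtain a b where ab: "a \<in> A" "b \<in> A - {a}"
      by (metis card_Suc_eq Diff_iff insert_iff singletonD)
    have c: "n = card (A - {a})" using Suc.hyps(2) ab by simp
    have m: "m = card (A - {a}) - 1" using c Suc by simp
    have "cc (\<subseteq>) (frel G (A - {a}) - {idrel G (A - {a})}) m"
      unfolding m by (rule Suc.hyps(1)[OF c]) (use Suc.prems in auto)
    from frel_insert_cc[OF Suc.prems ab this] show ?thesis using \<open>card A = Suc (Suc m)\<close> by simp
  qed
qed

section \<open>Standard quotients and the length of chains\<close>

lemma compose_esurj:
  assumes f: "f \<in> esurj G A B" and h: "h \<in> esurj G B C"
  shows "compose (pts G A) h f \<in> esurj G A C" "pull G A f (ker B C h) = ker A C (compose (pts G A) h f)"
proof -
  note fe = eqvD[OF esurjD(1)[OF f]] and he = eqvD[OF esurjD(1)[OF h]]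
  have "compose (pts G A) h f \<in> eqv G A C"
    unfolding eqv_def equivar_def
  proof (intro CollectI conjI ballI)
    show "compose (pts G A) h f \<in> pts G A \<rightarrow>\<^sub>E pts G C"
      by (intro PiE_I) (simp_all add: compose_def fe(1) he(1) del: split_paired_All)
    fix g z assume "g \<in> carrier G" "z \<in> pts G A"
    then show "compose (pts G A) h f (lmult G g z) = lmult G g (compose (pts G A) h f z)"
      using fe he by (simp add: compose_def)
  qed
  moreover have "compose (pts G A) h f ` pts G A = h ` (f ` pts G A)"
    by (auto simp: compose_def image_image)
  then have "compose (pts G A) h f ` pts G A = pts G C"
    using esurjD(2)[OF f] esurjD(2)[OF h] by simp
  ultimately show "compose (pts G A) h f \<in> esurj G A C" by (simp add: esurj_def)
  show "pull G A f (ker B C h) = ker A C (compose (pts G A) h f)"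
    using fe(1) by (auto simp: pull_def compose_def)
qed

lemma bij_esurj:
  assumes "bij_betw \<phi> A B"
  shows "(\<lambda>z\<in>pts G A. (fst z, \<phi> (snd z))) \<in> esurj G A B"
    "ker A B (\<lambda>z\<in>pts G A. (fst z, \<phi> (snd z))) = idrel G A"
proof -
  let ?f = "\<lambda>z\<in>pts G A. (fst z, \<phi> (snd z))"
  have e: "?f \<in> eqv G A B"
    using assms by (auto simp: eqv_def equivar_def pts_def lmult_def bij_betw_def)
  moreover have "?f ` pts G A = pts G B"
    using assms by (force simp: pts_def bij_betw_def image_iff)
  ultimately show "?f \<in> esurj G A B" by (simp add: esurj_def)
  have inj: "?f u = ?f v \<longleftrightarrow> u = v" if "u \<in> pts G A" "v \<in> pts G A" for u v
    using that assms by (auto simp: pts_def bij_betw_def inj_on_def)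
  show "ker A B ?f = idrel G A"
  proof (rule Set.set_eqI)
    fix w :: "('a \<times> nat) \<times> ('a \<times> nat)" obtain u v where w: "w = (u, v)" by (cases w)
    show "w \<in> ker A B ?f \<longleftrightarrow> w \<in> idrel G A"
      unfolding w ker_iff[OF e] Id_on_iff using inj[of u v] by blast
  qed
qed

text \<open>A nontrivial relation contains the kernel of a merge map, so indices can be removed one
  at a time until the relation is trivial; the survivors are then renumbered. The strict bound
  serves the induction on chains.\<close>

lemma frel_quotient:
  assumes "finite A" "r \<in> frel G A"
  shows "\<exists>k f. f \<in> esurj G A {1..k} \<and> r = ker A {1..k} f \<and> k \<le> card A \<and> (r \<noteq> idrel G A \<longrightarrow> k < card A)"
  using assms
proof (induction "card A" arbitrary: A r rule: less_induct)
  case less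
  show ?case
  proof (cases "r = idrel G A")
    case True
    obtain \<phi> where \<phi>: "bij_betw \<phi> A {1..card A}"
      using finite_same_card_bij[of A "{1..card A}"] less.prems(1) by auto
    show ?thesis
      using bij_esurj[OF \<phi>] True by (intro exI[of _ "card A"]) blast
  next
    case False
    obtain a m g where a: "a \<in> A" "m \<in> A - {a}" "g \<in> carrier G" "((\<one>, a), (g, m)) \<in> r"
      using nontrivial_rel[OF less.prems(2) False] .
    let ?B = "A - {a}" and ?f = "merge G A a m g"
    have f: "?f \<in> esurj G A ?B" by (rule merge_esurj[OF a(1-3)])
    obtain s where s: "s \<in> frel G ?B" "r = pull G A ?f s"
      using pull_surj[OF f less.prems(2) ker_merge_sub[OF a(1-3) less.prems(2) a(4)]] .
    have c: "card ?B < card A" using a less.prems(1) by (meson card_Diff1_less)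
    obtain k h where h: "h \<in> esurj G ?B {1..k}" "s = ker ?B {1..k} h" "k \<le> card ?B"
      using less.hyps[OF c _ s(1)] less.prems(1) by auto
    show ?thesis
      using compose_esurj[OF f h(1)] h s c
      by (intro exI[of _ k] exI[of _ "compose (pts G A) h ?f"]) auto
  qed
qed

text \<open>The least member of a chain is the kernel of a surjection onto fewer fibres, and the
  rest of the chain lives on that quotient.\<close>

lemma frel_chain_card:
  assumes "finite A" "A \<noteq> {}" "C \<subseteq> frel G A - {idrel G A}" "\<And>a b. a \<in> C \<Longrightarrow> b \<in> C \<Longrightarrow> a \<subseteq> b \<or> b \<subseteq> a"
  shows "card C < card A"
  using assms
proof (induction "card A" arbitrary: A C rule: less_induct)
  case less
  have finC: "finite C" using finite_subset[OF less.prems(3)] finite_frel[OF less.prems(1)] by simp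
  show ?case
  proof (cases "C = {}")
    case True
    then show ?thesis using less.prems by (simp add: card_gt_0_iff)
  next
    case False
    then obtain r where r: "r \<in> C" "\<And>b. b \<in> C \<Longrightarrow> r \<subseteq> b"
      using finite_chain_min[OF finC False less.prems(4)] by blast
    then have rf: "r \<in> frel G A" "r \<noteq> idrel G A" using less.prems(3) by auto
    obtain k f where f: "f \<in> esurj G A {1..k}" "r = ker A {1..k} f" "k < card A"
      using frel_quotient[OF less.prems(1) rf(1)] rf(2) by blast
    have "C - {r} \<subseteq> pull G A f ` (frel G {1..k} - {idrel G {1..k}})"
      unfolding pull_above(1)[OF f(1)] f(2)[symmetric] using r less.prems(3) by auto
    then obtain D where D: "D \<subseteq> frel G {1..k} - {idrel G {1..k}}" "C - {r} = pull G A f ` D"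
      by (meson subset_image_iff)
    \<comment> \<open>The bound fails for the empty index set, so the induction hypothesis requires
      a nonempty quotient.\<close>
    have "k \<noteq> 0"
    proof
      assume "k = 0"
      then have "pts G A = {}" using esurjD(2)[OF f(1)] by simp
      then show False using less.prems(2) one_closed by (auto simp: pts_def)
    qed
    then have "card D < card {1..k}"
    proof (intro less.hyps D)
      fix s t assume st: "s \<in> D" "t \<in> D"
      then have "pull G A f s \<in> C" "pull G A f t \<in> C" using D(2) by auto
      then have "pull G A f s \<subseteq> pull G A f t \<or> pull G A f t \<subseteq> pull G A f s" using less.prems(4) by blast
      moreover have "s \<in> frel G {1..k}" "t \<in> frel G {1..k}" using st D(1) by auto
      ultimately show "s \<subseteq> t \<or> t \<subseteq> s" using pull_mono_iff[OF f(1)] by blast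
    qed (use f(3) in auto)
    moreover have "card (C - {r}) = card D"
      unfolding D(2) by (rule card_image) (use inj_on_subset[OF pull_above(2)[OF f(1)]] D(1) in blast)
    ultimately show ?thesis using f(3) r(1) finC by (simp add: card_Diff_singleton)
  qed
qed

end

section \<open>The homology of the Dowling poset as an Euler characteristic\<close>

definition ract :: "('p \<Rightarrow> 'p) \<Rightarrow> 'p rel \<Rightarrow> 'p rel" where
  "ract x r = map_prod x x ` r"

text \<open>The Moebius number \<open>\<mu>(0, 1)\<close> of the relations fixed by \<open>x\<close>: \<open>euler\<close> counts the empty chain with sign \<open>1\<close>.\<close>

definition mchar :: "('a, 'b) monoid_scheme \<Rightarrow> nat set \<Rightarrow> ('a \<times> nat \<Rightarrow> 'a \<times> nat) \<Rightarrow> rat" where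
  "mchar G A x = - euler (frel G A - {idrel G A}) (\<subseteq>) (ract x)"

definition quot_elt :: "('a, 'b) monoid_scheme \<Rightarrow> nat \<Rightarrow> ('a \<times> nat) rel \<Rightarrow> 'a dowling_elt" where
  "quot_elt G n r = ({}, points G n // r)"

lemma euler_image:
  assumes inj: "inj_on \<phi> X" and fin: "finite X"
    and leq: "\<And>a b. a \<in> X \<Longrightarrow> b \<in> X \<Longrightarrow> leq' (\<phi> a) (\<phi> b) \<longleftrightarrow> leq a b"
    and h: "\<And>a. a \<in> X \<Longrightarrow> h a \<in> X" "\<And>a. a \<in> X \<Longrightarrow> h' (\<phi> a) = \<phi> (h a)"
  shows "euler (\<phi> ` X) leq' h' = euler X leq h"
  unfolding euler_def
proof (rule sum.reindex_cong[of "image \<phi>"])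
  let ?S = "{C. C \<subseteq> X \<and> finite C \<and> (\<forall>a\<in>C. \<forall>b\<in>C. leq a b \<or> leq b a) \<and> h ` C = C}"
  let ?T = "{C. C \<subseteq> \<phi> ` X \<and> finite C \<and> (\<forall>a\<in>C. \<forall>b\<in>C. leq' a b \<or> leq' b a) \<and> h' ` C = C}"
  show "inj_on (image \<phi>) ?S"
    using inj_on_image_Pow[OF inj] by (rule inj_on_subset) auto
  have hi: "h' ` \<phi> ` C = \<phi> ` h ` C" if "C \<subseteq> X" for C
    using that h(2) by (force simp: image_iff)
  have iff: "\<phi> ` C \<in> ?T \<longleftrightarrow> C \<in> ?S" if C: "C \<subseteq> X" for C
  proof -
    have "finite C" using fin C finite_subset by blast
    moreover have "(\<forall>a\<in>\<phi> ` C. \<forall>b\<in>\<phi> ` C. leq' a b \<or> leq' b a) \<longleftrightarrow> (\<forall>a\<in>C. \<forall>b\<in>C. leq a b \<or> leq b a)"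
      using leq C by (auto simp: subset_iff)
    moreover have "h ` C \<subseteq> X" using h(1) C by auto
    then have "h' ` \<phi> ` C = \<phi> ` C \<longleftrightarrow> h ` C = C"
      unfolding hi[OF C] using inj_on_image_eq_iff[OF inj, of "h ` C" C] C by simp
    ultimately show ?thesis using C by auto
  qed
  show "?T = image \<phi> ` ?S"
  proof
    show "?T \<subseteq> image \<phi> ` ?S"
    proof
      fix D assume D: "D \<in> ?T"
      then obtain C where C: "C \<subseteq> X" "D = \<phi> ` C" by (auto simp: subset_image_iff)
      with D iff[OF C(1)] show "D \<in> image \<phi> ` ?S" by blast
    qed
    show "image \<phi> ` ?S \<subseteq> ?T"
    proof (rule image_subsetI)
      fix C assume C: "C \<in> ?S"
      then have "C \<subseteq> X" by simp
      from iff[OF this] C show "\<phi> ` C \<in> ?T" by (rule iffD2)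
    qed
  qed
  fix C assume "C \<in> ?S"
  then show "(-1) ^ card (\<phi> ` C) = (-1 :: rat) ^ card C"
    using inj_on_subset[OF inj] by (simp add: card_image)
qed

context fgroup
begin

lemma wrD:
  assumes "x \<in> wr G A"
  shows "x permutes pts G A" "g \<in> carrier G \<Longrightarrow> z \<in> pts G A \<Longrightarrow> x (lmult G g z) = lmult G g (x z)"
    "z \<in> pts G A \<Longrightarrow> x z \<in> pts G A" "bij x" "inj x"
  using assms by (auto simp: wr_def equivar_def permutes_in_image permutes_bij permutes_inj)

lemma wr_inv: "x \<in> wr G A \<Longrightarrow> inv_into UNIV x \<in> wr G A"
  unfolding wr_def equivar_def
proof (intro CollectI conjI ballI)
  assume "x \<in> {x. x permutes pts G A \<and> (\<forall>g\<in>carrier G. \<forall>z\<in>pts G A. x (lmult G g z) = lmult G g (x z))}"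
  then have x: "x \<in> wr G A" by (simp add: wr_def equivar_def)
  show p: "inv_into UNIV x permutes pts G A" using wrD(1)[OF x] by (rule permutes_inv)
  fix g z assume gz: "g \<in> carrier G" "z \<in> pts G A"
  then have "inv_into UNIV x z \<in> pts G A" using p by (simp add: permutes_in_image)
  then have "x (lmult G g (inv_into UNIV x z)) = lmult G g z"
    using wrD(2)[OF x gz(1)] permutes_inverses(1)[OF wrD(1)[OF x]] by simp
  then show "inv_into UNIV x (lmult G g z) = lmult G g (inv_into UNIV x z)"
    using permutes_inverses(2)[OF wrD(1)[OF x]] by metis
qed

lemma ract_iff:
  assumes "x \<in> wr G A"
  shows "(u, v) \<in> ract x r \<longleftrightarrow> (inv_into UNIV x u, inv_into UNIV x v) \<in> r"
    "(x u, x v) \<in> ract x r \<longleftrightarrow> (u, v) \<in> r"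
proof -
  note i = permutes_inverses[OF wrD(1)[OF assms]]
  show a: "(u, v) \<in> ract x r \<longleftrightarrow> (inv_into UNIV x u, inv_into UNIV x v) \<in> r" for u v
    unfolding ract_def by (force simp: i image_iff)
  show "(x u, x v) \<in> ract x r \<longleftrightarrow> (u, v) \<in> r" by (simp add: a i)
qed

lemma ract_frel:
  assumes x: "x \<in> wr G A" and r: "r \<in> frel G A"
  shows "ract x r \<in> frel G A"
proof -
  let ?y = "inv_into UNIV x"
  note y = wr_inv[OF x]
  have "restrict ?y (pts G A) \<in> eqv G A A"
    using wrD(2,3)[OF y] by (auto simp: eqv_def equivar_def)
  then have "pull G A (restrict ?y (pts G A)) r \<in> frel G A" using r by (rule pull_frel)
  moreover have "ract x r = pull G A (restrict ?y (pts G A)) r"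
  proof (rule Set.set_eqI)
    fix w :: "('a \<times> nat) \<times> ('a \<times> nat)" obtain u v where w: "w = (u, v)" by (cases w)
    have "?y u \<in> pts G A \<longleftrightarrow> u \<in> pts G A" "?y v \<in> pts G A \<longleftrightarrow> v \<in> pts G A"
      using wrD(1)[OF y] by (simp_all add: permutes_in_image)
    then show "w \<in> ract x r \<longleftrightarrow> w \<in> pull G A (restrict ?y (pts G A)) r"
      using frelD(1)[OF r] unfolding w ract_iff(1)[OF x] by (auto simp: pull_def)
  qed
  ultimately show ?thesis by simp
qed

lemma ract_mono_iff: "x \<in> wr G A \<Longrightarrow> ract x r \<subseteq> ract x s \<longleftrightarrow> r \<subseteq> s"
  unfolding ract_def using prod.inj_map[of x x] wrD(5) by (simp add: inj_image_subset_iff)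

lemma ract_idrel: "x \<in> wr G A \<Longrightarrow> ract x (idrel G A) = idrel G A"
proof (rule Set.set_eqI)
  assume x: "x \<in> wr G A"
  note y = wr_inv[OF x]
  fix w :: "('a \<times> nat) \<times> ('a \<times> nat)" obtain u v where w: "w = (u, v)" by (cases w)
  have "inv_into UNIV x u \<in> pts G A \<longleftrightarrow> u \<in> pts G A"
    using wrD(1)[OF y] by (simp add: permutes_in_image)
  moreover have "inv_into UNIV x u = inv_into UNIV x v \<longleftrightarrow> u = v"
    using wrD(5)[OF y] by (rule inj_eq)
  ultimately show "w \<in> ract x (idrel G A) \<longleftrightarrow> w \<in> idrel G A"
    unfolding w ract_iff(1)[OF x] Id_on_iff by blast
qed

lemma inj_on_ract: "x \<in> wr G A \<Longrightarrow> inj_on (ract x) S"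
  by (intro inj_onI) (metis ract_mono_iff subset_antisym subset_refl)

lemma ract_proper:
  assumes "x \<in> wr G A" "r \<in> frel G A - {idrel G A}"
  shows "ract x r \<in> frel G A - {idrel G A}"
  using ract_frel[OF assms(1)] inj_on_ract[OF assms(1), of UNIV] ract_idrel[OF assms(1)] assms(2)
  by (metis Diff_iff UNIV_I inj_on_def singletonD singletonI)

section \<open>The dictionary between relations and Dowling elements\<close>

lemma quot_elt_le:
  assumes "equiv (points G n) r" "equiv (points G n) s"
  shows "dowling_le (quot_elt G n r) (quot_elt G n s) \<longleftrightarrow> r \<subseteq> s"
proof
  assume le: "dowling_le (quot_elt G n r) (quot_elt G n s)"
  show "r \<subseteq> s"
  proof
    fix w assume "w \<in> r"
    then obtain u v where w: "w = (u, v)" "(u, v) \<in> r" by (cases w) auto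
    then have u: "u \<in> points G n" using equiv_type[OF assms(1)] by auto
    then have ru: "u \<in> r `` {u}" by (rule equiv_class_self[OF assms(1)])
    then have "r `` {u} \<in> points G n // r" using u by (auto intro: quotientI)
    then obtain K where K: "K \<in> points G n // s" "r `` {u} \<subseteq> K"
      using le ru by (auto simp: dowling_le_def quot_elt_def)
    then have "u \<in> K" "v \<in> K" using w ru by auto
    then show "w \<in> s" using quotient_eq_iff[OF assms(2) K(1) K(1)] w(1) by blast
  qed
next
  assume rs: "r \<subseteq> s"
  show "dowling_le (quot_elt G n r) (quot_elt G n s)"
    unfolding dowling_le_def quot_elt_def
  proof (intro conjI ballI disjI2)
    fix K assume "K \<in> snd ({}, points G n // r)"
    then obtain z where "z \<in> points G n" "K = r `` {z}" by (auto elim: quotientE)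
    then show "\<exists>K'\<in>snd ({}, points G n // s). K \<subseteq> K'"
      using rs by (intro bexI[of _ "s `` {z}"]) (auto intro: quotientI)
  qed simp
qed

lemma points_eq: "points G n = pts G {1..n}"
  by (simp add: points_def pts_def)

lemma frel_equiv: "r \<in> frel G {1..n} \<Longrightarrow> equiv (points G n) r"
  by (simp add: frel_def points_eq)

text \<open>Translation by g carries the class of z onto the class of g z; if the two classes
  coincided, z would be related to g z, against freeness.\<close>

lemma quot_elt_dowling:
  assumes r: "r \<in> frel G {1..n}"
  shows "quot_elt G n r \<in> dowling G n"
proof -
  have cl: "lmult G g ` (r `` {z}) = r `` {lmult G g z}" if g: "g \<in> carrier G" and z: "z \<in> points G n" for g z
  proof
    show "lmult G g ` (r `` {z}) \<subseteq> r `` {lmult G g z}" using frelD(5)[OF r g] by auto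
    show "r `` {lmult G g z} \<subseteq> lmult G g ` (r `` {z})"
    proof
      fix w assume "w \<in> r `` {lmult G g z}"
      then have w: "(lmult G g z, w) \<in> r" "w \<in> pts G {1..n}" using frelD(1)[OF r] by auto
      have zp: "z \<in> pts G {1..n}" using z by (simp add: points_eq)
      have "(lmult G (inv g) (lmult G g z), lmult G (inv g) w) \<in> r"
        using frelD(5)[OF r inv_closed[OF g] w(1)] .
      then have "lmult G (inv g) w \<in> r `` {z}"
        using g zp by (simp add: lmult_lmult[OF inv_closed[OF g] g zp])
      moreover have "w = lmult G g (lmult G (inv g) w)"
        using g w(2) by (simp add: lmult_lmult[OF g inv_closed[OF g] w(2)])
      ultimately show "w \<in> lmult G g ` (r `` {z})" by blast
    qed
  qed
  have "lmult G g ` K \<noteq> K \<and> lmult G g ` K \<in> points G n // r"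
    if g: "g \<in> carrier G" "g \<noteq> \<one>" and K: "K \<in> points G n // r" for g K
  proof -
    obtain z where z: "z \<in> points G n" "K = r `` {z}" using K by (auto elim: quotientE)
    have gz: "lmult G g z \<in> points G n" using z g by (simp add: points_eq)
    have "r `` {lmult G g z} \<noteq> r `` {z}"
    proof
      assume "r `` {lmult G g z} = r `` {z}"
      moreover have "lmult G g z \<in> r `` {lmult G g z}"
        using frelD(2)[OF r, of "lmult G g z"] gz by (simp add: points_eq)
      ultimately have "(z, lmult G g z) \<in> r" by simp
      then show False using frelD(6)[OF r g(1)] z(1) g(2) by (simp add: points_eq)
    qed
    then show ?thesis unfolding z(2) cl[OF g(1) z(1)] using gz by (auto intro: quotientI)
  qed
  then show ?thesis
    using partition_on_quotient[OF frel_equiv[OF r]]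
    by (simp add: dowling_def quot_elt_def)
qed

lemma dowling_quot_elt:
  assumes a: "a \<in> dowling G n" "fst a = {}"
  obtains r where "r \<in> frel G {1..n}" "a = quot_elt G n r"
proof
  define \<pi> where "\<pi> = snd a"
  have P: "partition_on (points G n) \<pi>"
    and fr: "\<And>g K. g \<in> carrier G \<Longrightarrow> g \<noteq> \<one> \<Longrightarrow> K \<in> \<pi> \<Longrightarrow> lmult G g ` K \<noteq> K \<and> lmult G g ` K \<in> \<pi>"
    using a by (auto simp: dowling_def \<pi>_def)
  let ?r = "{(u, v). \<exists>K\<in>\<pi>. u \<in> K \<and> v \<in> K}"
  have e: "equiv (points G n) ?r" by (rule equiv_partition_on[OF P])
  \<comment> \<open>The unit element is treated separately, since the condition on Dowling elements
    concerns only the other group elements.\<close>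
  have r1: "(lmult G g u, lmult G g v) \<in> ?r" if g: "g \<in> carrier G" and uv: "(u, v) \<in> ?r" for g u v
  proof (cases "g = \<one>")
    case True
    have "u \<in> points G n" "v \<in> points G n" using equiv_type[OF e] uv by auto
    then show ?thesis using uv True by (simp add: points_eq)
  next
    case False
    then show ?thesis using uv fr[OF g False] by auto
  qed
  have r2: "g = \<one>" if g: "g \<in> carrier G" and z: "(z, lmult G g z) \<in> ?r" for g z
  proof (rule ccontr)
    assume ne: "g \<noteq> \<one>"
    obtain K where K: "K \<in> \<pi>" "z \<in> K" "lmult G g z \<in> K" using z by auto
    then have "lmult G g ` K \<inter> K \<noteq> {}" by auto
    moreover have "lmult G g ` K \<in> \<pi>" "lmult G g ` K \<noteq> K" using fr[OF g ne K(1)] by auto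
    ultimately show False using partition_onD2[OF P] K(1) by (auto simp: disjoint_def)
  qed
  show "?r \<in> frel G {1..n}"
    unfolding frel_def points_eq[symmetric]
  proof (intro CollectI conjI ballI impI e)
    show "case w of (u, v) \<Rightarrow> (lmult G g u, lmult G g v) \<in> ?r" if "g \<in> carrier G" "w \<in> ?r" for g w
      using r1[OF that(1), of "fst w" "snd w"] that(2) by (cases w) simp
  qed (rule r2)
  show "a = quot_elt G n ?r"
    using a(2) partition_on_eq_quotient[OF P] by (simp add: quot_elt_def \<pi>_def prod_eq_iff)
qed

lemma quot_elt_idrel: "quot_elt G n (idrel G {1..n}) = dowling_bot G n"
  by (auto simp: quot_elt_def dowling_bot_def points_eq quotient_def)

text \<open>The top is the only element whose first component consists of all points, and for n
  \<ge> 1 it is not among the elements with empty first component.\<close>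

lemma R_proper_eq:
  assumes "n \<ge> 1"
  shows "R_proper G n = quot_elt G n ` (frel G {1..n} - {idrel G {1..n}})"
proof -
  have ne: "points G n \<noteq> {}" using assms one_closed by (auto simp: points_def)
  have inj: "r = idrel G {1..n}" if "r \<in> frel G {1..n}" "quot_elt G n r = dowling_bot G n" for r
  proof -
    note e = frel_equiv[OF that(1)] frel_equiv[OF idrel_frel]
    have eq: "quot_elt G n r = quot_elt G n (idrel G {1..n})" unfolding quot_elt_idrel by (rule that(2))
    have "dowling_le (quot_elt G n r) (quot_elt G n (idrel G {1..n}))"
      unfolding eq by (rule iffD2[OF quot_elt_le[OF e(2,2)] order.refl])
    then have "r \<subseteq> idrel G {1..n}" by (rule iffD1[OF quot_elt_le[OF e]])
    then show ?thesis using idrel_sub[OF that(1)] by blast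
  qed
  have top: "a = dowling_top G n" if "a \<in> dowling G n" "fst a = points G n" for a
    using that by (auto simp: dowling_def dowling_top_def prod_eq_iff partition_on_def)
  show ?thesis
  proof (intro subset_antisym subsetI)
    fix a assume a: "a \<in> R_proper G n"
    then have "a \<in> dowling G n" "fst a = {}" using top[of a] unfolding R_proper_def R_poset_def by blast+
    then obtain r where r: "r \<in> frel G {1..n}" "a = quot_elt G n r" using dowling_quot_elt by blast
    moreover have "r \<noteq> idrel G {1..n}" using a r(2) quot_elt_idrel by (auto simp: R_proper_def)
    ultimately show "a \<in> quot_elt G n ` (frel G {1..n} - {idrel G {1..n}})" by blast
  next
    fix a assume "a \<in> quot_elt G n ` (frel G {1..n} - {idrel G {1..n}})"
    then obtain r where r: "r \<in> frel G {1..n}" "r \<noteq> idrel G {1..n}" "a = quot_elt G n r" by auto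
    then show "a \<in> R_proper G n"
      using quot_elt_dowling[OF r(1)] inj[OF r(1)] ne
      by (auto simp: R_proper_def R_poset_def quot_elt_def dowling_top_def)
  qed
qed

lemma dowling_act_quot_elt:
  assumes x: "x \<in> wr G {1..n}"
  shows "dowling_act x (quot_elt G n r) = quot_elt G n (ract x r)"
proof -
  have "x ` (r `` {z}) = ract x r `` {x z}" for z
    using wrD(5)[OF x] by (force simp: ract_def image_iff dest: injD)
  then have "(\<lambda>K. x ` K) ` (points G n // r) = (\<lambda>z. ract x r `` {z}) ` x ` points G n"
    by (simp add: quotient_def image_UN image_image UNION_singleton_eq_range)
  also have "x ` points G n = points G n"
    using permutes_image[OF wrD(1)[OF x]] by (simp add: points_eq)
  finally show ?thesis
    by (simp add: dowling_act_def quot_elt_def quotient_def UNION_singleton_eq_range)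
qed

theorem trace_R_homology:
  assumes n: "n \<ge> 1" and x: "x \<in> wr G {1..n}"
  shows "(-1) ^ n * rep_trace (R_homology G n) x = mchar G {1..n} x"
proof -
  define X where "X = frel G {1..n} - {idrel G {1..n}}"
  have RX: "R_proper G n = quot_elt G n ` X" by (simp add: X_def R_proper_eq[OF n])
  have eq: "equiv (points G n) r" if "r \<in> X" for r using that frel_equiv by (simp add: X_def)
  have le: "dowling_le (quot_elt G n r) (quot_elt G n s) \<longleftrightarrow> r \<subseteq> s" if "r \<in> X" "s \<in> X" for r s
    by (rule quot_elt_le[OF eq eq]) (use that in auto)
  have inj: "inj_on (quot_elt G n) X"
    by (intro inj_onI) (metis le subset_antisym subset_refl)
  have finX: "finite X" using finite_frel[of "{1..n}"] by (simp add: X_def)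
  have rX: "ract x r \<in> X" if "r \<in> X" for r using ract_proper[OF x] that by (simp add: X_def)
  interpret R: poset_on "R_proper G n" dowling_le
  proof
    fix a b c assume "a \<in> R_proper G n"
    then obtain r where r: "r \<in> X" "a = quot_elt G n r" by (auto simp: RX)
    then show "dowling_le a a" using le by simp
    assume "b \<in> R_proper G n"
    then obtain s where s: "s \<in> X" "b = quot_elt G n s" by (auto simp: RX)
    show "a = b" if "dowling_le a b" "dowling_le b a" using r s le that by auto
    assume "c \<in> R_proper G n"
    then obtain t where t: "t \<in> X" "c = quot_elt G n t" by (auto simp: RX)
    show "dowling_le a c" if "dowling_le a b" "dowling_le b c" using r s t le that by auto
  qed
  \<comment> \<open>A certificate with parameter n - 1 covers the degrees below n - 2, as the trace
    formula demands.\<close>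
  have cc: "cc dowling_le (R_proper G n) (n - 1)"
    unfolding RX
  proof (rule cc_image[OF _ inj])
    show "cc (\<subseteq>) X (n - 1)" using frel_cc[of "{1..n}"] by (simp add: X_def)
  qed (rule le)
  have "(-1) ^ n * rep_trace (reduced_homology (R_proper G n) dowling_le dowling_act (int n - 2)) x =
      - euler (R_proper G n) dowling_le (dowling_act x)"
  proof (rule R.hopf_trace)
    show "finite (R_proper G n)" using finX by (simp add: RX)
    have act: "dowling_act x (quot_elt G n r) = quot_elt G n (ract x r)" for r
      by (rule dowling_act_quot_elt[OF x])
    have lex: "ract x r \<subseteq> ract x s \<longleftrightarrow> r \<subseteq> s" for r s by (rule ract_mono_iff[OF x])
    show "dowling_le (dowling_act x a) (dowling_act x b) \<longleftrightarrow> dowling_le a b"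
      if "a \<in> R_proper G n" "b \<in> R_proper G n" for a b
      using that rX le lex by (auto simp: RX act)
    have "inj_on (dowling_act x) (R_proper G n)"
    proof (rule inj_onI)
      fix a b assume ab: "a \<in> R_proper G n" "b \<in> R_proper G n" "dowling_act x a = dowling_act x b"
      then obtain r s where rs: "r \<in> X" "a = quot_elt G n r" "s \<in> X" "b = quot_elt G n s"
        by (auto simp: RX)
      then have "quot_elt G n (ract x r) = quot_elt G n (ract x s)" using ab(3) by (simp add: act)
      then have "ract x r = ract x s" using rX rs by (intro inj_onD[OF inj]) auto
      then have "r = s" by (rule inj_onD[OF inj_on_ract[OF x, of UNIV]]) auto
      then show "a = b" using rs by simp
    qed
    moreover have "dowling_act x ` R_proper G n \<subseteq> R_proper G n" using rX by (auto simp: RX act)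
    ultimately show "bij_betw (dowling_act x) (R_proper G n) (R_proper G n)"
      using finX by (simp add: RX bij_betw_def endo_inj_surj)
    show "acyc dowling_le (R_proper G n) i" if "i < int n - 2" for i
      using that n by (intro R.cc_acyc[OF cc]) auto
    fix C assume C': "C \<in> R.chains"
    have C: "C \<subseteq> quot_elt G n ` X" "\<And>a b. a \<in> C \<Longrightarrow> b \<in> C \<Longrightarrow> dowling_le a b \<or> dowling_le b a"
      using R.chainsD(2)[OF C'] R.chainsD(3)[OF C'] unfolding RX by blast+
    then obtain D where D: "D \<subseteq> X" "C = quot_elt G n ` D" by (meson subset_image_iff)
    have "card C = card D" unfolding D(2) by (rule card_image[OF inj_on_subset[OF inj D(1)]])
    also have "\<dots> < card {1..n}"
    proof (rule frel_chain_card)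
      show "a \<subseteq> b \<or> b \<subseteq> a" if ab: "a \<in> D" "b \<in> D" for a b
        using C(2)[of "quot_elt G n a" "quot_elt G n b"] ab D le[of a b] le[of b a] by blast
    qed (use n D in \<open>auto simp: X_def\<close>)
    finally show "card C < n" by simp
  qed (use n in auto)
  also have "euler (R_proper G n) dowling_le (dowling_act x) = euler X (\<subseteq>) (ract x)"
    unfolding RX by (rule euler_image[OF inj finX]) (use le rX dowling_act_quot_elt[OF x] in auto)
  finally show ?thesis by (simp add: R_homology_def mchar_def X_def)
qed

end

section \<open>Summing over the poset\<close>

definition fchains :: "'p set set \<Rightarrow> ('p set \<Rightarrow> 'p set) \<Rightarrow> 'p set set set" where
  "fchains P h = {C. C \<subseteq> P \<and> finite C \<and> (\<forall>a\<in>C. \<forall>b\<in>C. a \<subseteq> b \<or> b \<subseteq> a) \<and> h ` C = C}"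

lemma euler_fchains: "euler P (\<subseteq>) h = (\<Sum>C\<in>fchains P h. (-1) ^ card C)"
  by (simp add: euler_def fchains_def)

lemma finite_fchains: "finite P \<Longrightarrow> finite (fchains P h)"
  by (rule finite_subset[of _ "Pow P"]) (auto simp: fchains_def)

context
  fixes P :: "'p set set" and h b
  assumes finP: "finite P" and hP: "inj_on h P"
    and mono: "\<And>r s. r \<in> P \<Longrightarrow> s \<in> P \<Longrightarrow> h r \<subseteq> h s \<longleftrightarrow> r \<subseteq> s"
    and b: "b \<in> P" "h b = b" "\<And>r. r \<in> P \<Longrightarrow> b \<subseteq> r"
begin

text \<open>Inserting or deleting the fixed bottom \<open>b\<close> is a sign-reversing involution
  on the fixed chains.\<close>

lemma sum_fchains_eq_0: "(\<Sum>C\<in>fchains P h. (-1 :: rat) ^ card C) = 0"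
proof -
  let ?F = "fchains P h"
  have ins: "insert b C \<in> ?F" if "C \<in> ?F" for C
    using that b by (auto simp: fchains_def)
  have del: "C - {b} \<in> ?F" if "C \<in> ?F" for C
  proof -
    have C: "C \<subseteq> P" "h ` C = C" using that by (auto simp: fchains_def)
    have "h ` (C - {b}) = h ` C - h ` ({b} \<inter> P)"
      using inj_on_image_set_diff[OF hP, of C "{b}"] C b by auto
    then have "h ` (C - {b}) = C - {b}" using b C(2) by auto
    then show ?thesis using that by (auto simp: fchains_def)
  qed
  have "(\<Sum>C\<in>?F. (-1 :: rat) ^ card C) = (\<Sum>C\<in>{C\<in>?F. b \<in> C}. (-1) ^ card C) + (\<Sum>C\<in>{C\<in>?F. b \<notin> C}. (-1) ^ card C)"
    using finite_fchains[OF finP, of h]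
    by (subst sum.union_disjoint[symmetric]) (auto intro!: sum.cong)
  also have "(\<Sum>C\<in>{C\<in>?F. b \<in> C}. (-1 :: rat) ^ card C) = (\<Sum>C\<in>{C\<in>?F. b \<notin> C}. - ((-1) ^ card C))"
  proof (rule sum.reindex_bij_witness[of _ "insert b" "\<lambda>C. C - {b}"])
    fix C assume C: "C \<in> {C\<in>?F. b \<in> C}"
    then have "finite C" by (auto simp: fchains_def)
    then have "card C = Suc (card (C - {b}))" using C by (metis (mono_tags, lifting) card_Suc_Diff1 mem_Collect_eq)
    then show "- ((-1) ^ card (C - {b})) = (-1 :: rat) ^ card C" by simp
  qed (use ins del in auto)
  finally show ?thesis by (simp add: sum_negf)
qed

text \<open>A nonempty fixed chain consists of its least element, which \<open>h\<close> fixes, and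
  a fixed chain strictly above it. All fixed chains together cancel, so the nonempty ones contribute
  -1, and taking away the least element flips the sign.\<close>

lemma sum_upper_euler: "(\<Sum>r | r \<in> P \<and> h r = r. euler {s \<in> P. r \<subset> s} (\<subseteq>) h) = 1"
proof -
  let ?F = "fchains P h" and ?Q = "\<lambda>r. {s \<in> P. r \<subset> s}"
  have "(\<Sum>r | r \<in> P \<and> h r = r. euler (?Q r) (\<subseteq>) h) =
      (\<Sum>(r, C)\<in>Sigma {r \<in> P. h r = r} (\<lambda>r. fchains (?Q r) h). (-1) ^ card C)"
    unfolding euler_fchains using finP finite_fchains[of _ h] by (subst sum.Sigma) auto
  \<comment> \<open>For a finite nonempty chain of sets the intersection is the least member, which
    gives the inverse of the bijection.\<close>
  also have "\<dots> = (\<Sum>C\<in>?F - {{}}. - ((-1) ^ card C))"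
  proof (rule sum.reindex_bij_witness[of _ "\<lambda>C. (\<Inter>C, C - {\<Inter>C})" "\<lambda>(r, C). insert r C"])
    fix p assume "p \<in> Sigma {r \<in> P. h r = r} (\<lambda>r. fchains (?Q r) h)"
    then obtain r C where p: "p = (r, C)" "r \<in> P" "h r = r" "C \<in> fchains (?Q r) h" by auto
    then have i: "\<Inter>(insert r C) = r" and n: "r \<notin> C" and f: "finite C" by (auto simp: fchains_def)
    show "(\<Inter>(case p of (r, C) \<Rightarrow> insert r C), (case p of (r, C) \<Rightarrow> insert r C) -
        {\<Inter>(case p of (r, C) \<Rightarrow> insert r C)}) = p"
      unfolding p(1) case_prod_conv i using n by simp
    show "(case p of (r, C) \<Rightarrow> insert r C) \<in> ?F - {{}}" using p by (auto simp: fchains_def)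
    show "- ((-1) ^ card (case p of (r, C) \<Rightarrow> insert r C)) = (case p of (r, C) \<Rightarrow> (-1 :: rat) ^ card C)"
      using n f by (simp add: p)
  next
    fix C assume C: "C \<in> ?F - {{}}"
    then have F: "C \<subseteq> P" "finite C" "C \<noteq> {}" "h ` C = C" "\<And>a b. a \<in> C \<Longrightarrow> b \<in> C \<Longrightarrow> a \<subseteq> b \<or> b \<subseteq> a"
      by (auto simp: fchains_def)
    obtain m where m: "m \<in> C" "\<And>b. b \<in> C \<Longrightarrow> m \<subseteq> b"
      using finite_chain_min[OF F(2,3,5)] by blast
    have im: "\<Inter>C = m" using m by blast
    show "(case (\<Inter>C, C - {\<Inter>C}) of (r, C) \<Rightarrow> insert r C) = C" using m(1) by (auto simp: im)
    \<comment> \<open>Some \<open>c\<close> in the chain is mapped to \<open>m\<close>, and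
      \<open>m\<close> lies below both \<open>c\<close> and the image of \<open>m\<close>;
      monotonicity then gives the two inclusions.\<close>
    have hm: "h m = m"
    proof
      from m(1) have "m \<in> h ` C" by (simp only: F(4))
      then obtain c where c: "c \<in> C" "h c = m" by blast
      then show "h m \<subseteq> m" using mono[of m c] m F(1) by auto
      show "m \<subseteq> h m" using m F(4) by blast
    qed
    have "h ` (C - {m}) = h ` C - h ` {m}"
      using inj_on_image_set_diff[OF hP, of C "{m}"] F(1) m(1) by auto
    then have hC: "h ` (C - {m}) = C - {m}" using hm F(4) by simp
    have "C - {m} \<in> fchains (?Q m) h"
      unfolding fchains_def
    proof (intro CollectI conjI ballI hC)
      show "C - {m} \<subseteq> ?Q m" using F(1) m(2) by blast
      show "finite (C - {m})" using F(2) by simp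
      fix a c assume "a \<in> C - {m}" "c \<in> C - {m}"
      then show "a \<subseteq> c \<or> c \<subseteq> a" by (intro F(5)) auto
    qed
    moreover have "m \<in> P" using m(1) F(1) by blast
    ultimately show "(\<Inter>C, C - {\<Inter>C}) \<in> Sigma {r \<in> P. h r = r} (\<lambda>r. fchains (?Q r) h)"
      using hm unfolding im by simp
  qed
  also have "\<dots> = - ((\<Sum>C\<in>?F. (-1) ^ card C) - 1)"
  proof -
    have "{} \<in> ?F" by (simp add: fchains_def)
    then have "(\<Sum>C\<in>?F. (-1 :: rat) ^ card C) = 1 + (\<Sum>C\<in>?F - {{}}. (-1) ^ card C)"
      using finite_fchains[OF finP, of h] by (simp add: sum.remove)
    then show ?thesis by (simp add: sum_negf)
  qed
  finally show ?thesis by (simp add: sum_fchains_eq_0)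
qed

end

context fgroup
begin

section \<open>Orders of wreath products and surjections with a given kernel\<close>

lemma finite_wr: "finite A \<Longrightarrow> finite (wr G A)"
  by (rule finite_subset[OF _ finite_permutations[OF finite_pts]]) (auto simp: wr_def)

lemma finite_esurj: "finite A \<Longrightarrow> finite B \<Longrightarrow> finite (esurj G A B)"
  by (rule finite_subset[of _ "pts G A \<rightarrow>\<^sub>E pts G B"])
    (auto simp: esurj_def eqv_def finite_pts intro!: finite_PiE)

lemma wrI:
  assumes "bij_betw f (pts G A) (pts G A)" "\<And>z. z \<notin> pts G A \<Longrightarrow> f z = z"
    and "\<And>g z. g \<in> carrier G \<Longrightarrow> z \<in> pts G A \<Longrightarrow> f (lmult G g z) = lmult G g (f z)"
  shows "f \<in> wr G A"
  using bij_imp_permutes[OF assms(1,2)] assms(3) by (simp add: wr_def equivar_def)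

text \<open>If \<open>x\<close> sent two fibres into the same one, some translate of (1, m) would
  have the same image as (1, k), against injectivity.\<close>

lemma base_permutes:
  assumes "finite A" "x \<in> wr G A"
  shows "base_perm G x permutes A"
proof -
  have m1: "(\<one>, m) \<in> pts G A" if "m \<in> A" for m using that by (simp add: pts_def)
  have xm: "x (\<one>, m) \<in> pts G A" if "m \<in> A" for m using wrD(3)[OF assms(2) m1[OF that]] .
  have "inj_on (base_perm G x) A"
  proof (rule inj_onI)
    fix m k assume mk: "m \<in> A" "k \<in> A" "base_perm G x m = base_perm G x k"
    obtain g i h j where gh: "x (\<one>, m) = (g, i)" "x (\<one>, k) = (h, j)" by (metis surj_pair)
    have g: "g \<in> carrier G" "h \<in> carrier G" "i = j"
      using xm[OF mk(1)] xm[OF mk(2)] gh mk by (auto simp: pts_def base_perm_def)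
    have "x (lmult G (h \<otimes> inv g) (\<one>, m)) = x (\<one>, k)"
      using wrD(2)[OF assms(2) _ m1[OF mk(1)], of "h \<otimes> inv g"] g gh by (simp add: lmult_def m_assoc)
    then have "lmult G (h \<otimes> inv g) (\<one>, m) = (\<one>, k)" by (rule injD[OF wrD(5)[OF assms(2)]])
    then show "m = k" by (simp add: lmult_def)
  qed
  moreover have "base_perm G x ` A \<subseteq> A" using xm by (auto simp: pts_def mem_Times_iff base_perm_def)
  ultimately have "bij_betw (base_perm G x) A A"
    unfolding bij_betw_def using endo_inj_surj[OF assms(1)] by blast
  then show ?thesis
  proof (rule bij_imp_permutes)
    fix m assume "m \<notin> A"
    then have "(\<one>, m) \<notin> pts G A" by (simp add: pts_def)
    then show "base_perm G x m = m"
      using permutes_not_in[OF wrD(1)[OF assms(2)]] by (simp add: base_perm_def)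
  qed
qed

text \<open>An equivariant permutation amounts to a free choice of a permutation of the indices and,
  for each index m, of a group element, the first component of the image of (1, m).\<close>

lemma card_wr:
  assumes "finite A"
  shows "card (wr G A) = card (carrier G) ^ card A * fact (card A)"
proof -
  define \<Phi> where "\<Phi> = (\<lambda>(\<sigma>, \<gamma>) z. if z \<in> pts G A then (fst z \<otimes> \<gamma> (snd z), \<sigma> (snd z)) else z)"
  define \<Psi> where "\<Psi> = (\<lambda>x :: 'a \<times> nat \<Rightarrow> 'a \<times> nat. (\<lambda>m. if m \<in> A then snd (x (\<one>, m)) else m, \<lambda>m\<in>A. fst (x (\<one>, m))))"
  let ?S = "{\<sigma>. \<sigma> permutes A} \<times> (A \<rightarrow>\<^sub>E carrier G)"
  have "bij_betw \<Phi> ?S (wr G A)"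
  proof (rule bij_betw_byWitness[of _ \<Psi>])
    show "\<forall>p\<in>?S. \<Psi> (\<Phi> p) = p"
    proof
      fix p assume "p \<in> ?S"
      then obtain \<sigma> \<gamma> where p: "p = (\<sigma>, \<gamma>)" "\<sigma> permutes A" "\<gamma> \<in> A \<rightarrow>\<^sub>E carrier G" by auto
      have "(\<lambda>m. if m \<in> A then snd (\<Phi> (\<sigma>, \<gamma>) (\<one>, m)) else m) = \<sigma>"
        using p permutes_not_in[OF p(2)] by (auto simp: \<Phi>_def pts_def)
      moreover have "(\<lambda>m\<in>A. fst (\<Phi> (\<sigma>, \<gamma>) (\<one>, m))) = \<gamma>"
        using p PiE_mem[OF p(3)] PiE_arb[OF p(3)] by (auto simp: \<Phi>_def pts_def restrict_def)
      ultimately show "\<Psi> (\<Phi> p) = p" by (simp add: \<Psi>_def p(1))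
    qed
    show "\<forall>x\<in>wr G A. \<Phi> (\<Psi> x) = x"
    proof (intro ballI ext)
      fix x z assume x: "x \<in> wr G A"
      show "\<Phi> (\<Psi> x) z = x z"
      proof (cases "z \<in> pts G A")
        case True
        then obtain g m where z: "z = (g, m)" "g \<in> carrier G" "m \<in> A" by (auto simp: pts_def)
        then have "(\<one>, m) \<in> pts G A" by (simp add: pts_def)
        from wrD(2)[OF x z(2) this] have "x z = lmult G g (x (\<one>, m))"
          using z by (simp add: lmult_def)
        then show ?thesis using True z by (simp add: \<Phi>_def \<Psi>_def lmult_def)
      next
        case False
        then show ?thesis using permutes_not_in[OF wrD(1)[OF x]] by (simp add: \<Phi>_def \<Psi>_def)
      qed
    qed
    show "\<Phi> ` ?S \<subseteq> wr G A"
    proof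
      fix x assume "x \<in> \<Phi> ` ?S"
      then obtain \<sigma> \<gamma> where p: "x = \<Phi> (\<sigma>, \<gamma>)" "\<sigma> permutes A" "\<gamma> \<in> A \<rightarrow>\<^sub>E carrier G" by auto
      have \<gamma>: "\<gamma> m \<in> carrier G" if "m \<in> A" for m using p(3) that by auto
      have \<sigma>: "\<sigma> m \<in> A \<longleftrightarrow> m \<in> A" for m using p(2) by (simp add: permutes_in_image)
      have xp: "x (g, m) = (g \<otimes> \<gamma> m, \<sigma> m)" if "g \<in> carrier G" "m \<in> A" for g m
        using that by (simp add: p(1) \<Phi>_def pts_def)
      have "inj_on x (pts G A)"
      proof (rule inj_onI)
        fix u v assume uv: "u \<in> pts G A" "v \<in> pts G A" "x u = x v"
        then obtain g m h k where u: "u = (g, m)" "g \<in> carrier G" "m \<in> A" "v = (h, k)" "h \<in> carrier G" "k \<in> A"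
          by (auto simp: pts_def)
        then have "m = k" using uv(3) xp permutes_inj[OF p(2)] by (auto dest: injD)
        then show "u = v" using uv(3) xp u \<gamma>[of m] by auto
      qed
      moreover have "x ` pts G A \<subseteq> pts G A" using xp \<gamma> \<sigma> by (auto simp: pts_def)
      ultimately have "bij_betw x (pts G A) (pts G A)"
        using finite_pts[OF assms] by (simp add: bij_betw_def endo_inj_surj)
      then show "x \<in> wr G A"
      proof (rule wrI)
        fix g z assume g: "g \<in> carrier G" and "z \<in> pts G A"
        then obtain h m where z: "z = (h, m)" "h \<in> carrier G" "m \<in> A" by (auto simp: pts_def)
        then show "x (lmult G g z) = lmult G g (x z)"
          using g xp \<gamma> by (simp add: lmult_def m_assoc)
      qed (simp add: p(1) \<Phi>_def)
    qed
    show "\<Psi> ` wr G A \<subseteq> ?S"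
    proof
      fix p assume "p \<in> \<Psi> ` wr G A"
      then obtain x where x: "x \<in> wr G A" "p = \<Psi> x" by auto
      have xm: "x (\<one>, m) \<in> pts G A" if "m \<in> A" for m
        using wrD(3)[OF x(1)] that by (simp add: pts_def)
      have "(\<lambda>m. if m \<in> A then snd (x (\<one>, m)) else m) = base_perm G x"
        using permutes_not_in[OF base_permutes[OF assms x(1)]] by (auto simp: base_perm_def)
      then have "(\<lambda>m. if m \<in> A then snd (x (\<one>, m)) else m) permutes A"
        using base_permutes[OF assms x(1)] by simp
      moreover have "(\<lambda>m\<in>A. fst (x (\<one>, m))) \<in> A \<rightarrow>\<^sub>E carrier G" using xm by (auto simp: pts_def mem_Times_iff)
      ultimately show "p \<in> ?S" by (simp add: x(2) \<Psi>_def)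
    qed
  qed
  then have "card (wr G A) = card ?S" by (rule bij_betw_same_card[symmetric])
  also have "\<dots> = card (carrier G) ^ card A * fact (card A)"
    using assms by (simp add: card_cartesian_product card_permutations card_PiE)
  finally show ?thesis .
qed

text \<open>\<open>f'\<close> is constant on the fibres of \<open>f\<close>, so it induces a map of
  the target to itself; that map is onto, hence bijective by finiteness.\<close>

lemma esurj_factor:
  assumes fin: "finite B" and f: "f \<in> esurj G A B" and f': "f' \<in> esurj G A B"
    and ker: "ker A B f \<subseteq> ker A B f'"
  shows "\<exists>!u. u \<in> wr G B \<and> (\<forall>z\<in>pts G A. f' z = u (f z))"
proof -
  note fe = esurjD(1)[OF f] and fe' = esurjD(1)[OF f']
  define s where "s = inv_into (pts G A) f"
  have s: "s w \<in> pts G A" "f (s w) = w" if "w \<in> pts G B" for w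
    using that esurjD(2)[OF f] by (auto simp: s_def inv_into_into f_inv_into_f)
  define u where "u = (\<lambda>w. if w \<in> pts G B then f' (s w) else w)"
  have eq: "f' z = u (f z)" if z: "z \<in> pts G A" for z
  proof -
    have w: "f z \<in> pts G B" using eqvD(1)[OF fe z] .
    have "(s (f z), z) \<in> ker A B f" using s[OF w] z by (simp add: ker_iff[OF fe])
    then have "(s (f z), z) \<in> ker A B f'" using ker by blast
    then show ?thesis using w by (simp add: ker_iff[OF fe'] u_def)
  qed
  have "u ` pts G B = pts G B"
  proof
    show "u ` pts G B \<subseteq> pts G B"
    proof (rule image_subsetI)
      fix w assume "w \<in> pts G B"
      then show "u w \<in> pts G B" using eqvD(1)[OF fe' s(1)[of w]] by (simp add: u_def)
    qed
    show "pts G B \<subseteq> u ` pts G B"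
    proof
      fix w assume "w \<in> pts G B"
      then have "w \<in> f' ` pts G A" by (simp only: esurjD(2)[OF f'])
      then obtain z where z: "z \<in> pts G A" "w = f' z" by blast
      then have "w = u (f z)" using eq by blast
      then show "w \<in> u ` pts G B" using eqvD(1)[OF fe z(1)] by blast
    qed
  qed
  then have "bij_betw u (pts G B) (pts G B)"
    using finite_pts[OF fin] by (simp add: bij_betw_def finite_surj_inj)
  then have "u \<in> wr G B"
  proof (rule wrI)
    fix g w assume g: "g \<in> carrier G" and w: "w \<in> pts G B"
    have "u (lmult G g w) = u (lmult G g (f (s w)))" using s(2)[OF w] by simp
    also have "\<dots> = u (f (lmult G g (s w)))" using eqvD(2)[OF fe g s(1)[OF w]] by simp
    also have "\<dots> = f' (lmult G g (s w))" using eq g s(1)[OF w] by simp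
    also have "\<dots> = lmult G g (f' (s w))" using eqvD(2)[OF fe' g s(1)[OF w]] by simp
    finally show "u (lmult G g w) = lmult G g (u w)" using w by (simp add: u_def)
  qed (simp add: u_def)
  moreover have "v = u" if v: "v \<in> wr G B" "\<forall>z\<in>pts G A. f' z = v (f z)" for v
  proof
    fix w show "v w = u w"
    proof (cases "w \<in> pts G B")
      case True
      then show ?thesis using v(2) s[OF True] by (auto simp: u_def simp del: split_paired_All)
    next
      case False
      then show ?thesis using permutes_not_in[OF wrD(1)[OF v(1)]] by (simp add: u_def)
    qed
  qed
  ultimately show ?thesis using eq by blast
qed

lemma wr_esurj:
  assumes f: "f \<in> esurj G A B" and u: "u \<in> wr G B"
  shows "compose (pts G A) u f \<in> esurj G A B" "ker A B (compose (pts G A) u f) = ker A B f"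
proof -
  have ur: "restrict u (pts G B) \<in> esurj G B B"
    using wrD(2,3)[OF u] permutes_image[OF wrD(1)[OF u]] by (auto simp: esurj_def eqv_def equivar_def)
  have e: "compose (pts G A) (restrict u (pts G B)) f = compose (pts G A) u f"
    using eqvD(1)[OF esurjD(1)[OF f]] by (auto simp: compose_def restrict_def)
  from compose_esurj(1)[OF f ur] show c: "compose (pts G A) u f \<in> esurj G A B" unfolding e .
  have "compose (pts G A) u f y = compose (pts G A) u f z \<longleftrightarrow> f y = f z" if "y \<in> pts G A" "z \<in> pts G A" for y z
    using that inj_eq[OF wrD(5)[OF u]] by (simp add: compose_def)
  then have "(y, z) \<in> ker A B (compose (pts G A) u f) \<longleftrightarrow> (y, z) \<in> ker A B f" for y z
    unfolding ker_iff[OF esurjD(1)[OF c]] ker_iff[OF esurjD(1)[OF f]] by blast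
  then show "ker A B (compose (pts G A) u f) = ker A B f" by auto
qed

text \<open>The wreath product of the target acts simply transitively on the surjections with a
  fixed kernel.\<close>

lemma card_esurj_ker:
  assumes fin: "finite B" and f: "f \<in> esurj G A B"
  shows "card {f' \<in> esurj G A B. ker A B f' = ker A B f} = card (wr G B)"
proof -
  have "bij_betw (\<lambda>u. compose (pts G A) u f) (wr G B) {f' \<in> esurj G A B. ker A B f' = ker A B f}"
    unfolding bij_betw_def
  proof
    show "inj_on (\<lambda>u. compose (pts G A) u f) (wr G B)"
    proof (rule inj_onI)
      fix u v assume uv: "u \<in> wr G B" "v \<in> wr G B" "compose (pts G A) u f = compose (pts G A) v f"
      have "\<forall>z\<in>pts G A. compose (pts G A) u f z = u (f z)" by (simp add: compose_def)
      moreover have "\<forall>z\<in>pts G A. compose (pts G A) u f z = v (f z)"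
        unfolding uv(3) by (simp add: compose_def)
      moreover have "\<exists>!w. w \<in> wr G B \<and> (\<forall>z\<in>pts G A. compose (pts G A) u f z = w (f z))"
        by (rule esurj_factor[OF fin f wr_esurj(1)[OF f uv(1)]]) (simp add: wr_esurj(2)[OF f uv(1)])
      ultimately show "u = v" using uv(1,2) by blast
    qed
    show "(\<lambda>u. compose (pts G A) u f) ` wr G B = {f' \<in> esurj G A B. ker A B f' = ker A B f}"
    proof (intro subset_antisym subsetI)
      fix f' assume "f' \<in> {f' \<in> esurj G A B. ker A B f' = ker A B f}"
      then have f': "f' \<in> esurj G A B" "ker A B f \<subseteq> ker A B f'" by auto
      then obtain u where u: "u \<in> wr G B" "\<forall>z\<in>pts G A. f' z = u (f z)"
        using esurj_factor[OF fin f f'] by blast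
      have "f' = compose (pts G A) u f"
      proof
        fix z show "f' z = compose (pts G A) u f z"
          using u(2) f'(1) by (cases "z \<in> pts G A") (auto simp: compose_def esurj_def eqv_def PiE_def extensional_def simp del: split_paired_All)
      qed
      then show "f' \<in> (\<lambda>u. compose (pts G A) u f) ` wr G B" using u by blast
    qed (use wr_esurj[OF f] in auto)
  qed
  then show ?thesis by (rule bij_betw_same_card[symmetric])
qed

text \<open>Pulling back along \<open>f\<close> identifies the nontrivial relations on the quotient
  with the relations strictly above the kernel and intertwines the actions of \<open>y\<close> and
  \<open>x\<close>.\<close>

lemma mchar_upper:
  assumes x: "x \<in> wr G A" and y: "y \<in> wr G B" and f: "f \<in> esurj G A B" and fin: "finite B"
    and xy: "\<And>z. z \<in> pts G A \<Longrightarrow> f (x z) = y (f z)"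
  shows "mchar G B y = - euler {s \<in> frel G A. ker A B f \<subset> s} (\<subseteq>) (ract x)"
proof -
  let ?X = "frel G B - {idrel G B}"
  have "euler (pull G A f ` ?X) (\<subseteq>) (ract x) = euler ?X (\<subseteq>) (ract y)"
  proof (rule euler_image)
    show "inj_on (pull G A f) ?X" using pull_above(2)[OF f] by (rule inj_on_subset) auto
    show "finite ?X" using finite_frel[OF fin] by simp
    fix s assume s: "s \<in> ?X"
    then show "ract y s \<in> ?X" by (rule ract_proper[OF y])
    show "pull G A f s \<subseteq> pull G A f t \<longleftrightarrow> s \<subseteq> t" for t
      using pull_mono_iff[OF f] s by blast
    have i: "inv_into UNIV y (f w) = f (inv_into UNIV x w) \<and> inv_into UNIV x w \<in> pts G A" if w: "w \<in> pts G A" for w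
    proof
      show p: "inv_into UNIV x w \<in> pts G A" using wrD(3)[OF wr_inv[OF x] w] .
      have "f w = y (f (inv_into UNIV x w))"
        using xy[OF p] permutes_inverses(1)[OF wrD(1)[OF x]] by simp
      then show "inv_into UNIV y (f w) = f (inv_into UNIV x w)"
        using permutes_inverses(2)[OF wrD(1)[OF y]] by simp
    qed
    have p: "inv_into UNIV x w \<in> pts G A \<longleftrightarrow> w \<in> pts G A" for w
      using permutes_in_image[OF wrD(1)[OF wr_inv[OF x]]] .
    show "ract x (pull G A f s) = pull G A f (ract y s)"
    proof (rule Set.set_eqI)
      fix w :: "('a \<times> nat) \<times> ('a \<times> nat)" obtain u v where w: "w = (u, v)" by (cases w)
      have "w \<in> ract x (pull G A f s) \<longleftrightarrow> u \<in> pts G A \<and> v \<in> pts G A \<and>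
          (f (inv_into UNIV x u), f (inv_into UNIV x v)) \<in> s"
        unfolding w ract_iff(1)[OF x] by (simp add: pull_def p)
      also have "\<dots> \<longleftrightarrow> u \<in> pts G A \<and> v \<in> pts G A \<and> (f u, f v) \<in> ract y s"
        unfolding ract_iff(1)[OF y] using i[of u] i[of v] by auto
      also have "\<dots> \<longleftrightarrow> w \<in> pull G A f (ract y s)" by (simp add: w pull_def)
      finally show "w \<in> ract x (pull G A f s) \<longleftrightarrow> w \<in> pull G A f (ract y s)" .
    qed
  qed
  then show ?thesis by (simp add: mchar_def pull_above(1)[OF f])
qed

text \<open>Composing \<open>f\<close> with \<open>x\<close> gives another surjection; it factors
  through \<open>f\<close>, by a unique \<open>y\<close>, once the kernel of \<open>f\<close> is
  stable under \<open>x\<close>.\<close>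

lemma ker_fixed_iff:
  assumes x: "x \<in> wr G A" and f: "f \<in> esurj G A B" and fin: "finite B"
  shows "ract x (ker A B f) = ker A B f \<longleftrightarrow> (\<exists>y\<in>wr G B. \<forall>z\<in>pts G A. f (x z) = y (f z))"
    and "y \<in> wr G B \<Longrightarrow> y' \<in> wr G B \<Longrightarrow> \<forall>z\<in>pts G A. f (x z) = y (f z) \<Longrightarrow>
      \<forall>z\<in>pts G A. f (x z) = y' (f z) \<Longrightarrow> y = y'"
proof -
  have xs: "restrict x (pts G A) \<in> esurj G A A"
    using wrD(2,3)[OF x] permutes_image[OF wrD(1)[OF x]] by (auto simp: esurj_def eqv_def equivar_def)
  define f' where "f' = compose (pts G A) f (restrict x (pts G A))"
  have f': "f' \<in> esurj G A B" unfolding f'_def by (rule compose_esurj(1)[OF xs f])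
  have f'x: "f' z = f (x z)" if "z \<in> pts G A" for z using that by (simp add: f'_def compose_def)
  have k': "(u, v) \<in> ker A B f' \<longleftrightarrow> (x u, x v) \<in> ker A B f" for u v
    unfolding ker_iff[OF esurjD(1)[OF f']] ker_iff[OF esurjD(1)[OF f]]
    using f'x[of u] f'x[of v] permutes_in_image[OF wrD(1)[OF x], of u]
      permutes_in_image[OF wrD(1)[OF x], of v] by auto
  have uniq: "\<exists>!y. y \<in> wr G B \<and> (\<forall>z\<in>pts G A. f' z = y (f z))" if "ract x (ker A B f) = ker A B f"
  proof (rule esurj_factor[OF fin f f'])
    show "ker A B f \<subseteq> ker A B f'"
    proof
      fix w assume "w \<in> ker A B f"
      then obtain u v where w: "w = (u, v)" "(u, v) \<in> ker A B f" by (cases w) auto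
      then have "(x u, x v) \<in> ract x (ker A B f)" unfolding ract_iff(2)[OF x] by blast
      then show "w \<in> ker A B f'" unfolding w(1) k' by (simp only: that)
    qed
  qed
  have ex: "\<exists>y\<in>wr G B. \<forall>z\<in>pts G A. f (x z) = y (f z)" if "ract x (ker A B f) = ker A B f"
    using uniq[OF that] f'x by auto
  have fixed: "ract x (ker A B f) = ker A B f"
    if y: "y \<in> wr G B" "\<forall>z\<in>pts G A. f (x z) = y (f z)" for y
  proof -
    have p: "inv_into UNIV x w \<in> pts G A \<longleftrightarrow> w \<in> pts G A" for w
      using permutes_in_image[OF wrD(1)[OF wr_inv[OF x]]] .
    have "f w = y (f (inv_into UNIV x w))" if "w \<in> pts G A" for w
      using y(2) p[of w] that permutes_inverses(1)[OF wrD(1)[OF x], of w] by metis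
    then have "f (inv_into UNIV x u) = f (inv_into UNIV x v) \<longleftrightarrow> f u = f v" if "u \<in> pts G A" "v \<in> pts G A" for u v
      using that inj_eq[OF wrD(5)[OF y(1)]] by metis
    then have "(u, v) \<in> ract x (ker A B f) \<longleftrightarrow> (u, v) \<in> ker A B f" for u v
      unfolding ract_iff(1)[OF x] ker_iff[OF esurjD(1)[OF f]] p by blast
    then show ?thesis by (intro Set.set_eqI) (metis surj_pair)
  qed
  show "ract x (ker A B f) = ker A B f \<longleftrightarrow> (\<exists>y\<in>wr G B. \<forall>z\<in>pts G A. f (x z) = y (f z))"
    using ex fixed by blast
  show "y = y'" if "y \<in> wr G B" "y' \<in> wr G B" "\<forall>z\<in>pts G A. f (x z) = y (f z)" "\<forall>z\<in>pts G A. f (x z) = y' (f z)"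
    using uniq[OF fixed[OF that(1,3)]] that f'x by auto
qed

definition surj_count :: "nat set \<Rightarrow> nat set \<Rightarrow> ('a \<times> nat \<Rightarrow> 'a \<times> nat) \<Rightarrow> ('a \<times> nat \<Rightarrow> 'a \<times> nat) \<Rightarrow> nat" where
  "surj_count A B x y = card {f \<in> esurj G A B. \<forall>z\<in>pts G A. f (x z) = y (f z)}"

text \<open>Each surjection induces a map from the target of the other onto its own target, so the
  targets have equal size, and the factor |G| cancels.\<close>

lemma esurj_same_card:
  assumes "finite A" "finite B" "finite C" "f \<in> esurj G A B" "f' \<in> esurj G A C" "ker A B f = ker A C f'"
  shows "card B = card C"
proof -
  have "card (pts G B) \<le> card (pts G C)" if f: "f \<in> esurj G A B" and f': "f' \<in> esurj G A C"
    and k: "ker A B f = ker A C f'" and fin: "finite C" for f f' B C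
  proof -
    have eq: "f u = f v" if "u \<in> pts G A" "v \<in> pts G A" "f' u = f' v" for u v
    proof -
      have "(u, v) \<in> ker A C f'" using that by (simp add: ker_iff[OF esurjD(1)[OF f']])
      then have "(u, v) \<in> ker A B f" by (simp only: k)
      then show ?thesis by (simp add: ker_iff[OF esurjD(1)[OF f]])
    qed
    have "pts G B = (\<lambda>w. f (inv_into (pts G A) f' w)) ` f' ` pts G A"
    proof -
      have "f (inv_into (pts G A) f' (f' z)) = f z" if "z \<in> pts G A" for z
        using that by (intro eq) (auto simp: inv_into_into f_inv_into_f)
      then have "(\<lambda>w. f (inv_into (pts G A) f' w)) ` f' ` pts G A = f ` pts G A"
        by (simp add: image_image)
      then show ?thesis using esurjD(2)[OF f] by simp
    qed
    then show ?thesis using esurjD(2)[OF f'] finite_pts[OF fin] by (metis card_image_le)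
  qed
  from this[OF assms(4,5,6,3)] this[OF assms(5,4) assms(6)[symmetric] assms(2)]
  have "card (pts G B) = card (pts G C)" by simp
  then show ?thesis using card_G_pos by (simp add: pts_def card_cartesian_product)
qed

text \<open>This is \<open>\<Sum>\<^sub>r \<mu>(r, 1) = - \<mu>(1, 1)\<close> over the relations \<open>r\<close> fixed by \<open>x\<close>, where a relation with
  quotient \<open>G \<times> [k]\<close> is counted once for each of the \<open>|G|\<^sup>k k!\<close> identifications of the quotient.\<close>

lemma mchar_sum:
  assumes fin: "finite A" and x: "x \<in> wr G A"
  shows "(\<Sum>k\<le>card A. \<Sum>y\<in>wr G {1..k}. of_nat (surj_count A {1..k} x y) * mchar G {1..k} y
    / of_nat (card (carrier G) ^ k * fact k)) = - 1"
proof -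
  let ?F = "{r \<in> frel G A. ract x r = r}"
  define \<mu> where "\<mu> r = - euler {s \<in> frel G A. r \<subset> s} (\<subseteq>) (ract x)" for r
  define c :: "nat \<Rightarrow> rat" where "c k = of_nat (card (carrier G) ^ k * fact k)" for k
  have c: "c k = of_nat (card (wr G {1..k}))" for k
    using card_wr[of "{1..k}"] by (simp add: c_def)
  have c0: "c k \<noteq> 0" for k using card_G_pos by (simp add: c_def)
  \<comment> \<open>A surjection with stable kernel determines \<open>y\<close>, so a sum over pairs
    of \<open>y\<close> and \<open>f\<close> is a sum over \<open>f\<close>, which is then grouped
    by kernels.\<close>
  have inner: "(\<Sum>y\<in>wr G B. of_nat (surj_count A B x y) * mchar G B y) =
      (\<Sum>r\<in>?F. of_nat (card {f \<in> esurj G A B. ker A B f = r}) * \<mu> r)" if B: "finite B" for B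
  proof -
    let ?E = "{f \<in> esurj G A B. ract x (ker A B f) = ker A B f}"
    define E where "E y = {f \<in> esurj G A B. \<forall>z\<in>pts G A. f (x z) = y (f z)}" for y
    have finE: "finite (E y)" for y using finite_esurj[OF fin B] by (simp add: E_def)
    have "(\<Sum>y\<in>wr G B. of_nat (surj_count A B x y) * mchar G B y) = (\<Sum>y\<in>wr G B. \<Sum>f\<in>E y. \<mu> (ker A B f))"
    proof (intro sum.cong HOL.refl)
      fix y assume y: "y \<in> wr G B"
      have "(\<Sum>f\<in>E y. \<mu> (ker A B f)) = (\<Sum>f\<in>E y. mchar G B y)"
        unfolding \<mu>_def by (intro sum.cong HOL.refl mchar_upper[OF x y _ B, symmetric]) (auto simp: E_def)
      then show "of_nat (surj_count A B x y) * mchar G B y = (\<Sum>f\<in>E y. \<mu> (ker A B f))"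
        by (simp add: surj_count_def E_def)
    qed
    also have "\<dots> = (\<Sum>f\<in>(\<Union>y\<in>wr G B. E y). \<mu> (ker A B f))"
    proof (rule sum.UNION_disjoint[symmetric])
      show "\<forall>y\<in>wr G B. \<forall>y'\<in>wr G B. y \<noteq> y' \<longrightarrow> E y \<inter> E y' = {}"
      proof (intro ballI impI, rule ccontr)
        fix y y' assume y: "y \<in> wr G B" "y' \<in> wr G B" "y \<noteq> y'" "E y \<inter> E y' \<noteq> {}"
        then obtain f where "f \<in> E y" "f \<in> E y'" by blast
        then have "f \<in> esurj G A B" "\<forall>z\<in>pts G A. f (x z) = y (f z)" "\<forall>z\<in>pts G A. f (x z) = y' (f z)"
          by (simp_all add: E_def)
        from ker_fixed_iff(2)[OF x this(1) B y(1,2) this(2,3)] y(3) show False by blast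
      qed
    qed (use finE finite_wr[OF B] in auto)
    also have "(\<Union>y\<in>wr G B. E y) = ?E"
      using ker_fixed_iff(1)[OF x _ B] by (auto simp: E_def simp del: split_paired_All)
    also have "(\<Sum>f\<in>?E. \<mu> (ker A B f)) = (\<Sum>r\<in>?F. \<Sum>f\<in>{f \<in> ?E. ker A B f = r}. \<mu> (ker A B f))"
      using finite_esurj[OF fin B] finite_frel[OF fin] pull_frel[OF esurjD(1) idrel_frel]
      by (intro sum.group[symmetric]) auto
    also have "\<dots> = (\<Sum>r\<in>?F. of_nat (card {f \<in> esurj G A B. ker A B f = r}) * \<mu> r)"
    proof (intro sum.cong HOL.refl)
      fix r assume r: "r \<in> ?F"
      then have "{f \<in> ?E. ker A B f = r} = {f \<in> esurj G A B. ker A B f = r}" by auto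
      then show "(\<Sum>f\<in>{f \<in> ?E. ker A B f = r}. \<mu> (ker A B f)) =
        of_nat (card {f \<in> esurj G A B. ker A B f = r}) * \<mu> r" by simp
    qed
    finally show ?thesis .
  qed
  \<comment> \<open>Only one size of the quotient occurs for \<open>r\<close>, and there the number
    of surjections is the order of the wreath product.\<close>
  have one: "(\<Sum>k\<le>card A. of_nat (card {f \<in> esurj G A {1..k}. ker A {1..k} f = r}) / c k) = 1" if r: "r \<in> ?F" for r
  proof -
    obtain j f where f: "f \<in> esurj G A {1..j}" "r = ker A {1..j} f" "j \<le> card A"
      using frel_quotient[OF fin] r by blast
    have "of_nat (card {f \<in> esurj G A {1..k}. ker A {1..k} f = r}) / c k = (if k = j then 1 else 0)" for k
    proof (cases "k = j")
      case True
      then show ?thesis using card_esurj_ker[OF _ f(1)] c0 by (simp add: f(2) c)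
    next
      case False
      have "k = j" if "f' \<in> esurj G A {1..k}" "ker A {1..k} f' = r" for f'
        using esurj_same_card[OF fin _ _ that(1) f(1)] that(2) f(2) by simp
      then have "{f \<in> esurj G A {1..k}. ker A {1..k} f = r} = {}" using False by blast
      then have "card {f \<in> esurj G A {1..k}. ker A {1..k} f = r} = 0" by (simp only: card.empty)
      then show ?thesis using False by simp
    qed
    then show ?thesis using f(3) by simp
  qed
  have "(\<Sum>k\<le>card A. \<Sum>y\<in>wr G {1..k}. of_nat (surj_count A {1..k} x y) * mchar G {1..k} y / c k) =
      (\<Sum>k\<le>card A. \<Sum>r\<in>?F. of_nat (card {f \<in> esurj G A {1..k}. ker A {1..k} f = r}) * \<mu> r / c k)"
    using inner by (simp add: sum_divide_distrib[symmetric])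
  also have "\<dots> = (\<Sum>r\<in>?F. (\<Sum>k\<le>card A. of_nat (card {f \<in> esurj G A {1..k}. ker A {1..k} f = r}) / c k) * \<mu> r)"
    by (subst sum.swap) (simp add: sum_distrib_right)
  also have "\<dots> = (\<Sum>r\<in>?F. \<mu> r)"
    using one by (intro sum.cong HOL.refl) simp
  also have "\<dots> = - (\<Sum>r\<in>?F. euler {s \<in> frel G A. r \<subset> s} (\<subseteq>) (ract x))"
    by (simp add: \<mu>_def sum_negf)
  also have "(\<Sum>r\<in>?F. euler {s \<in> frel G A. r \<subset> s} (\<subseteq>) (ract x)) = 1"
    by (rule sum_upper_euler[where b = "idrel G A"])
      (use finite_frel[OF fin] inj_on_ract[OF x] ract_mono_iff[OF x] idrel_frel ract_idrel[OF x] idrel_sub in auto)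
  finally show ?thesis by (simp add: c_def)
qed

end

section \<open>Splitting off the cycle through a point\<close>

context fgroup
begin

abbreviation bp where "bp \<equiv> base_perm G"

definition rs :: "('a \<times> nat \<Rightarrow> 'a \<times> nat) \<Rightarrow> nat set \<Rightarrow> 'a \<times> nat \<Rightarrow> 'a \<times> nat" where
  "rs x Z = perm_restrict x (pts G Z)"

text \<open>The base permutation is a single cycle through all of \<open>Z\<close>, and
  \<open>a\<close> serves as its base point.\<close>

definition cyc :: "nat \<Rightarrow> nat set \<Rightarrow> ('a \<times> nat \<Rightarrow> 'a \<times> nat) set" where
  "cyc a Z = {x \<in> wr G Z. orbit (bp x) a = Z}"

lemma rs_in [simp]: "z \<in> pts G Z \<Longrightarrow> rs x Z z = x z"
  and rs_out: "z \<notin> pts G Z \<Longrightarrow> rs x Z z = z"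
  by (simp_all add: rs_def perm_restrict_def)

lemma one_pts: "(\<one>, m) \<in> pts G A \<longleftrightarrow> m \<in> A"
  by (simp add: pts_def)

lemma wr_pt:
  assumes "x \<in> wr G A" "(g, m) \<in> pts G A"
  shows "x (g, m) = (g \<otimes> fst (x (\<one>, m)), bp x m)"
  using wrD(2)[OF assms(1), of g "(\<one>, m)"] assms(2) by (simp add: pts_def lmult_def base_perm_def)

lemma bp_rs: "m \<in> Z \<Longrightarrow> bp (rs x Z) m = bp x m"
  by (simp add: base_perm_def one_pts)

lemma snd_wr: "x \<in> wr G A \<Longrightarrow> z \<in> pts G A \<Longrightarrow> snd (x z) = bp x (snd z)"
  by (cases z) (simp add: wr_pt)

lemma pts_stable:
  assumes "x \<in> wr G A" "Z \<subseteq> A" "bp x ` Z = Z" "z \<in> pts G Z"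
  shows "x z \<in> pts G Z"
proof -
  have z: "z \<in> pts G A" using assms(4) pts_mono[OF assms(2)] by blast
  have "snd (x z) \<in> Z" using snd_wr[OF assms(1) z] assms(3,4) by (auto simp: pts_def)
  moreover have "x z \<in> pts G A" by (rule wrD(3)[OF assms(1) z])
  ultimately show ?thesis by (auto simp: pts_def mem_Times_iff)
qed

lemma rs_wr:
  assumes "finite A" "x \<in> wr G A" "Z \<subseteq> A" "bp x ` Z = Z"
  shows "rs x Z \<in> wr G Z"
proof (rule wrI)
  have "inj_on (rs x Z) (pts G Z)"
    using wrD(5)[OF assms(2)] by (auto simp: inj_on_def dest: injD simp del: split_paired_All)
  moreover have "rs x Z ` pts G Z \<subseteq> pts G Z"
    using pts_stable[OF assms(2-4)] by (intro image_subsetI) simp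
  ultimately show "bij_betw (rs x Z) (pts G Z) (pts G Z)"
    using finite_pts[OF finite_subset[OF assms(3,1)]] endo_inj_surj unfolding bij_betw_def by blast
  fix g z assume gz: "g \<in> carrier G" "z \<in> pts G Z"
  then have "z \<in> pts G A" using pts_mono[OF assms(3)] by blast
  then show "rs x Z (lmult G g z) = lmult G g (rs x Z z)"
    using wrD(2)[OF assms(2) gz(1)] gz by simp
qed (rule rs_out)

lemma wr_mono:
  assumes "Z \<subseteq> A" "y \<in> wr G Z"
  shows "y \<in> wr G A"
proof -
  have "y (lmult G g z) = lmult G g (y z)" if "g \<in> carrier G" "z \<in> pts G A" for g z
  proof (cases "z \<in> pts G Z")
    case True
    then show ?thesis using wrD(2)[OF assms(2) that(1)] by simp
  next
    case False
    then have "lmult G g z \<notin> pts G Z" using that by (auto simp: pts_def lmult_def)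
    then show ?thesis using False permutes_not_in[OF wrD(1)[OF assms(2)]] by simp
  qed
  then show ?thesis
    using permutes_subset[OF wrD(1)[OF assms(2)] pts_mono[OF assms(1)]] by (simp add: wr_def equivar_def)
qed

lemma wr_comp: "x \<in> wr G A \<Longrightarrow> y \<in> wr G A \<Longrightarrow> x \<circ> y \<in> wr G A"
proof -
  assume xy: "x \<in> wr G A" "y \<in> wr G A"
  have "(x \<circ> y) (lmult G g z) = lmult G g ((x \<circ> y) z)" if "g \<in> carrier G" "z \<in> pts G A" for g z
    using wrD(2)[OF xy(1) that(1) wrD(3)[OF xy(2) that(2)]] wrD(2)[OF xy(2) that] by simp
  then show ?thesis
    using permutes_compose[OF wrD(1)[OF xy(2)] wrD(1)[OF xy(1)]] by (simp add: wr_def equivar_def)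
qed

lemma stable_compl:
  assumes "finite A" "x \<in> wr G A" "Z \<subseteq> A" "bp x ` Z = Z"
  shows "bp x ` (A - Z) = A - Z"
  unfolding image_set_diff[OF permutes_inj[OF base_permutes[OF assms(1,2)]]] assms(4)
    permutes_image[OF base_permutes[OF assms(1,2)]] by (rule refl)

lemma orbit_stable:
  assumes "finite A" "x \<in> wr G A" "a \<in> A"
  shows "orbit (bp x) a \<subseteq> A" "bp x ` orbit (bp x) a = orbit (bp x) a" "a \<in> orbit (bp x) a"
proof -
  note p = base_permutes[OF assms(1,2)]
  show sub: "orbit (bp x) a \<subseteq> A" by (rule permutes_orbit_subset[OF p assms(3)])
  have "bp x ` orbit (bp x) a \<subseteq> orbit (bp x) a" by (auto intro: orbit.step)
  then show "bp x ` orbit (bp x) a = orbit (bp x) a"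
    by (intro endo_inj_surj finite_subset[OF sub assms(1)] inj_on_subset[OF permutes_inj[OF p]]) auto
  show "a \<in> orbit (bp x) a"
    by (rule permutation_self_in_orbit) (auto simp: permutation_permutes intro!: exI[of _ A] p assms(1))
qed

lemma orbit_rs:
  assumes "bp x ` Z = Z" "a \<in> Z"
  shows "orbit (bp (rs x Z)) a = orbit (bp x) a"
proof (rule orbit_cong0[OF assms(2)])
  show "bp (rs x Z) \<in> Z \<rightarrow> Z" using assms(1) by (auto simp: bp_rs)
qed (simp add: bp_rs)

text \<open>Every \<open>x\<close> is the product of its restrictions to the fibres over the cycle
  through \<open>a\<close> and to the remaining fibres; a function that is multiplicative under such
  splittings turns this into a product of sums.\<close>

lemma sum_wr_decomp:
  fixes \<phi> :: "nat set \<Rightarrow> ('a \<times> nat \<Rightarrow> 'a \<times> nat) \<Rightarrow> 'r::comm_semiring_1"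
  assumes fin: "finite A" and a: "a \<in> A"
    and mult: "\<And>x Z. x \<in> wr G A \<Longrightarrow> Z \<subseteq> A \<Longrightarrow> bp x ` Z = Z \<Longrightarrow> \<phi> A x = \<phi> Z (rs x Z) * \<phi> (A - Z) (rs x (A - Z))"
  shows "(\<Sum>x\<in>wr G A. \<phi> A x) = (\<Sum>Z | Z \<subseteq> A \<and> a \<in> Z. (\<Sum>x\<in>cyc a Z. \<phi> Z x) * (\<Sum>x\<in>wr G (A - Z). \<phi> (A - Z) x))"
proof -
  let ?T = "SIGMA Z:{Z. Z \<subseteq> A \<and> a \<in> Z}. cyc a Z \<times> wr G (A - Z)"
  have finZ: "finite {Z. Z \<subseteq> A \<and> a \<in> Z}" using fin by (auto intro: finite_subset[of _ "Pow A"])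
  have "(\<Sum>x\<in>wr G A. \<phi> A x) = (\<Sum>(Z, y, w)\<in>?T. \<phi> Z y * \<phi> (A - Z) w)"
  proof (rule sum.reindex_bij_witness[of _ "\<lambda>(Z, y, w). y \<circ> w"
        "\<lambda>x. (orbit (bp x) a, rs x (orbit (bp x) a), rs x (A - orbit (bp x) a))"])
    fix x assume x: "x \<in> wr G A"
    define Z where "Z = orbit (bp x) a"
    have Z: "Z \<subseteq> A" "bp x ` Z = Z" "a \<in> Z" using orbit_stable[OF fin x a] by (auto simp: Z_def)
    have Z': "A - Z \<subseteq> A" "bp x ` (A - Z) = A - Z" using stable_compl[OF fin x Z(1,2)] by auto
    show "(case (orbit (bp x) a, rs x (orbit (bp x) a), rs x (A - orbit (bp x) a)) of (Z, y, w) \<Rightarrow> y \<circ> w) = x"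
      unfolding Z_def[symmetric] prod.case
    proof
      fix z consider "z \<in> pts G Z" | "z \<in> pts G (A - Z)" | "z \<notin> pts G A" using Z(1) by (auto simp: pts_def)
      then show "(rs x Z \<circ> rs x (A - Z)) z = x z"
      proof cases
        case 1
        then have "z \<notin> pts G (A - Z)" by (auto simp: pts_def)
        then show ?thesis using 1 by (simp add: rs_out)
      next
        case 2
        then have "x z \<in> pts G (A - Z)" by (rule pts_stable[OF x Z'])
        then have "x z \<notin> pts G Z" by (auto simp: pts_def)
        then show ?thesis using 2 by (simp add: rs_out)
      next
        case 3
        then have "z \<notin> pts G Z" "z \<notin> pts G (A - Z)" using Z(1) by (auto simp: pts_def)
        then show ?thesis using permutes_not_in[OF wrD(1)[OF x] 3] by (simp add: rs_out)
      qed
    qed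
    show "(orbit (bp x) a, rs x (orbit (bp x) a), rs x (A - orbit (bp x) a)) \<in> ?T"
      unfolding Z_def[symmetric]
      using Z rs_wr[OF fin x Z(1,2)] rs_wr[OF fin x Z'] orbit_rs[OF Z(2,3)] by (simp add: cyc_def Z_def)
    show "(case (orbit (bp x) a, rs x (orbit (bp x) a), rs x (A - orbit (bp x) a)) of
        (Z, y, w) \<Rightarrow> \<phi> Z y * \<phi> (A - Z) w) = \<phi> A x"
      unfolding Z_def[symmetric] prod.case using mult[OF x Z(1,2)] by simp
  next
    fix p assume "p \<in> ?T"
    then obtain Z y w where p: "p = (Z, y, w)" "Z \<subseteq> A" "a \<in> Z" "y \<in> wr G Z" "orbit (bp y) a = Z" "w \<in> wr G (A - Z)"
      by (auto simp: cyc_def)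
    define x where "x = y \<circ> w"
    have x1: "x z = y z" if "z \<in> pts G Z" for z
    proof -
      have "z \<notin> pts G (A - Z)" using that by (auto simp: pts_def)
      then show ?thesis using permutes_not_in[OF wrD(1)[OF p(6)]] by (simp add: x_def)
    qed
    have x2: "x z = w z" if "z \<in> pts G (A - Z)" for z
    proof -
      have "w z \<in> pts G (A - Z)" by (rule wrD(3)[OF p(6) that])
      then have "w z \<notin> pts G Z" by (auto simp: pts_def)
      then show ?thesis using permutes_not_in[OF wrD(1)[OF p(4)]] by (simp add: x_def)
    qed
    have xA: "x \<in> wr G A" unfolding x_def
      by (rule wr_comp[OF wr_mono[OF p(2,4)] wr_mono[OF _ p(6)]]) auto
    have b: "bp y m = bp x m" if "m \<in> Z" for m using x1[of "(\<one>, m)"] that by (simp add: base_perm_def one_pts)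
    have finZ: "finite Z" using finite_subset[OF p(2) fin] .
    have "orbit (bp y) a = orbit (bp x) a"
      by (rule orbit_cong0[OF p(3) _ b]) (use permutes_in_image[OF base_permutes[OF finZ p(4)]] in auto)
    then have o: "orbit (bp x) a = Z" using p(5) by simp
    have r1: "rs x Z = y"
    proof
      fix z show "rs x Z z = y z"
        using x1 permutes_not_in[OF wrD(1)[OF p(4)]] by (cases "z \<in> pts G Z") (simp_all add: rs_out)
    qed
    have r2: "rs x (A - Z) = w"
    proof
      fix z show "rs x (A - Z) z = w z"
        using x2 permutes_not_in[OF wrD(1)[OF p(6)]] by (cases "z \<in> pts G (A - Z)") (simp_all add: rs_out)
    qed
    have e: "(case p of (Z, y, w) \<Rightarrow> y \<circ> w) = x" by (simp add: p(1) x_def)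
    show "(orbit (bp (case p of (Z, y, w) \<Rightarrow> y \<circ> w)) a,
         rs (case p of (Z, y, w) \<Rightarrow> y \<circ> w) (orbit (bp (case p of (Z, y, w) \<Rightarrow> y \<circ> w)) a),
         rs (case p of (Z, y, w) \<Rightarrow> y \<circ> w) (A - orbit (bp (case p of (Z, y, w) \<Rightarrow> y \<circ> w)) a)) = p"
      by (simp only: e o r1 r2) (simp only: p(1))
    show "(case p of (Z, y, w) \<Rightarrow> y \<circ> w) \<in> wr G A" unfolding e by (rule xA)
  qed
  also have "\<dots> = (\<Sum>Z | Z \<subseteq> A \<and> a \<in> Z. \<Sum>(y, w)\<in>cyc a Z \<times> wr G (A - Z). \<phi> Z y * \<phi> (A - Z) w)"
  proof (rule sum.Sigma[symmetric, OF finZ])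
    have "finite (cyc a Z \<times> wr G (A - Z))" if "Z \<subseteq> A" for Z
      using finite_wr[OF finite_subset[OF that fin]] finite_wr[of "A - Z"] fin by (simp add: cyc_def)
    then show "\<forall>Z\<in>{Z. Z \<subseteq> A \<and> a \<in> Z}. finite (cyc a Z \<times> wr G (A - Z))" by blast
  qed
  also have "\<dots> = (\<Sum>Z | Z \<subseteq> A \<and> a \<in> Z. (\<Sum>x\<in>cyc a Z. \<phi> Z x) * (\<Sum>x\<in>wr G (A - Z). \<phi> (A - Z) x))"
    by (simp add: sum_product sum.cartesian_product)
  finally show ?thesis .
qed

section \<open>Counting elements with a single cycle\<close>

lemma card_subsets_with_point:
  assumes "finite A" "a \<in> A" "l \<ge> 1"
  shows "card {Z. Z \<subseteq> A \<and> a \<in> Z \<and> card Z = l} = (card A - 1) choose (l - 1)"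
proof -
  have "bij_betw (insert a) {Y. Y \<subseteq> A - {a} \<and> card Y = l - 1} {Z. Z \<subseteq> A \<and> a \<in> Z \<and> card Z = l}"
  proof (rule bij_betw_byWitness[of _ "\<lambda>Z. Z - {a}"])
    show "insert a ` {Y. Y \<subseteq> A - {a} \<and> card Y = l - 1} \<subseteq> {Z. Z \<subseteq> A \<and> a \<in> Z \<and> card Z = l}"
    proof (rule image_subsetI)
      fix Y assume Y: "Y \<in> {Y. Y \<subseteq> A - {a} \<and> card Y = l - 1}"
      then have "finite Y" "a \<notin> Y" using assms(1) finite_subset by auto
      then have "card (insert a Y) = l" using Y assms(3) by simp
      then show "insert a Y \<in> {Z. Z \<subseteq> A \<and> a \<in> Z \<and> card Z = l}" using Y assms(2) by auto
    qed
  qed (use assms finite_subset in \<open>auto simp: card_Diff_singleton\<close>)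
  then have "card {Z. Z \<subseteq> A \<and> a \<in> Z \<and> card Z = l} = card {Y. Y \<subseteq> A - {a} \<and> card Y = l - 1}"
    by (rule bij_betw_same_card[symmetric])
  then show ?thesis using assms by (simp add: n_subsets)
qed

lemma sum_subsets_with_point:
  fixes F :: "nat \<Rightarrow> 'r::comm_semiring_1"
  assumes "finite A" "a \<in> A" "card A = Suc n"
  shows "(\<Sum>Z | Z \<subseteq> A \<and> a \<in> Z. F (card Z)) = (\<Sum>l\<le>n. of_nat (n choose l) * F (Suc l))"
proof -
  let ?S = "{Z. Z \<subseteq> A \<and> a \<in> Z}"
  have fin: "finite ?S" by (rule finite_subset[of _ "Pow A"]) (use assms in auto)
  have c: "card Z - 1 \<in> {..n} \<and> card Z \<ge> 1" if "Z \<in> ?S" for Z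
  proof -
    have "card Z \<le> Suc n" using that assms by (metis card_mono mem_Collect_eq)
    moreover have "card Z \<ge> 1" using that assms finite_subset[of Z A] by (auto simp: Suc_le_eq card_gt_0_iff)
    ultimately show ?thesis by auto
  qed
  have "(\<Sum>Z\<in>?S. F (card Z)) = (\<Sum>l\<le>n. \<Sum>Z\<in>{Z \<in> ?S. card Z - 1 = l}. F (card Z))"
    by (rule sum.group[symmetric]) (use fin c in auto)
  also have "\<dots> = (\<Sum>l\<le>n. \<Sum>Z\<in>{Z. Z \<subseteq> A \<and> a \<in> Z \<and> card Z = Suc l}. F (Suc l))"
  proof (intro sum.cong)
    fix l show "{Z \<in> ?S. card Z - 1 = l} = {Z. Z \<subseteq> A \<and> a \<in> Z \<and> card Z = Suc l}"
    proof -
      have "card Z - 1 = l \<longleftrightarrow> card Z = Suc l" if "Z \<in> ?S" for Z using c[OF that] by auto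
      then show ?thesis by blast
    qed
  qed auto
  finally show ?thesis using card_subsets_with_point[OF assms(1,2)] assms(3) by simp
qed

text \<open>Splitting off the cycle through \<open>a\<close> counts the whole wreath product. The
  terms with a shorter cycle are known by induction, and solving for the remaining term gives the
  formula.\<close>

lemma card_cyc:
  "finite A \<Longrightarrow> a \<in> A \<Longrightarrow> card (cyc a A) = card (carrier G) ^ card A * fact (card A - 1)"
proof (induction "card A" arbitrary: A rule: less_induct)
  case less
  define q where "q = card (carrier G)"
  obtain n where n: "card A = Suc n" using less.prems by (metis card_Suc_Diff1)
  define F :: "nat \<Rightarrow> nat" where "F l = (q ^ l * fact (l - 1)) * (q ^ (Suc n - l) * fact (Suc n - l))" for l
  have sub: "card Z < card A" "finite Z" if "Z \<subseteq> A" "Z \<noteq> A" for Z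
    using that less.prems by (auto intro: psubset_card_mono finite_subset)
  have "card (wr G A) = (\<Sum>Z | Z \<subseteq> A \<and> a \<in> Z. card (cyc a Z) * card (wr G (A - Z)))"
    using sum_wr_decomp[OF less.prems, of "\<lambda>_ _. 1 :: nat"] by simp
  also have "\<dots> = card (cyc a A) + (\<Sum>Z\<in>{Z. Z \<subseteq> A \<and> a \<in> Z} - {A}. card (cyc a Z) * card (wr G (A - Z)))"
    using less.prems card_wr[of "{}"] by (subst sum.remove[of _ A]) auto
  also have "(\<Sum>Z\<in>{Z. Z \<subseteq> A \<and> a \<in> Z} - {A}. card (cyc a Z) * card (wr G (A - Z))) =
      (\<Sum>Z\<in>{Z. Z \<subseteq> A \<and> a \<in> Z} - {A}. F (card Z))"
  proof (intro sum.cong HOL.refl)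
    fix Z assume "Z \<in> {Z. Z \<subseteq> A \<and> a \<in> Z} - {A}"
    then have Z: "Z \<subseteq> A" "a \<in> Z" "Z \<noteq> A" by auto
    note s = sub[OF Z(1,3)]
    have "card (A - Z) = Suc n - card Z" using card_Diff_subset[OF s(2) Z(1)] n by simp
    then show "card (cyc a Z) * card (wr G (A - Z)) = F (card Z)"
      using less.hyps[OF s Z(2)] card_wr[of "A - Z"] less.prems by (simp add: F_def q_def)
  qed
  finally have 1: "card (wr G A) = card (cyc a A) + (\<Sum>Z\<in>{Z. Z \<subseteq> A \<and> a \<in> Z} - {A}. F (card Z))" .
  have "(\<Sum>Z | Z \<subseteq> A \<and> a \<in> Z. F (card Z)) = F (card A) + (\<Sum>Z\<in>{Z. Z \<subseteq> A \<and> a \<in> Z} - {A}. F (card Z))"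
    using less.prems by (subst sum.remove[of _ A]) auto
  moreover have "(\<Sum>Z | Z \<subseteq> A \<and> a \<in> Z. F (card Z)) = (\<Sum>l\<le>n. (n choose l) * F (Suc l))"
    using sum_subsets_with_point[OF less.prems n, of F] by simp
  \<comment> \<open>All lengths of the cycle through \<open>a\<close> are equally frequent: each
    contributes n! q^(n+1), and n + 1 such terms make up the order of the wreath product.\<close>
  moreover have "(\<Sum>l\<le>n. (n choose l) * F (Suc l)) = (\<Sum>l\<le>n. fact n * q ^ Suc n)"
  proof (intro sum.cong HOL.refl)
    fix l assume "l \<in> {..n}"
    then have l: "l \<le> n" by simp
    have "q ^ Suc l * q ^ (n - l) = q ^ Suc n" using l by (simp flip: power_add add: mult.assoc)
    moreover have "fact l * fact (n - l) * (n choose l) = fact n" by (rule binomial_fact_lemma[OF l])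
    moreover have "(n choose l) * F (Suc l) = (fact l * fact (n - l) * (n choose l)) * (q ^ Suc l * q ^ (n - l))"
      by (simp add: F_def)
    ultimately show "(n choose l) * F (Suc l) = fact n * q ^ Suc n" by simp
  qed
  ultimately have 2: "Suc n * (fact n * q ^ Suc n) = F (card A) + (\<Sum>Z\<in>{Z. Z \<subseteq> A \<and> a \<in> Z} - {A}. F (card Z))"
    by simp
  have "card (wr G A) = Suc n * (fact n * q ^ Suc n)"
    using card_wr[OF less.prems(1)] by (simp add: n q_def distrib_left distrib_right mult_ac)
  with 1 2 have "card (cyc a A) = F (card A)" by simp
  then show ?case by (simp add: F_def n q_def)
qed

end

section \<open>Weighted sums over the wreath product\<close>

lemma orbit_enum:
  assumes "a \<in> orbit f a"
  shows "(f ^^ card (orbit f a)) a = a" "inj_on (\<lambda>j. (f ^^ j) a) {..<card (orbit f a)}"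
    "orbit f a = (\<lambda>j. (f ^^ j) a) ` {..<card (orbit f a)}"
proof -
  have c: "card (orbit f a) = funpow_dist1 f a a"
    using orbit_conv_funpow_dist1[OF assms] card_image[OF inj_on_funpow_dist1[OF assms]]
    by (metis card_atLeastLessThan diff_zero)
  show "(f ^^ card (orbit f a)) a = a" unfolding c by (rule funpow_dist1_prop[OF assms])
  show "inj_on (\<lambda>j. (f ^^ j) a) {..<card (orbit f a)}"
    unfolding c lessThan_atLeast0 by (rule inj_on_funpow_dist1[OF assms])
  show "orbit f a = (\<lambda>j. (f ^^ j) a) ` {..<card (orbit f a)}"
    unfolding c lessThan_atLeast0 by (rule orbit_conv_funpow_dist1[OF assms])
qed

context fgroup
begin

text \<open>The displacement of (1, m) in the group after \<open>j\<close> steps. When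
  \<open>j\<close> is the length of the cycle of \<open>m\<close>, its conjugacy class is the type
  of that cycle.\<close>

definition gain :: "('a \<times> nat \<Rightarrow> 'a \<times> nat) \<Rightarrow> nat \<Rightarrow> nat \<Rightarrow> 'a" where
  "gain x j m = fst ((x ^^ j) (\<one>, m))"

lemma wr_funpow: "x \<in> wr G A \<Longrightarrow> x ^^ j \<in> wr G A"
proof (induction j)
  case 0
  then show ?case by (simp add: wr_def equivar_def permutes_def)
next
  case (Suc j)
  then show ?case using wr_comp[of x A "x ^^ j"] by (simp only: funpow.simps)
qed

lemma funpow_pt:
  assumes "x \<in> wr G A" "m \<in> A"
  shows "(x ^^ j) (\<one>, m) = (gain x j m, (bp x ^^ j) m)" "(bp x ^^ j) m \<in> A" "gain x j m \<in> carrier G"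
proof -
  have p: "(x ^^ j) (\<one>, m) \<in> pts G A" for j
    by (rule wrD(3)[OF wr_funpow[OF assms(1)]]) (simp add: one_pts assms)
  have "snd ((x ^^ j) (\<one>, m)) = (bp x ^^ j) m"
  proof (induction j)
    case (Suc j)
    then show ?case using snd_wr[OF assms(1) p[of j]] by simp
  qed simp
  then show "(x ^^ j) (\<one>, m) = (gain x j m, (bp x ^^ j) m)" by (simp add: gain_def prod_eq_iff)
  with p[of j] show "(bp x ^^ j) m \<in> A" "gain x j m \<in> carrier G" by (simp_all add: pts_def)
qed

lemma funpow_lmult:
  assumes "x \<in> wr G A" "g \<in> carrier G" "z \<in> pts G A"
  shows "(x ^^ j) (lmult G g z) = lmult G g ((x ^^ j) z)"
  by (rule wrD(2)[OF wr_funpow[OF assms(1)] assms(2,3)])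

lemma gain_0 [simp]: "gain x 0 m = \<one>"
  by (simp add: gain_def)

lemma cycD:
  assumes "finite Z" "x \<in> cyc a Z"
  shows "x \<in> wr G Z" "a \<in> Z" "(bp x ^^ card Z) a = a" "inj_on (\<lambda>j. (bp x ^^ j) a) {..<card Z}"
    "Z = (\<lambda>j. (bp x ^^ j) a) ` {..<card Z}" "m \<in> Z \<Longrightarrow> orbit (bp x) m = Z" "0 < card Z"
proof -
  show x: "x \<in> wr G Z" using assms by (simp add: cyc_def)
  have o: "orbit (bp x) a = Z" using assms by (simp add: cyc_def)
  note p = base_permutes[OF assms(1) x]
  have perm: "permutation (bp x)" using p assms(1) by (auto simp: permutation_permutes)
  have s: "a \<in> orbit (bp x) a" by (rule permutation_self_in_orbit[OF perm])
  then show "a \<in> Z" using o by simp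
  then show "0 < card Z" using assms(1) by (auto simp: card_gt_0_iff)
  show "(bp x ^^ card Z) a = a" "inj_on (\<lambda>j. (bp x ^^ j) a) {..<card Z}"
    "Z = (\<lambda>j. (bp x ^^ j) a) ` {..<card Z}"
    using orbit_enum[OF s] unfolding o by blast+
  show "orbit (bp x) m = Z" if "m \<in> Z"
    using orbit_cyclic_eq3[OF cyclic_on_orbit[OF p assms(1)], of m a] that o by simp
qed

text \<open>Right translation by \<open>k\<close> over the point \<open>a\<close> multiplies the type of the cycle through \<open>a\<close>
  by \<open>k\<close>, so all types are equally frequent.\<close>

definition rtrans :: "nat \<Rightarrow> 'a \<Rightarrow> 'a \<times> nat \<Rightarrow> 'a \<times> nat" where
  "rtrans a k z = (if z \<in> pts G {a} then (fst z \<otimes> k, a) else z)"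

lemma rtrans_comp:
  assumes "k \<in> carrier G" "k' \<in> carrier G"
  shows "rtrans a k \<circ> rtrans a k' = rtrans a (k' \<otimes> k)"
  using assms by (auto simp: rtrans_def pts_def fun_eq_iff m_assoc)

lemma rtrans_one: "rtrans a \<one> = id"
  by (auto simp: rtrans_def pts_def fun_eq_iff)

lemma rtrans_wr:
  assumes "k \<in> carrier G"
  shows "rtrans a k \<in> wr G {a}"
proof (rule wrI)
  have "rtrans a k (rtrans a (inv k) z) = z" "rtrans a (inv k) (rtrans a k z) = z" for z
    using fun_cong[OF rtrans_comp[of k "inv k" a], of z] fun_cong[OF rtrans_comp[of "inv k" k a], of z] assms
    by (simp_all add: rtrans_one)
  moreover have "rtrans a k' z \<in> pts G {a}" if "k' \<in> carrier G" "z \<in> pts G {a}" for k' z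
    using that by (auto simp: rtrans_def pts_def)
  ultimately show "bij_betw (rtrans a k) (pts G {a}) (pts G {a})"
    using assms by (intro bij_betw_byWitness[of _ "rtrans a (inv k)"]) (auto simp del: split_paired_All)
  fix g z assume g: "g \<in> carrier G" and "z \<in> pts G {a}"
  then obtain h where "z = (h, a)" "h \<in> carrier G" by (auto simp: pts_def)
  then show "rtrans a k (lmult G g z) = lmult G g (rtrans a k z)"
    using g assms by (simp add: rtrans_def pts_def lmult_def m_assoc)
qed (simp add: rtrans_def)

lemma rtrans_cyc:
  assumes fin: "finite Z" and x: "x \<in> cyc a Z" and k: "k \<in> carrier G"
  shows "x \<circ> rtrans a k \<in> cyc a Z" "gain (x \<circ> rtrans a k) (card Z) a = k \<otimes> gain x (card Z) a"
proof -
  note xd = cycD[OF fin x]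
  let ?y = "x \<circ> rtrans a k"
  have y: "?y \<in> wr G Z" using wr_comp[OF xd(1) wr_mono[OF _ rtrans_wr[OF k]]] xd(2) by simp
  have b: "bp ?y m = bp x m" for m
  proof (cases "m = a")
    case True
    then show ?thesis using wr_pt[OF xd(1), of k a] k xd(2) by (simp add: base_perm_def rtrans_def pts_def)
  next
    case False
    then show ?thesis by (simp add: base_perm_def rtrans_def pts_def)
  qed
  then have "bp ?y = bp x" by auto
  then show "?y \<in> cyc a Z" using y x by (simp add: cyc_def)
  have "Suc j \<le> card Z \<Longrightarrow> (?y ^^ Suc j) (\<one>, a) = lmult G k ((x ^^ Suc j) (\<one>, a))" for j
  proof (induction j)
    case 0
    have "?y (\<one>, a) = x (lmult G k (\<one>, a))" using k by (simp add: rtrans_def pts_def lmult_def)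
    then show ?case using wrD(2)[OF xd(1) k] xd(2) by (simp add: one_pts)
  next
    case (Suc j)
    \<comment> \<open>Before the full turn the walk does not come back to the fibre over
      \<open>a\<close>, so the translation acts only in the first step.\<close>
    have ne: "(bp x ^^ Suc j) a \<noteq> a"
      using inj_onD[OF xd(4), of "Suc j" 0] Suc.prems by auto
    let ?z = "(x ^^ Suc j) (\<one>, a)"
    have z: "?z \<in> pts G Z" using wrD(3)[OF wr_funpow[OF xd(1)]] xd(2) by (simp only: one_pts)
    have "snd ?z \<noteq> a" using funpow_pt(1)[OF xd(1,2), of "Suc j"] ne by simp
    then have r: "rtrans a k (lmult G k ?z) = lmult G k ?z" by (auto simp: rtrans_def pts_def lmult_def)
    have IH: "(?y ^^ Suc j) (\<one>, a) = lmult G k ?z" using Suc.prems by (intro Suc.IH) simp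
    have "(?y ^^ Suc (Suc j)) (\<one>, a) = ?y ((?y ^^ Suc j) (\<one>, a))" by (simp only: funpow.simps comp_apply)
    also have "\<dots> = x (rtrans a k (lmult G k ?z))" unfolding IH by (rule comp_apply)
    also have "\<dots> = lmult G k (x ?z)" unfolding r by (rule wrD(2)[OF xd(1) k z])
    also have "\<dots> = lmult G k ((x ^^ Suc (Suc j)) (\<one>, a))" by simp
    finally show ?case .
  qed
  from this[of "card Z - 1"] xd(7) have "(?y ^^ card Z) (\<one>, a) = lmult G k ((x ^^ card Z) (\<one>, a))" by simp
  then show "gain ?y (card Z) a = k \<otimes> gain x (card Z) a" by (simp add: gain_def lmult_def)
qed

lemma card_cyc_gain:
  assumes fin: "finite Z" and a: "a \<in> Z" and h: "h \<in> carrier G"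
  shows "card {x \<in> cyc a Z. gain x (card Z) a = h} = card (carrier G) ^ (card Z - 1) * fact (card Z - 1)"
proof -
  let ?C = "\<lambda>h. {x \<in> cyc a Z. gain x (card Z) a = h}"
  have eq: "card (?C k) = card (?C \<one>)" if k: "k \<in> carrier G" for k
  proof -
    have i: "x \<circ> rtrans a k \<circ> rtrans a k' = x" if "k \<in> carrier G" "k' \<in> carrier G" "k' \<otimes> k = \<one>" for x k k'
      using rtrans_comp[OF that(1,2), of a] by (simp add: comp_assoc that(3) rtrans_one)
    have "bij_betw (\<lambda>x. x \<circ> rtrans a k) (?C \<one>) (?C k)"
    proof (rule bij_betw_byWitness[of _ "\<lambda>x. x \<circ> rtrans a (inv k)"])
      show "\<forall>x\<in>?C \<one>. (x \<circ> rtrans a k) \<circ> rtrans a (inv k) = x"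
        using i[OF k inv_closed[OF k] l_inv[OF k]] by blast
      show "\<forall>x\<in>?C k. (x \<circ> rtrans a (inv k)) \<circ> rtrans a k = x"
        using i[OF inv_closed[OF k] k r_inv[OF k]] by blast
      show "(\<lambda>x. x \<circ> rtrans a k) ` ?C \<one> \<subseteq> ?C k"
        using rtrans_cyc[OF fin _ k] k by (intro image_subsetI) simp
      show "(\<lambda>x. x \<circ> rtrans a (inv k)) ` ?C k \<subseteq> ?C \<one>"
        using rtrans_cyc[OF fin _ inv_closed[OF k]] k by (intro image_subsetI) simp
    qed
    then show ?thesis by (rule bij_betw_same_card[symmetric])
  qed
  have finC: "finite (cyc a Z)" using finite_wr[OF fin] by (simp add: cyc_def)
  have "card (cyc a Z) = (\<Sum>k\<in>carrier G. card (?C k))"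
    using finC fin_G funpow_pt(3)[OF cycD(1,2)[OF fin]]
    by (subst card_eq_sum, subst sum.group[symmetric, where g = "\<lambda>x. gain x (card Z) a" and T = "carrier G"]) auto
  also have "\<dots> = (\<Sum>k\<in>carrier G. card (?C \<one>))" by (intro sum.cong HOL.refl eq)
  also have "\<dots> = card (carrier G) * card (?C \<one>)" by simp
  finally have "card (carrier G) * card (?C \<one>) = card (carrier G) * (card (carrier G) ^ (card Z - 1) * fact (card Z - 1))"
    using card_cyc[OF fin a] fin a by (metis card_Suc_Diff1 diff_Suc_1 mult.assoc power_Suc)
  then show ?thesis using card_G_pos eq[OF h] by simp
qed

lemma sum_cyc_gain:
  fixes u :: "'a \<Rightarrow> 'r::comm_semiring_1"
  assumes fin: "finite Z" and a: "a \<in> Z"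
  shows "(\<Sum>x\<in>cyc a Z. u (gain x (card Z) a)) =
    of_nat (card (carrier G) ^ (card Z - 1) * fact (card Z - 1)) * (\<Sum>h\<in>carrier G. u h)"
proof -
  have finC: "finite (cyc a Z)" using finite_wr[OF fin] by (simp add: cyc_def)
  have "(\<Sum>x\<in>cyc a Z. u (gain x (card Z) a)) =
      (\<Sum>h\<in>carrier G. \<Sum>x\<in>{x \<in> cyc a Z. gain x (card Z) a = h}. u (gain x (card Z) a))"
    using finC fin_G funpow_pt(3)[OF cycD(1,2)[OF fin]] by (intro sum.group[symmetric]) auto
  also have "\<dots> = (\<Sum>h\<in>carrier G. of_nat (card (carrier G) ^ (card Z - 1) * fact (card Z - 1)) * u h)"
    using card_cyc_gain[OF assms] by (intro sum.cong HOL.refl) simp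
  finally show ?thesis by (simp add: sum_distrib_left)
qed

text \<open>The exponential formula for wreath products. For the generating function z of the
  normalised sums, \<open>zSuc\<close> is the differential equation q z' = u z, where u has the
  coefficients \<open>U (Suc l)\<close>; these come from single cycles.\<close>

lemma sum_wr_rec:
  fixes \<phi> :: "nat set \<Rightarrow> ('a \<times> nat \<Rightarrow> 'a \<times> nat) \<Rightarrow> 'r::comm_semiring_1" and U z :: "nat \<Rightarrow> 'r"
  assumes mult: "\<And>A x Z. finite A \<Longrightarrow> x \<in> wr G A \<Longrightarrow> Z \<subseteq> A \<Longrightarrow> bp x ` Z = Z \<Longrightarrow>
      \<phi> A x = \<phi> Z (rs x Z) * \<phi> (A - Z) (rs x (A - Z))"
    and cyc: "\<And>a Z. finite Z \<Longrightarrow> a \<in> Z \<Longrightarrow> (\<Sum>x\<in>cyc a Z. \<phi> Z x) =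
      of_nat (card (carrier G) ^ (card Z - 1) * fact (card Z - 1)) * U (card Z)"
    and empty: "\<phi> {} id = 1"
    and z0: "z 0 = 1"
    and zSuc: "\<And>n. of_nat (Suc n * card (carrier G)) * z (Suc n) = (\<Sum>l\<le>n. U (Suc l) * z (n - l))"
  shows "finite A \<Longrightarrow> (\<Sum>x\<in>wr G A. \<phi> A x) = of_nat (card (carrier G) ^ card A * fact (card A)) * z (card A)"
proof (induction "card A" arbitrary: A rule: less_induct)
  case less
  define q where "q = card (carrier G)"
  show ?case
  proof (cases "A = {}")
    case True
    have "wr G {} = {id}" by (auto simp: wr_def equivar_def)
    then show ?thesis using True empty z0 by simp
  next
    case False
    then obtain a where a: "a \<in> A" by auto
    obtain n where n: "card A = Suc n" using less.prems a by (metis card_Suc_Diff1)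
    define F :: "nat \<Rightarrow> 'r" where "F l = of_nat (q ^ (l - 1) * fact (l - 1)) * U l *
        (of_nat (q ^ (Suc n - l) * fact (Suc n - l)) * z (Suc n - l))" for l
    have "(\<Sum>x\<in>wr G A. \<phi> A x) =
        (\<Sum>Z | Z \<subseteq> A \<and> a \<in> Z. (\<Sum>x\<in>cyc a Z. \<phi> Z x) * (\<Sum>x\<in>wr G (A - Z). \<phi> (A - Z) x))"
      by (rule sum_wr_decomp[OF less.prems a]) (rule mult[OF less.prems])
    also have "\<dots> = (\<Sum>Z | Z \<subseteq> A \<and> a \<in> Z. F (card Z))"
    proof (intro sum.cong HOL.refl)
      fix Z assume "Z \<in> {Z. Z \<subseteq> A \<and> a \<in> Z}"
      then have Z: "Z \<subseteq> A" "a \<in> Z" "finite Z" using less.prems finite_subset by auto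
      have c: "card (A - Z) = Suc n - card Z" using card_Diff_subset[OF Z(3,1)] n by simp
      have "card (A - Z) < card A" using Z less.prems a by (intro psubset_card_mono) auto
      from less.hyps[OF this] less.prems
      show "(\<Sum>x\<in>cyc a Z. \<phi> Z x) * (\<Sum>x\<in>wr G (A - Z). \<phi> (A - Z) x) = F (card Z)"
        using cyc[OF Z(3,2)] by (simp add: F_def c q_def)
    qed
    also have "\<dots> = (\<Sum>l\<le>n. of_nat (n choose l) * F (Suc l))"
      by (rule sum_subsets_with_point[OF less.prems a n])
    \<comment> \<open>The binomial coefficient and the normalising factors of the two parts combine
      to n! q^n, whatever the cycle length.\<close>
    also have "\<dots> = (\<Sum>l\<le>n. of_nat (fact n * q ^ n) * (U (Suc l) * z (n - l)))"
    proof (intro sum.cong HOL.refl)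
      fix l assume "l \<in> {..n}"
      then have l: "l \<le> n" by simp
      have "q ^ l * q ^ (n - l) = q ^ n" using l by (simp flip: power_add)
      moreover have "fact l * fact (n - l) * (n choose l) = fact n" by (rule binomial_fact_lemma[OF l])
      ultimately have "(n choose l) * (q ^ l * fact l * (q ^ (n - l) * fact (n - l))) = fact n * q ^ n"
        by (metis (no_types, opaque_lifting) mult.commute mult.left_commute)
      moreover have "of_nat (n choose l) * F (Suc l) =
          of_nat ((n choose l) * (q ^ l * fact l * (q ^ (n - l) * fact (n - l)))) * (U (Suc l) * z (n - l))"
        unfolding of_nat_mult F_def diff_Suc_1 diff_Suc_Suc by (simp only: mult_ac)
      ultimately show "of_nat (n choose l) * F (Suc l) = of_nat (fact n * q ^ n) * (U (Suc l) * z (n - l))"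
        by simp
    qed
    also have "\<dots> = of_nat (fact n * q ^ n) * (of_nat (Suc n * q) * z (Suc n))"
      by (simp only: sum_distrib_left[symmetric] zSuc[folded q_def])
    also have "\<dots> = of_nat (q ^ Suc n * fact (Suc n)) * z (Suc n)"
    proof -
      have "fact n * q ^ n * (Suc n * q) = q ^ Suc n * fact (Suc n)" by (simp add: algebra_simps)
      then show ?thesis by (simp only: mult.assoc[symmetric] of_nat_mult[symmetric])
    qed
    finally show ?thesis by (simp add: n q_def)
  qed
qed

subsection \<open>Cycle weights\<close>

text \<open>\<open>Min Z\<close> is an arbitrary base point on the cycle; by \<open>cls_eq\<close>
  the class does not depend on it.\<close>

definition cls :: "('a \<times> nat \<Rightarrow> 'a \<times> nat) \<Rightarrow> nat set \<Rightarrow> 'a set" where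
  "cls x Z = conj_class G (gain x (card Z) (Min Z))"

text \<open>With \<open>psum\<close> as weight this is the monomial that records the cycle type, see
  \<open>cycle_indicator_eq\<close>.\<close>

definition wt :: "(nat \<Rightarrow> 'a set \<Rightarrow> 'r::comm_semiring_1) \<Rightarrow> nat set \<Rightarrow> ('a \<times> nat \<Rightarrow> 'a \<times> nat) \<Rightarrow> 'r" where
  "wt w A x = (\<Prod>Z\<in>orbit (bp x) ` A. w (card Z) (cls x Z))"

lemma conj_class_conj:
  assumes "g \<in> carrier G" "t \<in> carrier G"
  shows "conj_class G (inv g \<otimes> t \<otimes> g) = conj_class G t"
proof -
  have "h \<otimes> (inv g \<otimes> t \<otimes> g) \<otimes> inv h = (h \<otimes> inv g) \<otimes> t \<otimes> inv (h \<otimes> inv g)" if "h \<in> carrier G" for h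
    using assms that by (simp add: m_assoc inv_mult_group)
  then have "conj_class G (inv g \<otimes> t \<otimes> g) = (\<lambda>h. (h \<otimes> inv g) \<otimes> t \<otimes> inv (h \<otimes> inv g)) ` carrier G"
    unfolding conj_class_def by (intro image_cong) auto
  also have "\<dots> = (\<lambda>h. h \<otimes> t \<otimes> inv h) ` (\<lambda>h. h \<otimes> inv g) ` carrier G" by (simp add: image_image)
  also have "(\<lambda>h. h \<otimes> inv g) ` carrier G = carrier G"
  proof
    show "carrier G \<subseteq> (\<lambda>h. h \<otimes> inv g) ` carrier G"
    proof
      fix h assume "h \<in> carrier G"
      then have "h = (h \<otimes> g) \<otimes> inv g" "h \<otimes> g \<in> carrier G" using assms by (simp_all add: m_assoc)
      then show "h \<in> (\<lambda>h. h \<otimes> inv g) ` carrier G" by blast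
    qed
  qed (use assms in auto)
  finally show ?thesis by (simp add: conj_class_def)
qed

text \<open>Comparing x (x^l (1, m)) with x^l (x (1, m)) shows that moving the base point one step
  along the cycle conjugates the displacement.\<close>

lemma gain_conj_step:
  assumes x: "x \<in> wr G A" and m: "m \<in> A" and l: "(bp x ^^ l) m = m"
  shows "conj_class G (gain x l (bp x m)) = conj_class G (gain x l m)"
proof -
  define g where "g = fst (x (\<one>, m))"
  let ?m = "bp x m"
  have m': "?m \<in> A" using funpow_pt(2)[OF x m, of 1] by simp
  have g: "g \<in> carrier G" using wrD(3)[OF x, of "(\<one>, m)"] m by (auto simp: pts_def g_def mem_Times_iff)
  have xm: "x (\<one>, m) = (g, ?m)" by (simp add: base_perm_def g_def)
  note t = funpow_pt(3)[OF x m, of l] and t' = funpow_pt(3)[OF x m', of l]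
  have "x ((x ^^ l) (\<one>, m)) = (gain x l m \<otimes> g, ?m)"
    using funpow_pt(1)[OF x m, of l] wr_pt[OF x, of "gain x l m" m] t m l by (simp add: pts_def flip: g_def)
  moreover have "(x ^^ l) (x (\<one>, m)) = (g \<otimes> gain x l ?m, (bp x ^^ l) ?m)"
  proof -
    have "(x ^^ l) (x (\<one>, m)) = (x ^^ l) (lmult G g (\<one>, ?m))" unfolding xm using g by (simp add: lmult_def)
    also have "\<dots> = lmult G g ((x ^^ l) (\<one>, ?m))" by (rule funpow_lmult[OF x g]) (simp add: one_pts m')
    also have "\<dots> = (g \<otimes> gain x l ?m, (bp x ^^ l) ?m)" unfolding funpow_pt(1)[OF x m'] by (simp add: lmult_def)
    finally show ?thesis .
  qed
  ultimately have "g \<otimes> gain x l ?m = gain x l m \<otimes> g"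
    by (metis funpow_swap1 prod.inject)
  then have "gain x l ?m = inv g \<otimes> gain x l m \<otimes> g"
    using g t t' by (simp add: m_assoc inv_solve_left)
  then show ?thesis using conj_class_conj[OF g t] by simp
qed

lemma cls_eq:
  assumes fin: "finite A" and x: "x \<in> wr G A" and m: "m \<in> A"
  shows "cls x (orbit (bp x) m) = conj_class G (gain x (card (orbit (bp x) m)) m)"
proof -
  let ?Z = "orbit (bp x) m"
  let ?l = "card ?Z"
  note Z = orbit_stable[OF fin x m]
  have perm: "permutation (bp x)" using base_permutes[OF fin x] fin by (auto simp: permutation_permutes)
  have "k \<in> A \<and> orbit (bp x) k = ?Z \<and> conj_class G (gain x ?l k) = conj_class G (gain x ?l m)" if "k \<in> ?Z" for k
    using that
  proof induction
    case base
    have "(bp x ^^ ?l) m = m" by (rule orbit_enum(1)[OF Z(3)])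
    then show ?case using gain_conj_step[OF x m] funpow_pt(2)[OF x m, of 1] permutation_orbit_step[OF perm] by simp
  next
    case (step k)
    then have k: "k \<in> A" "orbit (bp x) k = ?Z" by auto
    have "(bp x ^^ ?l) k = k" using orbit_enum(1)[OF orbit_stable(3)[OF fin x k(1)]] k(2) by simp
    then show ?case using step gain_conj_step[OF x k(1)] funpow_pt(2)[OF x k(1), of 1]
        permutation_orbit_step[OF perm, of k] by simp
  qed
  moreover have "Min ?Z \<in> ?Z"
    using finite_subset[OF Z(1) fin] Z(3) by (intro Min_in) auto
  ultimately show ?thesis by (simp add: cls_def)
qed

lemma funpow_rs:
  assumes x: "x \<in> wr G A" and Z: "Z \<subseteq> A" "bp x ` Z = Z" and m: "m \<in> Z"
  shows "(rs x Z ^^ j) (\<one>, m) = (x ^^ j) (\<one>, m) \<and> (x ^^ j) (\<one>, m) \<in> pts G Z"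
proof (induction j)
  case 0
  show ?case using m by (simp add: one_pts)
next
  case (Suc j)
  then show ?case using pts_stable[OF x Z] by simp
qed

text \<open>A stable index set is a union of cycles, and the type of each cycle can be computed
  inside it.\<close>

lemma wt_mult:
  assumes fin: "finite A" and x: "x \<in> wr G A" and Z: "Z \<subseteq> A" "bp x ` Z = Z"
  shows "wt w A x = wt w Z (rs x Z) * wt w (A - Z) (rs x (A - Z))"
proof -
  have part: "wt w Y (rs x Y) = (\<Prod>C\<in>orbit (bp x) ` Y. w (card C) (cls x C))"
    if Y: "Y \<subseteq> A" "bp x ` Y = Y" for Y
  proof -
    have o: "orbit (bp (rs x Y)) ` Y = orbit (bp x) ` Y" using orbit_rs[OF Y(2)] by (intro image_cong) auto
    have "cls (rs x Y) C = cls x C" if C: "C \<in> orbit (bp x) ` Y" for C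
    proof -
      obtain m where m: "m \<in> Y" "C = orbit (bp x) m" using C by auto
      have mA: "m \<in> A" using m(1) Y(1) by auto
      have finY: "finite Y" using finite_subset[OF Y(1) fin] .
      have "cls (rs x Y) C = conj_class G (gain (rs x Y) (card C) m)"
        using cls_eq[OF finY rs_wr[OF fin x Y] m(1)] orbit_rs[OF Y(2) m(1)] m(2) by simp
      also have "gain (rs x Y) (card C) m = gain x (card C) m"
        using funpow_rs[OF x Y m(1)] by (simp add: gain_def)
      also have "conj_class G (gain x (card C) m) = cls x C"
        using cls_eq[OF fin x mA] m(2) by simp
      finally show ?thesis .
    qed
    then show ?thesis unfolding wt_def o by (intro prod.cong) auto
  qed
  have finA: "finite (orbit (bp x) ` Z)" "finite (orbit (bp x) ` (A - Z))"
    using finite_subset[OF Z(1) fin] fin by auto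
  have Z': "A - Z \<subseteq> A" "bp x ` (A - Z) = A - Z" using stable_compl[OF fin x Z] by auto
  have in_orb: "orbit (bp x) m \<subseteq> Y" if "bp x ` Y = Y" "m \<in> Y" for Y m
  proof
    fix k assume "k \<in> orbit (bp x) m"
    then show "k \<in> Y" by induction (use that in auto)
  qed
  have "orbit (bp x) ` Z \<inter> orbit (bp x) ` (A - Z) = {}"
  proof (rule ccontr)
    assume "orbit (bp x) ` Z \<inter> orbit (bp x) ` (A - Z) \<noteq> {}"
    then obtain m k where mk: "m \<in> Z" "k \<in> A - Z" "orbit (bp x) m = orbit (bp x) k" by auto
    then have "m \<in> A" using Z(1) by blast
    then have "m \<in> orbit (bp x) k" using orbit_stable(3)[OF fin x] mk(3) by auto
    then show False using in_orb[OF Z'(2) mk(2)] mk(1) by blast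
  qed
  moreover have "orbit (bp x) ` A = orbit (bp x) ` Z \<union> orbit (bp x) ` (A - Z)" using Z(1) by auto
  ultimately show ?thesis
    using part[OF Z] part[OF Z'] finA by (simp add: wt_def prod.union_disjoint)
qed

lemma wt_cyc:
  assumes "finite Z" "x \<in> cyc a Z"
  shows "wt w Z x = w (card Z) (conj_class G (gain x (card Z) a))"
proof -
  note xd = cycD[OF assms]
  have "orbit (bp x) ` Z = {Z}" using xd(2,6) by auto
  then show ?thesis using cls_eq[OF assms(1) xd(1,2)] xd(6)[OF xd(2)] by (simp add: wt_def)
qed

end

section \<open>Counting maps that intertwine two elements of wreath products\<close>

lemma funpow_orbit_dvd:
  assumes "m \<in> orbit f m"
  shows "(f ^^ l) m = m \<longleftrightarrow> card (orbit f m) dvd l"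
proof -
  let ?i = "card (orbit f m)"
  note e = orbit_enum[OF assms]
  have i: "?i > 0" using e(3) assms by (metis empty_iff gr0I image_empty lessThan_0)
  have "(f ^^ l) m = (f ^^ (l mod ?i)) m" by (rule funpow_mod_eq[OF e(1), symmetric])
  moreover have "(f ^^ (l mod ?i)) m = (f ^^ 0) m \<longleftrightarrow> l mod ?i = 0"
    by (rule inj_on_eq_iff[OF e(2)]) (use i in auto)
  ultimately show ?thesis by (simp add: dvd_eq_mod_eq_0)
qed

context fgroup
begin

definition maps :: "('a \<times> nat \<Rightarrow> 'a \<times> nat) \<Rightarrow> nat set \<Rightarrow> nat set \<Rightarrow> ('a \<times> nat \<Rightarrow> 'a \<times> nat) \<Rightarrow> ('a \<times> nat \<Rightarrow> 'a \<times> nat) set" where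
  "maps y S A x = {f \<in> eqv G A S. \<forall>z\<in>pts G A. f (x z) = y (f z)}"

lemma mapsD:
  assumes "f \<in> maps y S A x"
  shows "z \<in> pts G A \<Longrightarrow> f z \<in> pts G S" "g \<in> carrier G \<Longrightarrow> z \<in> pts G A \<Longrightarrow> f (lmult G g z) = lmult G g (f z)"
    "z \<in> pts G A \<Longrightarrow> f (x z) = y (f z)" "z \<notin> pts G A \<Longrightarrow> f z = undefined"
proof -
  have f: "f \<in> pts G A \<rightarrow>\<^sub>E pts G S" "equivar G A f" "\<forall>z\<in>pts G A. f (x z) = y (f z)"
    using assms by (simp_all add: maps_def eqv_def)
  show "z \<in> pts G A \<Longrightarrow> f z \<in> pts G S" using PiE_mem[OF f(1)] .
  show "z \<notin> pts G A \<Longrightarrow> f z = undefined" using PiE_arb[OF f(1)] .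
  show "g \<in> carrier G \<Longrightarrow> z \<in> pts G A \<Longrightarrow> f (lmult G g z) = lmult G g (f z)" using equivarD[OF f(2)] .
  show "z \<in> pts G A \<Longrightarrow> f (x z) = y (f z)" using f(3) by blast
qed

lemma mapsI:
  assumes "\<And>z. z \<in> pts G A \<Longrightarrow> f z \<in> pts G S" "\<And>g z. g \<in> carrier G \<Longrightarrow> z \<in> pts G A \<Longrightarrow> f (lmult G g z) = lmult G g (f z)"
    "\<And>z. z \<in> pts G A \<Longrightarrow> f (x z) = y (f z)" "\<And>z. z \<notin> pts G A \<Longrightarrow> f z = undefined"
  shows "f \<in> maps y S A x"
  unfolding maps_def eqv_def equivar_def using assms by (intro CollectI conjI ballI PiE_I) auto

text \<open>\<open>x\<close> preserves both the fibres over \<open>Z\<close> and those over the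
  complement, so a map amounts to a free choice of its two restrictions.\<close>

lemma card_maps_mult:
  assumes fin: "finite A" and x: "x \<in> wr G A" and Z: "Z \<subseteq> A" "bp x ` Z = Z"
  shows "card (maps y S A x) = card (maps y S Z (rs x Z)) * card (maps y S (A - Z) (rs x (A - Z)))"
proof -
  let ?Z' = "A - Z"
  note Z' = stable_compl[OF fin x Z]
  have sub: "pts G Z \<subseteq> pts G A" "pts G ?Z' \<subseteq> pts G A" using Z(1) by (auto intro!: pts_mono)
  have disj: "z \<notin> pts G Z" if "z \<in> pts G ?Z'" for z using that by (auto simp: pts_def)
  have cover: "z \<in> pts G Z \<or> z \<in> pts G ?Z'" if "z \<in> pts G A" for z using that by (auto simp: pts_def)
  have st: "z \<in> pts G Z \<Longrightarrow> x z \<in> pts G Z" "z \<in> pts G ?Z' \<Longrightarrow> x z \<in> pts G ?Z'" for z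
    using pts_stable[OF x Z] pts_stable[OF x _ Z'] by auto
  have res: "restrict f (pts G Y) \<in> maps y S Y (rs x Y)"
    if f: "f \<in> maps y S A x" and Y: "pts G Y \<subseteq> pts G A" "\<And>z. z \<in> pts G Y \<Longrightarrow> x z \<in> pts G Y" for f Y
  proof (rule mapsI)
    fix z assume "z \<in> pts G Y"
    then have z: "z \<in> pts G Y" "z \<in> pts G A" using Y(1) by auto
    show "restrict f (pts G Y) z \<in> pts G S" using mapsD(1)[OF f z(2)] z(1) by simp
    show "restrict f (pts G Y) (rs x Y z) = y (restrict f (pts G Y) z)"
      using mapsD(3)[OF f z(2)] z(1) Y(2) by simp
    fix g assume "g \<in> carrier G"
    then show "restrict f (pts G Y) (lmult G g z) = lmult G g (restrict f (pts G Y) z)"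
      using mapsD(2)[OF f _ z(2)] z(1) by simp
  qed simp
  define J where "J p = (\<lambda>z\<in>pts G A. if z \<in> pts G Z then fst p z else snd p z)"
    for p :: "('a \<times> nat \<Rightarrow> 'a \<times> nat) \<times> ('a \<times> nat \<Rightarrow> 'a \<times> nat)"
  have "bij_betw (\<lambda>f. (restrict f (pts G Z), restrict f (pts G ?Z'))) (maps y S A x)
      (maps y S Z (rs x Z) \<times> maps y S ?Z' (rs x ?Z'))"
  proof (rule bij_betw_byWitness[of _ J])
    show "\<forall>f\<in>maps y S A x. J (restrict f (pts G Z), restrict f (pts G ?Z')) = f"
    proof (intro ballI ext)
      fix f z assume f: "f \<in> maps y S A x"
      show "J (restrict f (pts G Z), restrict f (pts G ?Z')) z = f z"
        using mapsD(4)[OF f, of z] cover[of z] by (cases "z \<in> pts G A") (auto simp: J_def)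
    qed
    show "\<forall>p\<in>maps y S Z (rs x Z) \<times> maps y S ?Z' (rs x ?Z').
        (restrict (J p) (pts G Z), restrict (J p) (pts G ?Z')) = p"
    proof
      fix p assume "p \<in> maps y S Z (rs x Z) \<times> maps y S ?Z' (rs x ?Z')"
      then obtain f1 f2 where p: "p = (f1, f2)" "f1 \<in> maps y S Z (rs x Z)" "f2 \<in> maps y S ?Z' (rs x ?Z')" by auto
      have "restrict (J p) (pts G Z) z = f1 z" for z
        using mapsD(4)[OF p(2), of z] sub(1) by (cases "z \<in> pts G Z") (auto simp: J_def p(1) simp del: split_paired_All)
      moreover have "restrict (J p) (pts G ?Z') z = f2 z" for z
        using mapsD(4)[OF p(3), of z] sub(2) disj[of z] by (cases "z \<in> pts G ?Z'") (auto simp: J_def p(1) simp del: split_paired_All)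
      ultimately show "(restrict (J p) (pts G Z), restrict (J p) (pts G ?Z')) = p"
        unfolding p(1) by (simp only: prod.inject fun_eq_iff) blast
    qed
    show "(\<lambda>f. (restrict f (pts G Z), restrict f (pts G ?Z'))) ` maps y S A x \<subseteq>
        maps y S Z (rs x Z) \<times> maps y S ?Z' (rs x ?Z')"
      using res[OF _ sub(1) st(1)] res[OF _ sub(2) st(2)] by blast
    show "J ` (maps y S Z (rs x Z) \<times> maps y S ?Z' (rs x ?Z')) \<subseteq> maps y S A x"
    proof (rule image_subsetI)
      fix p assume "p \<in> maps y S Z (rs x Z) \<times> maps y S ?Z' (rs x ?Z')"
      then obtain f1 f2 where p: "p = (f1, f2)" "f1 \<in> maps y S Z (rs x Z)" "f2 \<in> maps y S ?Z' (rs x ?Z')" by auto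
      have J1: "J p z = f1 z" if "z \<in> pts G Z" for z using that sub(1) by (auto simp: J_def p(1) simp del: split_paired_All)
      have J2: "J p z = f2 z" if "z \<in> pts G ?Z'" for z
        using that sub(2) disj[OF that] by (auto simp: J_def p(1) simp del: split_paired_All)
      show "J p \<in> maps y S A x"
      proof (rule mapsI)
        fix z assume z: "z \<in> pts G A"
        show "J p z \<in> pts G S"
          using cover[OF z] J1[of z] J2[of z] mapsD(1)[OF p(2), of z] mapsD(1)[OF p(3), of z] by auto
        show "J p (x z) = y (J p z)"
          using cover[OF z]
        proof
          assume "z \<in> pts G Z"
          then show ?thesis using J1[of z] J1[of "x z"] st(1)[of z] mapsD(3)[OF p(2), of z] by simp
        next
          assume "z \<in> pts G ?Z'"
          then show ?thesis using J2[of z] J2[of "x z"] st(2)[of z] mapsD(3)[OF p(3), of z] by simp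
        qed
        fix g assume g: "g \<in> carrier G"
        show "J p (lmult G g z) = lmult G g (J p z)"
          using cover[OF z]
        proof
          assume "z \<in> pts G Z"
          then show ?thesis using J1[of z] J1[of "lmult G g z"] g mapsD(2)[OF p(2) g, of z] by simp
        next
          assume "z \<in> pts G ?Z'"
          then show ?thesis using J2[of z] J2[of "lmult G g z"] g mapsD(2)[OF p(3) g, of z] by simp
        qed
      qed (simp add: J_def)
    qed
  qed
  then show ?thesis by (simp add: bij_betw_same_card card_cartesian_product)
qed

text \<open>The points x^j (1, a) and their translates exhaust the fibres over the cycle, so a map
  is given by its value at (1, a); the only condition on this value comes from the full
  turn.\<close>

lemma card_maps_cyc:
  assumes finK: "finite K" and y: "y \<in> wr G K" and S: "S \<subseteq> K" "bp y ` S = S"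
    and fin: "finite Z" and x: "x \<in> cyc a Z"
  shows "card (maps y S Z x) = card {w \<in> pts G S. (y ^^ card Z) w = lmult G (gain x (card Z) a) w}"
proof -
  let ?l = "card Z" and ?h = "gain x (card Z) a" and ?o = "(\<one>, a)"
  note xd = cycD[OF fin x]
  have ySp: "(y ^^ j) w \<in> pts G S" if "w \<in> pts G S" for j w
    by (induction j) (use that pts_stable[OF y S] in auto)
  have SK: "pts G S \<subseteq> pts G K" by (rule pts_mono[OF S(1)])
  have o: "?o \<in> pts G Z" using xd(2) by (simp add: one_pts)
  have h: "?h \<in> carrier G" and xo: "(x ^^ j) ?o = (gain x j a, (bp x ^^ j) a)"
    and k: "gain x j a \<in> carrier G" for j using funpow_pt[OF xd(1,2)] by auto
  have xp: "(x ^^ j) ?o \<in> pts G Z" for j by (rule wrD(3)[OF wr_funpow[OF xd(1)] o])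
  have xl: "(x ^^ ?l) ?o = lmult G ?h ?o" using xo[of ?l] xd(3) h by (simp add: lmult_def)
  have fx: "f ((x ^^ j) ?o) = (y ^^ j) (f ?o)" if f: "f \<in> maps y S Z x" for f j
  proof (induction j)
    case (Suc j)
    then show ?case using mapsD(3)[OF f xp[of j]] by simp
  qed simp
  \<comment> \<open>\<open>idx m\<close> is the position of \<open>m\<close> on the cycle counted
    from \<open>a\<close>. With the factor \<open>c z\<close> below, each point is the translate by
    \<open>c z\<close> of the point reached from (1, a) in that many steps.\<close>
  define idx where "idx m = (LEAST j. (bp x ^^ j) a = m)" for m
  have idx: "idx m < ?l \<and> (bp x ^^ idx m) a = m" if m: "m \<in> Z" for m
  proof -
    have "m \<in> (\<lambda>j. (bp x ^^ j) a) ` {..<?l}" using m by (simp only: xd(5)[symmetric])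
    then obtain j where j: "j < ?l" "(bp x ^^ j) a = m" by blast
    have "(bp x ^^ idx m) a = m" unfolding idx_def by (rule LeastI[of _ j]) (rule j(2))
    moreover have "idx m \<le> j" unfolding idx_def by (rule Least_le) (rule j(2))
    ultimately show ?thesis using j(1) by simp
  qed
  have idx_eq: "idx ((bp x ^^ j) a) = j" if "j < ?l" for j
  proof -
    have "(bp x ^^ j) a \<in> Z" using xd(5) that by blast
    from idx[OF this] show ?thesis using inj_onD[OF xd(4), of _ j] that by auto
  qed
  define c where "c z = fst z \<otimes> inv (gain x (idx (snd z)) a)" for z
  have c: "c z \<in> carrier G" "z = lmult G (c z) ((x ^^ idx (snd z)) ?o)" "snd z \<in> Z" if z: "z \<in> pts G Z" for z
  proof -
    obtain g m where gm: "z = (g, m)" "g \<in> carrier G" "m \<in> Z" using z by (auto simp: pts_def)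
    show "c z \<in> carrier G" "snd z \<in> Z" using gm k by (auto simp: c_def)
    show "z = lmult G (c z) ((x ^^ idx (snd z)) ?o)"
      using gm idx[OF gm(3)] k by (simp add: xo c_def lmult_def m_assoc)
  qed
  \<comment> \<open>The map with value \<open>w\<close> at (1, a); equivariance and the intertwining
    condition leave no other choice.\<close>
  define F where "F w = (\<lambda>z\<in>pts G Z. lmult G (c z) ((y ^^ idx (snd z)) w))" for w
  let ?W = "{w \<in> pts G S. (y ^^ ?l) w = lmult G ?h w}"
  have "bij_betw (\<lambda>f. f ?o) (maps y S Z x) ?W"
  proof (rule bij_betw_byWitness[of _ F])
    show "\<forall>f\<in>maps y S Z x. F (f ?o) = f"
    proof (intro ballI ext)
      fix f z assume f: "f \<in> maps y S Z x"
      show "F (f ?o) z = f z"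
      proof (cases "z \<in> pts G Z")
        case True
        have "f z = lmult G (c z) (f ((x ^^ idx (snd z)) ?o))"
          using mapsD(2)[OF f c(1)[OF True] xp[of "idx (snd z)"]] c(2)[OF True] by metis
        then show ?thesis using True by (simp add: F_def fx[OF f])
      next
        case False
        then show ?thesis using mapsD(4)[OF f False] by (simp add: F_def)
      qed
    qed
    show "\<forall>w\<in>?W. F w ?o = w"
    proof
      fix w assume "w \<in> ?W"
      then have w: "w \<in> pts G S" by simp
      have "idx a = 0" using idx_eq[of 0] xd(7) by simp
      then show "F w ?o = w" using o lmult_one[OF w] by (simp add: F_def c_def)
    qed
    show "(\<lambda>f. f ?o) ` maps y S Z x \<subseteq> ?W"
    proof (rule image_subsetI)
      fix f assume f: "f \<in> maps y S Z x"
      have "(y ^^ ?l) (f ?o) = f (lmult G ?h ?o)" unfolding fx[OF f, symmetric] xl ..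
      then show "f ?o \<in> ?W" using mapsD(1)[OF f o] mapsD(2)[OF f h o] by simp
    qed
    show "F ` ?W \<subseteq> maps y S Z x"
    proof (rule image_subsetI)
      fix w assume "w \<in> ?W"
      then have w: "w \<in> pts G S" "(y ^^ ?l) w = lmult G ?h w" by auto
      show "F w \<in> maps y S Z x"
      proof (rule mapsI)
        fix z assume z: "z \<in> pts G Z"
        let ?j = "idx (snd z)"
        note cz = c[OF z]
        note ij = idx[OF cz(3)]
        have yj: "(y ^^ ?j) w \<in> pts G S" by (rule ySp[OF w(1)])
        show "F w z \<in> pts G S" using z yj cz by (simp add: F_def)
        show "F w (lmult G g z) = lmult G g (F w z)" if g: "g \<in> carrier G" for g
        proof -
          have "snd (lmult G g z) = snd z" "c (lmult G g z) = g \<otimes> c z"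
            using z g k by (auto simp: c_def lmult_def m_assoc pts_def)
          then show ?thesis using z g cz yj by (simp add: F_def lmult_lmult)
        qed
        have xz: "x z = lmult G (c z) ((x ^^ Suc ?j) ?o)"
          using wrD(2)[OF xd(1) cz(1) xp[of ?j]] cz(2) by simp
        have xzp: "x z \<in> pts G Z" by (rule wrD(3)[OF xd(1) z])
        have sx: "snd (x z) = (bp x ^^ Suc ?j) a" by (simp only: xz xo[of "Suc ?j"] lmult_def snd_conv)
        have fx': "fst (x z) = c z \<otimes> gain x (Suc ?j) a" by (simp only: xz xo[of "Suc ?j"] lmult_def fst_conv)
        have yF: "y (F w z) = lmult G (c z) ((y ^^ Suc ?j) w)"
        proof -
          have "(y ^^ ?j) w \<in> pts G K" using yj SK by blast
          then show ?thesis using z wrD(2)[OF y cz(1)] by (simp add: F_def)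
        qed
        \<comment> \<open>Only at the last position does the index jump back to 0, and there the
          defining equation of \<open>w\<close> absorbs the displacement after the full
          turn.\<close>
        show "F w (x z) = y (F w z)"
        proof (cases "Suc ?j < ?l")
          case True
          then have i: "idx (snd (x z)) = Suc ?j" unfolding sx by (rule idx_eq)
          have "c (x z) = c z" unfolding c_def[of "x z"] fx' i using k[of "Suc ?j"] cz(1) by (simp add: m_assoc)
          then show ?thesis unfolding yF using xzp by (simp add: F_def i del: funpow.simps)
        next
          case False
          then have l: "Suc ?j = ?l" using ij by simp
          have i: "idx (snd (x z)) = 0" unfolding sx l xd(3) using idx_eq[of 0] xd(7) by simp
          have "c (x z) = c z \<otimes> ?h" unfolding c_def[of "x z"] fx' i l using h cz(1) by simp
          then show ?thesis unfolding yF l w(2) using xzp by (simp add: F_def i lmult_lmult[OF cz(1) h w(1)])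
        qed
      qed (simp add: F_def)
    qed
  qed
  then show ?thesis by (rule bij_betw_same_card)
qed

section \<open>Fixed points of powers, sorted by cycles\<close>

lemma gain_mult:
  assumes y: "y \<in> wr G K" and m: "m \<in> K" and i: "(bp y ^^ i) m = m"
  shows "gain y (i * q) m = gain y i m [^] q"
proof (induction q)
  case (Suc q)
  have bq: "(bp y ^^ (i * q)) m = m"
    by (induction q) (simp_all add: funpow_add i)
  have t: "gain y i m [^] q \<in> carrier G" using funpow_pt(3)[OF y m] by simp
  have e: "(y ^^ (i * q)) (\<one>, m) = lmult G (gain y i m [^] q) (\<one>, m)"
    using funpow_pt(1)[OF y m, of "i * q"] Suc bq t by (simp add: lmult_def)
  have "(y ^^ (i * Suc q)) (\<one>, m) = (y ^^ i) ((y ^^ (i * q)) (\<one>, m))"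
    by (simp add: funpow_add)
  also have "\<dots> = lmult G (gain y i m [^] q) ((y ^^ i) (\<one>, m))"
    unfolding e by (rule funpow_lmult[OF y t]) (simp add: one_pts m)
  finally have E: "(y ^^ (i * Suc q)) (\<one>, m) = lmult G (gain y i m [^] q) ((y ^^ i) (\<one>, m))" .
  show ?case unfolding gain_def[of y "i * Suc q" m] E by (simp add: lmult_def gain_def[of y i m])
qed simp

lemma class_pow_conj_class:
  assumes t: "t \<in> carrier G"
  shows "class_pow G (conj_class G t) q = conj_class G (t [^] q)"
proof -
  have "(g \<otimes> t \<otimes> inv g) [^] q = g \<otimes> t [^] q \<otimes> inv g" if g: "g \<in> carrier G" for g
  proof (induction q)
    case (Suc q)
    have "(g \<otimes> t \<otimes> inv g) [^] Suc q = (g \<otimes> t [^] q \<otimes> inv g) \<otimes> (g \<otimes> t \<otimes> inv g)" using Suc by simp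
    also have "\<dots> = g \<otimes> t [^] q \<otimes> (inv g \<otimes> g) \<otimes> t \<otimes> inv g"
      using g t by (simp only: m_assoc inv_closed m_closed nat_pow_closed)
    finally show ?case using g t by (simp add: m_assoc)
  qed (use g in simp)
  then show ?thesis by (auto simp: class_pow_def conj_class_def image_image)
qed

text \<open>After exchanging the sums, for w = (g, m) the equation has a solution h only if m
  returns to itself after l steps, and then h is the conjugate by g of the displacement of m. Its
  class does not depend on g, whence the factor |G|.\<close>

lemma sum_conj_fixed:
  fixes v :: "'a set \<Rightarrow> 'r::comm_semiring_1"
  assumes finK: "finite K" and y: "y \<in> wr G K" and S: "S \<subseteq> K"
  shows "(\<Sum>h\<in>carrier G. of_nat (card {w \<in> pts G S. (y ^^ l) w = lmult G h w}) * v (conj_class G h)) =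
    of_nat (card (carrier G)) * (\<Sum>m | m \<in> S \<and> (bp y ^^ l) m = m. v (conj_class G (gain y l m)))"
proof -
  have finS: "finite S" using finite_subset[OF S finK] .
  have "(\<Sum>h\<in>carrier G. of_nat (card {w \<in> pts G S. (y ^^ l) w = lmult G h w}) * v (conj_class G h)) =
      (\<Sum>h\<in>carrier G. \<Sum>w\<in>pts G S. if (y ^^ l) w = lmult G h w then v (conj_class G h) else 0)"
    using finite_pts[OF finS] by (simp add: sum.If_cases Int_def)
  also have "\<dots> = (\<Sum>w\<in>pts G S. \<Sum>h\<in>carrier G. if (y ^^ l) w = lmult G h w then v (conj_class G h) else 0)"
    by (rule sum.swap)
  also have "\<dots> = (\<Sum>(g, m)\<in>carrier G \<times> S. if (bp y ^^ l) m = m then v (conj_class G (gain y l m)) else 0)"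
    unfolding pts_def[symmetric]
  proof (rule sum.cong[OF HOL.refl])
    fix w assume "w \<in> pts G S"
    then obtain g m where w: "w = (g, m)" "g \<in> carrier G" "m \<in> S" by (auto simp: pts_def)
    have m: "m \<in> K" using w(3) S by auto
    let ?t = "gain y l m"
    have t: "?t \<in> carrier G" by (rule funpow_pt(3)[OF y m])
    have "(y ^^ l) w = lmult G g ((y ^^ l) (\<one>, m))"
      using funpow_lmult[OF y w(2), of "(\<one>, m)" l] w m by (simp add: lmult_def one_pts)
    then have yw: "(y ^^ l) w = (g \<otimes> ?t, (bp y ^^ l) m)"
      unfolding funpow_pt(1)[OF y m] by (simp add: lmult_def)
    have iff: "(y ^^ l) w = lmult G h w \<longleftrightarrow> (bp y ^^ l) m = m \<and> h = g \<otimes> ?t \<otimes> inv g" if "h \<in> carrier G" for h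
    proof -
      have "g \<otimes> ?t = h \<otimes> g \<longleftrightarrow> h = g \<otimes> ?t \<otimes> inv g"
        using that w(2) t by (metis inv_solve_right m_closed)
      then show ?thesis unfolding yw by (auto simp: w(1) lmult_def)
    qed
    have cc: "conj_class G (g \<otimes> ?t \<otimes> inv g) = conj_class G ?t"
      using conj_class_conj[of "inv g" ?t] w(2) t by simp
    have "(\<Sum>h\<in>carrier G. if (y ^^ l) w = lmult G h w then v (conj_class G h) else 0) =
        (\<Sum>h\<in>carrier G. if h = g \<otimes> ?t \<otimes> inv g then if (bp y ^^ l) m = m then v (conj_class G ?t) else 0 else 0)"
      using iff cc by (intro sum.cong HOL.refl) auto
    also have "\<dots> = (if (bp y ^^ l) m = m then v (conj_class G ?t) else 0)"
      using fin_G w(2) t by simp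
    finally show "(\<Sum>h\<in>carrier G. if (y ^^ l) w = lmult G h w then v (conj_class G h) else 0) =
        (case w of (g, m) \<Rightarrow> if (bp y ^^ l) m = m then v (conj_class G (gain y l m)) else 0)"
      by (simp add: w(1))
  qed
  also have "\<dots> = (\<Sum>g\<in>carrier G. \<Sum>m\<in>S. if (bp y ^^ l) m = m then v (conj_class G (gain y l m)) else 0)"
    by (rule sum.cartesian_product[symmetric])
  finally show ?thesis using finS by (simp add: sum.inter_filter)
qed

text \<open>An index is fixed by the l-th power iff the length of its cycle C divides l. The
  displacement is then the power with exponent l / |C| of that after one turn, and all |C| indices
  contribute equally.\<close>

lemma sum_fixed_by_cycles:
  fixes v :: "'a set \<Rightarrow> 'r::comm_semiring_1"
  assumes finK: "finite K" and y: "y \<in> wr G K" and S: "S \<subseteq> K" "bp y ` S = S"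
  shows "(\<Sum>m | m \<in> S \<and> (bp y ^^ l) m = m. v (conj_class G (gain y l m))) =
    (\<Sum>C | C \<in> orbit (bp y) ` S \<and> card C dvd l. of_nat (card C) * v (class_pow G (cls y C) (l div card C)))"
proof -
  let ?O = "orbit (bp y)"
  have finS: "finite S" using finite_subset[OF S(1) finK] .
  have self: "m \<in> ?O m" if "m \<in> S" for m using orbit_stable(3)[OF finK y] that S(1) by auto
  have sub: "?O m \<subseteq> S" if "m \<in> S" for m
  proof
    fix k assume "k \<in> ?O m"
    then show "k \<in> S" by induction (use that S(2) in auto)
  qed
  have dv: "(bp y ^^ l) m = m \<longleftrightarrow> card (?O m) dvd l" if "m \<in> S" for m
    by (rule funpow_orbit_dvd[OF self[OF that]])
  have perm: "permutation (bp y)" using base_permutes[OF finK y] finK by (auto simp: permutation_permutes)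
  have same: "?O k = ?O m" if "k \<in> ?O m" for k m
    by (rule orbit_cyclic_eq3[OF cyclic_on_orbit'[OF perm] that])
  have val: "v (conj_class G (gain y l m)) = v (class_pow G (cls y (?O m)) (l div card (?O m)))"
    if m: "m \<in> S" and d: "card (?O m) dvd l" for m
  proof -
    let ?i = "card (?O m)"
    have mK: "m \<in> K" using m S by auto
    have "gain y (?i * (l div ?i)) m = gain y ?i m [^] (l div ?i)"
      by (rule gain_mult[OF y mK orbit_enum(1)[OF self[OF m]]])
    then show ?thesis
      using d cls_eq[OF finK y mK] class_pow_conj_class[OF funpow_pt(3)[OF y mK]] by simp
  qed
  have "(\<Sum>m | m \<in> S \<and> (bp y ^^ l) m = m. v (conj_class G (gain y l m))) =
      (\<Sum>m | m \<in> S \<and> card (?O m) dvd l. v (class_pow G (cls y (?O m)) (l div card (?O m))))"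
    using dv val by (intro sum.cong) auto
  also have "\<dots> = (\<Sum>C | C \<in> ?O ` S \<and> card C dvd l. \<Sum>m\<in>{m \<in> {m. m \<in> S \<and> card (?O m) dvd l}. ?O m = C}.
      v (class_pow G (cls y (?O m)) (l div card (?O m))))"
    using finS by (intro sum.group[symmetric]) auto
  also have "\<dots> = (\<Sum>C | C \<in> ?O ` S \<and> card C dvd l. of_nat (card C) * v (class_pow G (cls y C) (l div card C)))"
  proof (intro sum.cong HOL.refl)
    fix C assume C: "C \<in> {C. C \<in> ?O ` S \<and> card C dvd l}"
    have "{m \<in> {m. m \<in> S \<and> card (?O m) dvd l}. ?O m = C} = C"
    proof (intro subset_antisym subsetI)
      fix m assume "m \<in> {m \<in> {m. m \<in> S \<and> card (?O m) dvd l}. ?O m = C}"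
      then show "m \<in> C" using self[of m] by auto
    next
      fix m assume m: "m \<in> C"
      obtain k where k: "k \<in> S" "C = ?O k" using C by blast
      have "m \<in> S" using sub[OF k(1)] m k(2) by blast
      moreover have "?O m = C" using same[of m k] m k(2) by simp
      ultimately show "m \<in> {m \<in> {m. m \<in> S \<and> card (?O m) dvd l}. ?O m = C}" using C by simp
    qed
    moreover have "(\<Sum>m\<in>{m \<in> {m. m \<in> S \<and> card (?O m) dvd l}. ?O m = C}. v (class_pow G (cls y (?O m)) (l div card (?O m)))) =
      (\<Sum>m\<in>{m \<in> {m. m \<in> S \<and> card (?O m) dvd l}. ?O m = C}. v (class_pow G (cls y C) (l div card C)))"
      by (intro sum.cong) auto
    ultimately show "(\<Sum>m\<in>{m \<in> {m. m \<in> S \<and> card (?O m) dvd l}. ?O m = C}. v (class_pow G (cls y (?O m)) (l div card (?O m)))) =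
      of_nat (card C) * v (class_pow G (cls y C) (l div card C))" by simp
  qed
  finally show ?thesis .
qed

text \<open>The image of an intertwining map is stable under the group and under \<open>y\<close>,
  so it consists of the fibres over a set of cycles of \<open>y\<close>, onto which the map is a
  surjection.\<close>

lemma card_maps_by_image:
  assumes finK: "finite K" and y: "y \<in> wr G K" and finA: "finite A" and x: "x \<in> wr G A"
    and T: "T \<subseteq> orbit (bp y) ` K"
  shows "card (maps y (\<Union>T) A x) = (\<Sum>T'\<in>Pow T. surj_count A (\<Union>T') x y)"
proof -
  let ?E = "\<lambda>T'. {f \<in> esurj G A (\<Union>T'). \<forall>z\<in>pts G A. f (x z) = y (f z)}"
  let ?O = "orbit (bp y)"
  have perm: "permutation (bp y)" using base_permutes[OF finK y] finK by (auto simp: permutation_permutes)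
  have same: "?O k = ?O m" if "k \<in> ?O m" for k m
    by (rule orbit_cyclic_eq3[OF cyclic_on_orbit'[OF perm] that])
  have self: "m \<in> ?O m" for m by (rule permutation_self_in_orbit[OF perm])
  have TK: "\<Union>T \<subseteq> K" using T orbit_stable(1)[OF finK y] by fastforce
  have finT: "finite T" using finite_subset[OF T] finK by simp
  have fin': "finite (\<Union>T')" if "T' \<subseteq> T" for T'
    by (rule finite_subset[OF _ finK]) (use that TK in blast)
  have det: "T1 = T2" if "T1 \<subseteq> T" "T2 \<subseteq> T" "\<Union>T1 = \<Union>T2" for T1 T2
  proof -
    have "T1 \<subseteq> T2" if t: "T1 \<subseteq> T" "T2 \<subseteq> T" "\<Union>T1 = \<Union>T2" for T1 T2
    proof
      fix C assume C: "C \<in> T1"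
      then have "C \<in> ?O ` K" using t(1) T by blast
      then obtain m where m: "C = ?O m" by blast
      then have "m \<in> \<Union>T2" using self[of m] C unfolding t(3)[symmetric] by blast
      then obtain D where D: "D \<in> T2" "m \<in> D" by blast
      then have "D \<in> ?O ` K" using t(2) T by blast
      then obtain k where "D = ?O k" by blast
      then have "D = C" using same[of m k] D(2) m by simp
      then show "C \<in> T2" using D(1) by simp
    qed
    from this[OF that] this[OF that(2,1) that(3)[symmetric]] show ?thesis by blast
  qed
  have "maps y (\<Union>T) A x = (\<Union>T'\<in>Pow T. ?E T')"
  proof (intro subset_antisym subsetI)
    fix f assume f: "f \<in> maps y (\<Union>T) A x"
    \<comment> \<open>\<open>B\<close> collects the indices that occur in the image; by equivariance
      it is enough to test the unit element.\<close>
    define B where "B = {m. (\<one>, m) \<in> f ` pts G A}"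
    have im: "f ` pts G A = pts G B"
    proof (intro subset_antisym subsetI)
      fix w assume "w \<in> f ` pts G A"
      then obtain z where z: "z \<in> pts G A" "w = f z" by blast
      then have "w \<in> pts G (\<Union>T)" using mapsD(1)[OF f] by simp
      then obtain g m where w: "w = (g, m)" "g \<in> carrier G" by (auto simp: pts_def)
      have fz: "f z = (g, m)" using z(2) w(1) by simp
      have "f (lmult G (inv g) z) = lmult G (inv g) (g, m)"
        unfolding fz[symmetric] by (rule mapsD(2)[OF f inv_closed[OF w(2)] z(1)])
      also have "\<dots> = (\<one>, m)" using w(2) by (simp add: lmult_def)
      finally have "f (lmult G (inv g) z) = (\<one>, m)" .
      then have "(\<one>, m) \<in> f ` pts G A" using lmult_pts[OF inv_closed[OF w(2)] z(1)] by (metis image_eqI)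
      then show "w \<in> pts G B" using w by (simp add: B_def pts_def)
    next
      fix w assume "w \<in> pts G B"
      then obtain g m where w: "w = (g, m)" "g \<in> carrier G" "m \<in> B" by (auto simp: pts_def)
      then obtain z where z: "z \<in> pts G A" "(\<one>, m) = f z" by (auto simp: B_def simp del: split_paired_All)
      have "f (lmult G g z) = w" using mapsD(2)[OF f w(2) z(1)] w by (simp add: lmult_def flip: z(2))
      then show "w \<in> f ` pts G A" using lmult_pts[OF w(2) z(1)] by blast
    qed
    have BT: "B \<subseteq> \<Union>T"
    proof
      fix m assume "m \<in> B"
      then obtain z where "z \<in> pts G A" "(\<one>, m) = f z" by (auto simp: B_def simp del: split_paired_All)
      then have "(\<one>, m) \<in> pts G (\<Union>T)" using mapsD(1)[OF f] by simp
      then show "m \<in> \<Union>T" by (simp add: one_pts)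
    qed
    have step: "bp y m \<in> B" if m: "m \<in> B" for m
    proof -
      have mK: "m \<in> K" using m BT TK by blast
      have "(\<one>, m) \<in> f ` pts G A" using m by (simp add: B_def)
      then obtain z where z: "z \<in> pts G A" "(\<one>, m) = f z" by blast
      have "f (x z) = y (\<one>, m)" using mapsD(3)[OF f z(1)] z(2) by simp
      moreover have "f (x z) \<in> f ` pts G A" by (rule imageI[OF wrD(3)[OF x z(1)]])
      ultimately have "y (\<one>, m) \<in> pts G B" by (simp only: im)
      then show ?thesis by (auto simp: base_perm_def pts_def mem_Times_iff)
    qed
    have orbB: "?O m \<subseteq> B" if "m \<in> B" for m
    proof
      fix k assume "k \<in> ?O m"
      then show "k \<in> B" by induction (use that step in auto)
    qed
    define T' where "T' = {C \<in> T. C \<subseteq> B}"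
    have "\<Union>T' = B"
    proof (intro subset_antisym subsetI)
      fix m assume m: "m \<in> B"
      then obtain C where C: "C \<in> T" "m \<in> C" using BT by blast
      then obtain k where "C = ?O k" using T by blast
      then have "C = ?O m" using same[of m k] C(2) by simp
      then show "m \<in> \<Union>T'" using orbB[OF m] C by (auto simp: T'_def)
    qed (auto simp: T'_def)
    then have "f \<in> ?E T'"
      using f im by (auto simp: esurj_def maps_def eqv_def PiE_def Pi_def simp del: split_paired_All)
    then show "f \<in> (\<Union>T'\<in>Pow T. ?E T')" by (auto simp: T'_def)
  next
    fix f assume "f \<in> (\<Union>T'\<in>Pow T. ?E T')"
    then obtain T' where T': "T' \<subseteq> T" "f \<in> ?E T'" by blast
    have "pts G (\<Union>T') \<subseteq> pts G (\<Union>T)" using T'(1) by (intro pts_mono) auto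
    then show "f \<in> maps y (\<Union>T) A x"
      using T'(2) by (auto simp: esurj_def maps_def eqv_def PiE_def Pi_def simp del: split_paired_All)
  qed
  also have "card \<dots> = (\<Sum>T'\<in>Pow T. card (?E T'))"
  proof (rule card_UN_disjoint)
    show "\<forall>T'\<in>Pow T. finite (?E T')" using finite_esurj[OF finA fin'] by auto
    show "\<forall>T1\<in>Pow T. \<forall>T2\<in>Pow T. T1 \<noteq> T2 \<longrightarrow> ?E T1 \<inter> ?E T2 = {}"
    proof (intro ballI impI, rule ccontr)
      fix T1 T2 assume t: "T1 \<in> Pow T" "T2 \<in> Pow T" "T1 \<noteq> T2" "?E T1 \<inter> ?E T2 \<noteq> {}"
      then obtain f where "f \<in> esurj G A (\<Union>T1)" "f \<in> esurj G A (\<Union>T2)" by blast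
      then have "pts G (\<Union>T1) = pts G (\<Union>T2)" using esurjD(2) by metis
      then have "\<Union>T1 = \<Union>T2" unfolding set_eq_iff using one_pts by metis
      then show False using det t by blast
    qed
  qed (use finT in simp)
  finally show ?thesis by (simp only: surj_count_def)
qed

end

section \<open>Exponentials and logarithms of power series\<close>

text \<open>The value of the infinite sum when the n-th term vanishes below degree n: terms with n >
  k do not reach the coefficient of degree k.\<close>

definition fsum :: "(nat \<Rightarrow> 'r::comm_ring_1 fps) \<Rightarrow> 'r fps" where
  "fsum f = Abs_fps (\<lambda>k. \<Sum>n\<le>k. f n $ k)"

lemma fsum_nth: "fsum f $ k = (\<Sum>n\<le>k. f n $ k)"
  by (simp add: fsum_def)

lemma fsum_sums: "(\<And>n. vanish n (f n)) \<Longrightarrow> f sums fsum f"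
  unfolding fsum_def by (rule vanish_sums)

lemma suminf_eq_fsum: "(\<And>n. vanish n (f n)) \<Longrightarrow> suminf f = fsum f"
  by (rule sums_unique[symmetric, OF fsum_sums])

lemma fsum_nth_le:
  assumes "\<And>n. vanish n (f n)" "k \<le> N"
  shows "fsum f $ k = (\<Sum>n\<le>N. f n $ k)"
  unfolding fsum_nth by (rule sum.mono_neutral_left) (use assms in \<open>auto simp: vanish_def\<close>)

lemma vanish_mult_left: "vanish n F \<Longrightarrow> vanish n (H * F :: 'r::comm_ring_1 fps)"
  using vanish_mult[of 0 H n F] by (simp add: vanish_def)

lemma vanish_power_1: "F $ 0 = 0 \<Longrightarrow> vanish n (F ^ n :: 'r::comm_ring_1 fps)"
  using vanish_power[of 1 F n] by (simp add: vanish_def)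

lemma vanish_mono: "vanish n F \<Longrightarrow> m \<le> n \<Longrightarrow> vanish m F"
  by (auto simp: vanish_def)

lemma mult_fsum:
  assumes "\<And>n. vanish n (f n)"
  shows "H * fsum f = fsum (\<lambda>n. H * f n)"
proof (rule fps_ext)
  fix k
  have "(H * fsum f) $ k = (\<Sum>i=0..k. H $ i * (\<Sum>n\<le>k. f n $ (k - i)))"
    unfolding fps_mult_nth by (intro sum.cong refl) (simp add: fsum_nth_le[OF assms, where N = k])
  also have "\<dots> = (\<Sum>n\<le>k. \<Sum>i=0..k. H $ i * f n $ (k - i))"
    unfolding sum_distrib_left by (rule sum.swap)
  finally show "(H * fsum f) $ k = fsum (\<lambda>n. H * f n) $ k" by (simp add: fsum_nth fps_mult_nth)
qed

lemma deriv_fsum_nth: "fps_deriv (fsum f) $ k = (\<Sum>n\<le>Suc k. fps_deriv (f n) $ k)"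
  by (simp add: fsum_nth sum_distrib_left distrib_left)

definition qc :: "rat \<Rightarrow> 'a ppoly" where
  "qc r = Poly_Mapping.single 0 r"

lemma qconst_qc: "qconst r = fps_const (qc r)"
  by (simp add: qconst_def qc_def)

lemma qc_simps [simp]: "qc 0 = 0" "qc 1 = 1" "qc (r + s) = qc r + qc s" "qc (r * s) = qc r * qc s"
  by (simp_all add: qc_def single_add mult_single)

lemma qc_sum: "qc (\<Sum>e\<in>S. f e) = (\<Sum>e\<in>S. qc (f e))"
  by (induction S rule: infinite_finite_induct) simp_all

lemma of_nat_qc: "of_nat n = qc (of_nat n)"
  by (induction n) simp_all

lemma of_nat_qconst: "of_nat n = qconst (of_nat n)"
  by (induction n) (simp_all del: of_nat_Suc add: of_nat_Suc)

lemma ppoly_of_nat_cancel: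
  fixes P Q :: "'a ppoly"
  assumes "of_nat n * P = of_nat n * Q" "n > 0"
  shows "P = Q"
proof -
  have "qc (1 / of_nat n) * (of_nat n * P) = qc (1 / of_nat n) * (of_nat n * Q)" using assms(1) by simp
  moreover have "qc (1 / of_nat n) * (of_nat n * R) = R" for R :: "'a ppoly"
    using assms(2) by (simp add: of_nat_qc flip: mult.assoc qc_simps(4))
  ultimately show ?thesis by simp
qed

text \<open>Since positive integers can be cancelled, A' = H A determines each coefficient from the
  earlier ones. Identities between exponentials and logarithms are obtained by comparing such
  equations; the derivative is that in the variable recording the degree.\<close>

lemma deriv_eq_unique:
  fixes A B :: "'a pseries"
  assumes "A $ 0 = B $ 0" "fps_deriv A = H * A" "fps_deriv B = H * B"
  shows "A = B"
proof (rule fps_ext)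
  fix n show "A $ n = B $ n"
  proof (induction n rule: less_induct)
    case (less n)
    show ?case
    proof (cases n)
      case 0
      then show ?thesis using assms(1) by simp
    next
      case (Suc m)
      have "of_nat n * A $ n = (H * A) $ m" using assms(2) Suc by (metis Suc_eq_plus1 fps_deriv_nth)
      also have "\<dots> = (H * B) $ m"
        unfolding fps_mult_nth by (intro sum.cong refl) (use less Suc in auto)
      also have "\<dots> = of_nat n * B $ n" using assms(3) Suc by (metis Suc_eq_plus1 fps_deriv_nth)
      finally have E: "of_nat n * A $ n = of_nat n * B $ n" .
      show ?thesis by (rule ppoly_of_nat_cancel[OF E]) (simp add: Suc)
    qed
  qed
qed

section \<open>Exponential and logarithm\<close>

definition pexp :: "'a pseries \<Rightarrow> 'a pseries" where
  "pexp F = fsum (\<lambda>n. qconst (1 / fact n) * F ^ n)"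

lemma pexp_vanish: "F $ 0 = 0 \<Longrightarrow> vanish n (qconst (1 / fact n) * F ^ n)"
  by (intro vanish_mult_left vanish_power_1)

lemma pexp_0: "F $ 0 = 0 \<Longrightarrow> pexp F $ 0 = 1"
  by (simp add: pexp_def fsum_nth)

lemma deriv_qconst_mult: "fps_deriv (qconst r * F) = qconst r * fps_deriv F"
  by (simp add: qconst_qc)

lemma deriv_pexp:
  assumes "F $ 0 = 0"
  shows "fps_deriv (pexp F) = fps_deriv F * pexp F"
proof (rule fps_ext)
  fix k
  let ?f = "\<lambda>n. qconst (1 / fact n) * F ^ n"
  have d: "fps_deriv (?f (Suc n)) = fps_deriv F * ?f n" for n
  proof -
    have "qconst (1 / fact (Suc n)) * of_nat (Suc n) = qconst (1 / fact n)"
      unfolding of_nat_qconst qconst_simps(4)[symmetric] by (rule arg_cong[where f = qconst])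
        (simp add: fact_Suc del: of_nat_Suc)
    moreover have "fps_deriv (?f (Suc n)) = qconst (1 / fact (Suc n)) * (of_nat (Suc n) * fps_deriv F * F ^ n)"
      unfolding deriv_qconst_mult fps_deriv_power by (simp add: fps_of_nat del: of_nat_Suc)
    ultimately show ?thesis by (metis (no_types, opaque_lifting) mult.assoc mult.commute)
  qed
  have "fps_deriv (pexp F) $ k = (\<Sum>n\<le>Suc k. fps_deriv (?f n) $ k)"
    unfolding pexp_def by (rule deriv_fsum_nth)
  also have "\<dots> = fps_deriv (?f 0) $ k + (\<Sum>n\<le>k. fps_deriv (?f (Suc n)) $ k)"
    by (rule sum.atMost_Suc_shift)
  also have "\<dots> = (\<Sum>n\<le>k. (fps_deriv F * ?f n) $ k)"
    unfolding d by simp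
  also have "\<dots> = (fps_deriv F * pexp F) $ k"
    unfolding pexp_def mult_fsum[OF pexp_vanish[OF assms]] by (simp add: fsum_nth)
  finally show "fps_deriv (pexp F) $ k = (fps_deriv F * pexp F) $ k" .
qed

lemma pexp_add:
  assumes "F $ 0 = 0" "H $ 0 = 0"
  shows "pexp (F + H) = pexp F * pexp H"
proof (rule deriv_eq_unique[of _ _ "fps_deriv F + fps_deriv H"])
  show "fps_deriv (pexp (F + H)) = (fps_deriv F + fps_deriv H) * pexp (F + H)"
    using deriv_pexp[of "F + H"] assms by simp
  show "fps_deriv (pexp F * pexp H) = (fps_deriv F + fps_deriv H) * (pexp F * pexp H)"
    using deriv_pexp[OF assms(1)] deriv_pexp[OF assms(2)] by (simp add: algebra_simps)
qed (use assms in \<open>simp add: pexp_0\<close>)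

lemma pexp_zero: "pexp 0 = 1"
  by (rule deriv_eq_unique[of _ _ 0]) (use deriv_pexp[of 0] in \<open>simp_all add: pexp_0\<close>)

lemma pexp_sum: "finite S \<Longrightarrow> (\<And>i. i \<in> S \<Longrightarrow> f i $ 0 = 0) \<Longrightarrow> pexp (\<Sum>i\<in>S. f i) = (\<Prod>i\<in>S. pexp (f i))"
proof (induction S rule: finite_induct)
  case (insert i S)
  then show ?case using pexp_add[of "f i" "\<Sum>i\<in>S. f i"] by (simp add: fps_sum_nth)
qed (simp add: pexp_zero)

lemma log1p_fsum:
  assumes "F $ 0 = 0"
  shows "log1p F = fsum (\<lambda>k. qconst ((-1) ^ k / of_nat (Suc k)) * F ^ Suc k)"
    "vanish k (qconst ((-1) ^ k / of_nat (Suc k)) * F ^ Suc k)"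
proof -
  show v: "vanish k (qconst ((-1) ^ k / of_nat (Suc k)) * F ^ Suc k)" for k
    by (rule vanish_mult_left, rule vanish_mono[OF vanish_power_1[OF assms]]) simp
  show "log1p F = fsum (\<lambda>k. qconst ((-1) ^ k / of_nat (Suc k)) * F ^ Suc k)"
    unfolding log1p_def by (rule suminf_eq_fsum) (rule v)
qed

lemma log1p_vanish:
  assumes "vanish i F" "i \<ge> 1"
  shows "vanish i (log1p F)"
proof -
  have F0: "F $ 0 = 0" using assms by (simp add: vanish_def)
  have "vanish i (F ^ Suc k)" for k
    using vanish_power[OF assms(1), of "Suc k"] by (rule vanish_mono) simp
  then have "vanish i (qconst ((-1) ^ k / of_nat (Suc k)) * F ^ Suc k)" for k
    by (rule vanish_mult_left)
  then show ?thesis unfolding log1p_fsum(1)[OF F0] vanish_def fsum_nth by simp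
qed

lemma deriv_log1p:
  assumes "F $ 0 = 0"
  shows "fps_deriv (log1p F) * (1 + F) = fps_deriv F"
proof -
  let ?f = "\<lambda>k. qconst ((-1) ^ k / of_nat (Suc k)) * F ^ Suc k"
  \<comment> \<open>The terms of the geometric series of 1 / (1 + F).\<close>
  define g where "g k = qconst ((-1) ^ k) * F ^ k" for k
  have vg: "vanish k (g k)" for k unfolding g_def by (intro vanish_mult_left vanish_power_1 assms)
  have d: "fps_deriv (?f k) = fps_deriv F * g k" for k
  proof -
    have "qconst ((-1) ^ k / of_nat (Suc k)) * of_nat (Suc k) = qconst ((-1) ^ k)"
      unfolding of_nat_qconst qconst_simps(4)[symmetric] by (rule arg_cong[where f = qconst]) (simp del: of_nat_Suc)
    moreover have "fps_deriv (?f k) = qconst ((-1) ^ k / of_nat (Suc k)) * (of_nat (Suc k) * fps_deriv F * F ^ k)"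
      unfolding deriv_qconst_mult fps_deriv_power by (simp add: fps_of_nat del: of_nat_Suc)
    ultimately show ?thesis unfolding g_def by (metis (no_types, opaque_lifting) mult.assoc mult.commute)
  qed
  have 1: "fps_deriv (log1p F) = fps_deriv F * fsum g"
  proof (rule fps_ext)
    fix k
    have "fps_deriv (log1p F) $ k = (\<Sum>n\<le>Suc k. (fps_deriv F * g n) $ k)"
      unfolding log1p_fsum(1)[OF assms] deriv_fsum_nth d ..
    \<comment> \<open>Differentiation enlarges the range of summation by one, but the additional
      term still vanishes in degree k.\<close>
    also have "\<dots> = (\<Sum>n\<le>k. (fps_deriv F * g n) $ k)"
      using vanish_mult_left[OF vg[of "Suc k"], of "fps_deriv F"] by (simp add: vanish_def)
    also have "\<dots> = (fps_deriv F * fsum g) $ k"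
      unfolding mult_fsum[OF vg] by (simp add: fsum_nth)
    finally show "fps_deriv (log1p F) $ k = (fps_deriv F * fsum g) $ k" .
  qed
  have 2: "(1 + F) * fsum g = 1"
  proof (rule fps_ext)
    fix k
    have m: "qconst (- r) = - qconst r" for r
      using qconst_simps(3)[of r "- r"] by (simp add: eq_neg_iff_add_eq_0 add.commute del: qconst_simps(3))
    have t: "(1 + F) * g n = g n - g (Suc n)" for n
      by (simp add: g_def algebra_simps m)
    have "((1 + F) * fsum g) $ k = (\<Sum>n\<le>k. g n $ k - g (Suc n) $ k)"
      unfolding mult_fsum[OF vg] fsum_nth t by simp
    also have "\<dots> = g 0 $ k - g (Suc k) $ k" by (rule sum_telescope)
    also have "\<dots> = 1 $ k" using vg[of "Suc k"] by (simp add: vanish_def g_def)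
    finally show "((1 + F) * fsum g) $ k = 1 $ k" .
  qed
  show ?thesis unfolding 1 using 2 by (simp add: mult.assoc mult.commute[of "fsum g"])
qed

text \<open>Both sides have constant term 1, and the derivative of each is the side itself times the
  derivative of log(1 + F).\<close>

lemma pexp_log1p:
  assumes "F $ 0 = 0"
  shows "pexp (log1p F) = 1 + F"
proof (rule deriv_eq_unique[of _ _ "fps_deriv (log1p F)"])
  have l0: "log1p F $ 0 = 0" using log1p_vanish[of 1 F] assms by (simp add: vanish_def)
  then show "fps_deriv (pexp (log1p F)) = fps_deriv (log1p F) * pexp (log1p F)" by (rule deriv_pexp)
  show "pexp (log1p F) $ 0 = (1 + F) $ 0" using l0 assms by (simp add: pexp_0)
  show "fps_deriv (1 + F) = fps_deriv (log1p F) * (1 + F)" using deriv_log1p[OF assms] by simp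
qed

section \<open>Substitution homomorphisms\<close>

lemma A_ring_fsum: "(\<And>n. f n \<in> A_ring G) \<Longrightarrow> fsum f \<in> A_ring G"
  by (auto simp: A_ring_def fsum_nth intro!: homog_sum)

lemma pexp_A_ring: "F \<in> A_ring G \<Longrightarrow> pexp F \<in> A_ring G"
  unfolding pexp_def by (intro A_ring_fsum A_ring_mult A_ring_qconst A_ring_power)

lemma A_plus_iff: "F \<in> A_plus G \<longleftrightarrow> F \<in> A_ring G \<and> F $ 0 = 0"
  by (auto simp: A_plus_def)

lemma log1p_A_plus: "F \<in> A_plus G \<Longrightarrow> log1p F \<in> A_plus G"
  using log1p_vanish[of 1 F]
  by (auto simp: A_plus_iff log1p_fsum(1) vanish_def intro!: A_ring_fsum A_ring_mult A_ring_power)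

locale subst_hom =
  fixes H :: "('c, 'd) monoid_scheme" and G :: "('a, 'b) monoid_scheme" and \<phi> :: "'c pvar \<Rightarrow> 'a pseries"
  assumes graded: "graded_subst H G \<phi>"
begin

lemma hom: "cont_alg_hom H G (psubst \<phi>)"
  by (rule psubst_cont_alg_hom[OF graded])

lemma hom_A_ring: "F \<in> A_ring H \<Longrightarrow> psubst \<phi> F \<in> A_ring G"
  and hom_qconst: "psubst \<phi> (qconst r) = qconst r"
  and hom_add: "F \<in> A_ring H \<Longrightarrow> F' \<in> A_ring H \<Longrightarrow> psubst \<phi> (F + F') = psubst \<phi> F + psubst \<phi> F'"
  and hom_mult: "F \<in> A_ring H \<Longrightarrow> F' \<in> A_ring H \<Longrightarrow> psubst \<phi> (F * F') = psubst \<phi> F * psubst \<phi> F'"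
  using hom by (auto simp: cont_alg_hom_def)

lemma hom_1: "psubst \<phi> 1 = 1" and hom_0: "psubst \<phi> 0 = 0"
  using hom_qconst[of 1] hom_qconst[of 0] by simp_all

lemma hom_power: "F \<in> A_ring H \<Longrightarrow> psubst \<phi> (F ^ n) = psubst \<phi> F ^ n"
  by (induction n) (simp_all add: hom_1 hom_mult A_ring_power)

lemma hom_sum: "(\<And>i. i \<in> I \<Longrightarrow> f i \<in> A_ring H) \<Longrightarrow> psubst \<phi> (\<Sum>i\<in>I. f i) = (\<Sum>i\<in>I. psubst \<phi> (f i))"
  by (induction I rule: infinite_finite_induct) (simp_all add: hom_0 hom_add A_ring_sum)

lemma hom_prod: "(\<And>i. i \<in> I \<Longrightarrow> f i \<in> A_ring H) \<Longrightarrow> psubst \<phi> (\<Prod>i\<in>I. f i) = (\<Prod>i\<in>I. psubst \<phi> (f i))"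
  by (induction I rule: infinite_finite_induct) (simp_all add: hom_1 hom_mult A_ring_prod)

lemma hom_vanish: "F \<in> A_ring H \<Longrightarrow> vanish n F \<Longrightarrow> vanish n (psubst \<phi> F)"
  by (simp add: vanish_def psubst_nth[OF graded])

text \<open>Continuity in the form used for infinite sums: in each degree both sides reduce to the
  same finite sum.\<close>

lemma hom_fsum:
  assumes "\<And>n. f n \<in> A_ring H" "\<And>n. vanish n (f n)"
  shows "psubst \<phi> (fsum f) = fsum (\<lambda>n. psubst \<phi> (f n))"
proof (rule fps_ext)
  fix k
  have "psubst \<phi> (fsum f) $ k = (\<Sum>n\<le>k. eval_poly \<phi> (\<Sum>m\<le>k. f m $ n) $ k)"
    unfolding psubst_nth[OF graded A_ring_fsum[OF assms(1)]]
    by (intro sum.cong refl) (simp add: fsum_nth_le[OF assms(2), where N = k])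
  also have "\<dots> = (\<Sum>m\<le>k. \<Sum>n\<le>k. eval_poly \<phi> (f m $ n) $ k)"
    unfolding eval_poly_sum fps_sum_nth by (rule sum.swap)
  finally show "psubst \<phi> (fsum f) $ k = fsum (\<lambda>n. psubst \<phi> (f n)) $ k"
    by (simp add: fsum_nth psubst_nth[OF graded assms(1)])
qed

lemma hom_A_plus: "F \<in> A_plus H \<Longrightarrow> psubst \<phi> F \<in> A_plus G"
  using hom_A_ring hom_vanish[of F 1] by (auto simp: A_plus_iff vanish_def)

lemma hom_pexp:
  assumes "F \<in> A_plus H"
  shows "psubst \<phi> (pexp F) = pexp (psubst \<phi> F)"
  using assms unfolding pexp_def A_plus_iff
  by (subst hom_fsum) (simp_all add: A_ring_mult A_ring_power pexp_vanish hom_mult hom_qconst hom_power)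

lemma hom_log1p:
  assumes "F \<in> A_plus H"
  shows "psubst \<phi> (log1p F) = log1p (psubst \<phi> F)"
proof -
  have F: "F \<in> A_ring H" "F $ 0 = 0" "psubst \<phi> F $ 0 = 0"
    using assms hom_A_plus[OF assms] by (auto simp: A_plus_iff)
  show ?thesis unfolding log1p_fsum(1)[OF F(2)] log1p_fsum(1)[OF F(3)]
    by (subst hom_fsum) (use F log1p_fsum(2)[OF F(2)] in \<open>simp_all add: A_ring_mult A_ring_power hom_mult hom_qconst hom_power del: power_Suc\<close>)
qed

end

section \<open>The Moebius function and the plethystic logarithm\<close>

text \<open>Squarefree divisors are the products of sets of prime factors of \<open>n\<close>, so
  the sum is the expansion of the product of (-1) + 1 over all prime factors.\<close>

lemma sum_moebius:
  assumes "n > 0"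
  shows "(\<Sum>e | e dvd n. moebius e) = (if n = 1 then 1 else 0)"
proof -
  let ?P = "prime_factors n"
  have fin: "finite {e. e dvd n}" using assms by simp
  have "(\<Sum>e | e dvd n. moebius e) = (\<Sum>e | e dvd n \<and> squarefree e. (-1) ^ card (prime_factors e))"
    using fin by (intro sum.mono_neutral_cong_right) (auto simp: moebius_def)
  also have "\<dots> = (\<Sum>S\<in>Pow ?P. (-1) ^ card S)"
  proof (rule sum.reindex_bij_witness[of _ "\<lambda>S. \<Prod>S" prime_factors])
    fix e assume e: "e \<in> {e. e dvd n \<and> squarefree e}"
    then have e0: "e \<noteq> 0" using assms by auto
    show "\<Prod>(prime_factors e) = e"
    proof -
      have "e = (\<Prod>p\<in>prime_factors e. p ^ multiplicity p e)"
        using prime_factorization_nat[of e] e0 by simp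
      also have "\<dots> = (\<Prod>p\<in>prime_factors e. p)"
      proof (intro prod.cong refl)
        fix p assume p: "p \<in> prime_factors e"
        then have "multiplicity p e = 1"
          using e squarefree_factorial_semiring'[OF e0] by auto
        then show "p ^ multiplicity p e = p" by simp
      qed
      finally show ?thesis by simp
    qed
    show "prime_factors e \<in> Pow ?P" using e assms by (auto intro: dvd_prime_factors[THEN subsetD])
  next
    fix S assume S: "S \<in> Pow ?P"
    then have fS: "finite S" and pS: "\<And>p. p \<in> S \<Longrightarrow> prime p" using finite_subset[of S ?P] by auto
    have "multiplicity q (\<Prod>S) = (if q \<in> S then 1 else 0)" if "prime q" for q
      using multiplicity_prod_prime_powers[OF fS pS that, of "\<lambda>_. 1"] by simp
    note mult = this
    have S0: "\<Prod>S \<noteq> 0" using pS[of 0] fS by (auto simp: prod_zero_iff)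
    show pf: "prime_factors (\<Prod>S) = S"
      using mult S0 pS by (auto simp: prime_factors_multiplicity split: if_splits)
    have "\<Prod>S dvd n"
    proof (rule multiplicity_le_imp_dvd[OF S0])
      fix q :: nat assume q: "prime q"
      show "multiplicity q (\<Prod>S) \<le> multiplicity q n"
        using S q by (auto simp: mult prime_factors_multiplicity)
    qed
    moreover have "squarefree (\<Prod>S)"
      unfolding squarefree_factorial_semiring'[OF S0] pf using mult pS by auto
    ultimately show "\<Prod>S \<in> {e. e dvd n \<and> squarefree e}" by simp
  qed auto
  also have "\<dots> = (\<Prod>p\<in>?P. (-1::int) + 1)"
    by (subst prod_add) simp_all
  also have "\<dots> = (if n = 1 then 1 else 0)"
    using assms by (auto simp: prime_factorization_empty_iff power_0_left)
  finally show ?thesis .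
qed

section \<open>The cycle index of pairs\<close>

lemma fps_const_of_nat_mult: "of_nat n * (fps_const c * fps_X ^ k) = fps_const (of_nat n * c) * fps_X ^ k"
  for c :: "'r::comm_ring_1"
  by (simp add: fps_of_nat[symmetric] fps_const_mult[symmetric] mult.assoc del: fps_const_mult)

lemma psum_eq: "psum l c = fps_const (psum l c $ l) * fps_X ^ l"
  by (simp add: psum_def)

lemma prod_fps_const: "(\<Prod>i\<in>S. fps_const (f i)) = fps_const (\<Prod>i\<in>S. f i)"
  for f :: "'x \<Rightarrow> 'r::comm_ring_1"
  by (induction S rule: infinite_finite_induct) simp_all

text \<open>Inclusion-exclusion in a form without signs: the sums over all subsets determine the
  summands, by induction on the size of the set.\<close>

lemma Pow_sum_eq:
  fixes a b :: "'x set \<Rightarrow> 'r::comm_ring_1"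
  assumes "finite S" and eq: "\<And>T. T \<subseteq> S \<Longrightarrow> (\<Sum>T'\<in>Pow T. a T') = (\<Sum>T'\<in>Pow T. b T')"
  shows "T \<subseteq> S \<Longrightarrow> a T = b T"
proof (induction "card T" arbitrary: T rule: less_induct)
  case less
  have fin: "finite T" using finite_subset[OF less.prems assms(1)] .
  have r: "(\<Sum>T'\<in>Pow T. f T') = f T + (\<Sum>T'\<in>Pow T - {T}. f T')" for f :: "'x set \<Rightarrow> 'r"
    using fin by (subst sum.remove[of _ T]) auto
  have "(\<Sum>T'\<in>Pow T - {T}. a T') = (\<Sum>T'\<in>Pow T - {T}. b T')"
  proof (intro sum.cong HOL.refl less.hyps)
    fix T' assume "T' \<in> Pow T - {T}"
    then show "card T' < card T" "T' \<subseteq> S" using fin less.prems by (auto intro: psubset_card_mono)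
  qed
  then show ?case using eq[OF less.prems] unfolding r by simp
qed

context fgroup
begin

text \<open>The exponent of \<open>p\<^sub>i(c) \<circ> Exp\<close>, where \<open>Exp\<close> belongs to the trivial group. The term \<open>j = 0\<close> vanishes, as \<open>1 / 0 = 0\<close>.\<close>

definition PV :: "nat \<Rightarrow> 'a set \<Rightarrow> 'a pseries" where
  "PV i c = fsum (\<lambda>j. qconst (1 / of_nat j) * psum (i * j) (class_pow G c j))"

lemma PV_vanish:
  assumes "i \<ge> 1"
  shows "vanish j (qconst (1 / of_nat j) * psum (i * j) (class_pow G c j))"
proof -
  have "j \<le> i * j" using assms by simp
  then have "vanish j (psum (i * j) (class_pow G c j))" by (auto simp: vanish_def psum_nth)
  then show ?thesis by (rule vanish_mult_left)
qed

lemma PV_0: "PV i c $ 0 = 0"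
  by (simp add: PV_def fsum_nth)

text \<open>Only j = l / i contributes in degree l, and multiplication by l turns its coefficient 1
  / j into i.\<close>

lemma PV_nth:
  assumes "i \<ge> 1" "l \<ge> 1"
  shows "of_nat l * PV i c $ l = (if i dvd l then of_nat i * psum l (class_pow G c (l div i)) $ l else 0)"
proof -
  have t: "(qconst (1 / of_nat j) * psum (i * j) (class_pow G c j)) $ l =
      (if i * j = l then qc (1 / of_nat j) * psum l (class_pow G c j) $ l else 0)" for j
    by (auto simp: qconst_qc psum_nth)
  show ?thesis
  proof (cases "i dvd l")
    case True
    define j where "j = l div i"
    have j: "l = i * j" using True by (simp add: j_def)
    then have j0: "j \<noteq> 0" "j \<le> l" using assms by auto
    have "PV i c $ l = (\<Sum>j'\<le>l. if j' = j then qc (1 / of_nat j) * psum l (class_pow G c j) $ l else 0)"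
      unfolding PV_def fsum_nth t using j assms(1) by (intro sum.cong HOL.refl) auto
    then have "PV i c $ l = qc (1 / of_nat j) * psum l (class_pow G c j) $ l" using j0 by simp
    moreover have "of_nat l * qc (1 / of_nat j) = (of_nat i :: 'a ppoly)"
      unfolding of_nat_qc qc_simps(4)[symmetric] using j0 by (simp add: j del: qc_simps)
    ultimately show ?thesis using True by (simp add: j_def[symmetric] flip: mult.assoc)
  next
    case False
    then have "PV i c $ l = 0" unfolding PV_def fsum_nth t by (intro sum.neutral) auto
    then show ?thesis using False by simp
  qed
qed

text \<open>This is the coefficient of degree n in (exp V)' = V' exp V, multiplied by q and put in
  homogeneous form, so that it fits the recursion of \<open>sum_wr_rec\<close>.\<close>

lemma pexp_recursion:
  fixes V :: "'a pseries" and U :: "nat \<Rightarrow> 'a pseries"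
  assumes V: "V $ 0 = 0" and U: "\<And>l. U (Suc l) = fps_const (of_nat q * (of_nat (Suc l) * V $ Suc l)) * fps_X ^ Suc l"
  shows "of_nat (Suc n * q) * (fps_const (pexp V $ Suc n) * fps_X ^ Suc n) =
    (\<Sum>l\<le>n. U (Suc l) * (fps_const (pexp V $ (n - l)) * fps_X ^ (n - l)))"
proof -
  have "U (Suc l) * (fps_const (pexp V $ (n - l)) * fps_X ^ (n - l)) =
      fps_const (of_nat q * (fps_deriv V $ l * pexp V $ (n - l))) * fps_X ^ Suc n" if "l \<le> n" for l
  proof -
    have "U (Suc l) * (fps_const (pexp V $ (n - l)) * fps_X ^ (n - l)) =
        fps_const (of_nat q * (of_nat (Suc l) * V $ Suc l)) * fps_const (pexp V $ (n - l)) *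
        (fps_X ^ Suc l * fps_X ^ (n - l))"
      unfolding U by (simp only: mult_ac)
    also have "fps_X ^ Suc l * fps_X ^ (n - l) = (fps_X ^ Suc n :: 'a pseries)"
      unfolding power_add[symmetric] using that by simp
    finally show ?thesis by (simp add: mult_ac del: of_nat_Suc)
  qed
  then have "(\<Sum>l\<le>n. U (Suc l) * (fps_const (pexp V $ (n - l)) * fps_X ^ (n - l))) =
      (\<Sum>l\<le>n. fps_const (of_nat q * (fps_deriv V $ l * pexp V $ (n - l))) * fps_X ^ Suc n)" by simp
  also have "\<dots> = fps_const (of_nat q * (\<Sum>l\<le>n. fps_deriv V $ l * pexp V $ (n - l))) * fps_X ^ Suc n"
  proof -
    have fs: "(\<Sum>i\<in>S. fps_const (f i)) = fps_const (\<Sum>i\<in>S. f i)" for S :: "nat set" and f :: "nat \<Rightarrow> 'a ppoly"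
      by (induction S rule: infinite_finite_induct) auto
    show ?thesis unfolding sum_distrib_right[symmetric] fs sum_distrib_left ..
  qed
  also have "(\<Sum>l\<le>n. fps_deriv V $ l * pexp V $ (n - l)) = fps_deriv (pexp V) $ n"
    unfolding deriv_pexp[OF V] fps_mult_nth atMost_atLeast0 ..
  also have "\<dots> = of_nat (Suc n) * pexp V $ Suc n" by simp
  finally have E: "(\<Sum>l\<le>n. U (Suc l) * (fps_const (pexp V $ (n - l)) * fps_X ^ (n - l))) =
      fps_const (of_nat q * (of_nat (Suc n) * pexp V $ Suc n)) * fps_X ^ Suc n" .
  show ?thesis unfolding E fps_const_of_nat_mult by (simp only: of_nat_mult mult_ac)
qed

lemma card_cycle_pos:
  assumes "finite K" "y \<in> wr G K" "C \<in> orbit (bp y) ` K"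
  shows "card C \<ge> 1" "finite C"
proof -
  obtain m where m: "m \<in> K" "C = orbit (bp y) m" using assms(3) by auto
  then show "finite C" using finite_subset[OF orbit_stable(1)[OF assms(1,2)]] assms(1) by simp
  then show "card C \<ge> 1" using orbit_stable(3)[OF assms(1,2) m(1)] m(2) by (auto simp: Suc_le_eq card_gt_0_iff)
qed

lemma orbit_union:
  assumes "finite K" "y \<in> wr G K" "T \<subseteq> orbit (bp y) ` K"
  shows "\<Union>T \<subseteq> K" "bp y ` \<Union>T = \<Union>T" "orbit (bp y) ` \<Union>T = T"
proof -
  have perm: "permutation (bp y)" using base_permutes[OF assms(1,2)] assms(1) by (auto simp: permutation_permutes)
  have same: "orbit (bp y) k = C" if "C \<in> T" "k \<in> C" for k C
    using orbit_cyclic_eq3[OF cyclic_on_orbit'[OF perm]] that assms(3) by auto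
  have ne: "\<exists>k. k \<in> C" if "C \<in> T" for C using that assms(3) orbit_nonempty by fastforce
  show "\<Union>T \<subseteq> K" using assms(3) orbit_stable(1)[OF assms(1,2)] by fastforce
  have st: "bp y ` C = C" if "C \<in> T" for C
    using that assms(3) orbit_stable(2)[OF assms(1,2)] by auto
  then show "bp y ` \<Union>T = \<Union>T" by (auto simp: image_Union)
  show "orbit (bp y) ` \<Union>T = T"
  proof (intro subset_antisym subsetI)
    fix C assume C: "C \<in> T"
    obtain k where "k \<in> C" using ne[OF C] by blast
    then show "C \<in> orbit (bp y) ` \<Union>T" using same[OF C] C by (intro image_eqI[of _ _ k]) auto
  qed (use same in auto)
qed

text \<open>\<open>sum_wr_rec\<close> applied to the number of maps times the cycle monomial. With V
  the sum of the exponents \<open>PV\<close>, counting fixed points along the cycles of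
  \<open>y\<close> identifies the contribution of single cycles of length l as q l times the
  coefficient of V in degree l.\<close>

lemma sum_maps_wt:
  assumes finK: "finite K" and y: "y \<in> wr G K" and T: "T \<subseteq> orbit (bp y) ` K" and finA: "finite A"
  shows "(\<Sum>x\<in>wr G A. of_nat (card (maps y (\<Union>T) A x)) * wt psum A x) =
    of_nat (card (carrier G) ^ card A * fact (card A)) *
      (fps_const ((\<Prod>C\<in>T. pexp (PV (card C) (cls y C))) $ card A) * fps_X ^ card A)"
proof -
  define q where "q = card (carrier G)"
  define V where "V = (\<Sum>C\<in>T. PV (card C) (cls y C))"
  define U :: "nat \<Rightarrow> 'a pseries" where "U l = of_nat q * (\<Sum>C | C \<in> T \<and> card C dvd l.
      of_nat (card C) * psum l (class_pow G (cls y C) (l div card C)))" for l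
  note un = orbit_union[OF finK y T]
  have finT: "finite T" using finite_subset[OF T] finK by simp
  have cpos: "card C \<ge> 1" if "C \<in> T" for C using card_cycle_pos(1)[OF finK y] T that by blast
  have V0: "V $ 0 = 0" by (simp add: V_def fps_sum_nth PV_0)
  have pV: "pexp V = (\<Prod>C\<in>T. pexp (PV (card C) (cls y C)))"
    unfolding V_def by (rule pexp_sum[OF finT PV_0])
  have U: "U (Suc l) = fps_const (of_nat q * (of_nat (Suc l) * V $ Suc l)) * fps_X ^ Suc l" for l
  proof -
    have fs: "(\<Sum>i\<in>S. fps_const (f i)) = fps_const (\<Sum>i\<in>S. f i)" for S :: "nat set set" and f :: "nat set \<Rightarrow> 'a ppoly"
      by (induction S rule: infinite_finite_induct) auto
    have "of_nat (Suc l) * V $ Suc l = (\<Sum>C\<in>T. of_nat (Suc l) * PV (card C) (cls y C) $ Suc l)"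
      by (simp only: V_def fps_sum_nth sum_distrib_left)
    also have "\<dots> = (\<Sum>C\<in>T. if card C dvd Suc l then of_nat (card C) *
        psum (Suc l) (class_pow G (cls y C) (Suc l div card C)) $ Suc l else 0)"
      by (intro sum.cong HOL.refl PV_nth cpos) auto
    also have "\<dots> = (\<Sum>C | C \<in> T \<and> card C dvd Suc l. of_nat (card C) *
        psum (Suc l) (class_pow G (cls y C) (Suc l div card C)) $ Suc l)"
      using finT by (simp add: sum.inter_filter)
    finally have e: "of_nat (Suc l) * V $ Suc l = \<dots>" .
    have "of_nat (card C) * psum (Suc l) d = fps_const (of_nat (card C) * psum (Suc l) d $ Suc l) * fps_X ^ Suc l"
      for C :: "nat set" and d :: "'a set"
      by (subst psum_eq) (rule fps_const_of_nat_mult)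
    then have "U (Suc l) = of_nat q * (\<Sum>C | C \<in> T \<and> card C dvd Suc l. fps_const (of_nat (card C) *
        psum (Suc l) (class_pow G (cls y C) (Suc l div card C)) $ Suc l) * fps_X ^ Suc l)"
      unfolding U_def by (simp only:)
    also have "\<dots> = of_nat q * (fps_const (of_nat (Suc l) * V $ Suc l) * fps_X ^ Suc l)"
      unfolding sum_distrib_right[symmetric] fs e ..
    finally show ?thesis unfolding fps_const_of_nat_mult .
  qed
  have cyc: "(\<Sum>x\<in>cyc a Z. of_nat (card (maps y (\<Union>T) Z x)) * wt psum Z x) =
      of_nat (card (carrier G) ^ (card Z - 1) * fact (card Z - 1)) * U (card Z)"
    if Z: "finite Z" "a \<in> Z" for a Z
  proof -
    let ?u = "\<lambda>h. of_nat (card {w \<in> pts G (\<Union>T). (y ^^ card Z) w = lmult G h w}) * psum (card Z) (conj_class G h)"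
    have "(\<Sum>x\<in>cyc a Z. of_nat (card (maps y (\<Union>T) Z x)) * wt psum Z x) = (\<Sum>x\<in>cyc a Z. ?u (gain x (card Z) a))"
      by (intro sum.cong HOL.refl) (simp add: card_maps_cyc[OF finK y un(1,2) Z(1)] wt_cyc[OF Z(1)])
    also have "\<dots> = of_nat (card (carrier G) ^ (card Z - 1) * fact (card Z - 1)) * (\<Sum>h\<in>carrier G. ?u h)"
      by (rule sum_cyc_gain[OF Z])
    also have "(\<Sum>h\<in>carrier G. ?u h) = U (card Z)"
      unfolding sum_conj_fixed[OF finK y un(1)] sum_fixed_by_cycles[OF finK y un(1,2)] un(3) U_def q_def ..
    finally show ?thesis .
  qed
  show ?thesis unfolding pV[symmetric]
  proof (rule sum_wr_rec[where U = U and z = "\<lambda>n. fps_const (pexp V $ n) * fps_X ^ n"])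
    show "of_nat (card (maps y (\<Union>T) A x)) * wt psum A x =
      of_nat (card (maps y (\<Union>T) Z (rs x Z))) * wt psum Z (rs x Z) *
      (of_nat (card (maps y (\<Union>T) (A - Z) (rs x (A - Z)))) * wt psum (A - Z) (rs x (A - Z)))"
      if "finite A" "x \<in> wr G A" "Z \<subseteq> A" "bp x ` Z = Z" for A x Z
      unfolding card_maps_mult[OF that] wt_mult[OF that] of_nat_mult by (simp only: mult_ac)
    have "maps y (\<Union>T) {} id = {\<lambda>_. undefined}"
      by (auto simp: maps_def eqv_def equivar_def)
    then show "of_nat (card (maps y (\<Union>T) {} id)) * wt psum {} id = (1 :: 'a pseries)"
      by (simp add: wt_def)
    show "fps_const (pexp V $ 0) * fps_X ^ 0 = (1 :: 'a pseries)" using V0 by (simp add: pexp_0)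
    show "of_nat (Suc n * card (carrier G)) * (fps_const (pexp V $ Suc n) * fps_X ^ Suc n) =
        (\<Sum>l\<le>n. U (Suc l) * (fps_const (pexp V $ (n - l)) * fps_X ^ (n - l)))" for n
      unfolding q_def[symmetric] by (rule pexp_recursion[OF V0 U])
  qed (use cyc finA in auto)
qed

section \<open>Characteristics as normalised sums over the wreath product\<close>

definition cfac :: "nat \<Rightarrow> 'a pseries" where
  "cfac n = qconst (1 / (of_nat (card (carrier G)) ^ n * fact n))"

lemma cfac_mult: "cfac n * (of_nat (card (carrier G) ^ n * fact n) * F) = F"
proof -
  have "cfac n * of_nat (card (carrier G) ^ n * fact n) = 1"
    unfolding cfac_def of_nat_qconst qconst_simps(4)[symmetric] using card_G_pos by simp
  then show ?thesis by (simp flip: mult.assoc)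
qed

text \<open>Sorting all maps by image, and expanding the product of the factors (E - 1) + 1, give
  sums over the same sets of cycles. As this holds for every set \<open>T\<close> of cycles, the
  summands agree, and the set of all cycles gives the claim.\<close>

lemma surj_series:
  assumes y: "y \<in> wr G {1..k}"
  shows "(\<Prod>C\<in>orbit (bp y) ` {1..k}. pexp (PV (card C) (cls y C)) - 1) $ n =
    (cfac n * (\<Sum>x\<in>wr G {1..n}. of_nat (surj_count {1..n} {1..k} x y) * wt psum {1..n} x)) $ n"
proof -
  let ?O = "orbit (bp y) ` {1..k}" and ?E = "\<lambda>C. pexp (PV (card C) (cls y C))"
  define a where "a T = (cfac n * (\<Sum>x\<in>wr G {1..n}. of_nat (surj_count {1..n} (\<Union>T) x y) * wt psum {1..n} x)) $ n" for T
  define b where "b T = (\<Prod>C\<in>T. ?E C - 1) $ n" for T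
  have "a ?O = b ?O"
  proof (rule Pow_sum_eq[of ?O])
    fix T assume T: "T \<subseteq> ?O"
    have finT: "finite T" using finite_subset[OF T] by simp
    have "(\<Sum>T'\<in>Pow T. a T') = (cfac n * (\<Sum>x\<in>wr G {1..n}. of_nat (card (maps y (\<Union>T) {1..n} x)) * wt psum {1..n} x)) $ n"
    proof -
      have "(\<Sum>T'\<in>Pow T. a T') = (cfac n * (\<Sum>T'\<in>Pow T. \<Sum>x\<in>wr G {1..n}. of_nat (surj_count {1..n} (\<Union>T') x y) * wt psum {1..n} x)) $ n"
        unfolding a_def sum_distrib_left fps_sum_nth ..
      also have "(\<Sum>T'\<in>Pow T. \<Sum>x\<in>wr G {1..n}. of_nat (surj_count {1..n} (\<Union>T') x y) * wt psum {1..n} x) =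
          (\<Sum>x\<in>wr G {1..n}. (\<Sum>T'\<in>Pow T. of_nat (surj_count {1..n} (\<Union>T') x y)) * wt psum {1..n} x)"
        unfolding sum_distrib_right by (rule sum.swap)
      also have "\<dots> = (\<Sum>x\<in>wr G {1..n}. of_nat (card (maps y (\<Union>T) {1..n} x)) * wt psum {1..n} x)"
        using card_maps_by_image[OF _ y _ _ T] by (intro sum.cong HOL.refl) simp
      finally show ?thesis .
    qed
    also have "\<dots> = (\<Prod>C\<in>T. ?E C) $ n"
      using sum_maps_wt[OF _ y T, of "{1..n}"] cfac_mult[of n] by simp
    also have "(\<Prod>C\<in>T. ?E C) = (\<Prod>C\<in>T. (?E C - 1) + 1)" by simp
    also have "\<dots> = (\<Sum>T'\<in>Pow T. \<Prod>C\<in>T'. ?E C - 1)" by (subst prod_add[OF finT]) simp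
    also have "\<dots> $ n = (\<Sum>T'\<in>Pow T. b T')" by (simp add: b_def fps_sum_nth)
    finally show "(\<Sum>T'\<in>Pow T. a T') = (\<Sum>T'\<in>Pow T. b T')" .
  qed auto
  moreover have "\<Union>?O = {1..k}"
    using orbit_stable[OF _ y] by fastforce
  ultimately show ?thesis by (simp only: a_def b_def)
qed

lemma conj_class_in: "h \<in> carrier G \<Longrightarrow> conj_class G h \<in> conj_classes G"
  by (auto simp: conj_classes_def)

lemma cls_in:
  assumes "finite A" "x \<in> wr G A" "C \<in> orbit (bp x) ` A"
  shows "cls x C \<in> conj_classes G"
proof -
  obtain m where m: "m \<in> A" "C = orbit (bp x) m" using assms(3) by auto
  then show ?thesis using cls_eq[OF assms(1,2) m(1)] funpow_pt(3)[OF assms(2) m(1)] conj_class_in by simp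
qed

text \<open>\<open>cycle_count\<close> asks for some point of the cycle and some element of the
  class. The displacements along a cycle are conjugate, so this means that the cycle has class
  \<open>c\<close>, and the product can be grouped by length and class.\<close>

lemma cycle_indicator_eq:
  assumes x: "x \<in> wr G {1..n}"
  shows "cycle_indicator G n x = wt psum {1..n} x"
proof -
  let ?O = "orbit (bp x) ` {1..n}"
  have fin: "finite {1..n}" by simp
  have perm: "permutation (bp x)" using base_permutes[OF fin x] fin by (auto simp: permutation_permutes)
  have finC: "finite (conj_classes G)" using fin_G by (simp add: conj_classes_def)
  have iff: "(\<exists>m\<in>Z. \<exists>h\<in>c. (x ^^ card Z) (\<one>, m) = (h, m)) \<longleftrightarrow> cls x Z = c"
    if Z: "Z \<in> ?O" and c: "c \<in> conj_classes G" for Z c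
  proof
    assume "\<exists>m\<in>Z. \<exists>h\<in>c. (x ^^ card Z) (\<one>, m) = (h, m)"
    then obtain m h where m: "m \<in> Z" "h \<in> c" "gain x (card Z) m = h" by (auto simp: gain_def)
    obtain k where k: "k \<in> {1..n}" "Z = orbit (bp x) k" using Z by auto
    have mA: "m \<in> {1..n}" using orbit_stable(1)[OF fin x k(1)] m(1) k(2) by blast
    have Zm: "Z = orbit (bp x) m"
      using orbit_cyclic_eq3[OF cyclic_on_orbit'[OF perm], of m k] m(1) k(2) by simp
    have cl: "cls x Z = conj_class G h" using cls_eq[OF fin x mA] Zm m(3) by simp
    obtain t where t: "t \<in> carrier G" "c = conj_class G t" using c by (auto simp: conj_classes_def)
    obtain g where g: "g \<in> carrier G" "h = g \<otimes> t \<otimes> inv g" using m(2) t(2) by (auto simp: conj_class_def)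
    show "cls x Z = c" using conj_class_conj[of "inv g" t] g t cl by simp
  next
    assume c: "cls x Z = c"
    obtain k where k: "k \<in> {1..n}" "Z = orbit (bp x) k" using Z by auto
    let ?h = "gain x (card Z) k"
    have h: "?h \<in> carrier G" by (rule funpow_pt(3)[OF x k(1)])
    have "c = conj_class G ?h" using c cls_eq[OF fin x k(1)] k(2) by simp
    moreover have "?h \<in> conj_class G ?h"
      unfolding conj_class_def using h by (intro image_eqI[of _ _ \<one>]) auto
    moreover have kZ: "k \<in> Z" using orbit_stable(3)[OF fin x k(1)] k(2) by simp
    moreover have "(x ^^ card Z) (\<one>, k) = (?h, k)"
      using funpow_pt(1)[OF x k(1), of "card Z"] orbit_enum(1)[of k "bp x"] kZ k(2) by simp
    ultimately show "\<exists>m\<in>Z. \<exists>h\<in>c. (x ^^ card Z) (\<one>, m) = (h, m)" by blast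
  qed
  have "card Z \<in> {1..n}" if Z: "Z \<in> ?O" for Z
  proof -
    obtain k where k: "k \<in> {1..n}" "Z = orbit (bp x) k" using Z by auto
    have "card Z \<le> card {1..n}" using orbit_stable(1)[OF fin x k(1)] k(2) by (intro card_mono) auto
    then show ?thesis using card_cycle_pos(1)[OF fin x Z] by simp
  qed
  then have "wt psum {1..n} x = (\<Prod>p\<in>{1..n} \<times> conj_classes G.
      \<Prod>Z\<in>{Z \<in> ?O. (card Z, cls x Z) = p}. psum (card Z) (cls x Z))"
    unfolding wt_def using finC cls_in[OF fin x] by (intro prod.group[symmetric]) auto
  also have "\<dots> = (\<Prod>(i, c)\<in>{1..n} \<times> conj_classes G. psum i c ^ cycle_count G n x i c)"
  proof (rule prod.cong[OF HOL.refl])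
    fix p assume "p \<in> {1..n} \<times> conj_classes G"
    then obtain i c where p: "p = (i, c)" "c \<in> conj_classes G" by auto
    have "{Z \<in> ?O. (card Z, cls x Z) = p} = {Z \<in> ?O. card Z = i \<and> (\<exists>m\<in>Z. \<exists>h\<in>c. (x ^^ i) (\<one>, m) = (h, m))}"
      using iff[OF _ p(2)] p(1) by auto
    then have "card {Z \<in> ?O. (card Z, cls x Z) = p} = cycle_count G n x i c" by (simp add: cycle_count_def)
    moreover have "(\<Prod>Z\<in>{Z \<in> ?O. (card Z, cls x Z) = p}. psum (card Z) (cls x Z)) =
        (\<Prod>Z\<in>{Z \<in> ?O. (card Z, cls x Z) = p}. psum i c)"
      by (intro prod.cong) (auto simp: p(1))
    ultimately show "(\<Prod>Z\<in>{Z \<in> ?O. (card Z, cls x Z) = p}. psum (card Z) (cls x Z)) =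
        (case p of (i, c) \<Rightarrow> psum i c ^ cycle_count G n x i c)" by (simp add: p(1))
  qed
  also have "\<dots> = cycle_indicator G n x"
    by (simp add: cycle_indicator_def prod.cartesian_product)
  finally show ?thesis ..
qed

lemma wt_A_ring:
  assumes "finite A" "x \<in> wr G A"
  shows "wt psum A x \<in> A_ring G"
  unfolding wt_def by (intro A_ring_prod A_ring_psum card_cycle_pos(1)[OF assms] cls_in[OF assms])

lemma sum_card_cycles:
  assumes "finite A" "x \<in> wr G A"
  shows "(\<Sum>C\<in>orbit (bp x) ` A. card C) = card A"
proof -
  have perm: "permutation (bp x)" using base_permutes[OF assms(1,2)] assms(1) by (auto simp: permutation_permutes)
  have same: "orbit (bp x) k = orbit (bp x) m" if "k \<in> orbit (bp x) m" for k m
    by (rule orbit_cyclic_eq3[OF cyclic_on_orbit'[OF perm] that])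
  have "\<Union>(orbit (bp x) ` A) = A" using orbit_stable[OF assms] by fastforce
  moreover have "card (\<Union>(orbit (bp x) ` A)) = (\<Sum>C\<in>orbit (bp x) ` A. card C)"
  proof (rule card_Union_disjoint)
    show "pairwise disjnt (orbit (bp x) ` A)"
    proof (rule pairwiseI)
      fix C D assume "C \<in> orbit (bp x) ` A" "D \<in> orbit (bp x) ` A" and ne: "C \<noteq> D"
      then obtain m k where mk: "C = orbit (bp x) m" "D = orbit (bp x) k" by auto
      show "disjnt C D" unfolding disjnt_def
      proof (rule ccontr)
        assume "C \<inter> D \<noteq> {}"
        then obtain j where "j \<in> C" "j \<in> D" by blast
        then show False using same[of j m] same[of j k] mk ne by simp
      qed
    qed
  qed (use card_cycle_pos(2)[OF assms] in auto)
  ultimately show ?thesis by simp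
qed

text \<open>The cycle lengths add up to \<open>card A\<close>, so the monomial of \<open>x\<close>
  is homogeneous of that degree.\<close>

lemma wt_nth:
  assumes "finite A" "x \<in> wr G A" "N \<noteq> card A"
  shows "wt psum A x $ N = 0"
proof -
  let ?O = "orbit (bp x) ` A"
  have "wt psum A x = (\<Prod>C\<in>?O. fps_const (psum (card C) (cls x C) $ card C) * fps_X ^ card C)"
    unfolding wt_def by (simp only: psum_eq[symmetric])
  also have "\<dots> = (\<Prod>C\<in>?O. fps_const (psum (card C) (cls x C) $ card C)) * fps_X ^ card A"
    by (simp only: prod.distrib power_sum[symmetric] sum_card_cycles[OF assms(1,2)])
  also have "(\<Prod>C\<in>?O. fps_const (psum (card C) (cls x C) $ card C)) = fps_const (\<Prod>C\<in>?O. psum (card C) (cls x C) $ card C)"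
    by (rule prod_fps_const)
  finally show ?thesis using assms(3) by simp
qed

lemma wt_vanish: "finite A \<Longrightarrow> x \<in> wr G A \<Longrightarrow> vanish (card A) (wt psum A x)"
  unfolding vanish_def by (simp add: wt_nth)

lemma ch_eq: "ch G n M = cfac n * (\<Sum>x\<in>wr G {1..n}. qconst (rep_trace M x) * wt psum {1..n} x)"
  unfolding ch_def cfac_def wreath_eq using cycle_indicator_eq by simp

text \<open>Stated for arbitrary coefficients so as to serve both the trivial representation and the
  Moebius numbers.\<close>

lemma ch_like:
  "cfac n * (\<Sum>x\<in>wr G {1..n}. qconst (r x) * wt psum {1..n} x) \<in> A_ring G"
  "vanish n (cfac n * (\<Sum>x\<in>wr G {1..n}. qconst (r x) * wt psum {1..n} x))"
  using wt_A_ring[of "{1..n}"] wt_vanish[of "{1..n}"] unfolding cfac_def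
  by (auto intro!: A_ring_mult A_ring_sum vanish_mult_left vanish_sum)

lemma Exp_series_eq: "Exp_series G = fsum (\<lambda>n. cfac n * (\<Sum>x\<in>wr G {1..n}. wt psum {1..n} x))"
proof -
  have "ch G n trivial_rep = cfac n * (\<Sum>x\<in>wr G {1..n}. wt psum {1..n} x)" for n
    by (simp add: ch_eq)
  then show ?thesis
    unfolding Exp_series_def using ch_like(2)[of _ "\<lambda>_. 1"] by (simp add: suminf_eq_fsum)
qed

end

section \<open>Inverting the plethystic exponential\<close>

interpretation triv: fgroup triv
  by (intro fgroup.intro fgroup_axioms.intro) simp_all

lemma class_pow_triv: "class_pow triv {()} j = {()}"
  by (auto simp: class_pow_def)

text \<open>The exponential formula once more: each element is weighted by its cycle monomial and
  cycles of length l account for \<open>psum l\<close>, so that the exponent is the sum of all p_j /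
  j.\<close>

lemma Exp_series_triv: "Exp_series triv = pexp (triv.PV 1 {()})"
proof -
  let ?V = "triv.PV 1 {()}"
  have V0: "?V $ 0 = 0" by (rule triv.PV_0)
  have cc: "conj_class triv h = {()}" for h by (auto simp: conj_class_def singleton_group_def)
  have carr: "carrier triv = {()}" by (simp add: singleton_group_def)
  have S: "(\<Sum>x\<in>wr triv A. wt_t A x) = of_nat (card (carrier triv) ^ card A * fact (card A)) *
      (fps_const (pexp ?V $ card A) * fps_X ^ card A)"
    if wt_t: "wt_t = triv.wt psum" and A: "finite A" for wt_t and A
    unfolding wt_t
  proof (rule triv.sum_wr_rec[where U = "\<lambda>l. psum l {()}" and z = "\<lambda>n. fps_const (pexp ?V $ n) * fps_X ^ n"])
    show "triv.wt psum A x = triv.wt psum Z (triv.rs x Z) * triv.wt psum (A - Z) (triv.rs x (A - Z))"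
      if "finite A" "x \<in> wr triv A" "Z \<subseteq> A" "triv.bp x ` Z = Z" for A x Z
      by (rule triv.wt_mult[OF that])
    show "(\<Sum>x\<in>triv.cyc a Z. triv.wt psum Z x) =
        of_nat (card (carrier triv) ^ (card Z - 1) * fact (card Z - 1)) * psum (card Z) {()}"
      if Z: "finite Z" "a \<in> Z" for a Z
    proof -
      have "(\<Sum>x\<in>triv.cyc a Z. triv.wt psum Z x) = (\<Sum>x\<in>triv.cyc a Z. (\<lambda>h. psum (card Z) {()}) (triv.gain x (card Z) a))"
        by (intro sum.cong refl) (simp add: triv.wt_cyc[OF Z(1)] cc)
      also have "\<dots> = of_nat (card (carrier triv) ^ (card Z - 1) * fact (card Z - 1)) *
          (\<Sum>h\<in>carrier triv. psum (card Z) {()})"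
        by (rule triv.sum_cyc_gain[OF Z])
      finally show ?thesis by (simp add: carr)
    qed
    show "fps_const (pexp ?V $ 0) * fps_X ^ 0 = (1 :: unit pseries)" using V0 by (simp add: pexp_0)
    have U: "psum (Suc l) {()} = fps_const (of_nat 1 * (of_nat (Suc l) * ?V $ Suc l)) * fps_X ^ Suc l" for l
    proof -
      have "of_nat (Suc l) * ?V $ Suc l = psum (Suc l) {()} $ Suc l"
        using triv.PV_nth[of 1 "Suc l" "{()}"] by (simp add: class_pow_triv)
      then show ?thesis using psum_eq[of "Suc l" "{()}"] by simp
    qed
    show "of_nat (Suc n * card (carrier triv)) * (fps_const (pexp ?V $ Suc n) * fps_X ^ Suc n) =
        (\<Sum>l\<le>n. psum (Suc l) {()} * (fps_const (pexp ?V $ (n - l)) * fps_X ^ (n - l)))" for n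
      using triv.pexp_recursion[of ?V "\<lambda>l. psum l {()}" 1 n, OF V0 U] by (simp add: carr del: of_nat_Suc power_Suc)
  qed (use A in \<open>auto simp: triv.wt_def\<close>)
  have "triv.cfac n * (\<Sum>x\<in>wr triv {1..n}. triv.wt psum {1..n} x) = fps_const (pexp ?V $ n) * fps_X ^ n" for n
    using S[OF refl, of "{1..n}"] triv.cfac_mult[of n] by simp
  then have "Exp_series triv = fsum (\<lambda>n. fps_const (pexp ?V $ n) * fps_X ^ n)"
    by (simp add: triv.Exp_series_eq)
  also have "\<dots> = pexp ?V"
    by (rule fps_ext) (simp add: fsum_nth mult_delta_right)
  finally show ?thesis .
qed

lemma L_series_eq:
  "L_series = fsum (\<lambda>k. qconst (of_int (moebius (Suc k)) / of_nat (Suc k)) * log1p (psum (Suc k) {()}))"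
    (is "_ = fsum ?f")
  and L_vanish: "vanish k (qconst (of_int (moebius (Suc k)) / of_nat (Suc k)) * log1p (psum (Suc k) {()} :: unit pseries))"
  and L_A_plus: "L_series \<in> A_plus triv"
proof -
  have "vanish (Suc k) (log1p (psum (Suc k) {()} :: unit pseries))" for k
    by (rule log1p_vanish) (auto simp: vanish_def psum_nth)
  then show v: "vanish k (?f k)" for k by (intro vanish_mult_left) (rule vanish_mono, auto)
  show e: "L_series = fsum ?f" unfolding L_series_def by (rule suminf_eq_fsum) (rule v)
  have p: "psum (Suc k) {()} \<in> A_plus triv" for k by (auto simp: A_plus_iff psum_nth intro: A_ring_psum)
  have "log1p (psum (Suc k) {()} :: unit pseries) \<in> A_plus triv" for k by (rule log1p_A_plus[OF p])
  then show "L_series \<in> A_plus triv"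
    unfolding e A_plus_iff by (auto simp: fsum_nth intro!: A_ring_fsum A_ring_mult)
qed

context fgroup
begin

section \<open>Plethysm of a single power sum with Exp - 1 and with L\<close>

lemma class_pow_class_pow:
  assumes "c \<in> conj_classes G"
  shows "class_pow G (class_pow G c i) j = class_pow G c (i * j)"
proof -
  have "c \<subseteq> carrier G" using assms by (auto simp: conj_classes_def conj_class_def)
  then have "(\<lambda>h. (h [^] i) [^] j) ` c = (\<lambda>h. h [^] (i * j)) ` c"
    by (intro image_cong) (auto simp: nat_pow_pow)
  then show ?thesis by (simp add: class_pow_def image_image)
qed

lemma class_pow_1: "c \<in> conj_classes G \<Longrightarrow> class_pow G c 1 = c"
  by (force simp: class_pow_def conj_classes_def conj_class_def image_image)

text \<open>The plethysm p_i(c) o g as a function of g.\<close>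

abbreviation Pm :: "nat \<Rightarrow> 'a set \<Rightarrow> unit pseries \<Rightarrow> 'a pseries" where
  "Pm i c \<equiv> psubst (\<lambda>(j, _). psum (i * j) (class_pow G c j))"

context
  fixes i :: nat and c :: "'a set"
  assumes ic: "i \<ge> 1" "c \<in> conj_classes G"
begin

interpretation h: subst_hom triv G "\<lambda>(j, _). psum (i * j) (class_pow G c j)"
  by unfold_locales (rule graded_subst_inner[OF is_group ic])

lemma psum_class_pow_A_plus: "j \<ge> 1 \<Longrightarrow> psum (i * j) (class_pow G c j) \<in> A_plus G"
  using ic by (auto simp: A_plus_iff psum_nth intro!: A_ring_psum class_pow_conj_classes[OF is_group])

lemma psum_A_plus_triv: "j \<ge> 1 \<Longrightarrow> psum j {()} \<in> A_plus triv"
  by (auto simp: A_plus_iff psum_nth intro!: A_ring_psum)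

lemma Pm_psum: "j \<ge> 1 \<Longrightarrow> Pm i c (psum j {()}) = psum (i * j) (class_pow G c j)"
  using psubst_psum[OF graded_subst_inner[OF is_group ic], of j "{()}"] by simp

lemma PV_A_plus: "PV i c \<in> A_plus G"
proof -
  have "qconst (1 / of_nat j) * psum (i * j) (class_pow G c j) \<in> A_ring G" for j
    using psum_class_pow_A_plus[of j] by (cases "j = 0") (auto simp: A_plus_iff intro!: A_ring_mult)
  then have "PV i c \<in> A_ring G" unfolding PV_def by (rule A_ring_fsum)
  then show ?thesis by (simp add: A_plus_iff PV_0)
qed

lemma triv_PV_A_plus: "triv.PV 1 {()} \<in> A_plus triv"
proof -
  have "qconst (1 / of_nat j) * psum (1 * j) (class_pow triv {()} j) \<in> A_ring triv" for j
    using psum_A_plus_triv[of j] by (cases "j = 0") (auto simp: A_plus_iff class_pow_triv intro!: A_ring_mult)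
  then have "triv.PV 1 {()} \<in> A_ring triv" unfolding triv.PV_def by (rule A_ring_fsum)
  then show ?thesis by (simp add: A_plus_iff triv.PV_0)
qed

lemma Pm_PV: "Pm i c (triv.PV 1 {()}) = PV i c"
proof -
  have t: "qconst (1 / of_nat j) * psum (1 * j) (class_pow triv {()} j) \<in> A_ring triv" for j
    using psum_A_plus_triv[of j] by (cases "j = 0") (auto simp: A_plus_iff class_pow_triv intro!: A_ring_mult)
  have "Pm i c (qconst (1 / of_nat j) * psum (1 * j) (class_pow triv {()} j)) =
      qconst (1 / of_nat j) * psum (i * j) (class_pow G c j)" for j
    using psum_A_plus_triv[of j] Pm_psum[of j]
    by (cases "j = 0") (simp_all add: h.hom_0 class_pow_triv A_plus_iff h.hom_mult h.hom_qconst)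
  then show ?thesis
    unfolding triv.PV_def PV_def by (subst h.hom_fsum) (use t triv.PV_vanish[of 1] in simp_all)
qed

lemma Pm_Exp: "Pm i c (Exp_series triv - 1) = pexp (PV i c) - 1"
proof -
  have A: "pexp (triv.PV 1 {()}) \<in> A_ring triv" using triv_PV_A_plus by (auto simp: A_plus_iff intro: pexp_A_ring)
  \<comment> \<open>Subtracting 1 is written as adding a constant, the form in which the
    homomorphism laws are stated.\<close>
  have m: "(- 1 :: 'x pseries) = qconst (- 1)" by (simp add: qconst_qc qc_def single_uminus flip: fps_const_neg)
  have "Exp_series triv - 1 = pexp (triv.PV 1 {()}) + qconst (- 1)"
    unfolding Exp_series_triv by (simp flip: m)
  then have "Pm i c (Exp_series triv - 1) = pexp (PV i c) + qconst (- 1)"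
    by (simp only: h.hom_add[OF A A_ring_qconst] h.hom_pexp[OF triv_PV_A_plus] Pm_PV h.hom_qconst)
  then show ?thesis by (simp flip: m)
qed

lemma Pm_L: "Pm i c L_series = fsum (\<lambda>k. qconst (of_int (moebius (Suc k)) / of_nat (Suc k)) *
    log1p (psum (i * Suc k) (class_pow G c (Suc k))))"
proof -
  have l: "log1p (psum (Suc k) {()}) \<in> A_ring triv" for k
    using log1p_A_plus[OF psum_A_plus_triv[of "Suc k"]] by (simp add: A_plus_iff)
  have "Pm i c (qconst r * log1p (psum (Suc k) {()})) =
      qconst r * log1p (psum (i * Suc k) (class_pow G c (Suc k)))" for r k
    using h.hom_mult[OF A_ring_qconst l] h.hom_log1p[OF psum_A_plus_triv[of "Suc k"]] Pm_psum[of "Suc k"]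
    by (simp add: h.hom_qconst)
  then show ?thesis
    unfolding L_series_eq by (subst h.hom_fsum) (use l L_vanish in \<open>simp_all add: A_ring_mult\<close>)
qed

text \<open>Collecting the terms with j e = N, where e = k + 1, the logarithm of 1 + p_(iN)(c^N)
  gets as coefficient the sum of \<mu>(e) / N over the divisors e of N, which is zero unless N =
  1.\<close>

lemma log_inversion:
  "fsum (\<lambda>j. qconst (1 / of_nat j) * fsum (\<lambda>k. qconst (of_int (moebius (Suc k)) / of_nat (Suc k)) *
    log1p (psum (i * j * Suc k) (class_pow G c (j * Suc k))))) = log1p (psum i c)"
proof (rule fps_ext)
  fix K
  define Y where "Y N = log1p (psum (i * N) (class_pow G c N)) $ K" for N
  \<comment> \<open>In the coefficient of degree \<open>K\<close> only N \<le> K survives, which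
    makes the sums finite.\<close>
  have Y0: "Y N = 0" if "N > K" "N \<ge> 1" for N
  proof -
    have "vanish (i * N) (log1p (psum (i * N) (class_pow G c N)))"
      using ic that by (intro log1p_vanish) (auto simp: vanish_def psum_nth)
    moreover have "K < i * N" using that ic by (metis less_le_trans mult_le_mono1 nat_mult_1)
    ultimately show ?thesis by (simp add: Y_def vanish_def)
  qed
  have bound: "j \<le> K \<and> e \<le> K" if "j \<ge> 1" "e \<ge> 1" "j * e \<le> K" for j e :: nat
  proof -
    have "j * 1 \<le> j * e" "1 * e \<le> j * e" using that by (intro mult_le_mono; simp)+
    then show ?thesis using that(3) by linarith
  qed
  define w where "w j e = qc (1 / of_nat j) * (qc (of_int (moebius e) / of_nat e) * Y (j * e))" for j e
  have "fsum (\<lambda>j. qconst (1 / of_nat j) * fsum (\<lambda>k. qconst (of_int (moebius (Suc k)) / of_nat (Suc k)) *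
    log1p (psum (i * j * Suc k) (class_pow G c (j * Suc k))))) $ K = (\<Sum>j\<le>K. \<Sum>k\<le>K. w j (Suc k))"
    by (simp only: fsum_nth qconst_qc w_def Y_def fps_mult_left_const_nth sum_distrib_left mult.assoc)
  also have "\<dots> = (\<Sum>j\<in>{1..K}. \<Sum>e\<in>{1..Suc K}. w j e)"
  proof -
    have "(\<Sum>k\<le>K. w j (Suc k)) = (\<Sum>e\<in>{1..Suc K}. w j e)" for j
      by (rule sum.reindex_bij_witness[of _ "\<lambda>e. e - 1" Suc]) auto
    then have "(\<Sum>j\<le>K. \<Sum>k\<le>K. w j (Suc k)) = (\<Sum>j\<le>K. \<Sum>e\<in>{1..Suc K}. w j e)" by simp
    \<comment> \<open>The index j = 0 drops out because 1 / 0 = 0.\<close>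
    also have "\<dots> = (\<Sum>j\<in>{1..K}. \<Sum>e\<in>{1..Suc K}. w j e)"
      by (rule sum.mono_neutral_right) (auto simp: w_def not_le)
    finally show ?thesis .
  qed
  also have "\<dots> = (\<Sum>(j, e)\<in>{1..K} \<times> {1..Suc K}. w j e)" by (rule sum.cartesian_product)
  also have "\<dots> = (\<Sum>(j, e)\<in>{(j, e). j \<ge> 1 \<and> e \<ge> 1 \<and> j * e \<le> K}. w j e)"
  proof (rule sum.mono_neutral_right)
    show "{(j, e). j \<ge> 1 \<and> e \<ge> 1 \<and> j * e \<le> K} \<subseteq> {1..K} \<times> {1..Suc K}"
    proof
      fix p assume p: "p \<in> {(j, e). j \<ge> 1 \<and> e \<ge> 1 \<and> j * e \<le> K}"
      obtain j e where je: "p = (j, e)" by (cases p)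
      show "p \<in> {1..K} \<times> {1..Suc K}" using p bound[of j e] by (simp add: je)
    qed
    show "\<forall>p\<in>{1..K} \<times> {1..Suc K} - {(j, e). j \<ge> 1 \<and> e \<ge> 1 \<and> j * e \<le> K}. (case p of (j, e) \<Rightarrow> w j e) = 0"
    proof
      fix p assume p: "p \<in> {1..K} \<times> {1..Suc K} - {(j, e). j \<ge> 1 \<and> e \<ge> 1 \<and> j * e \<le> K}"
      obtain j e where je: "p = (j, e)" by (cases p)
      have "K < j * e" "j * e \<ge> 1" using p by (auto simp: je)
      from Y0[OF this] show "(case p of (j, e) \<Rightarrow> w j e) = 0" by (simp add: je w_def)
    qed
  qed simp
  also have "\<dots> = (\<Sum>N\<in>{1..K}. \<Sum>(j, e)\<in>{p \<in> {(j, e). j \<ge> 1 \<and> e \<ge> 1 \<and> j * e \<le> K}. fst p * snd p = N}. w j e)"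
  proof (rule sum.group[symmetric])
    show "finite {(j :: nat, e :: nat). j \<ge> 1 \<and> e \<ge> 1 \<and> j * e \<le> K}"
    proof (rule finite_subset)
      show "{(j :: nat, e :: nat). j \<ge> 1 \<and> e \<ge> 1 \<and> j * e \<le> K} \<subseteq> {..K} \<times> {..K}"
      proof
        fix p assume p: "p \<in> {(j, e). j \<ge> 1 \<and> e \<ge> 1 \<and> j * e \<le> K}"
        obtain j e where je: "p = (j, e)" by (cases p)
        show "p \<in> {..K} \<times> {..K}" using p bound[of j e] by (simp add: je)
      qed
    qed simp
  qed auto
  also have "\<dots> = (\<Sum>N\<in>{1..K}. if N = 1 then Y 1 else 0)"
  proof (intro sum.cong refl)
    fix N assume N: "N \<in> {1..K}"
    have "(\<Sum>(j, e)\<in>{p \<in> {(j, e). j \<ge> 1 \<and> e \<ge> 1 \<and> j * e \<le> K}. fst p * snd p = N}. w j e) =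
        (\<Sum>e | e dvd N. qc (of_int (moebius e) / of_nat N) * Y N)"
    proof (rule sum.reindex_bij_witness[of _ "\<lambda>e. (N div e, e)" snd])
      fix p assume p: "p \<in> {p \<in> {(j, e). j \<ge> 1 \<and> e \<ge> 1 \<and> j * e \<le> K}. fst p * snd p = N}"
      obtain j e where je: "p = (j, e)" by (cases p)
      with p have *: "j \<ge> 1" "e \<ge> 1" "j * e = N" by auto
      then show "(N div snd p, snd p) = p" "snd p \<in> {e. e dvd N}" by (auto simp: je)
      have "qc (1 / of_nat j) * (qc (of_int (moebius e) / of_nat e) * Y (j * e)) =
          qc (1 / of_nat j * (of_int (moebius e) / of_nat e)) * Y N"
        by (simp only: qc_simps(4) mult.assoc *(3))
      also have "1 / of_nat j * (of_int (moebius e) / of_nat e) = (of_int (moebius e) / of_nat N :: rat)"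
        by (simp flip: *(3))
      finally show "qc (of_int (moebius (snd p)) / of_nat N) * Y N = (case p of (j, e) \<Rightarrow> w j e)"
        by (simp add: je w_def)
    next
      fix e assume "e \<in> {e. e dvd N}"
      then have "e dvd N" by simp
      then show "(N div e, e) \<in> {p \<in> {(j, e). j \<ge> 1 \<and> e \<ge> 1 \<and> j * e \<le> K}. fst p * snd p = N}"
        using N by (auto simp: Suc_le_eq dvd_div_eq_0_iff intro: Nat.gr0I)
    qed simp
    also have "\<dots> = qc (of_int (\<Sum>e | e dvd N. moebius e) / of_nat N) * Y N"
      by (simp add: sum_divide_distrib qc_sum flip: sum_distrib_right)
    also have "\<dots> = (if N = 1 then Y 1 else 0)" using sum_moebius[of N] N by simp
    finally show "(\<Sum>(j, e)\<in>{p \<in> {(j, e). j \<ge> 1 \<and> e \<ge> 1 \<and> j * e \<le> K}. fst p * snd p = N}. w j e) =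
      (if N = 1 then Y 1 else 0)" .
  qed
  also have "\<dots> = log1p (psum i c) $ K"
  proof (cases "K = 0")
    case True
    have "vanish i (log1p (psum i c))" using ic by (intro log1p_vanish) (auto simp: vanish_def psum_nth)
    then show ?thesis using True ic by (simp add: vanish_def)
  next
    case False
    then show ?thesis using class_pow_1[OF ic(2)] by (simp add: Y_def)
  qed
  finally show "fsum (\<lambda>j. qconst (1 / of_nat j) * fsum (\<lambda>k. qconst (of_int (moebius (Suc k)) / of_nat (Suc k)) *
    log1p (psum (i * j * Suc k) (class_pow G c (j * Suc k))))) $ K = log1p (psum i c) $ K" .
qed

end

end

section \<open>The homology series and its two plethysms\<close>

lemma qconst_sum: "qconst (\<Sum>e\<in>S. f e) = (\<Sum>e\<in>S. qconst (f e))"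
  by (induction S rule: infinite_finite_induct) simp_all

lemma euler_empty: "euler {} leq h = 1"
  unfolding euler_def by (subst sum.cong[of _ "{{}}"]) auto

lemma qconst_uminus: "qconst (- r) = - qconst r"
  using qconst_simps(3)[of r "- r"] by (simp add: eq_neg_iff_add_eq_0 add.commute del: qconst_simps(3))

lemma qconst_neg_one_power: "qconst ((- 1) ^ n) = (- 1) ^ n"
  by (induction n) (simp_all add: qconst_uminus)

context fgroup
begin

text \<open>For n \<ge> 1 the signed characteristic of the homology; the value at n = 0 completes
  the series so that \<open>mchar_sum\<close> applies, whose sum starts at k = 0.\<close>

definition mchar_term :: "nat \<Rightarrow> 'a pseries" where
  "mchar_term n = cfac n * (\<Sum>y\<in>wr G {1..n}. qconst (mchar G {1..n} y) * wt psum {1..n} y)"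

lemma mchar_term_A_ring: "mchar_term n \<in> A_ring G" and mchar_term_vanish: "vanish n (mchar_term n)"
  unfolding mchar_term_def by (rule ch_like)+

lemma mchar_term_homology:
  assumes "n \<ge> 1"
  shows "(- 1) ^ n * ch G n (R_homology G n) = mchar_term n"
proof -
  have "(- 1) ^ n * ch G n (R_homology G n) = cfac n *
      (\<Sum>x\<in>wr G {1..n}. qconst ((- 1) ^ n) * qconst (rep_trace (R_homology G n) x) * wt psum {1..n} x)"
    by (simp add: ch_eq qconst_neg_one_power sum_distrib_left mult.assoc mult.left_commute)
  also have "\<dots> = mchar_term n"
    unfolding mchar_term_def
    by (intro arg_cong2[where f = "(*)"] sum.cong HOL.refl)
       (simp only: qconst_simps(4)[symmetric] trace_R_homology[OF assms])
  finally show ?thesis .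
qed

text \<open>Over the empty index set there is only the empty chain, so \<open>mchar\<close> is -1.
  Removing this term at the end yields the 1 in the theorem.\<close>

lemma mchar_term_0: "mchar_term 0 = - 1"
proof -
  have wr: "wr G {1..0} = {id}" by (auto simp: wr_def pts_def equivar_def)
  have "frel G {} - {idrel G {}} = {}" by (auto simp: frel_def pts_def equiv_def refl_on_def)
  then have "mchar G {} id = - 1" by (simp only: mchar_def euler_empty)
  then show ?thesis
    unfolding mchar_term_def wr by (simp add: cfac_def wt_def qconst_uminus)
qed

text \<open>Substituting these values sends f to f o (Exp - 1).\<close>

abbreviation exp_var where "exp_var \<equiv> \<lambda>(i, c). Pm i c (Exp_series triv - 1)"

lemma Exp_minus_1_A_plus: "Exp_series triv - 1 \<in> A_plus triv"
proof -
  have "triv.PV 1 {()} \<in> A_plus triv" using triv_PV_A_plus[of 1 "conj_class G \<one>"] conj_class_in by simp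
  then have "pexp (triv.PV 1 {()}) \<in> A_ring triv" "pexp (triv.PV 1 {()}) $ 0 = 1"
    by (simp_all add: A_plus_iff pexp_A_ring pexp_0)
  moreover from this(1) have "pexp (triv.PV 1 {()}) + qconst (- 1) \<in> A_ring triv"
    by (intro A_ring_add A_ring_qconst)
  ultimately show ?thesis by (simp add: A_plus_iff Exp_series_triv qconst_uminus)
qed

interpretation x: subst_hom G G exp_var
  by unfold_locales (rule graded_subst_outer[OF is_group Exp_minus_1_A_plus])

lemma exp_var_psum: "i \<ge> 1 \<Longrightarrow> c \<in> conj_classes G \<Longrightarrow> psubst exp_var (psum i c) = pexp (PV i c) - 1"
  by (subst psubst_psum[OF x.graded]) (simp_all add: Pm_Exp)

lemma exp_var_wt:
  assumes "finite A" "y \<in> wr G A"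
  shows "psubst exp_var (wt psum A y) = (\<Prod>C\<in>orbit (bp y) ` A. pexp (PV (card C) (cls y C)) - 1)"
  unfolding wt_def
  by (subst x.hom_prod) (intro A_ring_psum card_cycle_pos(1)[OF assms] cls_in[OF assms] prod.cong HOL.refl exp_var_psum | assumption)+

lemma exp_var_mchar_term: "psubst exp_var (mchar_term k) =
  cfac k * (\<Sum>y\<in>wr G {1..k}. qconst (mchar G {1..k} y) * (\<Prod>C\<in>orbit (bp y) ` {1..k}. pexp (PV (card C) (cls y C)) - 1))"
proof -
  have w: "wt psum {1..k} y \<in> A_ring G" if "y \<in> wr G {1..k}" for y by (rule wt_A_ring[OF _ that]) simp
  have "psubst exp_var (\<Sum>y\<in>wr G {1..k}. qconst (mchar G {1..k} y) * wt psum {1..k} y) =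
      (\<Sum>y\<in>wr G {1..k}. psubst exp_var (qconst (mchar G {1..k} y) * wt psum {1..k} y))"
    by (rule x.hom_sum) (intro A_ring_mult A_ring_qconst w)
  also have "\<dots> = (\<Sum>y\<in>wr G {1..k}. qconst (mchar G {1..k} y) * (\<Prod>C\<in>orbit (bp y) ` {1..k}. pexp (PV (card C) (cls y C)) - 1))"
  proof (intro sum.cong HOL.refl)
    fix y assume y: "y \<in> wr G {1..k}"
    show "psubst exp_var (qconst (mchar G {1..k} y) * wt psum {1..k} y) =
        qconst (mchar G {1..k} y) * (\<Prod>C\<in>orbit (bp y) ` {1..k}. pexp (PV (card C) (cls y C)) - 1)"
      by (simp only: x.hom_mult[OF A_ring_qconst w[OF y]] x.hom_qconst exp_var_wt[OF finite_atLeastAtMost y])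
  qed
  finally show ?thesis
    unfolding mchar_term_def cfac_def
    by (subst x.hom_mult) (simp_all only: A_ring_qconst A_ring_sum A_ring_mult w x.hom_qconst)
qed

text \<open>Substitution turns the cycle monomials of \<open>y\<close> into generating functions of
  surjections. After the sums are exchanged, each \<open>x\<close> in degree N receives the
  left-hand side of \<open>mchar_sum\<close>, that is -1, and what remains is minus the
  characteristic of the trivial representation.\<close>

lemma exp_var_total: "psubst exp_var (fsum mchar_term) = - Exp_series G"
proof (rule fps_ext)
  fix N
  let ?s = "\<lambda>k x y. surj_count {1..N} {1..k} x y"
  let ?d = "\<lambda>k. of_nat (card (carrier G) ^ k * fact k) :: rat"
  \<comment> \<open>\<open>mchar_term k\<close> and its image vanish below degree k, so only k \<le>
    N remains, the range of the sum in \<open>mchar_sum\<close>.\<close>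
  have "psubst exp_var (fsum mchar_term) $ N = (\<Sum>k\<le>N. psubst exp_var (mchar_term k) $ N)"
    by (subst x.hom_fsum) (simp_all add: mchar_term_A_ring mchar_term_vanish fsum_nth)
  also have "\<dots> = (\<Sum>k\<le>N. cfac k * (\<Sum>y\<in>wr G {1..k}. qconst (mchar G {1..k} y) *
      (cfac N * (\<Sum>x\<in>wr G {1..N}. of_nat (?s k x y) * wt psum {1..N} x)))) $ N"
    unfolding fps_sum_nth
  proof (intro sum.cong HOL.refl)
    fix k
    have "(cfac k * (\<Sum>y\<in>wr G {1..k}. qconst (m y) * F y)) $ N = (cfac k * (\<Sum>y\<in>wr G {1..k}. qconst (m y) * F' y)) $ N"
      if "\<And>y. y \<in> wr G {1..k} \<Longrightarrow> F y $ N = F' y $ N" for m and F F' :: "_ \<Rightarrow> 'a pseries"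
      unfolding cfac_def qconst_qc fps_mult_left_const_nth fps_sum_nth using that by simp
    from this[OF surj_series] show "psubst exp_var (mchar_term k) $ N = (cfac k * (\<Sum>y\<in>wr G {1..k}. qconst (mchar G {1..k} y) *
      (cfac N * (\<Sum>x\<in>wr G {1..N}. of_nat (?s k x y) * wt psum {1..N} x)))) $ N"
      unfolding exp_var_mchar_term .
  qed
  also have "(\<Sum>k\<le>N. cfac k * (\<Sum>y\<in>wr G {1..k}. qconst (mchar G {1..k} y) *
      (cfac N * (\<Sum>x\<in>wr G {1..N}. of_nat (?s k x y) * wt psum {1..N} x)))) =
      (\<Sum>k\<le>N. \<Sum>y\<in>wr G {1..k}. \<Sum>x\<in>wr G {1..N}. cfac N * (qconst (of_nat (?s k x y) * mchar G {1..k} y / ?d k) * wt psum {1..N} x))"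
  proof (intro sum.cong HOL.refl)
    fix k
    have e: "cfac k * (qconst (mchar G {1..k} y) * (cfac N * (of_nat (?s k x y) * W))) =
        cfac N * (qconst (of_nat (?s k x y) * mchar G {1..k} y / ?d k) * W)" for x y and W :: "'a pseries"
    proof -
      have "of_nat (?s k x y) * mchar G {1..k} y / ?d k =
          1 / (of_nat (card (carrier G)) ^ k * fact k) * mchar G {1..k} y * of_nat (?s k x y)" by simp
      then have "qconst (of_nat (?s k x y) * mchar G {1..k} y / ?d k) = cfac k * qconst (mchar G {1..k} y) * of_nat (?s k x y)"
        unfolding cfac_def of_nat_qconst by (simp only: qconst_simps(4))
      then show ?thesis by (simp add: mult_ac)
    qed
    show "cfac k * (\<Sum>y\<in>wr G {1..k}. qconst (mchar G {1..k} y) *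
      (cfac N * (\<Sum>x\<in>wr G {1..N}. of_nat (?s k x y) * wt psum {1..N} x))) =
      (\<Sum>y\<in>wr G {1..k}. \<Sum>x\<in>wr G {1..N}. cfac N * (qconst (of_nat (?s k x y) * mchar G {1..k} y / ?d k) * wt psum {1..N} x))"
      unfolding sum_distrib_left e ..
  qed
  \<comment> \<open>With \<open>x\<close> outermost, the inner sum over k and y is the one evaluated
    by \<open>mchar_sum\<close>.\<close>
  also have "\<dots> = (\<Sum>x\<in>wr G {1..N}. \<Sum>k\<le>N. \<Sum>y\<in>wr G {1..k}.
      cfac N * (qconst (of_nat (?s k x y) * mchar G {1..k} y / ?d k) * wt psum {1..N} x))"
  proof -
    have "(\<Sum>k\<le>N. \<Sum>y\<in>wr G {1..k}. \<Sum>x\<in>wr G {1..N}. T k y x) = (\<Sum>x\<in>wr G {1..N}. \<Sum>k\<le>N. \<Sum>y\<in>wr G {1..k}. T k y x)"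
      for T :: "_ \<Rightarrow> _ \<Rightarrow> _ \<Rightarrow> 'a pseries"
      by (rule trans[OF sum.cong[OF HOL.refl sum.swap] sum.swap])
    then show ?thesis .
  qed
  also have "\<dots> = (\<Sum>x\<in>wr G {1..N}. cfac N * (qconst (\<Sum>k\<le>N. \<Sum>y\<in>wr G {1..k}.
      of_nat (?s k x y) * mchar G {1..k} y / ?d k) * wt psum {1..N} x))"
    unfolding qconst_sum sum_distrib_left sum_distrib_right ..
  also have "\<dots> = (\<Sum>x\<in>wr G {1..N}. cfac N * (qconst (- 1) * wt psum {1..N} x))"
    using mchar_sum[of "{1..N}"] by (intro sum.cong HOL.refl) (simp only: finite_atLeastAtMost card_atLeastAtMost diff_Suc_1 Suc_eq_plus1[symmetric] add_0 simp_thms)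
  also have "\<dots> = - (cfac N * (\<Sum>x\<in>wr G {1..N}. wt psum {1..N} x))"
    by (simp add: qconst_uminus sum_negf sum_distrib_left)
  also have "\<dots> $ N = (- Exp_series G) $ N"
  proof -
    have "(cfac n * (\<Sum>x\<in>wr G {1..n}. wt psum {1..n} x)) $ N = 0" if n: "n < N" for n
    proof -
      have "wt psum {1..n} x $ N = 0" if "x \<in> wr G {1..n}" for x
        using wt_nth[OF _ that, of N] n by simp
      then show ?thesis by (simp add: cfac_def qconst_qc fps_sum_nth)
    qed
    then have "Exp_series G $ N = (cfac N * (\<Sum>x\<in>wr G {1..N}. wt psum {1..N} x)) $ N"
      unfolding Exp_series_eq fsum_nth by (subst sum.remove[of _ N]) (auto intro!: sum.neutral)
    then show ?thesis by simp
  qed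
  finally show "psubst exp_var (fsum mchar_term) $ N = (- Exp_series G) $ N" .
qed

text \<open>Substituting these values sends f to f o L.\<close>

abbreviation log_var where "log_var \<equiv> \<lambda>(i, c). Pm i c L_series"

interpretation l: subst_hom G G log_var
  by unfold_locales (rule graded_subst_outer[OF is_group L_A_plus])

lemma log_var_psum: "i \<ge> 1 \<Longrightarrow> c \<in> conj_classes G \<Longrightarrow> psubst log_var (psum i c) = Pm i c L_series"
  by (subst psubst_psum[OF l.graded]) simp_all

text \<open>By the power law for classes, substituting L into the terms p_(ij)(c^j) of the exponent
  produces exactly the double sum of \<open>log_inversion\<close>.\<close>

lemma log_var_PV:
  assumes ic: "i \<ge> 1" "c \<in> conj_classes G"
  shows "psubst log_var (PV i c) = log1p (psum i c)"
proof -
  have A: "psum (i * j) (class_pow G c j) \<in> A_ring G" if "j \<ge> 1" for j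
    using psum_class_pow_A_plus[OF ic that] by (simp add: A_plus_iff)
  have "qconst (1 / of_nat j) * psum (i * j) (class_pow G c j) \<in> A_ring G" for j
    using A[of j] by (cases "j = 0") (auto intro!: A_ring_mult)
  then have "psubst log_var (PV i c) = fsum (\<lambda>j. psubst log_var (qconst (1 / of_nat j) * psum (i * j) (class_pow G c j)))"
    unfolding PV_def using PV_vanish[OF ic(1)] by (rule l.hom_fsum)
  also have "(\<lambda>j. psubst log_var (qconst (1 / of_nat j) * psum (i * j) (class_pow G c j))) =
      (\<lambda>j. qconst (1 / of_nat j) * fsum (\<lambda>k. qconst (of_int (moebius (Suc k)) / of_nat (Suc k)) *
        log1p (psum (i * j * Suc k) (class_pow G c (j * Suc k)))))"
  proof
    fix j
    show "psubst log_var (qconst (1 / of_nat j) * psum (i * j) (class_pow G c j)) =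
      qconst (1 / of_nat j) * fsum (\<lambda>k. qconst (of_int (moebius (Suc k)) / of_nat (Suc k)) *
        log1p (psum (i * j * Suc k) (class_pow G c (j * Suc k))))"
    proof (cases "j = 0")
      case False
      then have ij: "i * j \<ge> 1" and cj: "class_pow G c j \<in> conj_classes G"
        using ic by (auto intro: class_pow_conj_classes[OF is_group])
      have "psubst log_var (qconst (1 / of_nat j) * psum (i * j) (class_pow G c j)) =
          qconst (1 / of_nat j) * Pm (i * j) (class_pow G c j) L_series"
        using False by (simp only: l.hom_mult[OF A_ring_qconst A] l.hom_qconst log_var_psum[OF ij cj])
      then show ?thesis using Pm_L[OF ij cj] by (simp only: class_pow_class_pow[OF ic(2)])
    qed (simp add: l.hom_0)
  qed
  also have "fsum \<dots> = log1p (psum i c)" by (rule log_inversion[OF ic])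
  finally show ?thesis .
qed

text \<open>The exponent of p_i(c) o Exp becomes log(1 + p_i(c)), whose exponential is 1 +
  p_i(c).\<close>

lemma log_exp_var_psum:
  assumes ic: "i \<ge> 1" "c \<in> conj_classes G"
  shows "psubst log_var (psubst exp_var (psum i c)) = psum i c"
proof -
  have P: "PV i c \<in> A_plus G" by (rule PV_A_plus[OF ic])
  then have A: "pexp (PV i c) \<in> A_ring G" by (simp add: A_plus_iff pexp_A_ring)
  have "psubst exp_var (psum i c) = pexp (PV i c) + qconst (- 1)"
    by (simp add: exp_var_psum[OF ic] qconst_uminus)
  then have "psubst log_var (psubst exp_var (psum i c)) = pexp (log1p (psum i c)) + qconst (- 1)"
    by (simp only: l.hom_add[OF A A_ring_qconst] l.hom_pexp[OF P] log_var_PV[OF ic] l.hom_qconst)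
  then show ?thesis using ic by (simp add: pexp_log1p psum_nth qconst_uminus)
qed

text \<open>The composite and the identity are both continuous homomorphisms, so agreement on the
  power sums suffices.\<close>

lemma log_exp_var:
  assumes F: "F \<in> A_ring G"
  shows "psubst log_var (psubst exp_var F) = F"
proof -
  have xy: "cont_alg_hom G G (psubst exp_var)" "cont_alg_hom G G (psubst log_var)" by (rule x.hom l.hom)+
  then have "psubst exp_var ` A_ring G \<subseteq> A_ring G" "continuous_on (A_ring G) (psubst exp_var)" "continuous_on (A_ring G) (psubst log_var)"
    by (auto simp: cont_alg_hom_def)
  then have "continuous_on (A_ring G) (psubst log_var \<circ> psubst exp_var)"
    by (intro continuous_on_compose) (auto elim: continuous_on_subset)
  then have comp: "cont_alg_hom G G (\<lambda>F. psubst log_var (psubst exp_var F))"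
    unfolding cont_alg_hom_def
    by (simp add: o_def x.hom_A_ring l.hom_A_ring x.hom_add l.hom_add x.hom_mult l.hom_mult x.hom_qconst l.hom_qconst)
  have ident: "cont_alg_hom G G (\<lambda>F. F)" by (simp add: cont_alg_hom_def continuous_on_id)
  have "psubst log_var (psubst exp_var F) = psubst (\<lambda>(i, c). psubst log_var (psubst exp_var (psum i c))) F"
    by (rule cont_alg_hom_eq_psubst[OF comp F])
  also have "\<dots> = psubst (\<lambda>(i, c). psum i c) F"
    by (rule psubst_cong[OF F]) (simp only: prod.case log_exp_var_psum)
  also have "\<dots> = F" by (rule cont_alg_hom_eq_psubst[OF ident F, symmetric])
  finally show ?thesis .
qed

lemma homology_series:
  "(\<lambda>k. (- 1) ^ Suc k * ch G (Suc k) (R_homology G (Suc k))) sums (1 - plethysm G (Exp_series G) L_series)"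
proof -
  have t: "fsum mchar_term \<in> A_ring G" by (rule A_ring_fsum) (rule mchar_term_A_ring)
  have E: "Exp_series G \<in> A_ring G"
    unfolding Exp_series_eq using ch_like(1)[of _ "\<lambda>_. 1"] by (intro A_ring_fsum) simp
  \<comment> \<open>Plethysm with L is applied to F o (Exp - 1) = - Exp_G.\<close>
  have "fsum mchar_term = psubst log_var (- Exp_series G)"
    using log_exp_var[OF t] by (simp add: exp_var_total)
  also have "\<dots> = psubst log_var (qconst (- 1) * Exp_series G)" by (simp add: qconst_uminus)
  also have "\<dots> = - plethysm G (Exp_series G) L_series"
    by (simp only: l.hom_mult[OF A_ring_qconst E] l.hom_qconst) (simp add: qconst_uminus plethysm_def)
  finally have f: "fsum mchar_term = - plethysm G (Exp_series G) L_series" .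
  have "vanish k (mchar_term (Suc k))" for k
    by (rule vanish_mono[OF mchar_term_vanish]) simp
  then have "(\<lambda>k. mchar_term (Suc k)) sums fsum (\<lambda>k. mchar_term (Suc k))"
    by (rule fsum_sums)
  \<comment> \<open>The shift of the index removes the term of degree 0, which is -1.\<close>
  also have "fsum (\<lambda>k. mchar_term (Suc k)) = fsum mchar_term - mchar_term 0"
  proof (rule fps_ext)
    fix k
    have "fsum mchar_term $ k = mchar_term 0 $ k + (\<Sum>n\<le>k. mchar_term (Suc n) $ k)"
      using fsum_nth_le[of mchar_term k "Suc k", OF mchar_term_vanish] unfolding sum.atMost_Suc_shift by simp
    then show "fsum (\<lambda>k. mchar_term (Suc k)) $ k = (fsum mchar_term - mchar_term 0) $ k"
      by (simp add: fsum_nth)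
  qed
  finally have "(\<lambda>k. mchar_term (Suc k)) sums (fsum mchar_term - mchar_term 0)" .
  then show ?thesis
    by (simp add: f mchar_term_0 mchar_term_homology del: power_Suc)
qed

end

theorem theorem2p2:
  fixes G :: "('a, 'b) monoid_scheme"
  assumes "group G" and "finite (carrier G)"
  shows "(\<lambda>k. (-1) ^ Suc k * ch G (Suc k) (R_homology G (Suc k)))
           sums (1 - plethysm G (Exp_series G) L_series)"
proof -
  interpret fgroup G using assms by (simp add: fgroup_def fgroup_axioms_def)
  show ?thesis by (rule homology_series)
qed

end
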